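(* Let $T>0$, $\theta\in[0,1]$, and let $b\in L^1((0,T);W^{1,p}(\mathbb{R}^d))\cap L^\infty((0,T)\times\mathbb{R}^d)$ be a divergence-free velocity field for some $1<p<\infty$, with regular Lagrangian flow $X$. For $\varepsilon>0$ let $b_\varepsilon$ be an approximating sequence for $b$ with constants $\bar C_0,\bar C_1,\bar C_2,\bar C_3,\alpha,\beta>0$. For $N\in\mathbb{N}$ let $h=T/N$ and $\varepsilon=h^{\frac{1}{2\beta}}$, and let $\tilde X^{h,\theta,\varepsilon}$ be the piecewise affine interpolation of the maps $X_i^{\theta,\varepsilon}$, $i=0,\dots,N$, given by the regularized $\theta$-method with time step $h$ and field $b_\varepsilon$. Then, for any given $r>0$ there exists a positive constant $C=C(d,p,r,T,\|b\|_{L^\infty},\|\nabla b\|_{L^1_tL^p_x},\bar C_1,\bar C_2)$ such that, for every $t\in[0,T]$, $$\int_{B_r}|\tilde X^{h,\theta,\varepsilon}(t,x)-X(t,x)|\,dx\le \frac{C}{|\log h|}.$$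
   Context: Notation: $B_r$ is the ball of radius $r$ centred at the origin of $\mathbb{R}^d$, $\mathcal{L}^d$ is Lebesgue measure, $\fint$ denotes the average integral, and $L^q_tL^s_x$ denotes $L^q((0,T);L^s(\mathbb{R}^d))$. Regular Lagrangian flow: $X$ is the regular Lagrangian flow of $b$ if (i) for a.e. $x\in\mathbb{R}^d$ the map $t\mapsto X(t,x)$ is an absolutely continuous solution of $\dot X(t,x)=b(t,X(t,x))$, $X(0,x)=x$; (ii) there is a constant $L>0$ independent of $t$ such that $\mathcal{L}^d(X(t,\cdot)^{-1}(A))\le L\,\mathcal{L}^d(A)$ for every open set $A\subset\mathbb{R}^d$. For $b$ as in the claim it exists and is unique (DiPerna–Lions). Approximating sequence: a family of velocity fields $\{b_\varepsilon\}_{\varepsilon}$ is an approximating sequence for $b$ if, for some constants $\bar C_0,\bar C_1,\bar C_2,\bar C_3,\alpha,\beta>0$, $$\|b_\varepsilon-b\|_{L^1_tL^1_x}\le\bar C_0\varepsilon^\alpha,\quad \|\nabla b_\varepsilon\|_{L^\infty_tL^\infty_x}\le\frac{\bar C_1}{\varepsilon^\beta},\quad \|\operatorname{div} b_\varepsilon\|_{L^\infty_tL^\infty_x}\le\bar C_2,\quad \|b_\varepsilon\|_{L^\infty_tL^\infty_x}\le\bar C_3.$$ Regularized $\theta$-method: let $h=T/N$ and $t_i=ih$ for $i=0,\dots,N$. Set $X_0^{\theta,\varepsilon}(x)=x$ and, for $i=0,\dots,N-1$, given $X_i^{\theta,\varepsilon}=X_i^{\theta,\varepsilon}(x)$, compute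 $X_{i+1}^{\theta,\varepsilon}=X_{i+1}^{\theta,\varepsilon}(x)$ by solving $$\frac{X_{i+1}^{\theta,\varepsilon}-X_i^{\theta,\varepsilon}}{h}=(1-\theta)\fint_{t_i}^{t_{i+1}}b_\varepsilon(s,X_i^{\theta,\varepsilon})\,ds+\theta\fint_{t_i}^{t_{i+1}}b_\varepsilon(s,X_{i+1}^{\theta,\varepsilon})\,ds.$$ The interpolation is $$\tilde X^{h,\theta,\varepsilon}(t,x)=X_i^{\theta,\varepsilon}(x)+\frac{t-t_i}{h}\big(X_{i+1}^{\theta,\varepsilon}(x)-X_i^{\theta,\varepsilon}(x)\big)\quad\text{for } t\in[t_i,t_{i+1}),\ i=0,\dots,N-1,$$ and $\tilde X^{h,\theta,\varepsilon}(T,x)=X_N^{\theta,\varepsilon}(x)$.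
   Formalization: The constant C may also depend on the constants C̄_0, α, β of the approximating sequence; with C independent of them the claim is false (take b=0 and b_ε equal to a fixed nonzero field for ε_k≤ε≤1, with C̄_0 growing as ε_k→0). *)

theory Defs
  imports "HOL-Analysis.Analysis" "HOL-Probability.Essential_Supremum"
begin

section \<open>Weak derivatives\<close>

abbreviation pderiv_dir :: "('a::euclidean_space \<Rightarrow> real) \<Rightarrow> 'a \<Rightarrow> 'a \<Rightarrow> real" where
  "pderiv_dir f i x \<equiv> frechet_derivative f (at x) i"

primrec times_differentiable :: "nat \<Rightarrow> ('a::euclidean_space \<Rightarrow> real) \<Rightarrow> bool" where
  "times_differentiable 0 f \<longleftrightarrow> continuous_on UNIV f"
| "times_differentiable (Suc k) f \<longleftrightarrow>
     (\<forall>x. f differentiable (at x)) \<and> (\<forall>i\<in>Basis. times_differentiable k (pderiv_dir f i))"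

definition test_function :: "('a::euclidean_space \<Rightarrow> real) \<Rightarrow> bool" where
  "test_function \<phi> \<longleftrightarrow> (\<forall>k. times_differentiable k \<phi>) \<and> compact (closure {x. \<phi> x \<noteq> 0})"

definition locally_integrable :: "('a::euclidean_space \<Rightarrow> 'b::euclidean_space) \<Rightarrow> bool" where
  "locally_integrable f \<longleftrightarrow> (\<forall>K. compact K \<longrightarrow> set_integrable lebesgue K f)"

text \<open>A gradient of a vector field is stored as a function \<open>D\<close> whose value \<open>D x i\<close>, for a basis
  vector \<open>i\<close>, is the partial derivative in direction \<open>i\<close>; values at other \<open>i\<close> are irrelevant.\<close>

definition weak_gradient ::
  "('a::euclidean_space \<Rightarrow> 'a) \<Rightarrow> ('a \<Rightarrow> 'a \<Rightarrow> 'a) \<Rightarrow> bool" where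
  "weak_gradient f D \<longleftrightarrow>
     locally_integrable f \<and>
     (\<forall>i\<in>Basis. locally_integrable (\<lambda>x. D x i) \<and>
        (\<forall>\<phi>. test_function \<phi> \<longrightarrow>
           (LINT x|lebesgue. pderiv_dir \<phi> i x *\<^sub>R f x) = - (LINT x|lebesgue. \<phi> x *\<^sub>R D x i)))"

definition frobenius :: "('a::euclidean_space \<Rightarrow> 'a) \<Rightarrow> real" where
  "frobenius D = sqrt (\<Sum>i\<in>Basis. (norm (D i))\<^sup>2)"

definition trace_div :: "('a::euclidean_space \<Rightarrow> 'a) \<Rightarrow> real" where
  "trace_div D = (\<Sum>i\<in>Basis. D i \<bullet> i)"


section \<open>Time-dependent fields and their norms\<close>

definition space_time :: "real \<Rightarrow> (real \<times> 'a::euclidean_space) measure" where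
  "space_time T = lebesgue_on ({0<..<T} \<times> UNIV)"

definition st_measurable :: "real \<Rightarrow> (real \<Rightarrow> 'a::euclidean_space \<Rightarrow> 'b::euclidean_space) \<Rightarrow> bool" where
  "st_measurable T f \<longleftrightarrow> (\<lambda>(t, x). f t x) \<in> borel_measurable (space_time T)"

definition spatial_weak_gradient ::
  "real \<Rightarrow> (real \<Rightarrow> 'a::euclidean_space \<Rightarrow> 'a) \<Rightarrow> (real \<Rightarrow> 'a \<Rightarrow> 'a \<Rightarrow> 'a) \<Rightarrow> bool" where
  "spatial_weak_gradient T b D \<longleftrightarrow>
     st_measurable T b \<and> (\<forall>i\<in>Basis. st_measurable T (\<lambda>t x. D t x i)) \<and>
     (AE t in lebesgue_on {0<..<T}. weak_gradient (b t) (D t))"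

definition Lp_norm :: "real \<Rightarrow> ('a::euclidean_space \<Rightarrow> 'b::euclidean_space) \<Rightarrow> ennreal" where
  "Lp_norm p f =
     (let I = (\<integral>\<^sup>+ x. ennreal (norm (f x) powr p) \<partial>lebesgue)
      in if I = top then top else ennreal (enn2real I powr (1 / p)))"

definition L1_Lp_norm ::
  "real \<Rightarrow> real \<Rightarrow> (real \<Rightarrow> 'a::euclidean_space \<Rightarrow> 'b::euclidean_space) \<Rightarrow> ennreal" where
  "L1_Lp_norm T p f = (\<integral>\<^sup>+ t. Lp_norm p (f t) \<partial>lebesgue_on {0<..<T})"

definition Linf_norm ::
  "real \<Rightarrow> (real \<Rightarrow> 'a::euclidean_space \<Rightarrow> 'b::euclidean_space) \<Rightarrow> ennreal" where
  "Linf_norm T f = esssup (space_time T) (\<lambda>(t, x). ennreal (norm (f t x)))"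

text \<open>\<open>D\<close> is determined by \<open>b\<close> up to null sets and serves as a name for the weak gradient.
  Joint measurability together with finiteness of the norms is Bochner integrability, since the
  Sobolev space is separable for finite \<open>p\<close>.\<close>

definition in_L1_W1p ::
  "real \<Rightarrow> real \<Rightarrow> (real \<Rightarrow> 'a::euclidean_space \<Rightarrow> 'a) \<Rightarrow> (real \<Rightarrow> 'a \<Rightarrow> 'a \<Rightarrow> 'a) \<Rightarrow> bool" where
  "in_L1_W1p T p b D \<longleftrightarrow>
     spatial_weak_gradient T b D \<and>
     L1_Lp_norm T p b < top \<and> L1_Lp_norm T p (\<lambda>t x. frobenius (D t x)) < top"

definition divergence_free :: "real \<Rightarrow> (real \<Rightarrow> 'a::euclidean_space \<Rightarrow> 'a \<Rightarrow> 'a) \<Rightarrow> bool" where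
  "divergence_free T D \<longleftrightarrow> (AE (t, x) in space_time T. trace_div (D t x) = 0)"


section \<open>Regular Lagrangian flows\<close>

definition abs_continuous_on_interval ::
  "real \<Rightarrow> real \<Rightarrow> (real \<Rightarrow> 'b::metric_space) \<Rightarrow> bool" where
  "abs_continuous_on_interval a b f \<longleftrightarrow>
     (\<forall>e>0. \<exists>d>0. \<forall>(n::nat) l u.
        (\<forall>i<n. a \<le> l i \<and> l i \<le> u i \<and> u i \<le> b) \<and>
        (\<forall>i<n. \<forall>j<n. i \<noteq> j \<longrightarrow> {l i<..<u i} \<inter> {l j<..<u j} = {}) \<and>
        (\<Sum>i<n. u i - l i) < d \<longrightarrow>
        (\<Sum>i<n. dist (f (u i)) (f (l i))) < e)"

definition regular_Lagrangian_flow ::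
  "real \<Rightarrow> (real \<Rightarrow> 'a::euclidean_space \<Rightarrow> 'a) \<Rightarrow> (real \<Rightarrow> 'a \<Rightarrow> 'a) \<Rightarrow> bool" where
  "regular_Lagrangian_flow T b X \<longleftrightarrow>
     (AE x in lebesgue.
        abs_continuous_on_interval 0 T (\<lambda>t. X t x) \<and> X 0 x = x \<and>
        (AE t in lebesgue_on {0<..<T}.
           ((\<lambda>s. X s x) has_vector_derivative b t (X t x)) (at t))) \<and>
     (\<forall>t\<in>{0..T}. X t \<in> borel_measurable lebesgue) \<and>
     (\<exists>L>0. \<forall>t\<in>{0..T}. \<forall>A. open A \<longrightarrow>
        emeasure lebesgue (X t -` A) \<le> ennreal L * emeasure lebesgue A)"


section \<open>Approximating sequences\<close>

text \<open>Since the scheme evaluates \<open>b\<epsilon> \<epsilon> s\<close> at points, the continuous representative in space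
  (which exists because the weak gradient is bounded) is the one meant.\<close>

definition approximating_sequence ::
  "real \<Rightarrow> (real \<Rightarrow> 'a::euclidean_space \<Rightarrow> 'a) \<Rightarrow> (real \<Rightarrow> real \<Rightarrow> 'a \<Rightarrow> 'a) \<Rightarrow>
   real \<Rightarrow> real \<Rightarrow> real \<Rightarrow> real \<Rightarrow> real \<Rightarrow> real \<Rightarrow> bool" where
  "approximating_sequence T b b\<epsilon> C0 C1 C2 C3 \<alpha> \<beta> \<longleftrightarrow>
     (\<forall>\<epsilon>>0.
        (AE t in lebesgue_on {0<..<T}. continuous_on UNIV (b\<epsilon> \<epsilon> t)) \<and>
        L1_Lp_norm T 1 (\<lambda>t x. b\<epsilon> \<epsilon> t x - b t x) \<le> ennreal (C0 * \<epsilon> powr \<alpha>) \<and>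
        Linf_norm T (b\<epsilon> \<epsilon>) \<le> ennreal C3 \<and>
        (\<exists>D. spatial_weak_gradient T (b\<epsilon> \<epsilon>) D \<and>
             Linf_norm T (\<lambda>t x. frobenius (D t x)) \<le> ennreal (C1 / \<epsilon> powr \<beta>) \<and>
             Linf_norm T (\<lambda>t x. trace_div (D t x)) \<le> ennreal C2))"


section \<open>The regularized theta-method\<close>

definition average :: "real \<Rightarrow> real \<Rightarrow> (real \<Rightarrow> 'a::euclidean_space) \<Rightarrow> 'a" where
  "average a b f = (1 / (b - a)) *\<^sub>R (LINT s:{a..b}|lebesgue. f s)"

text \<open>\<open>v\<close> is the velocity field and \<open>Y i\<close> the \<open>i\<close>-th map. The step is implicit for \<open>\<theta> > 0\<close>, so
  the maps are characterized by a relation instead of being computed.\<close>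

definition theta_method ::
  "real \<Rightarrow> nat \<Rightarrow> real \<Rightarrow> (real \<Rightarrow> 'a::euclidean_space \<Rightarrow> 'a) \<Rightarrow> (nat \<Rightarrow> 'a \<Rightarrow> 'a) \<Rightarrow> bool" where
  "theta_method T N \<theta> v Y \<longleftrightarrow>
     (let h = T / real N; t = (\<lambda>i. real i * h) in
        (\<forall>x. Y 0 x = x) \<and>
        (\<forall>i<N. \<forall>x.
           (1 / h) *\<^sub>R (Y (Suc i) x - Y i x) =
             (1 - \<theta>) *\<^sub>R average (t i) (t (Suc i)) (\<lambda>s. v s (Y i x)) +
             \<theta> *\<^sub>R average (t i) (t (Suc i)) (\<lambda>s. v s (Y (Suc i) x))))"

definition affine_interpolation ::
  "real \<Rightarrow> nat \<Rightarrow> (nat \<Rightarrow> 'a::euclidean_space \<Rightarrow> 'a) \<Rightarrow> real \<Rightarrow> 'a \<Rightarrow> 'a" where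
  "affine_interpolation T N Y t x =
     (if t \<ge> T then Y N x
      else let h = T / real N; i = nat \<lfloor>t / h\<rfloor>
           in Y i x + ((t - real i * h) / h) *\<^sub>R (Y (Suc i) x - Y i x))"

end

theory Submission
  imports Defs
begin

text \<open>One step of the scheme is a map \<open>x + \<kappa> w x\<close> followed by the inverse of another such map, where the
  time average \<open>w\<close> of \<open>b\<epsilon>\<close> has gradient at most \<open>C1 / sqrt h\<close> and divergence at most \<open>C2\<close>. The Jacobian
  of such a map is \<open>1 + O(h)\<close>: the divergence contributes \<open>h C2\<close> and all higher terms are bounded by
  \<open>(h C1 / sqrt h)\<^sup>2\<close>, which is where the choice of \<open>\<epsilon>\<close> enters. Hence the maps \<open>Y i\<close> increase volumes at most
  by a factor that depends on \<open>T\<close>, \<open>C1\<close> and \<open>C2\<close> only.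

  Following Crippa and De Lellis, one bounds the integral of \<open>ln (1 + |Z - X| / \<delta>)\<close> over a ball, where \<open>Z\<close> is
  the interpolation, by means of \<open>|b x - b y| \<le> c |x - y| (M|Db| x + M|Db| y)\<close> with the maximal function \<open>M\<close>.
  With \<open>\<delta>\<close> a small power of \<open>h\<close> this integral stays bounded, which gives the rate \<open>1 / |ln h|\<close>.

  These constants depend on the compressibility constant of \<open>X\<close>, about which nothing quantitative is assumed.
  However, the estimate for the explicit scheme with \<open>N\<close> tending to infinity shows that \<open>X\<close> inherits the uniform
  compressibility of the approximations, and the estimate is then applied a second time. For large
  \<open>h\<close> the displacements are bounded directly.\<close>

text \<open>Displacements cannot be bounded through \<open>C3\<close>, which must not enter the
  constant. Each velocity is therefore split into a part of size at most \<open>B\<close> and the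
  excess of the approximating field over \<open>b\<close> along the discrete maps, which
  compressibility makes small in L1. Consequently the delay between a path and the grid values at
  which the field is evaluated is also small only in L1 over a ball. Large delays are paid for with
  a factor \<open>1 / \<delta>\<^sup>2\<close>; the delay being of order \<open>h + h powr a\<close>
  with \<open>a = \<alpha> / (2 * \<beta>)\<close>, the square of \<open>\<delta>\<close> is taken
  as \<open>h powr min 1 a\<close>.

  A weak type bound for the maximal function suffices, because its compositions are only integrated
  over a ball and because its superlevel sets are open, the sets on which compressibility is
  assumed.

  The approximating fields are merely Lipschitz in space, so Jacobian estimates are proved for
  mollified fields and carried to the limit through preimages of open sets. All fields are replaced
  by Borel versions, for the sake of compositions and of Fubini; the null sets on which the versions
  differ have null preimages under compressible maps.\<close>

abbreviation joint_borel :: "(real \<Rightarrow> 'a::topological_space \<Rightarrow> 'b::topological_space) \<Rightarrow> bool" where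
  "joint_borel f \<equiv> (\<lambda>(t, x). f t x) \<in> borel_measurable borel"

abbreviation L1_distance :: "real \<Rightarrow> (real \<Rightarrow> 'a::euclidean_space \<Rightarrow> 'a) \<Rightarrow> (real \<Rightarrow> 'a \<Rightarrow> 'a) \<Rightarrow> ennreal" where
  "L1_distance T f f' \<equiv> \<integral>\<^sup>+t. indicator {0<..<T} t * (\<integral>\<^sup>+x. ennreal (norm (f t x - f' t x)) \<partial>lborel) \<partial>lborel"

abbreviation ball_distance :: "real \<Rightarrow> ('a::euclidean_space \<Rightarrow> 'a) \<Rightarrow> ('a \<Rightarrow> 'a) \<Rightarrow> ennreal" where
  "ball_distance r F F' \<equiv> \<integral>\<^sup>+x. indicator (ball 0 r) x * ennreal (norm (F x - F' x)) \<partial>lborel"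

section \<open>Calculus of iterated differentiability\<close>

lemma times_differentiable_SucD:
  "times_differentiable (Suc k) f \<Longrightarrow> times_differentiable k f"
proof (induction k arbitrary: f)
  case 0
  then show ?case
    by (auto intro!: differentiable_imp_continuous_on simp: differentiable_on_def differentiable_at_withinI)
next
  case (Suc k)
  have "times_differentiable k (pderiv_dir f i)" if "i \<in> Basis" for i
    using Suc.prems that by (intro Suc.IH) auto
  with Suc.prems show ?case by auto
qed

lemma times_differentiable_const: "times_differentiable k (\<lambda>_. c)"
proof (induction k arbitrary: c)
  case (Suc k)
  have "frechet_derivative (\<lambda>_. c) (at x) i = 0" for x i :: 'a
    by simp
  with Suc show ?case by auto
qed auto

lemma times_differentiable_inner: "times_differentiable k (\<lambda>x. x \<bullet> a)"
proof (cases k)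
  case (Suc m)
  have "(\<lambda>x. x \<bullet> a) differentiable at x" for x
    by (auto intro!: derivative_intros differentiableI)
  moreover have "frechet_derivative (\<lambda>x. x \<bullet> a) (at x) i = i \<bullet> a" for x i
    by (subst frechet_derivative_at[symmetric]) (auto intro!: derivative_eq_intros)
  ultimately show ?thesis using Suc by (simp add: times_differentiable_const)
qed (auto intro!: continuous_intros)

lemma times_differentiable_add:
  "times_differentiable k f \<Longrightarrow> times_differentiable k g \<Longrightarrow> times_differentiable k (\<lambda>x. f x + g x)"
proof (induction k arbitrary: f g)
  case (Suc k)
  have "frechet_derivative (\<lambda>x. f x + g x) (at x) i
      = frechet_derivative f (at x) i + frechet_derivative g (at x) i" for x i
  proof -
    have "((\<lambda>x. f x + g x) has_derivative (\<lambda>h. frechet_derivative f (at x) h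
        + frechet_derivative g (at x) h)) (at x)"
      using Suc.prems
      by (intro has_derivative_add) (auto simp: frechet_derivative_works[symmetric])
    from frechet_derivative_at[OF this, symmetric] show ?thesis
      by simp
  qed
  with Suc show ?case by auto
qed (auto intro!: continuous_intros)

lemma times_differentiable_mult:
  "times_differentiable k f \<Longrightarrow> times_differentiable k g \<Longrightarrow> times_differentiable k (\<lambda>x. f x * g x)"
proof (induction k arbitrary: f g)
  case (Suc k)
  have "frechet_derivative (\<lambda>x. f x * g x) (at x) i
      = f x * frechet_derivative g (at x) i + frechet_derivative f (at x) i * g x" for x i
  proof -
    have "((\<lambda>x. f x * g x) has_derivative (\<lambda>h. f x * frechet_derivative g (at x) h
        + frechet_derivative f (at x) h * g x)) (at x)"
      using Suc.prems
      by (intro has_derivative_mult) (auto simp: frechet_derivative_works[symmetric])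
    from frechet_derivative_at[OF this, symmetric] show ?thesis
      by simp
  qed
  then have "times_differentiable k (pderiv_dir (\<lambda>x. f x * g x) i)" if "i \<in> Basis" for i
    using Suc that times_differentiable_SucD[OF Suc.prems(1)] times_differentiable_SucD[OF Suc.prems(2)]
    by (simp del: times_differentiable.simps(2) add: times_differentiable_add
        times_differentiable.simps(2)[THEN iffD1, THEN conjunct2, rule_format])
  moreover have "(\<lambda>x. f x * g x) differentiable at x" for x
    using Suc.prems by simp
  ultimately show ?case by simp
qed (auto intro!: continuous_intros)

lemma times_differentiable_sum:
  "finite A \<Longrightarrow> (\<And>a. a \<in> A \<Longrightarrow> times_differentiable k (f a)) \<Longrightarrow> times_differentiable k (\<lambda>x. \<Sum>a\<in>A. f a x)"
  by (induction A rule: finite_induct) (auto intro!: times_differentiable_add times_differentiable_const)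

text \<open>The family is closed under differentiation: all derivatives of \<open>exp (-1/x)\<close> are of
  this form.\<close>

definition flat_exp :: "real poly \<Rightarrow> real \<Rightarrow> real" where
  "flat_exp P x = (if x \<le> 0 then 0 else poly P (1 / x) * exp (- (1 / x)))"

lemma poly_times_exp_neg_tendsto: "((\<lambda>y::real. poly P y * exp (- y)) \<longlongrightarrow> 0) at_top"
proof -
  have "((\<lambda>y::real. y ^ n * exp (- y)) \<longlongrightarrow> 0) at_top" for n
    using tendsto_power_div_exp_0[of n] by (simp add: exp_minus field_simps)
  then have "((\<lambda>y::real. \<Sum>i\<le>degree P. coeff P i * (y ^ i * exp (- y))) \<longlongrightarrow> (\<Sum>i\<le>degree P. coeff P i * 0)) at_top"
    by (intro tendsto_intros)
  then show ?thesis
    by (simp add: poly_altdef sum_distrib_right mult.assoc)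
qed

lemma flat_exp_tendsto_0: "(flat_exp P \<longlongrightarrow> 0) (at 0)"
proof (rule filterlim_split_at)
  show "(flat_exp P \<longlongrightarrow> 0) (at_left 0)"
    by (rule tendsto_eventually) (auto simp: eventually_at_filter flat_exp_def)
  have "((\<lambda>x. poly P (1/x) * exp (- (1/x))) \<longlongrightarrow> 0) (at_right (0::real))"
    using filterlim_compose[OF poly_times_exp_neg_tendsto filterlim_inverse_at_top_right]
    by (simp add: inverse_eq_divide)
  then show "(flat_exp P \<longlongrightarrow> 0) (at_right 0)"
    by (rule Lim_transform_eventually) (auto simp: eventually_at_filter flat_exp_def)
qed

text \<open>For positive \<open>x\<close> the chain rule gives the factor
  \<open>1 / x\<^sup>2\<close> times the difference of \<open>P\<close> and its derivative at
  \<open>1 / x\<close>; multiplication by \<open>[:0, 0, 1:]\<close> encodes that factor within the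
  same family.\<close>

lemma flat_exp_has_real_derivative:
  "(flat_exp P has_real_derivative flat_exp ([:0, 0, 1:] * (P - pderiv P)) x) (at x)"
proof -
  consider "x < 0" | "x = 0" | "x > 0" by linarith
  then show ?thesis
  proof cases
    case 1
    have "((\<lambda>_. 0) has_real_derivative 0) (at x)" by simp
    then have "(flat_exp P has_real_derivative 0) (at x)"
      by (rule has_field_derivative_transform_within_open[where S = "{..<0}"])
         (use 1 in \<open>auto simp: flat_exp_def\<close>)
    with 1 show ?thesis by (simp add: flat_exp_def)
  next
    case 2
    \<comment> \<open>At the origin the difference quotient is itself a \<open>flat_exp\<close>,
      with the polynomial multiplied by \<open>[:0, 1:]\<close>, so it tends to 0.\<close>
    have "((\<lambda>y. (flat_exp P y - flat_exp P 0) / (y - 0)) \<longlongrightarrow> 0) (at 0)"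
    proof (rule Lim_transform_eventually[OF flat_exp_tendsto_0[of "[:0, 1:] * P"]])
      show "\<forall>\<^sub>F y in at 0. flat_exp ([:0, 1:] * P) y = (flat_exp P y - flat_exp P 0) / (y - 0)"
        by (auto simp: eventually_at_filter flat_exp_def)
    qed
    with 2 show ?thesis
      by (simp add: has_field_derivative_iff flat_exp_def)
  next
    case 3
    have "((\<lambda>x. poly P (1 / x) * exp (- (1 / x))) has_real_derivative
        flat_exp ([:0, 0, 1:] * (P - pderiv P)) x) (at x)"
      using 3 by (auto intro!: derivative_eq_intros DERIV_chain2[OF poly_DERIV]
          simp: flat_exp_def field_simps power2_eq_square)
    then show ?thesis
      by (rule has_field_derivative_transform_within_open[where S = "{0<..}"])
         (use 3 in \<open>auto simp: flat_exp_def\<close>)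
  qed
qed

text \<open>The induction runs over all \<open>P\<close> at once, because each differentiation
  changes the polynomial; the chain and product rules then leave only the smoothness of
  \<open>q\<close>.\<close>

lemma times_differentiable_flat_exp:
  assumes "\<And>k. times_differentiable k q"
  shows "times_differentiable k (\<lambda>x. flat_exp P (q x))"
proof (induction k arbitrary: P)
  case 0
  have "continuous_on UNIV (flat_exp P)"
    by (meson flat_exp_has_real_derivative DERIV_isCont continuous_at_imp_continuous_on)
  moreover have "continuous_on UNIV q"
    using assms[of 0] by simp
  ultimately have "continuous_on UNIV (\<lambda>x. flat_exp P (q x))"
    by (rule continuous_on_compose2) simp
  then show ?case by simp
next
  case (Suc k)
  let ?Q = "[:0, 0, 1:] * (P - pderiv P)"
  have q: "(q has_derivative frechet_derivative q (at x)) (at x)" for x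
    using assms[of 1] by (simp add: frechet_derivative_works[symmetric])
  have der: "((\<lambda>x. flat_exp P (q x)) has_derivative
      (\<lambda>h. flat_exp ?Q (q x) * frechet_derivative q (at x) h)) (at x)" for x
    by (rule has_derivative_compose[OF q, of "flat_exp P" "(*) (flat_exp ?Q (q x))" x])
      (rule flat_exp_has_real_derivative[unfolded has_field_derivative_def])
  have "times_differentiable k (pderiv_dir (\<lambda>x. flat_exp P (q x)) i)" if "i \<in> Basis" for i
  proof -
    have eq: "pderiv_dir (\<lambda>x. flat_exp P (q x)) i = (\<lambda>x. flat_exp ?Q (q x) * pderiv_dir q i x)"
      by (rule ext) (simp add: frechet_derivative_at[OF der, symmetric])
    have "times_differentiable k (pderiv_dir q i)"
      using assms[of "Suc k"] that by simp
    then show ?thesis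
      unfolding eq by (intro times_differentiable_mult Suc.IH)
  qed
  with der show ?case
    by (auto simp: differentiable_def)
qed


section \<open>Test functions\<close>

lemma test_function_has_derivative:
  assumes "test_function \<phi>"
  shows "(\<phi> has_derivative frechet_derivative \<phi> (at x)) (at x)"
proof -
  have "times_differentiable 1 \<phi>"
    using assms by (auto simp: test_function_def)
  then show ?thesis
    by (simp add: frechet_derivative_works[symmetric])
qed

lemma test_function_continuous: "test_function \<phi> \<Longrightarrow> continuous_on A \<phi>"
  using continuous_on_subset[of UNIV \<phi> A] times_differentiable.simps(1)[of \<phi>]
  unfolding test_function_def by blast

lemma test_function_bounded_support:
  assumes "test_function \<phi>"
  obtains R where "R > 0" "\<And>x. norm x \<ge> R \<Longrightarrow> \<phi> x = 0"
proof -
  have "bounded (closure {x. \<phi> x \<noteq> 0})"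
    using assms by (simp add: test_function_def compact_imp_bounded)
  then obtain R where "R > 0" "\<And>x. x \<in> closure {x. \<phi> x \<noteq> 0} \<Longrightarrow> norm x < R"
    unfolding bounded_pos_less by auto
  moreover have "x \<in> closure {x. \<phi> x \<noteq> 0}" if "\<phi> x \<noteq> 0" for x
    using that closure_subset[of "{x. \<phi> x \<noteq> 0}"] by auto
  ultimately show ?thesis
    using that[of R] by force
qed

lemma test_function_pderiv:
  assumes "test_function \<phi>" "i \<in> Basis"
  shows "test_function (pderiv_dir \<phi> i)"
proof -
  have "pderiv_dir \<phi> i x = 0" if "x \<notin> closure {x. \<phi> x \<noteq> 0}" for x
  proof -
    have "((\<lambda>_. 0) has_derivative (\<lambda>_. 0)) (at x)"
      by simp
    then have "(\<phi> has_derivative (\<lambda>_. 0)) (at x)"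
    proof (rule has_derivative_transform_within_open)
      show "open (- closure {x. \<phi> x \<noteq> 0})" "x \<in> - closure {x. \<phi> x \<noteq> 0}"
        using that by auto
      show "0 = \<phi> y" if "y \<in> - closure {x. \<phi> x \<noteq> 0}" for y
        using that closure_subset[of "{x. \<phi> x \<noteq> 0}"] by auto
    qed
    from frechet_derivative_at[OF this, symmetric] show ?thesis by simp
  qed
  then have "{x. pderiv_dir \<phi> i x \<noteq> 0} \<subseteq> closure {x. \<phi> x \<noteq> 0}"
    by auto
  then have "closure {x. pderiv_dir \<phi> i x \<noteq> 0} \<subseteq> closure {x. \<phi> x \<noteq> 0}"
    by (simp add: closure_minimal)
  then have "compact (closure {x. pderiv_dir \<phi> i x \<noteq> 0})"
    using assms unfolding test_function_def
    by (meson bounded_subset closed_closure compact_eq_bounded_closed)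
  moreover have "times_differentiable k (pderiv_dir \<phi> i)" for k
  proof -
    have "times_differentiable (Suc k) \<phi>"
      using assms(1) unfolding test_function_def by blast
    then show ?thesis
      using assms(2) by simp
  qed
  ultimately show ?thesis
    by (simp add: test_function_def)
qed

lemma test_function_bounded:
  assumes "test_function \<phi>"
  obtains B where "B \<ge> 0" "\<And>x. \<bar>\<phi> x\<bar> \<le> B"
proof -
  obtain R where R: "R > 0" "\<And>x. norm x \<ge> R \<Longrightarrow> \<phi> x = 0"
    using test_function_bounded_support[OF assms] by blast
  have "bounded (\<phi> ` cball 0 R)"
    by (intro compact_imp_bounded compact_continuous_image test_function_continuous assms compact_cball)
  then obtain B where "\<forall>x\<in>cball 0 R. \<bar>\<phi> x\<bar> \<le> B"
    unfolding bounded_iff by auto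
  then have B: "\<And>x. norm x \<le> R \<Longrightarrow> \<bar>\<phi> x\<bar> \<le> B"
    by auto
  have "\<bar>\<phi> x\<bar> \<le> max B 0" for x
    using B[of x] R(2)[of x] by (cases "norm x \<le> R") auto
  then show ?thesis
    using that[of "max B 0"] by auto
qed

lemma linear_bound_Basis:
  fixes f :: "'a::euclidean_space \<Rightarrow> real"
  assumes "linear f" "\<And>i. i \<in> Basis \<Longrightarrow> \<bar>f i\<bar> \<le> B i"
  shows "\<bar>f h\<bar> \<le> (\<Sum>i\<in>Basis. B i) * norm h"
proof -
  have "f h = f (\<Sum>i\<in>Basis. (h \<bullet> i) *\<^sub>R i)"
    by (simp add: euclidean_representation)
  also have "\<dots> = (\<Sum>i\<in>Basis. (h \<bullet> i) * f i)"
    using assms(1) by (simp add: linear_sum linear_cmul)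
  also have "\<bar>\<dots>\<bar> \<le> (\<Sum>i\<in>Basis. norm h * B i)"
    by (rule order_trans[OF sum_abs])
      (auto intro!: sum_mono mult_mono simp: abs_mult Basis_le_norm assms(2))
  finally show ?thesis
    by (simp add: sum_distrib_left mult.commute)
qed

lemma test_function_Lipschitz:
  assumes "test_function \<phi>"
  obtains L where "L \<ge> 0" "\<And>x y. \<bar>\<phi> x - \<phi> y\<bar> \<le> L * norm (x - y)"
proof -
  have "\<forall>i\<in>Basis. \<exists>B\<ge>0. \<forall>x. \<bar>pderiv_dir \<phi> i x\<bar> \<le> B"
    using test_function_bounded[OF test_function_pderiv[OF assms]] by metis
  then obtain B where B: "\<And>i. i \<in> Basis \<Longrightarrow> B i \<ge> 0" "\<And>i x. i \<in> Basis \<Longrightarrow> \<bar>pderiv_dir \<phi> i x\<bar> \<le> B i"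
    by metis
  have "norm (\<phi> x - \<phi> y) \<le> (\<Sum>i\<in>Basis. B i) * norm (x - y)" for x y
  proof (rule differentiable_bound[where S = UNIV and f' = "\<lambda>x. frechet_derivative \<phi> (at x)"])
    show "onorm (frechet_derivative \<phi> (at x)) \<le> (\<Sum>i\<in>Basis. B i)" for x
      using linear_bound_Basis[OF has_derivative_linear[OF test_function_has_derivative[OF assms]] B(2)]
      by (intro onorm_bound sum_nonneg B) auto
  qed (auto intro!: test_function_has_derivative assms)
  then show ?thesis
    using that[of "\<Sum>i\<in>Basis. B i"] B by (auto intro!: sum_nonneg)
qed

text \<open>The partial derivatives are Lipschitz, so the derivative varies by at most
  \<open>C * norm h\<close> on the ball of radius \<open>norm h\<close>; the mean value inequality
  turns this into a quadratic remainder that is uniform in \<open>x\<close>.\<close>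

lemma test_function_linearization:
  assumes "test_function \<phi>"
  obtains C where "C \<ge> 0" "\<And>x h. \<bar>\<phi> (x + h) - \<phi> x - frechet_derivative \<phi> (at x) h\<bar> \<le> C * (norm h)\<^sup>2"
proof -
  have "\<forall>i\<in>Basis. \<exists>L\<ge>0. \<forall>x y. \<bar>pderiv_dir \<phi> i x - pderiv_dir \<phi> i y\<bar> \<le> L * norm (x - y)"
    using test_function_Lipschitz[OF test_function_pderiv[OF assms]] by metis
  then obtain L where L: "\<And>i. i \<in> Basis \<Longrightarrow> L i \<ge> 0"
    "\<And>i x y. i \<in> Basis \<Longrightarrow> \<bar>pderiv_dir \<phi> i x - pderiv_dir \<phi> i y\<bar> \<le> L i * norm (x - y)"
    by metis
  define C where "C = (\<Sum>i\<in>Basis. L i)"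
  have C: "C \<ge> 0"
    unfolding C_def by (intro sum_nonneg L)
  have "norm (\<phi> (x + h) - \<phi> x - frechet_derivative \<phi> (at x) ((x + h) - x)) \<le> norm ((x + h) - x) * (C * norm h)" for x h
  proof (rule differentiable_bound_linearization[where S = "cball x (norm h)" and f' = "\<lambda>x. frechet_derivative \<phi> (at x)"])
    show "x + t *\<^sub>R ((x + h) - x) \<in> cball x (norm h)" if "t \<in> {0..1}" for t
      using that by (auto simp: dist_norm mult_left_le_one_le)
    show "(\<phi> has_derivative frechet_derivative \<phi> (at y)) (at y within cball x (norm h))" for y
      by (rule has_derivative_at_withinI[OF test_function_has_derivative[OF assms]])
    show "onorm (frechet_derivative \<phi> (at y) - frechet_derivative \<phi> (at x)) \<le> C * norm h"
      if "y \<in> cball x (norm h)" for y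
      unfolding fun_diff_def
    proof (rule onorm_bound)
      fix v
      have lin: "linear (\<lambda>v. frechet_derivative \<phi> (at y) v - frechet_derivative \<phi> (at x) v)"
        using has_derivative_linear[OF test_function_has_derivative[OF assms]]
        by (intro linear_compose_sub) auto
      have "\<bar>frechet_derivative \<phi> (at y) v - frechet_derivative \<phi> (at x) v\<bar> \<le> (\<Sum>i\<in>Basis. L i * norm (y - x)) * norm v"
        by (intro linear_bound_Basis[OF lin] L)
      also have "\<dots> \<le> C * norm h * norm v"
        unfolding C_def sum_distrib_right[symmetric] using that L
        by (intro mult_right_mono mult_left_mono sum_nonneg) (auto simp: dist_norm norm_minus_commute)
      finally show "norm (frechet_derivative \<phi> (at y) v - frechet_derivative \<phi> (at x) v) \<le> C * norm h * norm v"
        by simp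
    qed (use C in simp)
  qed simp
  then have "\<bar>\<phi> (x + h) - \<phi> x - frechet_derivative \<phi> (at x) h\<bar> \<le> C * (norm h)\<^sup>2" for x h
    by (simp add: power2_eq_square mult.commute mult.left_commute)
  with C that show ?thesis by blast
qed

lemma test_function_translate:
  fixes \<phi> :: "'a::euclidean_space \<Rightarrow> real"
  assumes "test_function \<phi>"
  shows "test_function (\<lambda>y. \<phi> (y - x))"
    and "pderiv_dir (\<lambda>y. \<phi> (y - x)) i y = pderiv_dir \<phi> i (y - x)"
proof -
  have der: "((\<lambda>y. f (y - x)) has_derivative frechet_derivative f (at (y - x))) (at y)"
    if "f differentiable at (y - x)" for f :: "'a \<Rightarrow> real" and y
  proof -
    have "((\<lambda>y. y - x) has_derivative (\<lambda>h. h)) (at y)"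
      by (auto intro!: derivative_eq_intros)
    from has_derivative_compose[OF this, of f "frechet_derivative f (at (y - x))"] that
    show ?thesis by (simp add: frechet_derivative_works)
  qed
  have td: "times_differentiable k (\<lambda>y. f (y - x))" if "times_differentiable k f" for f :: "'a \<Rightarrow> real" and k
    using that
  proof (induction k arbitrary: f)
    case 0
    then have "continuous_on UNIV f" by simp
    then have "continuous_on UNIV (\<lambda>y. f (y - x))"
      by (rule continuous_on_compose2) (simp_all add: continuous_on_diff continuous_on_id continuous_on_const)
    then show ?case by simp
  next
    case (Suc k)
    have "pderiv_dir (\<lambda>y. f (y - x)) i = (\<lambda>y. pderiv_dir f i (y - x))" for i
      using frechet_derivative_at[OF der[of f], symmetric] Suc.prems by (auto intro!: ext)
    moreover have "times_differentiable k (\<lambda>y. pderiv_dir f i (y - x))" if "i \<in> Basis" for i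
      using Suc.prems that by (intro Suc.IH) auto
    moreover have "(\<lambda>y. f (y - x)) differentiable at y" for y
      using der[of f y] Suc.prems by (auto simp: differentiable_def)
    ultimately show ?case by simp
  qed
  show "pderiv_dir (\<lambda>y. \<phi> (y - x)) i y = pderiv_dir \<phi> i (y - x)"
  proof -
    have "\<phi> differentiable at (y - x)"
      using test_function_has_derivative[OF assms] unfolding differentiable_def by blast
    from frechet_derivative_at[OF der[OF this], symmetric] show ?thesis by simp
  qed
  obtain R where R: "R > 0" "\<And>x. norm x \<ge> R \<Longrightarrow> \<phi> x = 0"
    using test_function_bounded_support[OF assms] by blast
  have "{y. \<phi> (y - x) \<noteq> 0} \<subseteq> cball x R"
    using R(2) by (force simp: dist_norm norm_minus_commute not_le)
  then have "bounded {y. \<phi> (y - x) \<noteq> 0}"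
    using bounded_cball bounded_subset by blast
  then have "compact (closure {y. \<phi> (y - x) \<noteq> 0})"
    by (simp add: compact_closure)
  then show "test_function (\<lambda>y. \<phi> (y - x))"
    using assms td by (simp add: test_function_def)
qed

text \<open>The support of the kernel lies in the unit cube \<open>[0,1]\<^sup>d\<close> rather than in a
  ball around the origin, since the Lebesgue differentiation theorem of the library averages over
  cubes with \<open>x\<close> as a corner.\<close>

definition bump :: "'a::euclidean_space \<Rightarrow> real" where
  "bump w = flat_exp 1 (1 / 4 - (norm (w - (1 / 2) *\<^sub>R One))\<^sup>2)"

lemma bump_bounds: "0 \<le> bump w" "bump w \<le> 1"
  by (auto simp: bump_def flat_exp_def)

lemma bump_eq_0: 
  assumes "w \<notin> cbox 0 (One::'a::euclidean_space)"
  shows "bump w = 0"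
proof -
  obtain i :: 'a where i: "i \<in> Basis" "w \<bullet> i < 0 \<or> w \<bullet> i > 1"
    using assms by (auto simp: mem_box not_le)
  then have "1 / 2 \<le> \<bar>(w - (1 / 2) *\<^sub>R One) \<bullet> i\<bar>"
    by (auto simp: inner_diff_left)
  also have "\<dots> \<le> norm (w - (1 / 2) *\<^sub>R One)"
    by (rule Basis_le_norm[OF i(1)])
  finally have "(1 / 2)\<^sup>2 \<le> (norm (w - (1 / 2) *\<^sub>R One))\<^sup>2"
    by (intro power_mono) auto
  then show ?thesis
    by (simp add: bump_def flat_exp_def power2_eq_square)
qed

lemma test_function_bump: "\<tau> > 0 \<Longrightarrow> test_function (\<lambda>y. c * bump ((1 / \<tau>) *\<^sub>R y))"
proof -
  assume \<tau>: "\<tau> > 0"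
  \<comment> \<open>The squared distance to the centre of the cube is written in coordinates, so
    that the closure rules for sums and products apply.\<close>
  let ?q = "\<lambda>y::'a. 1 / 4 + (- 1) * (\<Sum>i\<in>Basis. (y \<bullet> ((1 / \<tau>) *\<^sub>R i) + (- 1 / 2)) * (y \<bullet> ((1 / \<tau>) *\<^sub>R i) + (- 1 / 2)))"
  have "times_differentiable k ?q" for k
    by (intro times_differentiable_add times_differentiable_mult times_differentiable_sum
        times_differentiable_const times_differentiable_inner) simp
  then have "times_differentiable k (\<lambda>y. c * flat_exp 1 (?q y))" for k
    by (intro times_differentiable_mult times_differentiable_const times_differentiable_flat_exp)
  moreover have "flat_exp 1 (?q y) = bump ((1 / \<tau>) *\<^sub>R y)" for y
  proof -
    have "(norm v)\<^sup>2 = (\<Sum>i\<in>Basis. (v \<bullet> i) * (v \<bullet> i))" for v :: 'a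
      by (simp only: power2_norm_eq_inner euclidean_inner[of v v])
    then show ?thesis
      unfolding bump_def by (simp add: inner_diff_left)
  qed
  moreover have "bounded {y::'a. c * bump ((1 / \<tau>) *\<^sub>R y) \<noteq> (0::real)}"
  proof (rule bounded_subset[OF bounded_cbox[of 0 "\<tau> *\<^sub>R (One::'a)"]], rule subsetI)
    fix y :: 'a assume "y \<in> {y. c * bump ((1 / \<tau>) *\<^sub>R y) \<noteq> 0}"
    then have "(1 / \<tau>) *\<^sub>R y \<in> cbox 0 One"
      using bump_eq_0 by force
    then show "y \<in> cbox 0 (\<tau> *\<^sub>R One)"
      using \<tau> by (auto simp: mem_box field_simps)
  qed
  ultimately show ?thesis
    by (simp add: test_function_def compact_closure)
qed

lemma bump_continuous: "continuous_on A (bump :: 'a::euclidean_space \<Rightarrow> real)"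
  using test_function_continuous[OF test_function_bump[of 1 1]] by simp

lemma bump_measurable[measurable]: "bump \<in> borel_measurable borel"
  by (intro borel_measurable_continuous_onI bump_continuous)

lemma bump_integrable: "integrable lborel (bump :: 'a::euclidean_space \<Rightarrow> real)"
proof -
  have "integrable lborel (\<lambda>w. indicator (cbox 0 One) w *\<^sub>R (bump w :: real))"
    by (intro borel_integrable_compact compact_cbox bump_continuous)
  moreover have "(\<lambda>w. indicator (cbox 0 One) w *\<^sub>R bump w :: real) = (bump :: 'a \<Rightarrow> real)"
  proof
    show "indicator (cbox 0 One) w *\<^sub>R bump w = bump w" for w :: 'a
      by (cases "w \<in> cbox 0 One") (auto simp: bump_eq_0)
  qed
  ultimately show ?thesis by (rule back_subst)
qed

lemma bump_integral_pos: "0 < (LINT w|lborel. bump (w::'a::euclidean_space))"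
proof -
  let ?c = "(1 / 2) *\<^sub>R (One::'a)"
  have "\<not> (AE w in lborel. bump (w::'a) = 0)"
  proof
    assume "AE w in lborel. bump (w::'a) = 0"
    moreover have "bump w \<noteq> 0" if "w \<in> ball ?c (1 / 2)" for w
    proof -
      have "(norm (w - ?c))\<^sup>2 < (1 / 2)\<^sup>2"
        using that by (intro power_strict_mono) (auto simp: dist_norm norm_minus_commute)
      then show ?thesis
        by (simp add: bump_def flat_exp_def power2_eq_square)
    qed
    ultimately have "AE w in lborel. w \<notin> ball ?c (1 / 2)"
      by (auto elim!: eventually_mono)
    then have "emeasure lborel (ball ?c (1 / 2)) = 0"
      by (subst (asm) AE_iff_measurable[where N = "ball ?c (1 / 2)"]) auto
    then have "negligible (ball ?c (1 / 2))"
      by (simp add: negligible_iff_null_sets null_sets_completion_iff null_setsI)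
    then show False
      using open_not_negligible[of "ball ?c (1 / 2)"] by simp
  qed
  then show ?thesis
    using integral_nonneg_eq_0_iff_AE[OF bump_integrable] bump_bounds
    by (metis (mono_tags, lifting) AE_I2 integral_nonneg_AE less_eq_real_def)
qed

definition kernel :: "'a::euclidean_space \<Rightarrow> real" where
  "kernel w = bump w / (LINT w|lborel. bump (w::'a))"

definition kernel_max :: "'a::euclidean_space itself \<Rightarrow> real" where
  "kernel_max _ = 1 / (LINT w|lborel. bump (w::'a))"

lemma kernel_max_pos: "kernel_max TYPE('a::euclidean_space) > 0"
  by (simp add: kernel_max_def bump_integral_pos)

lemma kernel_nonneg: "0 \<le> kernel w"
  and kernel_le: "kernel (w::'a::euclidean_space) \<le> kernel_max TYPE('a)"
  using bump_bounds[of w] bump_integral_pos[where 'a='a]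
  by (auto simp: kernel_def kernel_max_def divide_right_mono)

lemma kernel_eq_0: "w \<notin> cbox 0 One \<Longrightarrow> kernel w = 0"
  by (simp add: kernel_def bump_eq_0)

lemma kernel_measurable[measurable]: "kernel \<in> borel_measurable borel"
  unfolding kernel_def[abs_def] by measurable

lemma kernel_integrable: "integrable lborel kernel"
  unfolding kernel_def[abs_def] by (intro integrable_divide_zero bump_integrable)

lemma kernel_integral: "(LINT w|lborel. kernel (w::'a::euclidean_space)) = 1"
  using bump_integral_pos[where 'a='a] by (simp add: kernel_def[abs_def])

lemma kernel_nn_integral: "(\<integral>\<^sup>+w. ennreal (kernel (w::'a::euclidean_space)) \<partial>lborel) = 1"
  by (subst nn_integral_eq_integral) (auto simp: kernel_integrable kernel_nonneg kernel_integral)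

lemma test_function_kernel:
  "\<tau> > 0 \<Longrightarrow> test_function (\<lambda>y. c * kernel ((1 / \<tau>) *\<^sub>R (y::'a::euclidean_space)))"
  using test_function_bump[where 'a='a, of \<tau> "c / (LINT w|lborel. bump (w::'a))"] by (simp add: kernel_def)

section \<open>Convolution with a test function\<close>

text \<open>The argument is \<open>y - x\<close> rather than \<open>x - y\<close>: a kernel
  supported in the unit cube then averages over a cube with corner \<open>x\<close>, and for fixed
  \<open>x\<close> the kernel is a translate of \<open>\<psi>\<close>, again a test function with
  the same partial derivatives.\<close>

definition conv :: "('a::euclidean_space \<Rightarrow> real) \<Rightarrow> ('a \<Rightarrow> 'b::euclidean_space) \<Rightarrow> 'a \<Rightarrow> 'b" where
  "conv \<psi> f x = (LINT y|lebesgue. \<psi> (y - x) *\<^sub>R f y)"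

lemma locally_integrable_measurable:
  assumes "locally_integrable f"
  shows "f \<in> borel_measurable lebesgue"
proof (rule borel_measurable_LIMSEQ_metric)
  show "(\<lambda>x. indicator (cball 0 (real n)) x *\<^sub>R f x) \<in> borel_measurable lebesgue" for n
    using assms by (auto simp: locally_integrable_def set_integrable_def intro: borel_measurable_integrable)
  show "(\<lambda>n. indicator (cball 0 (real n)) x *\<^sub>R f x) \<longlonglongrightarrow> f x" for x
  proof (rule tendsto_eventually)
    obtain m :: nat where "norm x \<le> real m"
      using real_arch_simple by blast
    then show "\<forall>\<^sub>F n in sequentially. indicator (cball 0 (real n)) x *\<^sub>R f x = f x"
      by (intro eventually_sequentiallyI[of m]) auto
  qed
qed

lemma locally_integrable_ball:
  assumes "locally_integrable f"
  shows "integrable lebesgue (\<lambda>y. indicator (cball x R) y *\<^sub>R f y)"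
  using assms by (simp add: locally_integrable_def set_integrable_def)

lemma test_function_borel: "test_function \<phi> \<Longrightarrow> \<phi> \<in> borel_measurable borel"
  by (intro borel_measurable_continuous_onI test_function_continuous)

lemma test_function_lebesgue: "test_function \<phi> \<Longrightarrow> (\<lambda>y. \<phi> (y - x)) \<in> borel_measurable lebesgue"
  by (intro measurable_completion) (auto intro!: test_function_borel[OF test_function_translate(1)])

lemma conv_integrable:
  assumes "test_function \<psi>" "locally_integrable f"
  shows "integrable lebesgue (\<lambda>y. \<psi> (y - x) *\<^sub>R f y)"
proof -
  obtain R where R: "R > 0" "\<And>x. norm x \<ge> R \<Longrightarrow> \<psi> x = 0"
    using test_function_bounded_support[OF assms(1)] by blast
  obtain B where B: "B \<ge> 0" "\<And>x. \<bar>\<psi> x\<bar> \<le> B"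
    using test_function_bounded[OF assms(1)] by blast
  show ?thesis
  proof (rule Bochner_Integration.integrable_bound)
    show "integrable lebesgue (\<lambda>y. B *\<^sub>R (indicator (cball x R) y *\<^sub>R f y))"
      by (intro integrable_scaleR_right locally_integrable_ball assms)
    show "(\<lambda>y. \<psi> (y - x) *\<^sub>R f y) \<in> borel_measurable lebesgue"
      using test_function_lebesgue[OF assms(1)] locally_integrable_measurable[OF assms(2)]
      by (rule borel_measurable_scaleR)
    have "norm (\<psi> (y - x) *\<^sub>R f y) \<le> norm (B *\<^sub>R (indicator (cball x R) y *\<^sub>R f y))" for y
      using R(2)[of "y - x"] B
      by (cases "y \<in> cball x R") (auto simp: dist_norm norm_minus_commute intro!: mult_right_mono)
    then show "AE y in lebesgue. norm (\<psi> (y - x) *\<^sub>R f y) \<le> norm (B *\<^sub>R (indicator (cball x R) y *\<^sub>R f y))"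
      by simp
  qed
qed

text \<open>\<open>E h y\<close> is the error of an expansion of \<open>\<psi>\<close>, with an order \<open>k\<close> that is \<open>1\<close> for continuity
  and \<open>2\<close> for differentiability of the convolution.\<close>

lemma conv_error_bound:
  fixes E :: "'a::euclidean_space \<Rightarrow> 'a \<Rightarrow> real" and f :: "'a \<Rightarrow> 'b::euclidean_space"
  assumes f: "locally_integrable f" and C: "C \<ge> 0"
    and E: "\<And>h y. \<bar>E h y\<bar> \<le> C * norm h ^ k" "\<And>h y. norm h \<le> 1 \<Longrightarrow> norm (y - x) \<ge> R \<Longrightarrow> E h y = 0"
    and int: "\<And>h. integrable lebesgue (\<lambda>y. E h y *\<^sub>R f y)"
  obtains K where "K \<ge> 0"
    "\<And>h. norm h \<le> 1 \<Longrightarrow> norm (LINT y|lebesgue. E h y *\<^sub>R f y) \<le> K * norm h ^ k"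
proof -
  let ?I = "LINT y|lebesgue. norm (indicator (cball x R) y *\<^sub>R f y)"
  have I: "integrable lebesgue (\<lambda>y. norm (indicator (cball x R) y *\<^sub>R f y))"
    by (intro integrable_norm locally_integrable_ball f)
  show ?thesis
  proof (rule that[of "C * ?I"])
    show "0 \<le> C * ?I"
      using C by simp
    fix h :: 'a assume h: "norm h \<le> 1"
    have "norm (LINT y|lebesgue. E h y *\<^sub>R f y) \<le> (LINT y|lebesgue. norm (E h y *\<^sub>R f y))"
      by (rule integral_norm_bound)
    also have "\<dots> \<le> (LINT y|lebesgue. (C * norm h ^ k) * norm (indicator (cball x R) y *\<^sub>R f y))"
    proof (rule integral_mono)
      show "norm (E h y *\<^sub>R f y) \<le> (C * norm h ^ k) * norm (indicator (cball x R) y *\<^sub>R f y)" for y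
        using E(1)[of h y] E(2)[of h y] h C
        by (cases "y \<in> cball x R") (auto simp: dist_norm norm_minus_commute intro!: mult_right_mono)
    qed (intro integrable_norm int I integrable_mult_right)+
    also have "\<dots> = (C * norm h ^ k) * ?I"
      by (rule integral_mult_right_zero)
    finally show "norm (LINT y|lebesgue. E h y *\<^sub>R f y) \<le> C * ?I * norm h ^ k"
      by (simp only: mult_ac)
  qed
qed

lemma conv_continuous:
  assumes "test_function \<psi>" "locally_integrable f"
  shows "continuous (at x) (conv \<psi> f)"
proof -
  obtain R where R: "R > 0" "\<And>x. norm x \<ge> R \<Longrightarrow> \<psi> x = 0"
    using test_function_bounded_support[OF assms(1)] by blast
  obtain L where L: "L \<ge> 0" "\<And>x y. \<bar>\<psi> x - \<psi> y\<bar> \<le> L * norm (x - y)"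
    using test_function_Lipschitz[OF assms(1)] by blast
  define E where "E h y = \<psi> (y - (x + h)) - \<psi> (y - x)" for h y
  have int: "integrable lebesgue (\<lambda>y. E h y *\<^sub>R f y)" for h
    unfolding E_def scaleR_diff_left by (intro Bochner_Integration.integrable_diff conv_integrable assms)
  have E_0: "E h y = 0" if "norm h \<le> 1" "norm (y - x) \<ge> R + 1" for h y
  proof -
    have "norm (y - (x + h)) \<ge> R"
      using that norm_triangle_ineq4[of "y - (x + h)" "- h"] by (auto simp: algebra_simps)
    then show ?thesis
      using that R by (simp add: E_def)
  qed
  have E_bound: "\<bar>E h y\<bar> \<le> L * norm h ^ 1" for h y
    using L(2)[of "y - (x + h)" "y - x"] by (simp add: E_def)
  obtain K where K: "K \<ge> 0" "\<And>h. norm h \<le> 1 \<Longrightarrow> norm (LINT y|lebesgue. E h y *\<^sub>R f y) \<le> K * norm h ^ 1"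
    using conv_error_bound[OF assms(2) L(1) E_bound E_0 int] by blast
  have bd: "norm (conv \<psi> f (x + h) - conv \<psi> f x) \<le> K * norm h" if "norm h \<le> 1" for h
    using K(2)[OF that] unfolding E_def conv_def scaleR_diff_left
    by (subst (asm) Bochner_Integration.integral_diff) (auto intro!: conv_integrable assms)
  have "((\<lambda>h. conv \<psi> f (x + h) - conv \<psi> f x) \<longlongrightarrow> 0) (at 0)"
  proof (rule Lim_null_comparison)
    show "\<forall>\<^sub>F h in at 0. norm (conv \<psi> f (x + h) - conv \<psi> f x) \<le> K * norm h"
      unfolding eventually_at by (rule exI[of _ 1]) (auto simp: bd)
    have "((\<lambda>h::'a. K * norm h) \<longlongrightarrow> K * norm (0::'a)) (at 0)"
      by (intro tendsto_mult tendsto_const tendsto_norm[OF tendsto_ident_at])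
    then show "((\<lambda>h::'a. K * norm h) \<longlongrightarrow> 0) (at 0)" by simp
  qed
  then show ?thesis
    unfolding isCont_iff by (rule LIM_zero_cancel)
qed

text \<open>Moving \<open>x\<close> by \<open>h\<close> moves the argument of \<open>\<psi>\<close>
  by \<open>- h\<close>, so the linear term is minus the integral of the derivative of
  \<open>\<psi>\<close> against \<open>f\<close>. Testing the weak gradient with the translate of
  \<open>\<psi>\<close> turns this into the convolution with \<open>D\<close>, and the two minus
  signs cancel. The quadratic remainder of \<open>\<psi>\<close> controls the rest.\<close>

lemma conv_has_derivative:
  assumes \<psi>: "test_function \<psi>" and wg: "weak_gradient f D"
  shows "(conv \<psi> f has_derivative (\<lambda>h. \<Sum>i\<in>Basis. (h \<bullet> i) *\<^sub>R conv \<psi> (\<lambda>y. D y i) x)) (at x)"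
proof -
  have f: "locally_integrable f"
    using wg by (simp add: weak_gradient_def)
  let ?\<psi>' = "\<lambda>y. frechet_derivative \<psi> (at (y - x))"
  define G where "G h = (\<Sum>i\<in>Basis. (h \<bullet> i) *\<^sub>R conv \<psi> (\<lambda>y. D y i) x)" for h
  have lin: "linear (?\<psi>' y)" for y
    using test_function_has_derivative[OF \<psi>] has_derivative_linear by blast
  have expand: "?\<psi>' y h = (\<Sum>i\<in>Basis. (h \<bullet> i) * pderiv_dir \<psi> i (y - x))" for y h
    using lin by (subst euclidean_representation[of h, symmetric], subst linear_sum)
      (auto simp: linear_cmul)
  have int_i: "integrable lebesgue (\<lambda>y. pderiv_dir \<psi> i (y - x) *\<^sub>R f y)" if "i \<in> Basis" for i
    using conv_integrable[OF test_function_pderiv[OF \<psi> that] f] .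
  have int': "integrable lebesgue (\<lambda>y. ?\<psi>' y h *\<^sub>R f y)" for h
    unfolding expand[where h = h] scaleR_sum_left scaleR_scaleR[symmetric]
    by (intro Bochner_Integration.integrable_sum integrable_scaleR_right int_i)
  have G: "(LINT y|lebesgue. ?\<psi>' y h *\<^sub>R f y) = - G h" for h
  proof -
    have "(LINT y|lebesgue. ?\<psi>' y h *\<^sub>R f y)
        = (\<Sum>i\<in>Basis. LINT y|lebesgue. (h \<bullet> i) *\<^sub>R pderiv_dir \<psi> i (y - x) *\<^sub>R f y)"
      unfolding expand[where h = h] scaleR_sum_left scaleR_scaleR[symmetric]
      by (rule Bochner_Integration.integral_sum) (intro integrable_scaleR_right int_i)
    also have "\<dots> = (\<Sum>i\<in>Basis. (h \<bullet> i) *\<^sub>R (LINT y|lebesgue. pderiv_dir \<psi> i (y - x) *\<^sub>R f y))"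
      by (simp only: integral_scaleR_right)
    also have "\<dots> = (\<Sum>i\<in>Basis. (h \<bullet> i) *\<^sub>R - conv \<psi> (\<lambda>y. D y i) x)"
    proof (rule sum.cong[OF refl])
      fix i :: 'a assume i: "i \<in> Basis"
      have "(LINT y|lebesgue. pderiv_dir (\<lambda>y. \<psi> (y - x)) i y *\<^sub>R f y)
          = - (LINT y|lebesgue. \<psi> (y - x) *\<^sub>R D y i)"
        using wg i test_function_translate(1)[OF \<psi>] by (auto simp: weak_gradient_def)
      then show "(h \<bullet> i) *\<^sub>R (LINT y|lebesgue. pderiv_dir \<psi> i (y - x) *\<^sub>R f y)
          = (h \<bullet> i) *\<^sub>R - conv \<psi> (\<lambda>y. D y i) x"
        by (simp add: test_function_translate(2)[OF \<psi>] conv_def)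
    qed
    finally show ?thesis
      by (simp add: G_def sum_negf)
  qed
  obtain R where R: "R > 0" "\<And>x. norm x \<ge> R \<Longrightarrow> \<psi> x = 0"
    using test_function_bounded_support[OF \<psi>] by blast
  obtain C where C: "C \<ge> 0" "\<And>x h. \<bar>\<psi> (x + h) - \<psi> x - frechet_derivative \<psi> (at x) h\<bar> \<le> C * (norm h)\<^sup>2"
    using test_function_linearization[OF \<psi>] by blast
  define E where "E h y = \<psi> (y - (x + h)) - \<psi> (y - x) - ?\<psi>' y (- h)" for h y
  have intE: "integrable lebesgue (\<lambda>y. E h y *\<^sub>R f y)" for h
    unfolding E_def scaleR_diff_left
    by (intro Bochner_Integration.integrable_diff conv_integrable \<psi> f int')
  have E_bound: "\<bar>E h y\<bar> \<le> C * norm h ^ 2" for h y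
    using C(2)[of "y - x" "- h"] by (simp add: E_def algebra_simps)
  have "pderiv_dir \<psi> i z = 0" if z: "norm z \<ge> R + 1" and i: "i \<in> Basis" for z i
  proof -
    have "((\<lambda>_. 0) has_derivative (\<lambda>_. 0)) (at z)"
      by simp
    then have "(\<psi> has_derivative (\<lambda>_. 0)) (at z)"
    proof (rule has_derivative_transform_within_open)
      show "open (- cball 0 R)" "z \<in> - cball 0 R"
        using z by auto
      show "0 = \<psi> y" if "y \<in> - cball 0 R" for y
        using that R(2)[of y] by auto
    qed
    from frechet_derivative_at[OF this, symmetric] show ?thesis by simp
  qed
  then have E_0: "E h y = 0" if "norm h \<le> 1" "norm (y - x) \<ge> R + 1" for h y
  proof -
    have "norm (y - (x + h)) \<ge> R"
      using that norm_triangle_ineq4[of "y - (x + h)" "- h"] by (auto simp: algebra_simps)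
    then show ?thesis
      using that R \<open>\<And>z i. R + 1 \<le> norm z \<Longrightarrow> i \<in> Basis \<Longrightarrow> pderiv_dir \<psi> i z = 0\<close>
      unfolding E_def expand[where h = "- h"] by (simp add: sum.neutral)
  qed
  obtain K where K: "K \<ge> 0" "\<And>h. norm h \<le> 1 \<Longrightarrow> norm (LINT y|lebesgue. E h y *\<^sub>R f y) \<le> K * norm h ^ 2"
    using conv_error_bound[OF f C(1) E_bound E_0 intE] by blast
  have bd: "norm (conv \<psi> f (x + h) - conv \<psi> f x - G h) \<le> K * norm h ^ 2" if "norm h \<le> 1" for h
  proof -
    have "(LINT y|lebesgue. E h y *\<^sub>R f y) = conv \<psi> f (x + h) - conv \<psi> f x - - G (- h)"
      unfolding E_def scaleR_diff_left conv_def G[symmetric]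
      using conv_integrable[OF \<psi> f, of "x + h"] conv_integrable[OF \<psi> f, of x] int'[of "- h"]
      by (simp only: Bochner_Integration.integral_diff Bochner_Integration.integrable_diff)
    moreover have "G (- h) = - G h"
      by (simp add: G_def sum_negf)
    ultimately show ?thesis
      using K(2)[OF that] by simp
  qed
  have lin_G: "bounded_linear G"
    unfolding G_def by (auto intro!: bounded_linear_sum bounded_linear_intros)
  have "((\<lambda>h. (conv \<psi> f (x + h) - conv \<psi> f x - G h) /\<^sub>R norm h) \<longlongrightarrow> 0) (at 0)"
  proof (rule Lim_null_comparison)
    have "norm ((conv \<psi> f (x + h) - conv \<psi> f x - G h) /\<^sub>R norm h) \<le> K * norm h"
      if "h \<noteq> 0" "norm h < 1" for h
    proof -
      have "norm ((conv \<psi> f (x + h) - conv \<psi> f x - G h) /\<^sub>R norm h)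
          = norm (conv \<psi> f (x + h) - conv \<psi> f x - G h) / norm h"
        by (simp only: norm_scaleR) (simp add: divide_inverse mult.commute)
      also have "\<dots> \<le> K * norm h ^ 2 / norm h"
        using bd[of h] that by (intro divide_right_mono) auto
      also have "\<dots> = K * norm h"
        using that by (simp add: power2_eq_square)
      finally show ?thesis .
    qed
    then show "\<forall>\<^sub>F h in at 0. norm ((conv \<psi> f (x + h) - conv \<psi> f x - G h) /\<^sub>R norm h) \<le> K * norm h"
      unfolding eventually_at by (intro exI[of _ 1]) auto
    have "((\<lambda>h::'a. K * norm h) \<longlongrightarrow> K * norm (0::'a)) (at 0)"
      by (intro tendsto_mult tendsto_const tendsto_norm[OF tendsto_ident_at])
    then show "((\<lambda>h::'a. K * norm h) \<longlongrightarrow> 0) (at 0)" by simp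
  qed
  then have "((\<lambda>h. norm ((conv \<psi> f (x + h) - conv \<psi> f x - G h) /\<^sub>R norm h)) \<longlongrightarrow> 0) (at 0)"
    by (rule tendsto_norm_zero)
  moreover have "norm ((conv \<psi> f (x + h) - conv \<psi> f x - G h) /\<^sub>R norm h)
      = norm (conv \<psi> f (x + h) - conv \<psi> f x - G h) / norm h" for h
    by (simp only: norm_scaleR) (simp add: divide_inverse mult.commute)
  ultimately show ?thesis
    using lin_G unfolding G_def[symmetric] has_derivative_at by (simp only: simp_thms)
qed

section \<open>Mollification\<close>

lemma ball_borel[measurable]: "ball x r \<in> sets borel"
  by (rule borel_open[OF open_ball])

definition scaled_kernel :: "real \<Rightarrow> 'a::euclidean_space \<Rightarrow> real" where
  "scaled_kernel \<tau> y = (1 / \<tau> ^ DIM('a)) * kernel ((1 / \<tau>) *\<^sub>R y)"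

definition mollify :: "real \<Rightarrow> ('a::euclidean_space \<Rightarrow> 'b::euclidean_space) \<Rightarrow> 'a \<Rightarrow> 'b" where
  "mollify \<tau> = conv (scaled_kernel \<tau>)"

lemma test_function_scaled_kernel: "\<tau> > 0 \<Longrightarrow> test_function (scaled_kernel \<tau>)"
  unfolding scaled_kernel_def[abs_def] by (rule test_function_kernel)

lemma scaled_kernel_measurable[measurable]: "scaled_kernel \<tau> \<in> borel_measurable borel"
  unfolding scaled_kernel_def[abs_def] by measurable

lemma scaled_kernel_nonneg: "\<tau> > 0 \<Longrightarrow> 0 \<le> scaled_kernel \<tau> y"
  by (simp add: scaled_kernel_def kernel_nonneg)

lemma nn_integral_affine:
  fixes F :: "'a::euclidean_space \<Rightarrow> ennreal"
  assumes [measurable]: "F \<in> borel_measurable borel" and c: "c > 0"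
  shows "(\<integral>\<^sup>+y. F y \<partial>lborel) = ennreal (c ^ DIM('a)) * (\<integral>\<^sup>+u. F (t + c *\<^sub>R u) \<partial>lborel)"
proof -
  have "(\<integral>\<^sup>+y. F y \<partial>lborel) = (\<integral>\<^sup>+y. F y \<partial>density (distr lborel borel (\<lambda>x. t + c *\<^sub>R x)) (\<lambda>_. \<bar>c\<bar> ^ DIM('a)))"
    using lborel_affine[of c t] c by simp
  also have "\<dots> = ennreal (c ^ DIM('a)) * (\<integral>\<^sup>+u. F (t + c *\<^sub>R u) \<partial>lborel)"
    using c by (simp add: nn_integral_density nn_integral_distr nn_integral_cmult)
  finally show ?thesis .
qed

lemma nn_integral_translate:
  fixes F :: "'a::euclidean_space \<Rightarrow> ennreal"
  assumes [measurable]: "F \<in> borel_measurable borel"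
  shows "(\<integral>\<^sup>+u. F (t + u) \<partial>lborel) = (\<integral>\<^sup>+y. F y \<partial>lborel)"
  using nn_integral_affine[OF assms, of 1 t] by simp

lemma nn_integral_scaled_kernel:
  fixes g :: "'a::euclidean_space \<Rightarrow> ennreal"
  assumes [measurable]: "g \<in> borel_measurable borel" and \<tau>: "\<tau> > 0"
  shows "(\<integral>\<^sup>+y. ennreal (scaled_kernel \<tau> (y - x)) * g y \<partial>lborel)
      = (\<integral>\<^sup>+w. ennreal (kernel w) * g (x + \<tau> *\<^sub>R w) \<partial>lborel)"
proof -
  have "(\<integral>\<^sup>+y. ennreal (scaled_kernel \<tau> (y - x)) * g y \<partial>lborel)
      = ennreal (\<tau> ^ DIM('a)) * (\<integral>\<^sup>+w. ennreal (scaled_kernel \<tau> (\<tau> *\<^sub>R w)) * g (x + \<tau> *\<^sub>R w) \<partial>lborel)"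
    using nn_integral_affine[of "\<lambda>y. ennreal (scaled_kernel \<tau> (y - x)) * g y" \<tau> x] \<tau> by simp
  also have "\<dots> = (\<integral>\<^sup>+w. ennreal (\<tau> ^ DIM('a)) * (ennreal (scaled_kernel \<tau> (\<tau> *\<^sub>R w)) * g (x + \<tau> *\<^sub>R w)) \<partial>lborel)"
    by (rule nn_integral_cmult[symmetric]) measurable
  also have "\<dots> = (\<integral>\<^sup>+w. ennreal (kernel w) * g (x + \<tau> *\<^sub>R w) \<partial>lborel)"
  proof (rule nn_integral_cong)
    fix w :: 'a
    have "ennreal (\<tau> ^ DIM('a)) * ennreal (scaled_kernel \<tau> (\<tau> *\<^sub>R w)) = ennreal (kernel w)"
      using \<tau> by (subst ennreal_mult[symmetric]) (auto simp: scaled_kernel_def kernel_nonneg)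
    then show "ennreal (\<tau> ^ DIM('a)) * (ennreal (scaled_kernel \<tau> (\<tau> *\<^sub>R w)) * g (x + \<tau> *\<^sub>R w))
        = ennreal (kernel w) * g (x + \<tau> *\<^sub>R w)"
      by (simp add: mult.assoc[symmetric])
  qed
  finally show ?thesis .
qed

lemma scaled_kernel_integral:
  assumes "\<tau> > 0"
  shows "integrable lebesgue (\<lambda>y. scaled_kernel \<tau> (y - x))"
    and "(LINT y|lebesgue. scaled_kernel \<tau> (y - x)) = 1"
proof -
  have "(\<integral>\<^sup>+y. ennreal (scaled_kernel \<tau> (y - x)) \<partial>lborel) = 1"
    using nn_integral_scaled_kernel[of "\<lambda>_. 1" \<tau> x] assms by (simp add: kernel_nn_integral)
  then have "has_bochner_integral lborel (\<lambda>y. scaled_kernel \<tau> (y - x)) 1"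
    using assms by (intro has_bochner_integral_nn_integral) (auto simp: scaled_kernel_nonneg)
  then have "has_bochner_integral lebesgue (\<lambda>y. scaled_kernel \<tau> (y - x)) 1"
    by (auto simp: has_bochner_integral_iff integrable_completion integral_completion)
  then show "integrable lebesgue (\<lambda>y. scaled_kernel \<tau> (y - x))"
    and "(LINT y|lebesgue. scaled_kernel \<tau> (y - x)) = 1"
    by (auto simp: has_bochner_integral_iff)
qed

lemma mollify_norm_le:
  assumes [measurable]: "f \<in> borel_measurable borel" and "locally_integrable f" "\<tau> > 0"
  shows "ennreal (norm (mollify \<tau> f x)) \<le> (\<integral>\<^sup>+w. ennreal (kernel w) * ennreal (norm (f (x + \<tau> *\<^sub>R w))) \<partial>lborel)"
proof -
  have "ennreal (norm (mollify \<tau> f x)) \<le> (\<integral>\<^sup>+y. ennreal (norm (scaled_kernel \<tau> (y - x) *\<^sub>R f y)) \<partial>lebesgue)"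
    unfolding mollify_def conv_def
    by (intro integral_norm_bound_ennreal conv_integrable test_function_scaled_kernel assms)
  also have "\<dots> = (\<integral>\<^sup>+y. ennreal (scaled_kernel \<tau> (y - x)) * ennreal (norm (f y)) \<partial>lborel)"
    using assms(3) by (simp add: nn_integral_completion scaled_kernel_nonneg ennreal_mult)
  also have "\<dots> = (\<integral>\<^sup>+w. ennreal (kernel w) * ennreal (norm (f (x + \<tau> *\<^sub>R w))) \<partial>lborel)"
    using assms(3) by (intro nn_integral_scaled_kernel) auto
  finally show ?thesis .
qed

text \<open>Lebesgue points: the differentiation theorem is applied to the countably many functions
  \<open>norm (f y - q)\<close> with \<open>q\<close> in a dense set. Choosing \<open>q\<close> near
  \<open>f x\<close> bounds the mean oscillation of \<open>f\<close> over small cubes with corner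
  \<open>x\<close>, and the kernel is at most \<open>kernel_max\<close> over the volume of the
  cube.\<close>

lemma mollify_tendsto_AE:
  fixes f :: "'a::euclidean_space \<Rightarrow> 'b::euclidean_space"
  assumes f: "locally_integrable f"
  obtains N where "negligible N" "\<And>x. x \<notin> N \<Longrightarrow> ((\<lambda>\<tau>. mollify \<tau> f x) \<longlongrightarrow> f x) (at_right 0)"
proof -
  obtain Q :: "'b set" where Q: "countable Q" "\<And>X. open X \<Longrightarrow> X \<noteq> {} \<Longrightarrow> \<exists>q\<in>Q. q \<in> X"
    using countable_dense_exists by blast
  have fint: "set_integrable lebesgue (cbox a b) (\<lambda>y. norm (f y - q))" for a b q
  proof -
    have "set_integrable lebesgue (cbox a b) f"
      using f by (simp add: locally_integrable_def)
    moreover have "set_integrable lebesgue (cbox a b) (\<lambda>_. q)"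
      unfolding set_integrable_def
      by (rule integrable_completion[THEN iffD2]) (auto intro!: borel_integrable_compact)
    ultimately show ?thesis
      by (intro set_integrable_norm set_integral_diff)
  qed
  have "\<forall>q\<in>Q. \<exists>N. negligible N \<and> (\<forall>x e. x \<notin> N \<longrightarrow> 0 < e \<longrightarrow> (\<exists>d>0. \<forall>h. 0 < h \<and> h < d \<longrightarrow>
      norm (integral (cbox x (x + h *\<^sub>R One)) (\<lambda>y. norm (f y - q)) /\<^sub>R h ^ DIM('a) - norm (f x - q)) < e))"
  proof
    fix q
    have "(\<lambda>y. norm (f y - q)) integrable_on cbox a b" for a b
      using fint[of a b q] by (rule set_lebesgue_integral_eq_integral(1))
    from integrable_ccontinuous_explicit[OF this]
    show "\<exists>N. negligible N \<and> (\<forall>x e. x \<notin> N \<longrightarrow> 0 < e \<longrightarrow> (\<exists>d>0. \<forall>h. 0 < h \<and> h < d \<longrightarrow>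
      norm (integral (cbox x (x + h *\<^sub>R One)) (\<lambda>y. norm (f y - q)) /\<^sub>R h ^ DIM('a) - norm (f x - q)) < e))"
      by metis
  qed
  then obtain N where N: "\<And>q. q \<in> Q \<Longrightarrow> negligible (N q)"
    "\<And>q x e. q \<in> Q \<Longrightarrow> x \<notin> N q \<Longrightarrow> 0 < e \<Longrightarrow> \<exists>d>0. \<forall>h. 0 < h \<and> h < d \<longrightarrow>
      norm (integral (cbox x (x + h *\<^sub>R One)) (\<lambda>y. norm (f y - q)) /\<^sub>R h ^ DIM('a) - norm (f x - q)) < e"
    by metis
  show ?thesis
  proof (rule that)
    show "negligible (\<Union>q\<in>Q. N q)"
      using Q(1) N(1) by (intro negligible_countable_Union) auto
    fix x assume x: "x \<notin> (\<Union>q\<in>Q. N q)"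
    let ?K = "kernel_max TYPE('a)"
    have K: "?K > 0" by (rule kernel_max_pos)
    show "((\<lambda>\<tau>. mollify \<tau> f x) \<longlongrightarrow> f x) (at_right 0)"
    proof (rule tendstoI)
      fix e :: real assume e: "e > 0"
      \<comment> \<open>The cube average of \<open>norm (f y - q)\<close> is below
        \<open>2 * \<eta>\<close> and is weighted by \<open>?K\<close>; exchanging \<open>q\<close>
        for \<open>f x\<close> costs another \<open>\<eta>\<close>. The total is below
        \<open>(3 * ?K + 1) * \<eta>\<close>.\<close>
      define \<eta> where "\<eta> = e / (3 * ?K + 1)"
      have \<eta>: "\<eta> > 0" using e K by (simp add: \<eta>_def)
      then obtain q where q: "q \<in> Q" "dist (f x) q < \<eta>"
        using Q(2)[of "ball (f x) \<eta>"] by auto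
      have xq: "x \<notin> N q" using x q(1) by blast
      obtain d where d: "d > 0" "\<And>h. 0 < h \<Longrightarrow> h < d \<Longrightarrow>
          norm (integral (cbox x (x + h *\<^sub>R One)) (\<lambda>y. norm (f y - q)) /\<^sub>R h ^ DIM('a) - norm (f x - q)) < \<eta>"
        using N(2)[OF q(1) xq \<eta>] by auto
      have "dist (mollify h f x) (f x) < e" if h: "0 < h" "h < d" for h
      proof -
        let ?C = "cbox x (x + h *\<^sub>R One)"
        have int: "integrable lebesgue (\<lambda>y. scaled_kernel h (y - x) *\<^sub>R f y)"
          by (intro conv_integrable test_function_scaled_kernel f h)
        have intc: "integrable lebesgue (\<lambda>y. scaled_kernel h (y - x) *\<^sub>R c)" for c :: 'b
          using scaled_kernel_integral(1)[OF h(1)] by (intro integrable_scaleR_left) auto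
        have ind: "norm (scaled_kernel h (y - x) *\<^sub>R (f y - q)) \<le> ?K / h ^ DIM('a) * (indicator ?C y * norm (f y - q))" for y
        proof (cases "y \<in> ?C")
          case True
          then show ?thesis
            using h kernel_nonneg[of "(1 / h) *\<^sub>R (y - x)"] kernel_le[of "(1 / h) *\<^sub>R (y - x)"]
            by (auto simp: scaled_kernel_def divide_simps intro!: mult_right_mono)
        next
          case False
          then have "(1 / h) *\<^sub>R (y - x) \<notin> cbox 0 One"
            using h by (auto simp: mem_box field_simps inner_simps)
          then show ?thesis
            by (simp add: scaled_kernel_def kernel_eq_0 False)
        qed
        have "mollify h f x - f x = (LINT y|lebesgue. scaled_kernel h (y - x) *\<^sub>R (f y - q)) + (q - f x)"
          unfolding mollify_def conv_def scaleR_diff_right using scaled_kernel_integral[OF h(1), of x]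
          by (simp add: Bochner_Integration.integral_diff[OF int intc])
        then have "norm (mollify h f x - f x) \<le> norm (LINT y|lebesgue. scaled_kernel h (y - x) *\<^sub>R (f y - q)) + norm (q - f x)"
          by (simp only: norm_triangle_ineq)
        also have "norm (LINT y|lebesgue. scaled_kernel h (y - x) *\<^sub>R (f y - q))
            \<le> (LINT y|lebesgue. norm (scaled_kernel h (y - x) *\<^sub>R (f y - q)))"
          by (rule integral_norm_bound)
        also have "\<dots> \<le> (LINT y|lebesgue. ?K / h ^ DIM('a) * (indicator ?C y * norm (f y - q)))"
          using int intc fint[of x "x + h *\<^sub>R One" q]
          by (intro integral_mono ind integrable_norm integrable_mult_right)
            (auto simp: scaleR_diff_right set_integrable_def)
        also have "\<dots> = ?K / h ^ DIM('a) * integral ?C (\<lambda>y. norm (f y - q))"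
          using set_lebesgue_integral_eq_integral(2)[OF fint[of x "x + h *\<^sub>R One" q]]
          by (simp add: set_lebesgue_integral_def)
        also have "\<dots> = ?K * (integral ?C (\<lambda>y. norm (f y - q)) /\<^sub>R h ^ DIM('a))"
          by (simp add: field_simps)
        also have "\<dots> \<le> ?K * (2 * \<eta>)"
          using d(2)[OF h] q(2) K by (intro mult_left_mono) (auto simp: dist_norm)
        also have "?K * (2 * \<eta>) + norm (q - f x) < ?K * (2 * \<eta>) + \<eta>"
          using q(2) by (simp add: dist_norm norm_minus_commute)
        also have "\<dots> \<le> \<eta> * (3 * ?K + 1)"
          using K \<eta> by (simp add: algebra_simps)
        also have "\<dots> = e"
          using K by (simp add: \<eta>_def)
        finally show ?thesis
          by (simp add: dist_norm)
      qed
      then show "\<forall>\<^sub>F \<tau> in at_right 0. dist (mollify \<tau> f x) (f x) < e"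
        using d(1) by (auto simp: eventually_at_right_field)
    qed
  qed
qed

section \<open>The maximal function\<close>

text \<open>The mean over the ball of radius \<open>\<rho>\<close> around \<open>x\<close>,
  multiplied by the volume of the unit ball. Pulling back to the fixed unit ball makes measurability
  in \<open>x\<close> and exchanges of integrals immediate.\<close>

definition ball_avg :: "('a::euclidean_space \<Rightarrow> ennreal) \<Rightarrow> real \<Rightarrow> 'a \<Rightarrow> ennreal" where
  "ball_avg g \<rho> x = (\<integral>\<^sup>+w. indicator (ball 0 1) w * g (x + \<rho> *\<^sub>R w) \<partial>lborel)"

text \<open>Only dyadic radii are used, which keeps the supremum countable and hence measurable.\<close>

definition maximal :: "('a::euclidean_space \<Rightarrow> ennreal) \<Rightarrow> 'a \<Rightarrow> ennreal" where
  "maximal g x = (SUP k::int. ball_avg g (2 powr k) x)"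

text \<open>Rounding \<open>\<rho> * m\<close> up to a power of 2 at most doubles it, which accounts
  for the factor 2 in \<open>2 * m\<close>. Every radius is thereby covered by the dyadic
  ones.\<close>

lemma ball_avg_large_le:
  fixes g :: "'a::euclidean_space \<Rightarrow> ennreal"
  assumes [measurable]: "g \<in> borel_measurable borel" and "\<rho> > 0" "m > 0"
  shows "(\<integral>\<^sup>+w. indicator (ball 0 m) w * g (x + \<rho> *\<^sub>R w) \<partial>lborel) \<le> ennreal ((2 * m) ^ DIM('a)) * maximal g x"
proof -
  define k where "k = \<lceil>log 2 (\<rho> * m)\<rceil>"
  define \<sigma> where "\<sigma> = (2::real) powr k"
  have pos: "\<rho> * m > 0" using assms by simp
  have 1: "\<rho> * m \<le> \<sigma>"
    using pos unfolding \<sigma>_def k_def by (simp add: le_powr_iff)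
  have "real_of_int k < log 2 (\<rho> * m) + 1"
    unfolding k_def by linarith
  then have "\<sigma> < 2 powr (log 2 (\<rho> * m) + 1)"
    unfolding \<sigma>_def by simp
  also have "\<dots> = 2 * (\<rho> * m)"
    using pos by (simp add: powr_add)
  finally have 2: "\<sigma> < 2 * (\<rho> * m)" .
  define c where "c = \<sigma> / \<rho>"
  have c: "c > 0" "c \<le> 2 * m" "m \<le> c"
    using 1 2 assms by (auto simp: c_def field_simps \<sigma>_def)
  have "(\<integral>\<^sup>+w. indicator (ball 0 m) w * g (x + \<rho> *\<^sub>R w) \<partial>lborel)
      = ennreal (c ^ DIM('a)) * (\<integral>\<^sup>+u. indicator (ball 0 m) (c *\<^sub>R u) * g (x + \<rho> *\<^sub>R (c *\<^sub>R u)) \<partial>lborel)"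
    using nn_integral_affine[of "\<lambda>w. indicator (ball 0 m) w * g (x + \<rho> *\<^sub>R w)" c 0] c by simp
  also have "\<dots> \<le> ennreal (c ^ DIM('a)) * ball_avg g \<sigma> x"
    unfolding ball_avg_def
  proof (intro mult_left_mono nn_integral_mono)
    fix u :: 'a
    have i: "indicator (ball 0 m) (c *\<^sub>R u) \<le> (indicator (ball 0 1) u :: ennreal)"
    proof (cases "norm u < 1")
      case False
      then have "c * 1 \<le> c * norm u"
        using c by (intro mult_left_mono) auto
      then have "\<not> c * norm u < m" using c by linarith
      then show ?thesis using c by (simp add: indicator_def)
    qed (simp add: indicator_def)
    have e: "\<rho> *\<^sub>R (c *\<^sub>R u) = \<sigma> *\<^sub>R u"
      using assms by (simp add: c_def)
    show "indicator (ball 0 m) (c *\<^sub>R u) * g (x + \<rho> *\<^sub>R (c *\<^sub>R u)) \<le> indicator (ball 0 1) u * g (x + \<sigma> *\<^sub>R u)"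
      unfolding e by (rule mult_right_mono[OF i]) simp
  qed simp
  also have "\<dots> \<le> ennreal ((2 * m) ^ DIM('a)) * maximal g x"
    using c unfolding maximal_def \<sigma>_def
    by (intro mult_mono ennreal_leI power_mono SUP_upper) auto
  finally show ?thesis .
qed

lemma ball_avg_eq:
  fixes g :: "'a::euclidean_space \<Rightarrow> ennreal"
  assumes [measurable]: "g \<in> borel_measurable borel" and \<rho>: "\<rho> > 0"
  shows "ennreal (\<rho> ^ DIM('a)) * ball_avg g \<rho> x = (\<integral>\<^sup>+y. indicator (ball x \<rho>) y * g y \<partial>lborel)"
proof -
  have "(\<integral>\<^sup>+y. indicator (ball x \<rho>) y * g y \<partial>lborel)
      = ennreal (\<rho> ^ DIM('a)) * (\<integral>\<^sup>+u. indicator (ball x \<rho>) (x + \<rho> *\<^sub>R u) * g (x + \<rho> *\<^sub>R u) \<partial>lborel)"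
    by (rule nn_integral_affine[OF _ \<rho>]) measurable
  moreover have "indicator (ball x \<rho>) (x + \<rho> *\<^sub>R u) = (indicator (ball 0 1) u :: ennreal)" for u
    using \<rho> by (auto simp: indicator_def dist_norm)
  ultimately show ?thesis
    by (simp add: ball_avg_def)
qed

lemma ball_avg_measurable[measurable]:
  fixes g :: "'a::euclidean_space \<Rightarrow> ennreal"
  assumes [measurable]: "g \<in> borel_measurable borel"
  shows "ball_avg g \<rho> \<in> borel_measurable borel"
  unfolding ball_avg_def[abs_def] by measurable

lemma maximal_measurable[measurable]:
  fixes g :: "'a::euclidean_space \<Rightarrow> ennreal"
  assumes [measurable]: "g \<in> borel_measurable borel"
  shows "maximal g \<in> borel_measurable borel"
  unfolding maximal_def[abs_def] by measurable

text \<open>Ball averages are lower semicontinuous by Fatou, since a point of the open ball around a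
  limit centre eventually lies in the balls around the approaching centres; a supremum preserves
  this. Openness lets compressibility, which is tested on open sets, act on superlevel sets.\<close>

lemma open_maximal_gt:
  fixes g :: "'a::euclidean_space \<Rightarrow> ennreal"
  assumes g[measurable]: "g \<in> borel_measurable borel"
  shows "open {x. \<kappa> < maximal g x}"
proof -
  have "closed {x. ball_avg g \<rho> x \<le> \<kappa>}" if \<rho>: "\<rho> > 0" for \<rho>
    unfolding closed_sequential_limits
  proof safe
    fix x :: "nat \<Rightarrow> 'a" and l
    assume x: "\<forall>n. x n \<in> {x. ball_avg g \<rho> x \<le> \<kappa>}" and lim: "x \<longlonglongrightarrow> l"
    have "ennreal (\<rho> ^ DIM('a)) * ball_avg g \<rho> l = (\<integral>\<^sup>+y. indicator (ball l \<rho>) y * g y \<partial>lborel)"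
      by (rule ball_avg_eq[OF g \<rho>])
    also have "\<dots> \<le> (\<integral>\<^sup>+y. liminf (\<lambda>n. indicator (ball (x n) \<rho>) y * g y) \<partial>lborel)"
    proof (rule nn_integral_mono)
      fix y
      show "indicator (ball l \<rho>) y * g y \<le> liminf (\<lambda>n. indicator (ball (x n) \<rho>) y * g y)"
      proof (cases "y \<in> ball l \<rho>")
        case True
        have "(\<lambda>n. dist (x n) y) \<longlonglongrightarrow> dist l y"
          by (intro tendsto_intros lim)
        with True have "\<forall>\<^sub>F n in sequentially. dist (x n) y < \<rho>"
          by (intro order_tendstoD) auto
        then have "\<forall>\<^sub>F n in sequentially. g y \<le> indicator (ball (x n) \<rho>) y * g y"
          by eventually_elim auto
        then have "g y \<le> liminf (\<lambda>n. indicator (ball (x n) \<rho>) y * g y)"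
          by (rule Liminf_bounded)
        with True show ?thesis by simp
      qed simp
    qed
    also have "\<dots> \<le> liminf (\<lambda>n. \<integral>\<^sup>+y. indicator (ball (x n) \<rho>) y * g y \<partial>lborel)"
      by (rule nn_integral_liminf) measurable
    also have "\<dots> = liminf (\<lambda>n. ennreal (\<rho> ^ DIM('a)) * ball_avg g \<rho> (x n))"
      using ball_avg_eq[OF g \<rho>] by simp
    also have "\<dots> \<le> liminf (\<lambda>n. ennreal (\<rho> ^ DIM('a)) * \<kappa>)"
      using x by (intro Liminf_mono always_eventually) (auto intro!: mult_left_mono)
    also have "\<dots> = ennreal (\<rho> ^ DIM('a)) * \<kappa>"
      by (simp add: Liminf_const)
    finally show "ball_avg g \<rho> l \<le> \<kappa>"
      using \<rho> by (subst (asm) ennreal_mult_le_mult_iff) (auto simp: ennreal_eq_0_iff not_le)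
  qed
  then have "open (- {x. ball_avg g (2 powr real_of_int k) x \<le> \<kappa>})" for k
    by (simp add: open_Compl)
  then have "open (\<Union>k::int. - {x. ball_avg g (2 powr k) x \<le> \<kappa>})"
    by (intro open_UN) auto
  moreover have "{x. \<kappa> < maximal g x} = (\<Union>k::int. - {x. ball_avg g (2 powr k) x \<le> \<kappa>})"
    by (auto simp: maximal_def less_SUP_iff not_le)
  ultimately show ?thesis by simp
qed

text \<open>The power of 5 is the enlargement in Vitali's covering lemma; the other factor comes
  from the threshold \<open>\<mu> = \<kappa> / (2 * \<omega>)\<close> in
  \<open>maximal_weak_type\<close>, where \<open>\<omega>\<close> is the volume of the unit
  ball.\<close>

definition weak_type_const :: "'a::euclidean_space itself \<Rightarrow> real \<Rightarrow> real" where
  "weak_type_const _ p = 5 ^ DIM('a) * (2 * measure lborel (ball (0::'a) 1)) powr p"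

lemma measure_ball_pos: "0 < \<rho> \<Longrightarrow> 0 < measure lborel (ball (x::'a::euclidean_space) \<rho>)"
  using content_ball_pos[of \<rho> x] by (simp add: measure_completion)

lemma emeasure_ball_scale:
  assumes "\<rho> > 0"
  shows "emeasure lborel (ball (x::'a::euclidean_space) \<rho>) = ennreal (\<rho> ^ DIM('a) * measure lborel (ball (0::'a) 1))"
proof -
  have fin: "emeasure lborel (ball (0::'a) 1) = ennreal (measure lborel (ball (0::'a) 1))"
    using emeasure_lborel_ball_finite[of "0::'a" 1]
    by (intro emeasure_eq_ennreal_measure) (simp add: less_top)
  have "emeasure lborel (ball x \<rho>) = ennreal (\<rho> ^ DIM('a)) * ball_avg (\<lambda>_. 1) \<rho> x"
    using ball_avg_eq[of "\<lambda>_. 1" \<rho> x] assms by simp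
  also have "ball_avg (\<lambda>_. 1) \<rho> x = emeasure lborel (ball (0::'a) 1)"
    by (simp add: ball_avg_def)
  finally show ?thesis
    using assms by (simp add: fin ennreal_mult)
qed

text \<open>The pointwise bound \<open>g \<le> \<mu> + \<mu>\<^sup>1\<^sup>-\<^sup>p g\<^sup>p\<close> replaces Jensen's inequality, reducing the
  weak \<open>(p,p)\<close> estimate to the covering argument for \<open>g\<^sup>p\<close>.\<close>

lemma maximal_weak_type:
  fixes g :: "'a::euclidean_space \<Rightarrow> real"
  assumes [measurable]: "g \<in> borel_measurable borel" and g0: "\<And>x. g x \<ge> 0" and p: "p > 1" and l: "\<kappa> > 0"
  shows "emeasure lborel {x. ennreal \<kappa> < maximal (\<lambda>x. ennreal (g x)) x}
    \<le> ennreal (weak_type_const TYPE('a) p / \<kappa> powr p) * (\<integral>\<^sup>+x. ennreal (g x powr p) \<partial>lborel)"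
proof -
  define A where "A = (\<integral>\<^sup>+x. ennreal (g x powr p) \<partial>lborel)"
  define \<omega> where "\<omega> = measure lborel (ball (0::'a) 1)"
  have \<omega>: "\<omega> > 0" unfolding \<omega>_def by (rule measure_ball_pos) simp
  \<comment> \<open>With this \<open>\<mu>\<close> the constant term of the pointwise bound
    contributes exactly \<open>\<kappa> / 2\<close> to a ball average, so the term with the
    \<open>p\<close>-th power must carry the other half.\<close>
  define \<mu> where "\<mu> = \<kappa> / (2 * \<omega>)"
  have \<mu>: "\<mu> > 0" using l \<omega> by (simp add: \<mu>_def)
  define c where "c = \<kappa> / 2 * \<mu> powr (p - 1)"
  have c: "c > 0" using l \<mu> by (simp add: c_def)
  define I where "I x \<rho> = (\<integral>\<^sup>+y. ennreal (g y powr p) * indicator (ball x \<rho>) y \<partial>lborel)" for x \<rho>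
  have Wc: "weak_type_const TYPE('a) p / \<kappa> powr p = 5 ^ DIM('a) * \<omega> / c"
  proof -
    have "(2 * \<omega>) powr p = (2 * \<omega>) * (2 * \<omega>) powr (p - 1)"
      using powr_add[of "2 * \<omega>" 1 "p - 1"] \<omega> by simp
    moreover have "\<kappa> powr p = \<kappa> * \<kappa> powr (p - 1)"
      using powr_add[of \<kappa> 1 "p - 1"] l by simp
    moreover have "\<mu> powr (p - 1) = \<kappa> powr (p - 1) / (2 * \<omega>) powr (p - 1)"
      using l \<omega> by (simp add: \<mu>_def powr_divide)
    ultimately show ?thesis
      using l \<omega> \<mu> unfolding weak_type_const_def \<omega>_def[symmetric] c_def
      by (simp add: field_simps)
  qed
  have key: "ennreal (c * \<rho> ^ DIM('a)) \<le> I x \<rho>" if \<rho>: "\<rho> > 0" and gt: "ennreal \<kappa> < ball_avg (\<lambda>x. ennreal (g x)) \<rho> x" for x \<rho>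
  proof -
    have pw: "g y \<le> \<mu> + \<mu> powr (1 - p) * g y powr p" for y
    proof (cases "g y \<le> \<mu>")
      case True
      then show ?thesis using \<mu> by (auto intro: add_increasing2)
    next
      case False
      then have "g y powr 1 = g y powr (1 - p) * g y powr p"
        using \<mu> by (subst powr_add[symmetric]) auto
      also have "\<dots> \<le> \<mu> powr (1 - p) * g y powr p"
        using False \<mu> p by (intro mult_right_mono powr_mono2') auto
      finally show ?thesis using False \<mu> by simp
    qed
    have "ball_avg (\<lambda>x. ennreal (g x)) \<rho> x
        \<le> (\<integral>\<^sup>+w. ennreal \<mu> * indicator (ball 0 1) w + ennreal (\<mu> powr (1 - p)) * (indicator (ball 0 1) w * ennreal (g (x + \<rho> *\<^sub>R w) powr p)) \<partial>lborel)"
      unfolding ball_avg_def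
    proof (rule nn_integral_mono)
      fix w :: 'a
      show "indicator (ball 0 1) w * ennreal (g (x + \<rho> *\<^sub>R w))
        \<le> ennreal \<mu> * indicator (ball 0 1) w + ennreal (\<mu> powr (1 - p)) * (indicator (ball 0 1) w * ennreal (g (x + \<rho> *\<^sub>R w) powr p))"
        using pw[of "x + \<rho> *\<^sub>R w"] \<mu>
        by (auto simp: indicator_def ennreal_plus[symmetric] ennreal_mult[symmetric] simp del: ennreal_plus intro!: ennreal_leI)
    qed
    also have "\<dots> = ennreal \<mu> * emeasure lborel (ball (0::'a) 1) + ennreal (\<mu> powr (1 - p)) * ball_avg (\<lambda>y. ennreal (g y powr p)) \<rho> x"
      by (simp add: nn_integral_add nn_integral_cmult ball_avg_def)
    also have "ennreal \<mu> * emeasure lborel (ball (0::'a) 1) = ennreal (\<kappa> / 2)"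
      using emeasure_ball_scale[of 1 "0::'a"] \<mu> \<omega>
      by (simp add: ennreal_mult[symmetric] \<omega>_def[symmetric]) (simp add: \<mu>_def)
    finally have "ennreal \<kappa> < ennreal (\<kappa> / 2) + ennreal (\<mu> powr (1 - p)) * ball_avg (\<lambda>y. ennreal (g y powr p)) \<rho> x"
      using gt by order
    then have *: "ennreal (\<kappa> / 2) + ennreal (\<kappa> / 2) < ennreal (\<kappa> / 2) + ennreal (\<mu> powr (1 - p)) * ball_avg (\<lambda>y. ennreal (g y powr p)) \<rho> x"
      using l by (simp add: ennreal_plus[symmetric] del: ennreal_plus)
    then have "ennreal (\<kappa> / 2) \<le> ennreal (\<mu> powr (1 - p)) * ball_avg (\<lambda>y. ennreal (g y powr p)) \<rho> x"
      by (metis add_left_mono linorder_not_less nle_le)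
    then have "ennreal (\<mu> powr (p - 1) * \<rho> ^ DIM('a)) * ennreal (\<kappa> / 2)
        \<le> ennreal (\<mu> powr (p - 1) * \<rho> ^ DIM('a)) * (ennreal (\<mu> powr (1 - p)) * ball_avg (\<lambda>y. ennreal (g y powr p)) \<rho> x)"
      by (rule mult_left_mono) simp
    also have "\<dots> = ennreal (\<mu> powr (p - 1) * \<mu> powr (1 - p)) * (ennreal (\<rho> ^ DIM('a)) * ball_avg (\<lambda>y. ennreal (g y powr p)) \<rho> x)"
      using \<mu> \<rho> by (simp add: ennreal_mult mult_ac)
    also have "\<mu> powr (p - 1) * \<mu> powr (1 - p) = 1"
      using \<mu> by (simp add: powr_add[symmetric])
    also have "ennreal (\<rho> ^ DIM('a)) * ball_avg (\<lambda>y. ennreal (g y powr p)) \<rho> x = I x \<rho>"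
      unfolding I_def by (subst ball_avg_eq[OF _ \<rho>]) (auto simp: mult.commute)
    also have "ennreal (\<mu> powr (p - 1) * \<rho> ^ DIM('a)) * ennreal (\<kappa> / 2) = ennreal (c * \<rho> ^ DIM('a))"
      using l \<mu> \<rho> by (subst ennreal_mult[symmetric]) (auto simp: c_def mult_ac)
    finally show ?thesis by simp
  qed
  show ?thesis
  proof (cases "A = top")
    case True
    then show ?thesis
      using l c \<omega> unfolding A_def[symmetric] Wc by (simp add: ennreal_mult_top)
  next
    case False
    define K where "K = {(x, \<rho>). \<rho> > 0 \<and> ennreal (c * \<rho> ^ DIM('a)) \<le> I x \<rho>}"
    \<comment> \<open>A ball in \<open>K\<close> carries mass at least
      \<open>c * \<rho> ^ DIM('a)\<close>, so the finite total mass bounds the radii, as Vitali's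
      lemma requires. The maximum with 1 covers radii below 1, for which the radius exceeds its
      power.\<close>
    define Bd where "Bd = max 1 (enn2real A / c)"
    have r: "0 < snd i \<and> snd i \<le> Bd" if i: "i \<in> K" for i
    proof
      show "0 < snd i" using i by (auto simp: K_def)
      have "ennreal (c * snd i ^ DIM('a)) \<le> I (fst i) (snd i)"
        using i by (auto simp: K_def)
      also have "\<dots> \<le> A"
        unfolding I_def A_def by (intro nn_integral_mono) (auto simp: indicator_def)
      also have "A = ennreal (enn2real A)"
        using False by (simp add: less_top)
      finally have "c * snd i ^ DIM('a) \<le> enn2real A"
        by (simp add: ennreal_le_iff)
      then have "snd i ^ DIM('a) \<le> enn2real A / c"
        using c by (simp add: field_simps)
      moreover have "snd i \<le> snd i ^ DIM('a)" if "snd i \<ge> 1"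
        using that by (intro self_le_power) auto
      ultimately show "snd i \<le> Bd"
        unfolding Bd_def by linarith
    qed
    have cover: "{x. ennreal \<kappa> < maximal (\<lambda>x. ennreal (g x)) x} \<subseteq> (\<Union>i\<in>K. ball (fst i) (snd i))"
    proof
      fix x assume "x \<in> {x. ennreal \<kappa> < maximal (\<lambda>x. ennreal (g x)) x}"
      then obtain k :: int where "ennreal \<kappa> < ball_avg (\<lambda>x. ennreal (g x)) (2 powr k) x"
        by (auto simp: maximal_def less_SUP_iff)
      then have "(x, 2 powr k) \<in> K"
        using key[of "2 powr k" x] by (auto simp: K_def)
      then show "x \<in> (\<Union>i\<in>K. ball (fst i) (snd i))"
        by (intro UN_I[of "(x, 2 powr k)"]) auto
    qed
    obtain C where C: "countable C" "C \<subseteq> K"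
      "pairwise (\<lambda>i j. disjnt (ball (fst i) (snd i)) (ball (fst j) (snd j))) C"
      "{x. ennreal \<kappa> < maximal (\<lambda>x. ennreal (g x)) x} \<subseteq> (\<Union>i\<in>C. ball (fst i) (5 * snd i))"
      using Vitali_covering_lemma_balls[OF cover r] by blast
    define e where "e = to_nat_on C"
    have e: "inj_on e C" unfolding e_def by (rule inj_on_to_nat_on[OF C(1)])
    define X where "X n = (\<Union>i\<in>{i\<in>C. e i = n}. ball (fst i) (5 * snd i))" for n
    define Y where "Y n = (\<Union>i\<in>{i\<in>C. e i = n}. ball (fst i) (snd i))" for n
    have [measurable]: "X n \<in> sets borel" "Y n \<in> sets borel" for n
      unfolding X_def Y_def by (auto intro!: borel_open)
    let ?M = "density lborel (\<lambda>x. ennreal (g x powr p))"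
    have XY: "emeasure lborel (X n) \<le> ennreal (5 ^ DIM('a) * \<omega> / c) * emeasure ?M (Y n)" for n
    proof (cases "\<exists>i\<in>C. e i = n")
      case True
      then obtain i where i: "i \<in> C" "e i = n" by blast
      then have single: "{i\<in>C. e i = n} = {i}"
        using e by (auto dest: inj_onD)
      have i_pos: "snd i > 0" and iK: "ennreal (c * snd i ^ DIM('a)) \<le> I (fst i) (snd i)"
        using i C(2) r by (auto simp: K_def)
      have "emeasure lborel (X n) = ennreal ((5 * snd i) ^ DIM('a) * \<omega>)"
        unfolding X_def single using i_pos emeasure_ball_scale[of "5 * snd i" "fst i"] by (simp add: \<omega>_def)
      also have "\<dots> = ennreal (5 ^ DIM('a) * \<omega> / c) * ennreal (c * snd i ^ DIM('a))"
        using c \<omega> i_pos by (subst ennreal_mult[symmetric]) (auto simp: power_mult_distrib)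
      also have "\<dots> \<le> ennreal (5 ^ DIM('a) * \<omega> / c) * I (fst i) (snd i)"
        by (intro mult_left_mono iK) simp
      also have "I (fst i) (snd i) = emeasure ?M (Y n)"
        unfolding Y_def single I_def by (simp add: emeasure_density)
      finally show ?thesis .
    next
      case False
      then have "X n = {}" by (auto simp: X_def)
      then show ?thesis by simp
    qed
    have "disjoint_family Y"
    proof (unfold disjoint_family_on_def, intro ballI impI)
      fix m n :: nat assume "m \<noteq> n"
      have "ball (fst i) (snd i) \<inter> ball (fst j) (snd j) = {}" if "i \<in> C" "j \<in> C" "e i = m" "e j = n" for i j
      proof -
        have "i \<noteq> j" using that \<open>m \<noteq> n\<close> by blast
        from pairwiseD[OF C(3) that(1,2) this] show ?thesis
          unfolding disjnt_def .
      qed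
      then show "Y m \<inter> Y n = {}"
        unfolding Y_def by blast
    qed
    then have sumY: "(\<Sum>n. emeasure ?M (Y n)) = emeasure ?M (\<Union>n. Y n)"
      by (intro suminf_emeasure) auto
    have "emeasure lborel {x. ennreal \<kappa> < maximal (\<lambda>x. ennreal (g x)) x} \<le> emeasure lborel (\<Union>n. X n)"
    proof (rule emeasure_mono)
      have "(\<Union>i\<in>C. ball (fst i) (5 * snd i)) = (\<Union>n. X n)"
        unfolding X_def by blast
      with C(4) show "{x. ennreal \<kappa> < maximal (\<lambda>x. ennreal (g x)) x} \<subseteq> (\<Union>n. X n)"
        by simp
    qed simp
    also have "\<dots> \<le> (\<Sum>n. emeasure lborel (X n))"
      by (rule emeasure_subadditive_countably) auto
    also have "\<dots> \<le> (\<Sum>n. ennreal (5 ^ DIM('a) * \<omega> / c) * emeasure ?M (Y n))"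
      by (intro suminf_le XY) auto
    also have "\<dots> = ennreal (5 ^ DIM('a) * \<omega> / c) * emeasure ?M (\<Union>n. Y n)"
      by (simp add: sumY)
    also have "\<dots> \<le> ennreal (5 ^ DIM('a) * \<omega> / c) * emeasure ?M UNIV"
      by (intro mult_left_mono emeasure_mono) auto
    also have "emeasure ?M UNIV = A"
      by (simp add: emeasure_density A_def)
    finally show ?thesis
      by (simp add: Wc A_def)
  qed
qed

text \<open>A dyadic layer-cake argument: beyond \<open>\<kappa>\<close> the function is dominated
  by the levels \<open>2 ^ (k + 1) * \<kappa>\<close> on the sets where it exceeds
  \<open>2 ^ k * \<kappa>\<close>. The weak bound makes this a geometric series of ratio
  \<open>2 powr (1 - p)\<close>, convergent because \<open>p > 1\<close>. The measure of
  \<open>E\<close> enters only through the part below \<open>\<kappa>\<close>.\<close>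

lemma nn_integral_le_of_weak_type:
  fixes F :: "'x \<Rightarrow> ennreal"
  assumes [measurable]: "F \<in> borel_measurable M" "E \<in> sets M"
    and p: "p > 1" and l: "\<kappa> > 0" and K: "K \<ge> 0"
    and weak: "\<And>s. s \<ge> 1 \<Longrightarrow> emeasure M {x\<in>space M. ennreal (s * \<kappa>) < F x} \<le> ennreal (K / s powr p)"
  shows "(\<integral>\<^sup>+x. F x * indicator E x \<partial>M) \<le> ennreal \<kappa> * emeasure M E + ennreal (2 * \<kappa> * K / (1 - 2 powr (1 - p)))"
proof -
  define S where "S k = {x\<in>space M. ennreal (2 ^ k * \<kappa>) < F x}" for k :: nat
  have [measurable]: "S k \<in> sets M" for k
    unfolding S_def by measurable
  have pw: "F x \<le> ennreal \<kappa> + (\<Sum>k. ennreal (2 ^ (k + 1) * \<kappa>) * indicator (S k) x)" (is "_ \<le> ?R")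
    if x: "x \<in> space M" for x
  proof (rule dense_le)
    fix z assume z: "z < F x"
    then have "z < top" by (rule order.strict_trans2) simp
    then obtain y where y: "y \<ge> 0" "z = ennreal y"
      by (cases z) auto
    show "z \<le> ?R"
    proof (cases "y \<le> \<kappa>")
      case True
      then have "z \<le> ennreal \<kappa>" using y by (simp add: ennreal_leI)
      then show ?thesis by (rule add_increasing2[rotated]) simp
    next
      case False
      obtain n where "y / \<kappa> < 2 ^ n"
        using real_arch_pow[of 2 "y / \<kappa>"] by auto
      then have n: "y \<le> 2 ^ n * \<kappa>" using l by (simp add: field_simps)
      \<comment> \<open>The least dyadic level not below \<open>y\<close> is at most twice a level
        strictly below \<open>y\<close>, hence strictly below \<open>F x\<close>.\<close>
      define m where "m = (LEAST n. y \<le> 2 ^ n * \<kappa>)"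
      have m: "y \<le> 2 ^ m * \<kappa>"
        unfolding m_def using n by (rule LeastI)
      have "m \<noteq> 0" using m False by (intro notI) simp
      then obtain k where k: "m = Suc k" by (cases m) auto
      then have "\<not> y \<le> 2 ^ k * \<kappa>"
        using not_less_Least[of k "\<lambda>n. y \<le> 2 ^ n * \<kappa>"] by (simp add: m_def[symmetric])
      then have "ennreal (2 ^ k * \<kappa>) < ennreal y"
        using l False by (intro ennreal_lessI) auto
      then have "x \<in> S k"
        using x z y by (auto simp: S_def)
      then have "ennreal (2 ^ (k + 1) * \<kappa>) = ennreal (2 ^ (k + 1) * \<kappa>) * indicator (S k) x"
        by simp
      also have "\<dots> \<le> (\<Sum>k. ennreal (2 ^ (k + 1) * \<kappa>) * indicator (S k) x)"
      proof -
        have "f k \<le> suminf f" for f :: "nat \<Rightarrow> ennreal"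
          using sum_le_suminf[of f "{k}"] by simp
        then show ?thesis .
      qed
      also have "\<dots> \<le> ?R" by (rule add_increasing) simp_all
      finally have "ennreal (2 ^ (k + 1) * \<kappa>) \<le> ?R" .
      moreover have "z \<le> ennreal (2 ^ (k + 1) * \<kappa>)"
        using m k y by (simp add: ennreal_leI)
      ultimately show ?thesis by (rule order_trans[rotated])
    qed
  qed
  define q where "q = 2 powr (1 - p)"
  have q: "0 < q" "q < 1"
    using p powr_less_mono[of "1 - p" 0 2] by (auto simp: q_def)
  have "(\<integral>\<^sup>+x. F x * indicator E x \<partial>M)
      \<le> (\<integral>\<^sup>+x. ennreal \<kappa> * indicator E x + (\<Sum>k. ennreal (2 ^ (k + 1) * \<kappa>) * indicator (S k) x) \<partial>M)"
    using pw by (intro nn_integral_mono) (auto simp: indicator_def)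
  also have "\<dots> = ennreal \<kappa> * emeasure M E + (\<Sum>k. ennreal (2 ^ (k + 1) * \<kappa>) * emeasure M (S k))"
    by (simp add: nn_integral_add nn_integral_cmult_indicator nn_integral_suminf)
  also have "(\<Sum>k. ennreal (2 ^ (k + 1) * \<kappa>) * emeasure M (S k)) \<le> (\<Sum>k. ennreal (2 * \<kappa> * K * q ^ k))"
  proof (intro suminf_le)
    fix k
    have "ennreal (2 ^ (k + 1) * \<kappa>) * emeasure M (S k) \<le> ennreal (2 ^ (k + 1) * \<kappa>) * ennreal (K / (2 ^ k) powr p)"
      unfolding S_def by (intro mult_left_mono weak) auto
    also have "\<dots> = ennreal (2 * \<kappa> * K * (2 ^ k * (2 ^ k) powr (- p)))"
      using l K by (subst ennreal_mult[symmetric]) (auto simp: powr_minus field_simps)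
    also have "(2::real) ^ k * (2 ^ k) powr (- p) = q ^ k"
    proof -
      have "(2::real) ^ k * (2 ^ k) powr (- p) = 2 powr (real k + real k * (- p))"
        by (simp only: powr_realpow[symmetric, of 2] zero_less_numeral powr_powr powr_add[symmetric])
      also have "real k + real k * (- p) = (1 - p) * real k"
        by (simp add: algebra_simps)
      also have "2 powr ((1 - p) * real k) = q ^ k"
        using q by (simp only: q_def powr_powr[symmetric] powr_realpow)
      finally show ?thesis .
    qed
    finally show "ennreal (2 ^ (k + 1) * \<kappa>) * emeasure M (S k) \<le> ennreal (2 * \<kappa> * K * q ^ k)" .
  qed auto
  also have "\<dots> = ennreal (2 * \<kappa> * K / (1 - q))"
  proof (rule suminf_ennreal_eq)
    show "0 \<le> 2 * \<kappa> * K * q ^ k" for k using l K q by simp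
    show "(\<lambda>k. 2 * \<kappa> * K * q ^ k) sums (2 * \<kappa> * K / (1 - q))"
      using sums_mult[OF geometric_sums[of q], of "2 * \<kappa> * K"] q by simp
  qed
  finally show ?thesis
    by (simp add: q_def add_left_mono)
qed

section \<open>Pointwise estimates for weakly differentiable functions\<close>

lemma cball_borel[measurable]: "cball x r \<in> sets borel"
  by (rule borel_closed[OF closed_cball])

lemma norm_le_DIM_of_unit_cube:
  assumes "w \<in> cbox 0 (One::'a::euclidean_space)"
  shows "norm w \<le> DIM('a)"
proof -
  have "norm w \<le> (\<Sum>i\<in>Basis. \<bar>w \<bullet> i\<bar>)"
    by (rule norm_le_l1)
  also have "\<dots> \<le> (\<Sum>i\<in>(Basis::'a set). 1)"
    using assms by (intro sum_mono) (auto simp: mem_box)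
  finally show ?thesis by simp
qed

definition mollified_avg :: "real \<Rightarrow> ('a::euclidean_space \<Rightarrow> ennreal) \<Rightarrow> 'a \<Rightarrow> ennreal" where
  "mollified_avg \<tau> g x = (\<integral>\<^sup>+w. ennreal (kernel w) * g (x + \<tau> *\<^sub>R w) \<partial>lborel)"

lemma mollified_avg_measurable[measurable]:
  fixes g :: "'a::euclidean_space \<Rightarrow> ennreal"
  assumes [measurable]: "g \<in> borel_measurable borel"
  shows "mollified_avg \<tau> g \<in> borel_measurable borel"
  unfolding mollified_avg_def[abs_def] by measurable

text \<open>The two summands in the second factor belong to the cases
  \<open>\<tau> \<le> \<rho>\<close> and \<open>\<tau> > \<rho>\<close> of
  \<open>ball_avg_mollified_le\<close>; the common power comes from enlarging a ball to radius
  \<open>DIM('a) + 1\<close> and then to a dyadic radius.\<close>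

definition mollified_const :: "'a::euclidean_space itself \<Rightarrow> real" where
  "mollified_const _ = (2 * (DIM('a) + 1)) ^ DIM('a) * (1 + kernel_max TYPE('a) * measure lborel (ball (0::'a) 1))"

lemma ball_avg_shifted_le:
  fixes g :: "'a::euclidean_space \<Rightarrow> ennreal"
  assumes [measurable]: "g \<in> borel_measurable borel" and "\<rho> > 0" and v: "norm v \<le> DIM('a)"
  shows "(\<integral>\<^sup>+u. indicator (ball 0 1) u * g (x + \<rho> *\<^sub>R (v + u)) \<partial>lborel)
    \<le> ennreal ((2 * (DIM('a) + 1)) ^ DIM('a)) * maximal g x"
proof -
  have "(\<integral>\<^sup>+u. indicator (ball 0 1) u * g (x + \<rho> *\<^sub>R (v + u)) \<partial>lborel)
      = (\<integral>\<^sup>+u. indicator (ball 0 1) (u - v) * g (x + \<rho> *\<^sub>R u) \<partial>lborel)"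
    using nn_integral_translate[of "\<lambda>u. indicator (ball 0 1) (u - v) * g (x + \<rho> *\<^sub>R u)" v] by simp
  also have "\<dots> \<le> (\<integral>\<^sup>+u. indicator (ball 0 (DIM('a) + 1)) u * g (x + \<rho> *\<^sub>R u) \<partial>lborel)"
  proof (intro nn_integral_mono mult_right_mono)
    fix u :: 'a
    have "norm u < DIM('a) + 1" if "norm (u - v) < 1"
      using that v norm_triangle_ineq[of "u - v" v] by simp
    then show "indicator (ball 0 1) (u - v) \<le> (indicator (ball 0 (DIM('a) + 1)) u :: ennreal)"
      by (auto simp: indicator_def add.commute)
  qed simp
  also have "\<dots> \<le> ennreal ((2 * (DIM('a) + 1)) ^ DIM('a)) * maximal g x"
    using ball_avg_large_le[OF assms(1,2), of "DIM('a) + 1" x] by simp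
  finally show ?thesis .
qed

lemma kernel_avg_shifted_le:
  fixes g :: "'a::euclidean_space \<Rightarrow> ennreal"
  assumes [measurable]: "g \<in> borel_measurable borel" and "\<tau> > 0" and v: "norm v \<le> 1"
  shows "(\<integral>\<^sup>+w. ennreal (kernel w) * g (x + \<tau> *\<^sub>R (v + w)) \<partial>lborel)
    \<le> ennreal (kernel_max TYPE('a)) * (ennreal ((2 * (DIM('a) + 1)) ^ DIM('a)) * maximal g x)"
proof -
  have "(\<integral>\<^sup>+w. ennreal (kernel w) * g (x + \<tau> *\<^sub>R (v + w)) \<partial>lborel)
      = (\<integral>\<^sup>+w. ennreal (kernel (w - v)) * g (x + \<tau> *\<^sub>R w) \<partial>lborel)"
    using nn_integral_translate[of "\<lambda>w. ennreal (kernel (w - v)) * g (x + \<tau> *\<^sub>R w)" v] by simp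
  also have "\<dots> \<le> (\<integral>\<^sup>+w. ennreal (kernel_max TYPE('a)) * (indicator (cball 0 (DIM('a) + 1)) w * g (x + \<tau> *\<^sub>R w)) \<partial>lborel)"
  proof (rule nn_integral_mono)
    fix w :: 'a
    show "ennreal (kernel (w - v)) * g (x + \<tau> *\<^sub>R w)
        \<le> ennreal (kernel_max TYPE('a)) * (indicator (cball 0 (DIM('a) + 1)) w * g (x + \<tau> *\<^sub>R w))"
    proof (cases "w - v \<in> cbox 0 One")
      case True
      from norm_le_DIM_of_unit_cube[OF True] have "norm w \<le> DIM('a) + 1"
        using v norm_triangle_ineq[of "w - v" v] by simp
      then show ?thesis
        using kernel_le[of "w - v"] by (auto intro!: mult_right_mono ennreal_leI simp: indicator_def add.commute)
    qed (simp add: kernel_eq_0)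
  qed
  also have "\<dots> = ennreal (kernel_max TYPE('a)) * (\<integral>\<^sup>+w. indicator (cball 0 (DIM('a) + 1)) w * g (x + \<tau> *\<^sub>R w) \<partial>lborel)"
    by (rule nn_integral_cmult) measurable
  also have "(\<integral>\<^sup>+w. indicator (cball 0 (DIM('a) + 1)) w * g (x + \<tau> *\<^sub>R w) \<partial>lborel)
      = (\<integral>\<^sup>+w. indicator (ball 0 (DIM('a) + 1)) w * g (x + \<tau> *\<^sub>R w) \<partial>lborel)"
  proof (rule nn_integral_cong_AE)
    have "negligible (sphere (0::'a) (DIM('a) + 1))"
      by (rule negligible_sphere)
    then have "AE w in lebesgue. w \<notin> sphere (0::'a) (DIM('a) + 1)"
      unfolding negligible_iff_null_sets by (rule AE_not_in)
    then have "AE w in lborel. w \<notin> sphere (0::'a) (DIM('a) + 1)"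
      by (simp only: AE_completion_iff)
    then show "AE w in lborel. indicator (cball 0 (DIM('a) + 1)) w * g (x + \<tau> *\<^sub>R w)
        = indicator (ball 0 (DIM('a) + 1)) w * g (x + \<tau> *\<^sub>R w)"
      by eventually_elim (auto simp: indicator_def)
  qed
  also have "\<dots> \<le> ennreal ((2 * (DIM('a) + 1)) ^ DIM('a)) * maximal g x"
    using ball_avg_large_le[OF assms(1,2), of "DIM('a) + 1" x] by simp
  finally show ?thesis
    by (simp add: mult_left_mono)
qed

text \<open>The larger of the two scales absorbs the smaller one: if
  \<open>\<tau> \<le> \<rho>\<close>, a point of the kernel shifts the ball by at most
  \<open>DIM('a)\<close> radii; otherwise a point of the ball shifts the kernel by at most one unit.
  The constant is uniform in \<open>\<tau>\<close>, which permits the limit in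
  \<open>weak_gradient_pointwise\<close>.\<close>

lemma ball_avg_mollified_le:
  fixes g :: "'a::euclidean_space \<Rightarrow> ennreal"
  assumes [measurable]: "g \<in> borel_measurable borel" and \<rho>: "\<rho> > 0" and \<tau>: "\<tau> > 0"
  shows "ball_avg (mollified_avg \<tau> g) \<rho> x \<le> ennreal (mollified_const TYPE('a)) * maximal g x"
proof -
  let ?c = "(2 * (real DIM('a) + 1)) ^ DIM('a)" and ?K = "kernel_max TYPE('a)" and ?\<omega> = "measure lborel (ball (0::'a) 1)"
  have K: "?K > 0" by (rule kernel_max_pos)
  have \<omega>: "?\<omega> > 0" by (rule measure_ball_pos) simp
  show ?thesis
  proof (cases "\<tau> \<le> \<rho>")
    case True
    have "ball_avg (mollified_avg \<tau> g) \<rho> x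
        = (\<integral>\<^sup>+u. \<integral>\<^sup>+w. indicator (ball 0 1) u * (ennreal (kernel w) * g (x + \<rho> *\<^sub>R u + \<tau> *\<^sub>R w)) \<partial>lborel \<partial>lborel)"
      by (simp add: ball_avg_def mollified_avg_def nn_integral_cmult)
    also have "\<dots> = (\<integral>\<^sup>+w. \<integral>\<^sup>+u. indicator (ball 0 1) u * (ennreal (kernel w) * g (x + \<rho> *\<^sub>R u + \<tau> *\<^sub>R w)) \<partial>lborel \<partial>lborel)"
      by (rule lborel_pair.Fubini') measurable
    also have "\<dots> = (\<integral>\<^sup>+w. ennreal (kernel w) * (\<integral>\<^sup>+u. indicator (ball 0 1) u * g (x + \<rho> *\<^sub>R ((\<tau> / \<rho>) *\<^sub>R w + u)) \<partial>lborel) \<partial>lborel)"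
    proof (rule nn_integral_cong)
      fix w
      have "x + \<rho> *\<^sub>R u + \<tau> *\<^sub>R w = x + \<rho> *\<^sub>R ((\<tau> / \<rho>) *\<^sub>R w + u)" for u
        using \<rho> by (simp add: scaleR_add_right)
      then have "(\<integral>\<^sup>+u. indicator (ball 0 1) u * (ennreal (kernel w) * g (x + \<rho> *\<^sub>R u + \<tau> *\<^sub>R w)) \<partial>lborel)
          = (\<integral>\<^sup>+u. ennreal (kernel w) * (indicator (ball 0 1) u * g (x + \<rho> *\<^sub>R ((\<tau> / \<rho>) *\<^sub>R w + u))) \<partial>lborel)"
        by (simp only: mult.left_commute)
      also have "\<dots> = ennreal (kernel w) * (\<integral>\<^sup>+u. indicator (ball 0 1) u * g (x + \<rho> *\<^sub>R ((\<tau> / \<rho>) *\<^sub>R w + u)) \<partial>lborel)"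
        by (rule nn_integral_cmult) measurable
      finally show "(\<integral>\<^sup>+u. indicator (ball 0 1) u * (ennreal (kernel w) * g (x + \<rho> *\<^sub>R u + \<tau> *\<^sub>R w)) \<partial>lborel)
          = ennreal (kernel w) * (\<integral>\<^sup>+u. indicator (ball 0 1) u * g (x + \<rho> *\<^sub>R ((\<tau> / \<rho>) *\<^sub>R w + u)) \<partial>lborel)" .
    qed
    also have "\<dots> \<le> (\<integral>\<^sup>+w. ennreal (kernel (w::'a)) * (ennreal ?c * maximal g x) \<partial>lborel)"
    proof (rule nn_integral_mono)
      fix w :: 'a
      show "ennreal (kernel w) * (\<integral>\<^sup>+u. indicator (ball 0 1) u * g (x + \<rho> *\<^sub>R ((\<tau> / \<rho>) *\<^sub>R w + u)) \<partial>lborel)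
          \<le> ennreal (kernel w) * (ennreal ?c * maximal g x)"
      proof (cases "w \<in> cbox 0 One")
        case w: True
        have "norm ((\<tau> / \<rho>) *\<^sub>R w) \<le> 1 * norm w"
          using True \<rho> \<tau> unfolding norm_scaleR by (intro mult_right_mono) auto
        also have "\<dots> \<le> DIM('a)"
          using norm_le_DIM_of_unit_cube[OF w] by simp
        finally show ?thesis
          using ball_avg_shifted_le[OF assms(1) \<rho>, of "(\<tau> / \<rho>) *\<^sub>R w" x]
          by (intro mult_left_mono) (auto simp: add.commute)
      qed (simp add: kernel_eq_0)
    qed
    also have "\<dots> = ennreal ?c * maximal g x"
      by (simp add: nn_integral_multc kernel_nn_integral)
    also have "\<dots> \<le> ennreal (mollified_const TYPE('a)) * maximal g x"
      using K \<omega> unfolding mollified_const_def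
      by (intro mult_right_mono ennreal_leI) (auto simp: add.commute)
    finally show ?thesis .
  next
    case False
    have "ball_avg (mollified_avg \<tau> g) \<rho> x \<le> (\<integral>\<^sup>+u. indicator (ball (0::'a) 1) u * (ennreal ?K * (ennreal ?c * maximal g x)) \<partial>lborel)"
      unfolding ball_avg_def
    proof (rule nn_integral_mono)
      fix u :: 'a
      show "indicator (ball 0 1) u * mollified_avg \<tau> g (x + \<rho> *\<^sub>R u) \<le> indicator (ball 0 1) u * (ennreal ?K * (ennreal ?c * maximal g x))"
      proof (cases "u \<in> ball 0 1")
        case True
        have "norm ((\<rho> / \<tau>) *\<^sub>R u) \<le> 1 * 1"
          using True False \<rho> \<tau> unfolding norm_scaleR by (intro mult_mono) auto
        moreover have "x + \<tau> *\<^sub>R ((\<rho> / \<tau>) *\<^sub>R u + w) = x + \<rho> *\<^sub>R u + \<tau> *\<^sub>R w" for w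
          using \<tau> by (simp add: scaleR_add_right)
        ultimately have "mollified_avg \<tau> g (x + \<rho> *\<^sub>R u) \<le> ennreal ?K * (ennreal ?c * maximal g x)"
          using kernel_avg_shifted_le[OF assms(1) \<tau>, of "(\<rho> / \<tau>) *\<^sub>R u" x]
          by (simp add: mollified_avg_def add_ac)
        then show ?thesis by (rule mult_left_mono) simp
      qed simp
    qed
    also have "\<dots> = emeasure lborel (ball (0::'a) 1) * (ennreal ?K * (ennreal ?c * maximal g x))"
      by (simp add: nn_integral_multc)
    also have "\<dots> = ennreal (?c * (?K * ?\<omega>)) * maximal g x"
      using emeasure_ball_scale[of 1 "0::'a"] K \<omega> by (simp add: ennreal_mult mult_ac)
    also have "\<dots> \<le> ennreal (mollified_const TYPE('a)) * maximal g x"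
      unfolding mollified_const_def
      by (intro mult_right_mono ennreal_leI mult_mono) (use K \<omega> in \<open>auto simp: add.commute\<close>)
    finally show ?thesis .
  qed
qed

section \<open>Difference bounds by averages of the gradient\<close>

lemma segment_bound:
  fixes F :: "'a::euclidean_space \<Rightarrow> 'b::euclidean_space"
  assumes der: "\<And>x. (F has_derivative (\<lambda>h. \<Sum>i\<in>Basis. (h \<bullet> i) *\<^sub>R A i x)) (at x)"
    and cont: "\<And>i x. i \<in> Basis \<Longrightarrow> continuous (at x) (A i)"
    and G: "\<And>x. ennreal (\<Sum>i\<in>Basis. norm (A i x)) \<le> G x"
    and [measurable]: "G \<in> borel_measurable borel"
  shows "ennreal (norm (F z - F x)) \<le> ennreal (norm (z - x)) * (\<integral>\<^sup>+s. indicator {0..1} s * G (x + s *\<^sub>R (z - x)) \<partial>lborel)"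
proof -
  define q where "q s = (\<Sum>i\<in>Basis. ((z - x) \<bullet> i) *\<^sub>R A i (x + s *\<^sub>R (z - x)))" for s :: real
  have contq: "continuous_on {0..1} q"
    unfolding q_def
  proof (intro continuous_on_sum continuous_on_scaleR continuous_on_const)
    fix i :: 'a assume "i \<in> Basis"
    then have "continuous_on UNIV (A i)"
      using cont by (simp add: continuous_at_imp_continuous_on)
    then show "continuous_on {0..1} (\<lambda>s. A i (x + s *\<^sub>R (z - x)))"
      by (rule continuous_on_compose2) (auto intro!: continuous_intros)
  qed
  have vd: "((\<lambda>s. F (x + s *\<^sub>R (z - x))) has_vector_derivative q s) (at s within {0..1})" for s
  proof -
    have "((\<lambda>s. x + s *\<^sub>R (z - x)) has_derivative (\<lambda>h. h *\<^sub>R (z - x))) (at s within {0..1})"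
      by (auto intro!: derivative_eq_intros)
    from has_derivative_compose[OF this der]
    show ?thesis
      by (simp add: has_vector_derivative_def q_def scaleR_sum_right)
  qed
  have "has_bochner_integral lborel (\<lambda>s. indicator {0..1} s *\<^sub>R q s) (F (x + 1 *\<^sub>R (z - x)) - F (x + 0 *\<^sub>R (z - x)))"
    by (rule has_bochner_integral_FTC_Icc[OF _ vd contq]) simp
  then have int: "integrable lborel (\<lambda>s. indicator {0..1} s *\<^sub>R q s)"
    and eq: "(LINT s|lborel. indicator {0..1} s *\<^sub>R q s) = F z - F x"
    by (auto simp: has_bochner_integral_iff)
  have "ennreal (norm (F z - F x)) \<le> (\<integral>\<^sup>+s. ennreal (norm (indicator {0..1} s *\<^sub>R q s)) \<partial>lborel)"
    unfolding eq[symmetric] by (rule integral_norm_bound_ennreal[OF int])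
  also have "\<dots> \<le> (\<integral>\<^sup>+s. ennreal (norm (z - x)) * (indicator {0..1} s * G (x + s *\<^sub>R (z - x))) \<partial>lborel)"
  proof (rule nn_integral_mono)
    fix s :: real
    have "norm (q s) \<le> (\<Sum>i\<in>Basis. norm (z - x) * norm (A i (x + s *\<^sub>R (z - x))))"
      unfolding q_def by (rule order_trans[OF norm_sum]) (auto intro!: sum_mono mult_right_mono Basis_le_norm)
    then have "ennreal (norm (q s)) \<le> ennreal (norm (z - x)) * ennreal (\<Sum>i\<in>Basis. norm (A i (x + s *\<^sub>R (z - x))))"
      by (subst ennreal_mult[symmetric]) (auto intro!: ennreal_leI sum_nonneg simp: sum_distrib_left)
    also have "\<dots> \<le> ennreal (norm (z - x)) * G (x + s *\<^sub>R (z - x))"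
      by (intro mult_left_mono G) simp
    finally show "ennreal (norm (indicator {0..1} s *\<^sub>R q s)) \<le> ennreal (norm (z - x)) * (indicator {0..1} s * G (x + s *\<^sub>R (z - x)))"
      by (auto simp: indicator_def)
  qed
  also have "\<dots> = ennreal (norm (z - x)) * (\<integral>\<^sup>+s. indicator {0..1} s * G (x + s *\<^sub>R (z - x)) \<partial>lborel)"
    by (rule nn_integral_cmult) measurable
  finally show ?thesis .
qed

text \<open>By Fubini, the average over end points of integrals along segments becomes an integral
  over \<open>s\<close> of averages at scale \<open>s * R\<close>. The ball of radius 1/2 around
  \<open>e\<close> lies in the unit ball, and rescaling it costs \<open>2 ^ DIM('a)\<close>. The
  degenerate parameter \<open>s = 0\<close> is a null set.\<close>

lemma cone_average_le:
  fixes G :: "'a::euclidean_space \<Rightarrow> ennreal"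
  assumes [measurable]: "G \<in> borel_measurable borel" and R: "R > 0" and e: "norm e \<le> 1 / 2"
    and S: "\<And>\<rho>. \<rho> > 0 \<Longrightarrow> ball_avg G \<rho> x \<le> S"
  shows "(\<integral>\<^sup>+w. indicator (ball 0 1) w * (\<integral>\<^sup>+s. indicator {0..1::real} s * G (x + s *\<^sub>R (R *\<^sub>R (e + (1 / 2) *\<^sub>R w))) \<partial>lborel) \<partial>lborel)
    \<le> ennreal (2 ^ DIM('a)) * S"
proof -
  have "(\<integral>\<^sup>+w. indicator (ball 0 1) w * (\<integral>\<^sup>+s. indicator {0..1::real} s * G (x + s *\<^sub>R (R *\<^sub>R (e + (1 / 2) *\<^sub>R w))) \<partial>lborel) \<partial>lborel)
      = (\<integral>\<^sup>+w. \<integral>\<^sup>+s. indicator (ball 0 1) w * (indicator {0..1::real} s * G (x + s *\<^sub>R (R *\<^sub>R (e + (1 / 2) *\<^sub>R w)))) \<partial>lborel \<partial>lborel)"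
    by (intro nn_integral_cong nn_integral_cmult[symmetric]) measurable
  also have "\<dots> = (\<integral>\<^sup>+s. \<integral>\<^sup>+w. indicator (ball 0 1) w * (indicator {0..1::real} s * G (x + s *\<^sub>R (R *\<^sub>R (e + (1 / 2) *\<^sub>R w)))) \<partial>lborel \<partial>lborel)"
    by (rule lborel_pair.Fubini') measurable
  also have "\<dots> \<le> (\<integral>\<^sup>+s. indicator {0..1::real} s * (ennreal (2 ^ DIM('a)) * S) \<partial>lborel)"
  proof (rule nn_integral_mono_AE)
    have *: "(\<integral>\<^sup>+w. indicator (ball 0 1) w * (indicator {0..1::real} s * G (x + s *\<^sub>R (R *\<^sub>R (e + (1 / 2) *\<^sub>R w)))) \<partial>lborel)
        \<le> indicator {0..1::real} s * (ennreal (2 ^ DIM('a)) * S)" if "s \<noteq> 0" for s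
    proof (cases "s \<in> {0..1}")
      case True
      with that have s: "s * R > 0" using R by auto
      let ?\<Phi> = "\<lambda>u. indicator (ball 0 1) (2 *\<^sub>R (u - e)) * G (x + (s * R) *\<^sub>R u)"
      have "(\<integral>\<^sup>+w. indicator (ball 0 1) w * G (x + (s * R) *\<^sub>R (e + (1 / 2) *\<^sub>R w)) \<partial>lborel)
          = ennreal (2 ^ DIM('a)) * (ennreal ((1 / 2) ^ DIM('a)) * (\<integral>\<^sup>+w. ?\<Phi> (e + (1 / 2) *\<^sub>R w) \<partial>lborel))"
        by (simp add: mult.assoc[symmetric] ennreal_mult[symmetric] power_mult_distrib[symmetric])
      also have "\<dots> = ennreal (2 ^ DIM('a)) * (\<integral>\<^sup>+u. ?\<Phi> u \<partial>lborel)"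
        by (subst nn_integral_affine[of ?\<Phi> "1 / 2" e]) auto
      also have "\<dots> \<le> ennreal (2 ^ DIM('a)) * ball_avg G (s * R) x"
        unfolding ball_avg_def
      proof (intro mult_left_mono nn_integral_mono mult_right_mono)
        fix u :: 'a
        have "norm u < 1" if "norm (2 *\<^sub>R (u - e)) < 1"
          using that e norm_triangle_ineq[of "u - e" e] by simp
        then show "indicator (ball 0 1) (2 *\<^sub>R (u - e)) \<le> (indicator (ball 0 1) u :: ennreal)"
          by (auto simp: indicator_def)
      qed auto
      also have "\<dots> \<le> ennreal (2 ^ DIM('a)) * S"
        using S[OF s] by (intro mult_left_mono) auto
      finally show ?thesis using True by simp
    qed simp
    have "AE s in lborel. s \<noteq> (0::real)"
      by (rule AE_lborel_singleton)
    then show "AE s in lborel. (\<integral>\<^sup>+w. indicator (ball 0 1) w * (indicator {0..1::real} s * G (x + s *\<^sub>R (R *\<^sub>R (e + (1 / 2) *\<^sub>R w)))) \<partial>lborel)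
        \<le> indicator {0..1::real} s * (ennreal (2 ^ DIM('a)) * S)"
      by eventually_elim (rule *)
  qed
  also have "\<dots> = ennreal (2 ^ DIM('a)) * S"
    by (simp add: nn_integral_multc)
  finally show ?thesis .
qed

text \<open>A single segment cannot be controlled by ball averages, so \<open>F x\<close> and
  \<open>F y\<close> are both compared with \<open>F z\<close> and the result is averaged over all
  \<open>z\<close> in the ball of radius \<open>R / 2\<close> around the midpoint. The segments from
  \<open>x\<close> and from \<open>y\<close> then sweep out cones, on which
  \<open>cone_average_le\<close> applies.\<close>

lemma pointwise_difference_le:
  fixes F :: "'a::euclidean_space \<Rightarrow> 'b::euclidean_space"
  assumes der: "\<And>x. (F has_derivative (\<lambda>h. \<Sum>i\<in>Basis. (h \<bullet> i) *\<^sub>R A i x)) (at x)"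
    and cont: "\<And>i x. i \<in> Basis \<Longrightarrow> continuous (at x) (A i)"
    and G: "\<And>x. ennreal (\<Sum>i\<in>Basis. norm (A i x)) \<le> G x"
    and [measurable]: "G \<in> borel_measurable borel"
    and S: "\<And>\<rho> x. \<rho> > 0 \<Longrightarrow> ball_avg G \<rho> x \<le> S x"
  shows "ennreal (norm (F x - F y)) \<le> ennreal (2 ^ DIM('a) / measure lborel (ball (0::'a) 1) * norm (x - y)) * (S x + S y)"
proof (cases "x = y")
  case False
  define R where "R = norm (x - y)"
  have R: "R > 0" using False by (simp add: R_def)
  let ?\<omega> = "measure lborel (ball (0::'a) 1)"
  have \<omega>: "?\<omega> > 0" by (rule measure_ball_pos) simp
  define J where "J x e = (\<integral>\<^sup>+w. indicator (ball 0 1) w * (\<integral>\<^sup>+s. indicator {0..1::real} s * G (x + s *\<^sub>R (R *\<^sub>R (e + (1 / 2) *\<^sub>R w))) \<partial>lborel) \<partial>lborel)" for x e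
  \<comment> \<open>The point \<open>x + R *\<^sub>R e\<close> is the midpoint of \<open>x\<close>
    and \<open>y\<close>; seen from \<open>y\<close> it is \<open>y + R *\<^sub>R (- e)\<close>, so
    the same family \<open>z w\<close> serves both end points.\<close>
  define e where "e = (1 / (2 * R)) *\<^sub>R (y - x)"
  have e: "norm e \<le> 1 / 2" "norm (- e) \<le> 1 / 2"
    using R by (auto simp: e_def R_def norm_minus_commute)
  define z where "z w = x + R *\<^sub>R (e + (1 / 2) *\<^sub>R w)" for w
  have z': "z w = y + R *\<^sub>R (- e + (1 / 2) *\<^sub>R w)" for w
  proof -
    have "x + R *\<^sub>R e = y + R *\<^sub>R (- e)"
      using R by (simp add: e_def algebra_simps) (simp add: scaleR_left_distrib[symmetric])
    then show ?thesis
      unfolding z_def scaleR_add_right add.assoc[symmetric] by simp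
  qed
  have meas: "(\<lambda>w. indicator (ball 0 1) w * (\<integral>\<^sup>+s. indicator {0..1::real} s * G (x + s *\<^sub>R (R *\<^sub>R (e + (1 / 2) *\<^sub>R w))) \<partial>lborel)) \<in> borel_measurable borel" for x e
    by measurable
  have bound: "ennreal (norm (F (x + R *\<^sub>R (e + (1 / 2) *\<^sub>R w)) - F x))
      \<le> ennreal R * (\<integral>\<^sup>+s. indicator {0..1::real} s * G (x + s *\<^sub>R (R *\<^sub>R (e + (1 / 2) *\<^sub>R w))) \<partial>lborel)"
    if "norm e \<le> 1 / 2" "norm w < 1" for x e w
  proof -
    have "norm (e + (1 / 2) *\<^sub>R w) \<le> 1"
      using that norm_triangle_ineq[of e "(1 / 2) *\<^sub>R w"] by simp
    then have le: "norm (R *\<^sub>R (e + (1 / 2) *\<^sub>R w)) \<le> R"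
      using R by (simp add: mult_left_le)
    have "ennreal (norm (F z - F x)) \<le> ennreal (norm (z - x)) * (\<integral>\<^sup>+s. indicator {0..1} s * G (x + s *\<^sub>R (z - x)) \<partial>lborel)" for z
      by (rule segment_bound[OF der _ G assms(4)]) (rule cont)
    from this[of "x + R *\<^sub>R (e + (1 / 2) *\<^sub>R w)"] have "ennreal (norm (F (x + R *\<^sub>R (e + (1 / 2) *\<^sub>R w)) - F x))
      \<le> ennreal (norm (R *\<^sub>R (e + (1 / 2) *\<^sub>R w))) * (\<integral>\<^sup>+s. indicator {0..1::real} s * G (x + s *\<^sub>R (R *\<^sub>R (e + (1 / 2) *\<^sub>R w))) \<partial>lborel)"
      by (simp only: add_diff_cancel_left')
    also have "\<dots> \<le> ennreal R * (\<integral>\<^sup>+s. indicator {0..1::real} s * G (x + s *\<^sub>R (R *\<^sub>R (e + (1 / 2) *\<^sub>R w))) \<partial>lborel)"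
      by (intro mult_right_mono ennreal_leI le) simp
    finally show ?thesis .
  qed
  have "ennreal ?\<omega> * ennreal (norm (F x - F y)) = (\<integral>\<^sup>+w. indicator (ball (0::'a) 1) w * ennreal (norm (F x - F y)) \<partial>lborel)"
    using emeasure_ball_scale[of 1 "0::'a"] by (simp add: nn_integral_multc)
  also have "\<dots> \<le> (\<integral>\<^sup>+w. ennreal R * (indicator (ball 0 1) w * (\<integral>\<^sup>+s. indicator {0..1::real} s * G (x + s *\<^sub>R (R *\<^sub>R (e + (1 / 2) *\<^sub>R w))) \<partial>lborel))
      + ennreal R * (indicator (ball 0 1) w * (\<integral>\<^sup>+s. indicator {0..1::real} s * G (y + s *\<^sub>R (R *\<^sub>R (- e + (1 / 2) *\<^sub>R w))) \<partial>lborel)) \<partial>lborel)"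
  proof (rule nn_integral_mono)
    fix w :: 'a
    show "indicator (ball (0::'a) 1) w * ennreal (norm (F x - F y)) \<le>
      ennreal R * (indicator (ball 0 1) w * (\<integral>\<^sup>+s. indicator {0..1::real} s * G (x + s *\<^sub>R (R *\<^sub>R (e + (1 / 2) *\<^sub>R w))) \<partial>lborel))
      + ennreal R * (indicator (ball 0 1) w * (\<integral>\<^sup>+s. indicator {0..1::real} s * G (y + s *\<^sub>R (R *\<^sub>R (- e + (1 / 2) *\<^sub>R w))) \<partial>lborel))"
    proof (cases "norm w < 1")
      case True
      have "norm (F x - F y) \<le> norm (F (z w) - F x) + norm (F (z w) - F y)"
        using norm_triangle_ineq4[of "F (z w) - F y" "F (z w) - F x"] by simp
      then have "ennreal (norm (F x - F y)) \<le> ennreal (norm (F (z w) - F x)) + ennreal (norm (F (z w) - F y))"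
        by (simp add: ennreal_plus[symmetric] del: ennreal_plus)
      also have "\<dots> \<le> ennreal R * (\<integral>\<^sup>+s. indicator {0..1::real} s * G (x + s *\<^sub>R (R *\<^sub>R (e + (1 / 2) *\<^sub>R w))) \<partial>lborel)
        + ennreal R * (\<integral>\<^sup>+s. indicator {0..1::real} s * G (y + s *\<^sub>R (R *\<^sub>R (- e + (1 / 2) *\<^sub>R w))) \<partial>lborel)"
        using bound[OF e(1) True, of x] bound[OF e(2) True, of y]
        unfolding z_def[symmetric] z'[symmetric] by (rule add_mono)
      finally show ?thesis using True by simp
    qed simp
  qed
  also have "\<dots> = ennreal R * J x e + ennreal R * J y (- e)"
    unfolding J_def using meas by (simp add: nn_integral_add nn_integral_cmult)
  also have "\<dots> \<le> ennreal R * (ennreal (2 ^ DIM('a)) * S x) + ennreal R * (ennreal (2 ^ DIM('a)) * S y)"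
    unfolding J_def by (intro add_mono mult_left_mono cone_average_le R e S) auto
  also have "\<dots> = ennreal (2 ^ DIM('a) * R) * (S x + S y)"
    using R by (simp add: ennreal_mult distrib_left distrib_right mult_ac)
  finally have *: "ennreal ?\<omega> * ennreal (norm (F x - F y)) \<le> ennreal (2 ^ DIM('a) * R) * (S x + S y)" .
  have "ennreal (norm (F x - F y)) = ennreal (1 / ?\<omega>) * (ennreal ?\<omega> * ennreal (norm (F x - F y)))"
    using \<omega> by (simp add: ennreal_mult[symmetric])
  also have "\<dots> \<le> ennreal (1 / ?\<omega>) * (ennreal (2 ^ DIM('a) * R) * (S x + S y))"
    by (intro mult_left_mono *) simp
  also have "\<dots> = ennreal (2 ^ DIM('a) / ?\<omega> * R) * (S x + S y)"
    using \<omega> R by (simp add: mult.assoc[symmetric] ennreal_mult[symmetric])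
  finally show ?thesis by (simp add: R_def)
qed simp

definition sobolev_const :: "'a::euclidean_space itself \<Rightarrow> real" where
  "sobolev_const _ = 2 ^ DIM('a) / measure lborel (ball (0::'a) 1) * mollified_const TYPE('a)"

lemma mollify_has_derivative:
  assumes "\<tau> > 0" "weak_gradient f D"
  shows "(mollify \<tau> f has_derivative (\<lambda>h. \<Sum>i\<in>Basis. (h \<bullet> i) *\<^sub>R mollify \<tau> (\<lambda>y. D y i) x)) (at x)"
  unfolding mollify_def by (intro conv_has_derivative test_function_scaled_kernel assms)

lemma mollify_continuous:
  "\<tau> > 0 \<Longrightarrow> locally_integrable f \<Longrightarrow> continuous (at x) (mollify \<tau> f)"
  unfolding mollify_def by (intro conv_continuous test_function_scaled_kernel)

text \<open>The inequality holds everywhere for mollifications, with a constant independent of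
  \<open>\<tau>\<close>, and passes to the limit wherever they converge to \<open>f\<close>. The
  exceptional set is thus a set of points and not of pairs, as needed when \<open>x\<close> and
  \<open>y\<close> are images under different maps.\<close>

lemma weak_gradient_pointwise:
  fixes f :: "'a::euclidean_space \<Rightarrow> 'a"
  assumes wg: "weak_gradient f D"
    and D[measurable]: "\<And>i. i \<in> Basis \<Longrightarrow> (\<lambda>x. D x i) \<in> borel_measurable borel"
  defines "g \<equiv> \<lambda>x. ennreal (\<Sum>i\<in>Basis. norm (D x i))"
  obtains N where "negligible N" "\<And>x y. x \<notin> N \<Longrightarrow> y \<notin> N \<Longrightarrow>
    ennreal (norm (f x - f y)) \<le> ennreal (sobolev_const TYPE('a) * norm (x - y)) * (maximal g x + maximal g y)"
proof -
  have f: "locally_integrable f" and Di: "\<And>i. i \<in> Basis \<Longrightarrow> locally_integrable (\<lambda>x. D x i)"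
    using wg by (auto simp: weak_gradient_def)
  have [measurable]: "g \<in> borel_measurable borel"
    unfolding g_def by measurable
  have K: "kernel_max TYPE('a) > 0" by (rule kernel_max_pos)
  have C: "mollified_const TYPE('a) > 0"
    unfolding mollified_const_def using K measure_ball_pos[of 1 "0::'a"] by (intro mult_pos_pos add_pos_pos) auto
  have G: "ennreal (\<Sum>i\<in>Basis. norm (mollify \<tau> (\<lambda>y. D y i) x)) \<le> mollified_avg \<tau> g x" if \<tau>: "\<tau> > 0" for \<tau> x
  proof -
    have "ennreal (\<Sum>i\<in>Basis. norm (mollify \<tau> (\<lambda>y. D y i) x)) = (\<Sum>i\<in>Basis. ennreal (norm (mollify \<tau> (\<lambda>y. D y i) x)))"
      by (simp add: sum_ennreal)
    also have "\<dots> \<le> (\<Sum>i\<in>Basis. \<integral>\<^sup>+w. ennreal (kernel w) * ennreal (norm (D (x + \<tau> *\<^sub>R w) i)) \<partial>lborel)"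
      by (intro sum_mono mollify_norm_le[OF D Di \<tau>])
    also have "\<dots> = (\<integral>\<^sup>+w. (\<Sum>i\<in>Basis. ennreal (kernel w) * ennreal (norm (D (x + \<tau> *\<^sub>R w) i))) \<partial>lborel)"
      by (rule nn_integral_sum[symmetric]) measurable
    also have "\<dots> = mollified_avg \<tau> g x"
      unfolding mollified_avg_def g_def by (simp add: sum_ennreal sum_distrib_left[symmetric])
    finally show ?thesis .
  qed
  have ineq: "ennreal (norm (mollify \<tau> f x - mollify \<tau> f y))
      \<le> ennreal (sobolev_const TYPE('a) * norm (x - y)) * (maximal g x + maximal g y)" if \<tau>: "\<tau> > 0" for \<tau> x y
  proof -
    have "ennreal (norm (mollify \<tau> f x - mollify \<tau> f y))
        \<le> ennreal (2 ^ DIM('a) / measure lborel (ball (0::'a) 1) * norm (x - y)) *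
          (ennreal (mollified_const TYPE('a)) * maximal g x + ennreal (mollified_const TYPE('a)) * maximal g y)"
      by (rule pointwise_difference_le[OF mollify_has_derivative[OF \<tau> wg] mollify_continuous[OF \<tau> Di] G[OF \<tau>]])
        (auto intro!: ball_avg_mollified_le \<tau>)
    also have "\<dots> = ennreal (sobolev_const TYPE('a) * norm (x - y)) * (maximal g x + maximal g y)"
      unfolding distrib_left[symmetric] mult.assoc[symmetric] sobolev_const_def using C
      by (subst ennreal_mult[symmetric]) (auto simp: mult_ac)
    finally show ?thesis .
  qed
  obtain N where N: "negligible N" "\<And>x. x \<notin> N \<Longrightarrow> ((\<lambda>\<tau>. mollify \<tau> f x) \<longlongrightarrow> f x) (at_right 0)"
    using mollify_tendsto_AE[OF f] by blast
  show ?thesis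
  proof (rule that[OF N(1)])
    fix x y assume xy: "x \<notin> N" "y \<notin> N"
    have "((\<lambda>\<tau>. ennreal (norm (mollify \<tau> f x - mollify \<tau> f y))) \<longlongrightarrow> ennreal (norm (f x - f y))) (at_right 0)"
      by (intro tendsto_ennrealI tendsto_intros N xy)
    then show "ennreal (norm (f x - f y)) \<le> ennreal (sobolev_const TYPE('a) * norm (x - y)) * (maximal g x + maximal g y)"
    proof (rule tendsto_upperbound)
      show "\<forall>\<^sub>F \<tau> in at_right 0. ennreal (norm (mollify \<tau> f x - mollify \<tau> f y))
          \<le> ennreal (sobolev_const TYPE('a) * norm (x - y)) * (maximal g x + maximal g y)"
        using ineq by (auto simp: eventually_at_right_field intro!: exI[of _ 1])
    qed simp
  qed
qed

text \<open>The kernel is a probability density on the cube, so the mollification is a mean of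
  values within \<open>e\<close> of \<open>c\<close>. The bounds on mollified gradients and
  divergences are obtained from this.\<close>

lemma mollify_close:
  fixes f :: "'a::euclidean_space \<Rightarrow> 'b::euclidean_space"
  assumes \<tau>: "\<tau> > 0" and f: "locally_integrable f"
    and e: "AE y in lebesgue. y \<in> cbox x (x + \<tau> *\<^sub>R One) \<longrightarrow> norm (f y - c) \<le> e"
  shows "norm (mollify \<tau> f x - c) \<le> e"
proof -
  have int: "integrable lebesgue (\<lambda>y. scaled_kernel \<tau> (y - x) *\<^sub>R f y)"
    by (intro conv_integrable test_function_scaled_kernel f \<tau>)
  have intc: "integrable lebesgue (\<lambda>y. scaled_kernel \<tau> (y - x) *\<^sub>R c)"
    using scaled_kernel_integral(1)[OF \<tau>] by (intro integrable_scaleR_left) auto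
  have eq: "mollify \<tau> f x - c = (LINT y|lebesgue. scaled_kernel \<tau> (y - x) *\<^sub>R (f y - c))"
    unfolding mollify_def conv_def scaleR_diff_right using scaled_kernel_integral[OF \<tau>, of x]
    by (simp add: Bochner_Integration.integral_diff[OF int intc])
  have "norm (mollify \<tau> f x - c) \<le> (LINT y|lebesgue. norm (scaled_kernel \<tau> (y - x) *\<^sub>R (f y - c)))"
    unfolding eq by (rule integral_norm_bound)
  also have "\<dots> \<le> (LINT y|lebesgue. scaled_kernel \<tau> (y - x) * e)"
  proof (rule integral_mono_AE)
    show "integrable lebesgue (\<lambda>y. norm (scaled_kernel \<tau> (y - x) *\<^sub>R (f y - c)))"
      unfolding scaleR_diff_right by (intro integrable_norm Bochner_Integration.integrable_diff int intc)
    show "integrable lebesgue (\<lambda>y. scaled_kernel \<tau> (y - x) * e)"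
      using scaled_kernel_integral(1)[OF \<tau>] by (intro integrable_mult_left) auto
    show "AE y in lebesgue. norm (scaled_kernel \<tau> (y - x) *\<^sub>R (f y - c)) \<le> scaled_kernel \<tau> (y - x) * e"
      using e
    proof eventually_elim
      case (elim y)
      show ?case
      proof (cases "y \<in> cbox x (x + \<tau> *\<^sub>R One)")
        case True
        with elim show ?thesis
          using scaled_kernel_nonneg[OF \<tau>, of "y - x"] by (simp add: mult_left_mono)
      next
        case False
        then have "(1 / \<tau>) *\<^sub>R (y - x) \<notin> cbox 0 One"
          using \<tau> by (auto simp: mem_box field_simps inner_simps)
        then show ?thesis
          by (simp add: scaled_kernel_def kernel_eq_0)
      qed
    qed
  qed
  also have "\<dots> = e"
    using scaled_kernel_integral(2)[OF \<tau>, of x] by simp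
  finally show ?thesis .
qed

section \<open>Volume distortion of near-identity maps\<close>

text \<open>A new index at most doubles the old error and adds a cross term of at most
  \<open>card I * e\<^sup>2\<close>, which is below \<open>3 ^ card I * e\<^sup>2\<close>; hence the
  factor 3 per index.\<close>

lemma prod_one_plus_approx:
  fixes x :: "'i \<Rightarrow> real"
  assumes "finite I" "\<And>i. i \<in> I \<Longrightarrow> \<bar>x i\<bar> \<le> e" "e \<le> 1"
  shows "\<bar>(\<Prod>i\<in>I. 1 + x i) - 1 - (\<Sum>i\<in>I. x i)\<bar> \<le> 3 ^ card I * e\<^sup>2"
  using assms
proof (induction I rule: finite_induct)
  case (insert j I)
  have e0: "0 \<le> e" using insert.prems(1)[of j] by simp
  let ?E = "(\<Prod>i\<in>I. 1 + x i) - 1 - (\<Sum>i\<in>I. x i)"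
  have "(\<Prod>i\<in>insert j I. 1 + x i) - 1 - (\<Sum>i\<in>insert j I. x i) = ?E * (1 + x j) + (\<Sum>i\<in>I. x i) * x j"
    using insert.hyps by (simp add: algebra_simps)
  also have "\<bar>\<dots>\<bar> \<le> \<bar>?E\<bar> * \<bar>1 + x j\<bar> + \<bar>\<Sum>i\<in>I. x i\<bar> * \<bar>x j\<bar>"
    by (rule order_trans[OF abs_triangle_ineq]) (simp add: abs_mult)
  also have "\<dots> \<le> (3 ^ card I * e\<^sup>2) * 2 + (card I * e) * e"
  proof (intro add_mono mult_mono)
    show "\<bar>?E\<bar> \<le> 3 ^ card I * e\<^sup>2" using insert by auto
    show "\<bar>1 + x j\<bar> \<le> 2" using insert.prems(1)[of j] insert.prems(2) by auto
    show "\<bar>\<Sum>i\<in>I. x i\<bar> \<le> card I * e"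
      using sum_bounded_above[of I "\<lambda>i. \<bar>x i\<bar>" e] insert.prems(1)
      by (intro order_trans[OF sum_abs]) auto
    show "\<bar>x j\<bar> \<le> e" using insert.prems(1)[of j] by auto
  qed (use e0 in auto)
  also have "\<dots> \<le> (3 ^ card I * e\<^sup>2) * 2 + 3 ^ card I * e\<^sup>2"
  proof -
    have "real (card I) \<le> 3 ^ card I"
      using of_nat_less_two_power[of "card I", where 'a=real] power_mono[of "2::real" 3 "card I"] by linarith
    then have "real (card I) * e\<^sup>2 \<le> 3 ^ card I * e\<^sup>2"
      by (rule mult_right_mono) simp
    then show ?thesis by (simp add: power2_eq_square mult_ac)
  qed
  also have "\<dots> = 3 ^ card (insert j I) * e\<^sup>2"
    using insert.hyps by simp
  finally show ?case .
qed simp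

text \<open>The summand \<open>3 ^ n\<close> belongs to the diagonal product, the other one to the
  remaining permutations, each of which contributes at most \<open>2 ^ n * e\<^sup>2\<close> to the
  determinant.\<close>

definition det_const :: "nat \<Rightarrow> real" where
  "det_const n = fact n * 2 ^ n + 3 ^ n"

text \<open>A permutation other than the identity moves some \<open>i\<close> and, by injectivity,
  also its image; its product therefore contains two off-diagonal entries and is of second order.
  The diagonal product is 1 plus the trace of the deviation up to second order.\<close>

lemma det_near_identity:
  fixes M :: "real^'n^'n"
  assumes M: "\<And>i j. \<bar>M $ i $ j - (if i = j then 1 else 0)\<bar> \<le> e" and e: "e \<le> 1"
  shows "\<bar>det M - 1 - (\<Sum>i\<in>UNIV. M $ i $ i - 1)\<bar> \<le> det_const CARD('n) * e\<^sup>2"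
proof -
  have e0: "0 \<le> e" using M[of undefined undefined] by linarith
  let ?P = "{p. p permutes (UNIV::'n set)}"
  let ?t = "\<lambda>p. of_int (sign p) * (\<Prod>i\<in>UNIV. M $ i $ p i)"
  have fin: "finite ?P" by simp
  have small: "\<bar>?t p\<bar> \<le> 2 ^ CARD('n) * e\<^sup>2" if "p \<in> ?P - {id}" for p
  proof -
    have perm: "p permutes UNIV" and "p \<noteq> id" using that by auto
    then obtain i where i: "p i \<noteq> i" by (auto simp: fun_eq_iff)
    define j where "j = p i"
    have j: "j \<noteq> i" "p j \<noteq> j"
      using i permutes_inj[OF perm] unfolding j_def by (auto dest: injD)
    have "\<bar>\<Prod>i\<in>UNIV. M $ i $ p i\<bar> = (\<Prod>k\<in>UNIV. \<bar>M $ k $ p k\<bar>)"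
      by (simp add: abs_prod)
    also have "\<dots> = (\<Prod>k\<in>UNIV - {i, j}. \<bar>M $ k $ p k\<bar>) * (\<Prod>k\<in>{i, j}. \<bar>M $ k $ p k\<bar>)"
      by (rule prod.subset_diff) auto
    also have "\<dots> \<le> (\<Prod>k\<in>UNIV - {i, j}. 2) * (e * e)"
    proof (intro mult_mono prod_mono)
      show "0 \<le> \<bar>M $ k $ p k\<bar> \<and> \<bar>M $ k $ p k\<bar> \<le> 2" for k
        using M[of k "p k"] e by (auto split: if_splits)
      show "(\<Prod>k\<in>{i, j}. \<bar>M $ k $ p k\<bar>) \<le> e * e"
        using j M[of i "p i"] M[of j "p j"] i e0 by (auto intro!: mult_mono)
    qed (auto intro!: prod_nonneg mult_nonneg_nonneg)
    also have "\<dots> \<le> 2 ^ CARD('n) * (e * e)"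
      by (intro mult_right_mono) (auto intro!: power_increasing card_mono simp: e0)
    also have "\<bar>\<Prod>i\<in>UNIV. M $ i $ p i\<bar> = \<bar>?t p\<bar>"
      by (simp add: abs_mult sign_def)
    finally show ?thesis by (simp add: power2_eq_square)
  qed
  have "det M = ?t id + (\<Sum>p\<in>?P - {id}. ?t p)"
    unfolding det_def by (rule sum.remove[OF fin]) (simp add: permutes_id)
  then have "det M - 1 - (\<Sum>i\<in>UNIV. M $ i $ i - 1)
      = ((\<Prod>i\<in>UNIV. 1 + (M $ i $ i - 1)) - 1 - (\<Sum>i\<in>UNIV. M $ i $ i - 1)) + (\<Sum>p\<in>?P - {id}. ?t p)"
    by simp
  also have "\<bar>\<dots>\<bar> \<le> 3 ^ CARD('n) * e\<^sup>2 + (\<Sum>p\<in>?P - {id}. 2 ^ CARD('n) * e\<^sup>2)"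
  proof (rule order_trans[OF abs_triangle_ineq], intro add_mono)
    show "\<bar>(\<Prod>i\<in>UNIV. 1 + (M $ i $ i - 1)) - 1 - (\<Sum>i\<in>UNIV. M $ i $ i - 1)\<bar> \<le> 3 ^ CARD('n) * e\<^sup>2"
      using M[of i i for i] by (intro prod_one_plus_approx[OF _ _ e]) auto
    show "\<bar>\<Sum>p\<in>?P - {id}. ?t p\<bar> \<le> (\<Sum>p\<in>?P - {id}. 2 ^ CARD('n) * e\<^sup>2)"
      by (rule order_trans[OF sum_abs]) (intro sum_mono small)
  qed
  also have "\<dots> \<le> 3 ^ CARD('n) * e\<^sup>2 + fact CARD('n) * (2 ^ CARD('n) * e\<^sup>2)"
  proof -
    have "card (?P - {id}) \<le> card ?P"
      by (intro card_mono fin) auto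
    also have "card ?P = fact CARD('n)"
      by (simp add: card_permutations)
    finally have "real (card (?P - {id})) \<le> fact CARD('n)"
      by (metis of_nat_fact of_nat_le_iff)
    then show ?thesis
      by (simp add: mult_right_mono)
  qed
  also have "\<dots> = det_const CARD('n) * e\<^sup>2"
    by (simp add: det_const_def algebra_simps)
  finally show ?thesis .
qed

text \<open>The change of variables theorem of the library is stated for \<open>real ^ 'n\<close> with a
  well-ordered index type; this index type transfers it to an arbitrary Euclidean space.\<close>

typedef (overloaded) ('a::euclidean_space) coord = "{..<DIM('a)}"
  by (rule exI[of _ 0]) simp

instantiation coord :: (euclidean_space) linorder
begin

definition less_eq_coord :: "'a coord \<Rightarrow> 'a coord \<Rightarrow> bool" where
  "less_eq_coord x y \<longleftrightarrow> Rep_coord x \<le> Rep_coord y"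

definition less_coord :: "'a coord \<Rightarrow> 'a coord \<Rightarrow> bool" where
  "less_coord x y \<longleftrightarrow> Rep_coord x < Rep_coord y"

instance
  by standard (auto simp: less_eq_coord_def less_coord_def Rep_coord_inject)

end

instance coord :: (euclidean_space) wellorder
proof
  fix P :: "'a coord \<Rightarrow> bool" and a
  assume step: "\<And>x. (\<And>y. y < x \<Longrightarrow> P y) \<Longrightarrow> P x"
  show "P a"
    by (induction a rule: measure_induct_rule[of Rep_coord]) (auto intro: step simp: less_coord_def)
qed

instance coord :: (euclidean_space) finite
proof
  have "finite (range (Rep_coord :: 'a coord \<Rightarrow> nat))"
    by (rule finite_subset[of _ "{..<DIM('a)}"]) (use Rep_coord in auto)
  then show "finite (UNIV :: 'a coord set)"
    by (rule finite_imageD) (simp add: inj_on_def Rep_coord_inject)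
qed

lemma range_Rep_coord: "range (Rep_coord :: 'a::euclidean_space coord \<Rightarrow> nat) = {..<DIM('a)}"
  using type_definition.Rep_range[OF type_definition_coord] .

lemma card_coord: "CARD('a::euclidean_space coord) = DIM('a)"
proof -
  have "card (range (Rep_coord :: 'a coord \<Rightarrow> nat)) = CARD('a coord)"
    by (rule card_image) (simp add: inj_on_def Rep_coord_inject)
  then show ?thesis by (simp add: range_Rep_coord)
qed

definition coord_vec :: "'a::euclidean_space coord \<Rightarrow> 'a" where
  "coord_vec = (SOME f. bij_betw f UNIV Basis)"

lemma bij_coord_vec: "bij_betw (coord_vec :: 'a::euclidean_space coord \<Rightarrow> 'a) UNIV Basis"
proof -
  have "\<exists>f :: 'a coord \<Rightarrow> 'a. bij_betw f UNIV Basis"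
    by (intro finite_same_card_bij) (auto simp: card_coord)
  then show ?thesis
    unfolding coord_vec_def by (rule someI_ex)
qed

lemma coord_vec_Basis: "coord_vec k \<in> Basis"
  using bij_coord_vec by (auto simp: bij_betw_def)

lemma inner_coord_vec: "coord_vec k \<bullet> coord_vec l = (if k = l then 1 else 0)"
proof -
  have "coord_vec k = coord_vec l \<longleftrightarrow> k = l"
    using bij_coord_vec by (auto simp: bij_betw_def inj_on_def)
  then show ?thesis
    by (simp add: inner_Basis coord_vec_Basis)
qed

lemma sum_coord_vec: "(\<Sum>k\<in>UNIV. f (coord_vec k)) = (\<Sum>i\<in>Basis. f i)"
  using sum.reindex_bij_betw[OF bij_coord_vec] .

lemma prod_coord_vec: "(\<Prod>k\<in>UNIV. f (coord_vec k)) = (\<Prod>i\<in>Basis. f i)"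
  using prod.reindex_bij_betw[OF bij_coord_vec] .

definition to_cart :: "'a::euclidean_space \<Rightarrow> real ^ 'a coord" where
  "to_cart x = (\<chi> k. x \<bullet> coord_vec k)"

definition of_cart :: "real ^ 'a coord \<Rightarrow> 'a::euclidean_space" where
  "of_cart y = (\<Sum>k\<in>UNIV. y $ k *\<^sub>R coord_vec k)"

lemma of_cart_inner: "of_cart y \<bullet> coord_vec k = y $ k"
  by (simp add: of_cart_def inner_sum_left inner_coord_vec if_distrib sum.delta' cong: if_cong)

lemma to_of_cart[simp]: "to_cart (of_cart y) = y"
  by (simp add: to_cart_def of_cart_inner vec_eq_iff)

lemma of_to_cart[simp]: "of_cart (to_cart x) = x"
  unfolding of_cart_def to_cart_def
  by (simp add: sum_coord_vec[of "\<lambda>i. (x \<bullet> i) *\<^sub>R i"] euclidean_representation)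

lemma bounded_linear_to_cart: "bounded_linear (to_cart :: 'a::euclidean_space \<Rightarrow> _)"
  by (rule linear_conv_bounded_linear[THEN iffD1])
    (auto intro!: linearI simp: to_cart_def vec_eq_iff inner_add_left)

lemma bounded_linear_of_cart: "bounded_linear (of_cart :: _ \<Rightarrow> 'a::euclidean_space)"
  by (rule linear_conv_bounded_linear[THEN iffD1])
    (auto intro!: linearI simp: of_cart_def scaleR_add_left sum.distrib scaleR_sum_right)

lemma to_cart_measurable[measurable]: "to_cart \<in> borel_measurable borel"
  by (intro borel_measurable_continuous_onI linear_continuous_on bounded_linear_to_cart)

lemma of_cart_measurable[measurable]: "of_cart \<in> borel_measurable borel"
  by (intro borel_measurable_continuous_onI linear_continuous_on bounded_linear_of_cart)

lemma distr_to_cart: "distr lborel borel (to_cart :: 'a::euclidean_space \<Rightarrow> _) = lborel"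
proof (rule lborel_eqI[symmetric])
  fix l u :: "real ^ 'a coord"
  assume le: "\<And>b. b \<in> Basis \<Longrightarrow> l \<bullet> b \<le> u \<bullet> b"
  have le': "l $ k \<le> u $ k" for k
    using le[of "axis k 1"] by (simp add: inner_axis axis_in_Basis_iff)
  have "to_cart -` box l u = box (of_cart l :: 'a) (of_cart u)"
  proof -
    have "x \<in> to_cart -` box l u \<longleftrightarrow> x \<in> box (of_cart l) (of_cart u)" for x :: 'a
    proof -
      have "x \<in> to_cart -` box l u \<longleftrightarrow> (\<forall>k. l $ k < x \<bullet> coord_vec k \<and> x \<bullet> coord_vec k < u $ k)"
        by (simp add: mem_box_cart to_cart_def)
      also have "\<dots> \<longleftrightarrow> (\<forall>i\<in>range coord_vec. of_cart l \<bullet> i < x \<bullet> i \<and> x \<bullet> i < of_cart u \<bullet> i)"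
        by (simp add: of_cart_inner)
      also have "range (coord_vec :: 'a coord \<Rightarrow> 'a) = Basis"
        by (rule bij_betw_imp_surj_on[OF bij_coord_vec])
      finally show ?thesis by (simp add: mem_box)
    qed
    then show ?thesis by blast
  qed
  then have "emeasure (distr lborel borel (to_cart :: 'a \<Rightarrow> _)) (box l u) = emeasure lborel (box (of_cart l :: 'a) (of_cart u))"
    by (simp add: emeasure_distr)
  also have "\<dots> = ennreal (\<Prod>i\<in>Basis. (of_cart u - of_cart l :: 'a) \<bullet> i)"
  proof (rule emeasure_lborel_box)
    fix i :: 'a assume "i \<in> Basis"
    then obtain k where "i = coord_vec k"
      using bij_coord_vec by (auto simp: bij_betw_def image_iff)
    then show "of_cart l \<bullet> i \<le> of_cart u \<bullet> i"
      using le' by (simp add: of_cart_inner)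
  qed
  also have "(\<Prod>i\<in>Basis. (of_cart u - of_cart l :: 'a) \<bullet> i) = (\<Prod>k\<in>UNIV. (u - l) $ k)"
    by (subst prod_coord_vec[symmetric]) (simp add: inner_diff_left of_cart_inner)
  also have "\<dots> = (\<Prod>b\<in>Basis. (u - l) \<bullet> b)"
    unfolding Basis_vec_def
    by (subst prod.UNION_disjoint) (auto simp: axis_eq_axis inner_axis)
  finally show "emeasure (distr lborel borel (to_cart :: 'a \<Rightarrow> _)) (box l u) = ennreal (\<Prod>b\<in>Basis. (u - l) \<bullet> b)" .
qed simp

lemma emeasure_of_cart_vimage:
  assumes "S \<in> sets borel"
  shows "emeasure lborel (of_cart -` S) = emeasure lborel (S :: 'a::euclidean_space set)"
proof -
  have m: "of_cart -` S \<in> sets borel"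
    using measurable_sets[OF of_cart_measurable assms] by simp
  have "emeasure lborel (of_cart -` S) = emeasure (distr lborel borel (to_cart :: 'a \<Rightarrow> _)) (of_cart -` S)"
    by (simp add: distr_to_cart)
  also have "\<dots> = emeasure lborel (to_cart -` of_cart -` S)"
    using m by (simp add: emeasure_distr)
  also have "to_cart -` of_cart -` S = S" by auto
  finally show ?thesis .
qed

section \<open>Change of variables for maps near the identity\<close>

lemma measure_image_bounds_cart:
  fixes f :: "real ^ 'n::{finite,wellorder} \<Rightarrow> real ^ 'n::_"
  assumes S: "S \<in> lmeasurable"
    and der: "\<And>x. (f has_derivative f' x) (at x)"
    and inj: "inj f"
    and det: "\<And>x. m \<le> \<bar>det (matrix (f' x))\<bar>" "\<And>x. \<bar>det (matrix (f' x))\<bar> \<le> M"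
  shows "f ` S \<in> lmeasurable" "m * measure lebesgue S \<le> measure lebesgue (f ` S)"
    "measure lebesgue (f ` S) \<le> M * measure lebesgue S"
proof -
  have der': "(f has_derivative f' x) (at x within S)" for x
    by (rule has_derivative_at_withinI[OF der])
  have inj': "inj_on f S" using inj by (auto intro: inj_on_subset)
  have Sl: "S \<in> sets lebesgue" using S by auto
  have int: "(\<lambda>x. \<bar>det (matrix (f' x))\<bar>) integrable_on S"
  proof (rule measurable_bounded_by_integrable_imp_integrable[where g = "\<lambda>_. M"])
    have "(\<lambda>x. det (matrix (f' x))) \<in> borel_measurable (lebesgue_on S)"
      by (rule borel_measurable_det_Jacobian[OF Sl der'])
    then show "(\<lambda>x. \<bar>det (matrix (f' x))\<bar>) \<in> borel_measurable (lebesgue_on S)"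
      by measurable
    show "(\<lambda>_. M) integrable_on S"
      using S by (simp add: integrable_on_const)
  qed (use det Sl in auto)
  show "f ` S \<in> lmeasurable"
    using measurable_differentiable_image_eq[OF Sl der' inj'] int by blast
  have eq: "measure lebesgue (f ` S) = integral S (\<lambda>x. \<bar>det (matrix (f' x))\<bar>)"
    by (rule measure_differentiable_image_eq[OF Sl der' inj' int])
  have const: "(\<lambda>_. c) integrable_on S" "integral S (\<lambda>_. c) = c * measure lebesgue S" for c :: real
    using S integral_mult_right[of S c "\<lambda>_. 1"] by (auto simp: integrable_on_const lmeasure_integral)
  show "m * measure lebesgue S \<le> measure lebesgue (f ` S)"
    unfolding eq const(2)[symmetric] by (intro integral_le const int det)
  show "measure lebesgue (f ` S) \<le> M * measure lebesgue S"
    unfolding eq const(2)[symmetric] by (intro integral_le const int det)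
qed

text \<open>In coordinates the Jacobian matrix is the identity plus \<open>\<kappa>\<close> times
  the gradient, so its determinant deviates from 1 by the trace, which \<open>C\<close> bounds, and
  by second-order terms. In the lower bound \<open>T\<close> is any Borel set containing the image,
  since the image itself is only known to be Lebesgue measurable.\<close>

lemma measure_image_bounds:
  fixes F :: "'a::euclidean_space \<Rightarrow> 'a"
  assumes der: "\<And>x. (F has_derivative (\<lambda>h. h + \<kappa> *\<^sub>R (\<Sum>i\<in>Basis. (h \<bullet> i) *\<^sub>R A i x))) (at x)"
    and inj: "inj F" and l: "\<And>i x. i \<in> Basis \<Longrightarrow> norm (A i x) \<le> \<eta>"
    and tr: "\<And>x. \<bar>\<Sum>i\<in>Basis. A i x \<bullet> i\<bar> \<le> C" and kl: "\<bar>\<kappa>\<bar> * \<eta> \<le> 1"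
    and S: "S \<in> sets borel" "bounded S"
  defines "q \<equiv> \<bar>\<kappa>\<bar> * C + det_const DIM('a) * (\<bar>\<kappa>\<bar> * \<eta>)\<^sup>2"
  assumes q: "q \<le> 1"
  shows "T \<in> sets borel \<Longrightarrow> F ` S \<subseteq> T \<Longrightarrow> ennreal (1 - q) * emeasure lborel S \<le> emeasure lborel T"
    and "F ` S \<in> sets borel \<Longrightarrow> emeasure lborel (F ` S) \<le> ennreal (1 + q) * emeasure lborel S"
proof -
  define f where "f y = to_cart (F (of_cart y))" for y :: "real ^ 'a coord"
  define F' where "F' x h = h + \<kappa> *\<^sub>R (\<Sum>i\<in>Basis. (h \<bullet> i) *\<^sub>R A i x)" for x h
  define f' where "f' y h = to_cart (F' (of_cart y) (of_cart h))" for y h :: "real ^ 'a coord"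
  have der': "(f has_derivative f' y) (at y)" for y
  proof -
    have "((\<lambda>y. F (of_cart y)) has_derivative (\<lambda>h. F' (of_cart y) (of_cart h))) (at y)"
      by (rule has_derivative_compose[OF bounded_linear_imp_has_derivative[OF bounded_linear_of_cart] der[folded F'_def]])
    from has_derivative_compose[OF this bounded_linear_imp_has_derivative[OF bounded_linear_to_cart]]
    show ?thesis by (simp add: f_def[abs_def] f'_def[abs_def])
  qed
  have inj': "inj f"
  proof (rule injI)
    fix x y assume "f x = f y"
    then have "F (of_cart x) = F (of_cart y)"
      by (metis f_def of_to_cart)
    then have "of_cart x = of_cart y"
      using inj by (auto dest: injD)
    then show "x = y" by (metis to_of_cart)
  qed
  have of_cart_axis: "of_cart (axis k 1) = (coord_vec k :: 'a)" for k
  proof -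
    have "(\<Sum>l\<in>UNIV. axis k 1 $ l *\<^sub>R (coord_vec l :: 'a)) = (\<Sum>l\<in>UNIV. if l = k then coord_vec l else 0)"
      by (intro sum.cong) (auto simp: axis_def)
    then show ?thesis by (simp add: of_cart_def)
  qed
  have entry: "matrix (f' y) $ j $ k = (if j = k then 1 else 0) + \<kappa> * (A (coord_vec k) (of_cart y) \<bullet> coord_vec j)" for y j k
  proof -
    have "(\<Sum>i\<in>Basis. (coord_vec k \<bullet> i) *\<^sub>R A i x) = A (coord_vec k) x" for x :: 'a
      by (subst sum.remove[OF _ coord_vec_Basis[of k]])
        (auto simp: coord_vec_Basis inner_Basis intro!: sum.neutral split: if_splits)
    then show ?thesis
      by (simp add: matrix_def f'_def F'_def of_cart_axis to_cart_def inner_add_left inner_coord_vec)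
  qed
  have entry_small: "\<bar>matrix (f' y) $ j $ k - (if j = k then 1 else 0)\<bar> \<le> \<bar>\<kappa>\<bar> * \<eta>" for y j k
  proof -
    have "\<bar>A (coord_vec k) (of_cart y) \<bullet> coord_vec j\<bar> \<le> \<eta>"
      using Basis_le_norm[OF coord_vec_Basis, of "A (coord_vec k) (of_cart y)" j] l[OF coord_vec_Basis, of k "of_cart y"]
      by linarith
    then show ?thesis by (simp add: entry abs_mult mult_left_mono)
  qed
  have det: "\<bar>det (matrix (f' y)) - 1\<bar> \<le> q" for y
  proof -
    have "(\<Sum>k\<in>UNIV. matrix (f' y) $ k $ k - 1) = \<kappa> * (\<Sum>i\<in>Basis. A i (of_cart y) \<bullet> i)"
      using sum_coord_vec[of "\<lambda>i. A i (of_cart y) \<bullet> i"] by (simp add: entry sum_distrib_left[symmetric])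
    then have "\<bar>\<Sum>k\<in>UNIV. matrix (f' y) $ k $ k - 1\<bar> \<le> \<bar>\<kappa>\<bar> * C"
      using tr[of "of_cart y"] by (simp add: abs_mult mult_left_mono)
    moreover have "\<bar>det (matrix (f' y)) - 1 - (\<Sum>k\<in>UNIV. matrix (f' y) $ k $ k - 1)\<bar> \<le> det_const DIM('a) * (\<bar>\<kappa>\<bar> * \<eta>)\<^sup>2"
      using det_near_identity[OF entry_small kl] by (simp add: card_coord)
    ultimately show ?thesis unfolding q_def by linarith
  qed
  have det_lo: "1 - q \<le> \<bar>det (matrix (f' y))\<bar>" for y
    using det[of y] by arith
  have det_hi: "\<bar>det (matrix (f' y))\<bar> \<le> 1 + q" for y
    using det[of y] by arith
  define S' where "S' = (of_cart :: _ \<Rightarrow> 'a) -` S"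
  have q0: "0 \<le> q" using det[of undefined] by linarith
  have S'_borel: "S' \<in> sets borel"
    using measurable_sets[OF of_cart_measurable S(1)] by (simp add: S'_def)
  have finS: "emeasure lborel S < top"
    using emeasure_bounded_finite[OF S(2)] by simp
  have emS': "emeasure lborel S' = emeasure lborel S"
    unfolding S'_def by (rule emeasure_of_cart_vimage[OF S(1)])
  have S'_lm: "S' \<in> lmeasurable"
    using S'_borel finS emS' by (auto simp: fmeasurable_def)
  note bounds = measure_image_bounds_cart[OF S'_lm der' inj' det_lo det_hi]
  have eS: "emeasure lborel S = ennreal (measure lebesgue S')"
    using S'_lm S'_borel by (simp add: emS'[symmetric] fmeasurable_def emeasure_eq_ennreal_measure measure_completion)
  have image: "f ` S' = of_cart -` (F ` S)"
  proof safe
    fix y assume "y \<in> S'"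
    then show "f y \<in> of_cart -` (F ` S)" by (auto simp: f_def S'_def)
  next
    fix y x assume "of_cart y = F x" "x \<in> S"
    then have "y = f (to_cart x)" "to_cart x \<in> S'"
      by (auto simp: f_def S'_def) (metis to_of_cart)
    then show "y \<in> f ` S'" by blast
  qed
  have eFS: "emeasure lebesgue (f ` S') = ennreal (measure lebesgue (f ` S'))"
    using bounds(1) by (intro emeasure_eq_ennreal_measure) (auto simp: fmeasurable_def simp del: emeasure_completion)
  show "ennreal (1 - q) * emeasure lborel S \<le> emeasure lborel T" if T: "T \<in> sets borel" "F ` S \<subseteq> T"
  proof -
    have T': "of_cart -` T \<in> sets borel"
      using measurable_sets[OF of_cart_measurable T(1)] by simp
    have "ennreal (1 - q) * emeasure lborel S = ennreal ((1 - q) * measure lebesgue S')"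
      using q by (simp add: eS ennreal_mult)
    also have "\<dots> \<le> emeasure lebesgue (f ` S')"
      unfolding eFS by (intro ennreal_leI bounds)
    also have "\<dots> \<le> emeasure lebesgue (of_cart -` T)"
      using T' T(2) unfolding image by (intro emeasure_mono) auto
    also have "\<dots> = emeasure lborel T"
      using T' emeasure_of_cart_vimage[OF T(1)] by simp
    finally show ?thesis .
  qed
  show "emeasure lborel (F ` S) \<le> ennreal (1 + q) * emeasure lborel S" if FS: "F ` S \<in> sets borel"
  proof -
    have FS': "of_cart -` (F ` S) \<in> sets borel"
      using measurable_sets[OF of_cart_measurable FS] by simp
    have "emeasure lborel (F ` S) = emeasure lebesgue (f ` S')"
      unfolding image using FS' emeasure_of_cart_vimage[OF FS] by simp
    also have "\<dots> \<le> ennreal ((1 + q) * measure lebesgue S')"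
      unfolding eFS by (intro ennreal_leI bounds)
    also have "\<dots> = ennreal (1 + q) * emeasure lborel S"
      using q0 by (simp add: eS ennreal_mult)
    finally show ?thesis .
  qed
qed

section \<open>Volume bounds for Lipschitz perturbations of the identity\<close>

text \<open>For open \<open>A\<close>, a limit lying in \<open>A\<close> forces the sequence into
  \<open>A\<close> eventually, so the indicator of the limiting preimage is below the lower limit of
  the indicators, and Fatou applies.\<close>

lemma emeasure_vimage_limit:
  fixes G :: "'a::euclidean_space \<Rightarrow> 'b::euclidean_space"
  assumes lim: "\<And>x. (\<lambda>n. Gs n x) \<longlonglongrightarrow> G x" and A: "open A"
    and [measurable]: "\<And>n. Gs n \<in> borel_measurable borel" "G \<in> borel_measurable borel"
    and bound: "\<forall>\<^sub>F n in sequentially. emeasure lborel (Gs n -` A) \<le> b"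
  shows "emeasure lborel (G -` A) \<le> b"
proof -
  have [measurable]: "A \<in> sets borel" using A by (rule borel_open)
  have m: "f -` A \<in> sets borel" if "f \<in> borel_measurable borel" for f :: "'a \<Rightarrow> 'b"
    using measurable_sets[OF that, of A] by simp
  have "emeasure lborel (G -` A) = (\<integral>\<^sup>+x. indicator (G -` A) x \<partial>lborel)"
    using m by simp
  also have "\<dots> \<le> (\<integral>\<^sup>+x. liminf (\<lambda>n. indicator (Gs n -` A) x) \<partial>lborel)"
  proof (rule nn_integral_mono)
    fix x
    show "indicator (G -` A) x \<le> liminf (\<lambda>n. indicator (Gs n -` A) x :: ennreal)"
    proof (cases "G x \<in> A")
      case True
      have "\<forall>\<^sub>F n in sequentially. Gs n x \<in> A"
        by (rule topological_tendstoD[OF lim A True])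
      then have "\<forall>\<^sub>F n in sequentially. 1 \<le> (indicator (Gs n -` A) x :: ennreal)"
        by eventually_elim simp
      then have "1 \<le> liminf (\<lambda>n. indicator (Gs n -` A) x :: ennreal)"
        by (rule Liminf_bounded)
      then show ?thesis using True by simp
    qed simp
  qed
  also have "\<dots> \<le> liminf (\<lambda>n. \<integral>\<^sup>+x. indicator (Gs n -` A) x \<partial>lborel)"
    by (rule nn_integral_liminf) (use m in auto)
  also have "\<dots> = liminf (\<lambda>n. emeasure lborel (Gs n -` A))"
    using m by simp
  also have "\<dots> \<le> limsup (\<lambda>n. emeasure lborel (Gs n -` A))"
    by (rule Liminf_le_Limsup) simp
  also have "\<dots> \<le> b"
    by (rule Limsup_bounded[OF bound])
  finally show ?thesis .
qed

lemma emeasure_bounded_exhaustion: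
  assumes "A \<in> sets borel"
    and "\<And>n::nat. c * emeasure lborel (A \<inter> ball 0 (real n)) \<le> (b::ennreal)"
  shows "c * emeasure lborel (A :: 'a::euclidean_space set) \<le> b"
proof -
  have "(SUP n. emeasure lborel (A \<inter> ball 0 (real n))) = emeasure lborel (\<Union>n. A \<inter> ball 0 (real n))"
    using assms(1) by (intro SUP_emeasure_incseq) (auto simp: incseq_def)
  also have "(\<Union>n. A \<inter> ball 0 (real n)) = A"
    using reals_Archimedean2 by auto
  finally have "c * emeasure lborel A = c * (SUP n. emeasure lborel (A \<inter> ball 0 (real n)))"
    by simp
  also have "\<dots> = (SUP n. c * emeasure lborel (A \<inter> ball 0 (real n)))"
    by (rule SUP_mult_left_ennreal)
  also have "\<dots> \<le> b"
    by (intro SUP_least assms)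
  finally show ?thesis .
qed

lemma Lipschitz_imp_continuous:
  fixes f :: "'a::metric_space \<Rightarrow> 'b::metric_space"
  assumes "\<And>x y. dist (f x) (f y) \<le> L * dist x y"
  shows "continuous_on S f"
proof (rule continuous_on_subset[OF lipschitz_on_continuous_on])
  show "(max L 0)-lipschitz_on UNIV f"
  proof (rule lipschitz_onI)
    fix x y :: 'a
    have "L * dist x y \<le> max L 0 * dist x y"
      by (intro mult_right_mono) auto
    with assms[of x y] show "dist (f x) (f y) \<le> max L 0 * dist x y"
      by linarith
  qed simp
qed simp

text \<open>The identity dominates the contraction: distances shrink by a factor of at most 2, which
  gives injectivity and a Lipschitz inverse, and Banach's fixed point theorem gives
  surjectivity.\<close>

lemma contraction_perturbation:
  fixes w :: "'a::euclidean_space \<Rightarrow> 'a"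
  assumes w: "\<And>x y. norm (w x - w y) \<le> 1 / 2 * norm (x - y)"
  shows contraction_perturbation_expand: "norm (x - y) \<le> 2 * norm ((x + w x) - (y + w y))"
    and contraction_perturbation_bij: "bij (\<lambda>x. x + w x)"
    and contraction_perturbation_inv: "continuous_on UNIV (inv (\<lambda>x. x + w x))"
proof -
  show expand: "norm (x - y) \<le> 2 * norm ((x + w x) - (y + w y))" for x y
  proof -
    have "norm (x - y) \<le> norm ((x + w x) - (y + w y)) + norm (w x - w y)"
      using norm_triangle_ineq4[of "(x + w x) - (y + w y)" "w x - w y"] by (simp add: algebra_simps)
    with w[of x y] show ?thesis by simp
  qed
  have "inj (\<lambda>x. x + w x)"
  proof (rule injI)
    fix x y assume "x + w x = y + w y"
    then show "x = y" using expand[of x y] by simp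
  qed
  moreover have "\<exists>x. y = x + w x" for y
  proof -
    have "\<exists>!x. y - w x = x"
    proof (rule banach_fix_type)
      show "\<forall>a b. dist (y - w a) (y - w b) \<le> 1 / 2 * dist a b"
        using w by (auto simp: dist_norm norm_minus_commute)
    qed auto
    then obtain x where "y - w x = x" by blast
    then have "y = x + w x" by (metis diff_add_cancel)
    then show ?thesis by blast
  qed
  ultimately show bij: "bij (\<lambda>x. x + w x)"
    by (auto simp: bij_def surj_def)
  have inv: "inv (\<lambda>x. x + w x) y + w (inv (\<lambda>x. x + w x) y) = y" for y
    using surj_f_inv_f[OF bij_is_surj[OF bij], of y] .
  have "dist (inv (\<lambda>x. x + w x) x) (inv (\<lambda>x. x + w x) y) \<le> 2 * dist x y" for x y
    using expand[of "inv (\<lambda>x. x + w x) x" "inv (\<lambda>x. x + w x) y"] unfolding inv by (simp add: dist_norm)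
  then show "continuous_on UNIV (inv (\<lambda>x. x + w x))"
    by (intro Lipschitz_imp_continuous[of _ 2])
qed

lemma vimage_inv_bij: "bij f \<Longrightarrow> inv f -` A = f ` A"
  using bij_vimage_eq_inv_image[OF bij_imp_bij_inv, of f A] by (simp add: inv_inv_eq)

text \<open>The bound \<open>\<eta>\<close> concerns each partial derivative, and adding
  \<open>DIM('a)\<close> of them gives the Lipschitz constant. The divergence is mollified as a
  single function, so that its own bound \<open>C\<close> survives instead of a multiple of
  \<open>\<eta>\<close>.\<close>

lemma weak_gradient_bounded_mollify:
  fixes v :: "'a::euclidean_space \<Rightarrow> 'a" and \<eta> C :: real
  assumes wg: "weak_gradient v D"
    and l: "AE x in lebesgue. \<forall>i\<in>Basis. norm (D x i) \<le> \<eta>"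
    and tr: "AE x in lebesgue. \<bar>trace_div (D x)\<bar> \<le> C" and \<tau>: "\<tau> > 0"
  shows "i \<in> Basis \<Longrightarrow> norm (mollify \<tau> (\<lambda>y. D y i) x) \<le> \<eta>"
    and "\<bar>\<Sum>i\<in>Basis. mollify \<tau> (\<lambda>y. D y i) x \<bullet> i\<bar> \<le> C"
    and "norm (mollify \<tau> v x - mollify \<tau> v y) \<le> DIM('a) * \<eta> * norm (x - y)"
proof -
  have Di: "\<And>i. i \<in> Basis \<Longrightarrow> locally_integrable (\<lambda>x. D x i)"
    using wg by (auto simp: weak_gradient_def)
  show A: "norm (mollify \<tau> (\<lambda>y. D y i) x) \<le> \<eta>" if "i \<in> Basis" for i x
  proof -
    have "AE y in lebesgue. y \<in> cbox x (x + \<tau> *\<^sub>R One) \<longrightarrow> norm (D y i - 0) \<le> \<eta>"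
      using l by eventually_elim (use that in simp)
    from mollify_close[OF \<tau> Di[OF that] this] show ?thesis by simp
  qed
  have "mollify \<tau> (\<lambda>y. trace_div (D y)) x = (\<Sum>i\<in>Basis. mollify \<tau> (\<lambda>y. D y i) x \<bullet> i)"
  proof -
    have int: "integrable lebesgue (\<lambda>y. scaled_kernel \<tau> (y - x) *\<^sub>R D y i)" if "i \<in> Basis" for i
      by (intro conv_integrable test_function_scaled_kernel Di \<tau> that)
    have "mollify \<tau> (\<lambda>y. trace_div (D y)) x = (LINT y|lebesgue. (\<Sum>i\<in>Basis. (scaled_kernel \<tau> (y - x) *\<^sub>R D y i) \<bullet> i))"
      by (simp add: mollify_def conv_def trace_div_def sum_distrib_left)
    also have "\<dots> = (\<Sum>i\<in>Basis. (LINT y|lebesgue. (scaled_kernel \<tau> (y - x) *\<^sub>R D y i) \<bullet> i))"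
      by (intro Bochner_Integration.integral_sum integrable_inner_left int)
    also have "\<dots> = (\<Sum>i\<in>Basis. mollify \<tau> (\<lambda>y. D y i) x \<bullet> i)"
      unfolding mollify_def conv_def by (intro sum.cong refl integral_inner_left int)
    finally show ?thesis .
  qed
  moreover have "locally_integrable (\<lambda>y. trace_div (D y))"
    unfolding locally_integrable_def trace_div_def
  proof (intro allI impI)
    fix K :: "'a set" assume K: "compact K"
    have "integrable lebesgue (\<lambda>y. \<Sum>i\<in>Basis. (indicator K y *\<^sub>R D y i) \<bullet> i)"
      using Di K by (intro Bochner_Integration.integrable_sum integrable_inner_left)
        (auto simp: locally_integrable_def set_integrable_def)
    then show "set_integrable lebesgue K (\<lambda>y. \<Sum>i\<in>Basis. D y i \<bullet> i)"
      by (simp add: set_integrable_def sum_distrib_left)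
  qed
  moreover have "AE y in lebesgue. y \<in> cbox x (x + \<tau> *\<^sub>R One) \<longrightarrow> norm (trace_div (D y) - 0) \<le> C"
    using tr by eventually_elim simp
  ultimately show "\<bar>\<Sum>i\<in>Basis. mollify \<tau> (\<lambda>y. D y i) x \<bullet> i\<bar> \<le> C"
    using mollify_close[OF \<tau>, of "\<lambda>y. trace_div (D y)" x 0 C] by simp
  obtain i :: 'a where "i \<in> Basis"
    using nonempty_Basis by blast
  from order_trans[OF norm_ge_zero A[OF this]] have "\<eta> \<ge> 0" .
  then have l0: "0 \<le> DIM('a) * \<eta>" by simp
  have "ennreal (norm (mollify \<tau> v x - mollify \<tau> v y)) \<le> ennreal (norm (x - y)) *
      (\<integral>\<^sup>+s. indicator {0..1::real} s * ennreal (DIM('a) * \<eta>) \<partial>lborel)"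
  proof (rule segment_bound[where G = "\<lambda>_. ennreal (DIM('a) * \<eta>)" and A = "\<lambda>i. mollify \<tau> (\<lambda>y. D y i)"])
    show "(mollify \<tau> v has_derivative (\<lambda>h. \<Sum>i\<in>Basis. (h \<bullet> i) *\<^sub>R mollify \<tau> (\<lambda>y. D y i) x)) (at x)" for x
      by (rule mollify_has_derivative[OF \<tau> wg])
    show "continuous (at x) (mollify \<tau> (\<lambda>y. D y i))" if "i \<in> Basis" for i x
      by (rule mollify_continuous[OF \<tau> Di[OF that]])
    show "ennreal (\<Sum>i\<in>Basis. norm (mollify \<tau> (\<lambda>y. D y i) x)) \<le> ennreal (DIM('a) * \<eta>)" for x
      using sum_bounded_above[of Basis "\<lambda>i. norm (mollify \<tau> (\<lambda>y. D y i) x)" \<eta>] A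
      by (intro ennreal_leI) auto
  qed auto
  also have "\<dots> = ennreal (DIM('a) * \<eta> * norm (x - y))"
    using l0 by (simp add: nn_integral_multc ennreal_mult[symmetric] mult_ac)
  finally show "norm (mollify \<tau> v x - mollify \<tau> v y) \<le> DIM('a) * \<eta> * norm (x - y)"
    using l0 by (simp add: ennreal_le_iff)
qed

lemma mollify_tendsto_continuous:
  fixes v :: "'a::euclidean_space \<Rightarrow> 'b::euclidean_space"
  assumes v: "continuous_on UNIV v" "locally_integrable v"
  shows "((\<lambda>\<tau>. mollify \<tau> v x) \<longlongrightarrow> v x) (at_right 0)"
proof (rule tendstoI)
  fix e :: real assume e: "e > 0"
  have "continuous (at x) v"
    using v(1) by (simp add: continuous_on_eq_continuous_at)
  then obtain d where d: "d > 0" "\<And>y. dist y x < d \<Longrightarrow> dist (v y) (v x) < e / 2"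
    using e unfolding continuous_at_eps_delta by (meson half_gt_zero)
  have "dist (mollify \<tau> v x) (v x) < e" if \<tau>: "0 < \<tau>" "\<tau> < d / (DIM('a) + 1)" for \<tau>
  proof -
    have "norm (v y - v x) \<le> e / 2" if y: "y \<in> cbox x (x + \<tau> *\<^sub>R One)" for y
    proof -
      have "(1 / \<tau>) *\<^sub>R (y - x) \<in> cbox 0 One"
        using \<tau> y by (auto simp: mem_box field_simps inner_simps)
      from norm_le_DIM_of_unit_cube[OF this] have "\<tau> * norm ((1 / \<tau>) *\<^sub>R (y - x)) \<le> \<tau> * DIM('a)"
        using \<tau> by (intro mult_left_mono) auto
      then have "norm (y - x) \<le> \<tau> * DIM('a)"
        using \<tau> unfolding norm_scaleR by simp
      also have "\<dots> < d"
        using \<tau> by (simp add: field_simps)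
      finally show ?thesis using d(2)[of y] by (simp add: dist_norm)
    qed
    then have "norm (mollify \<tau> v x - v x) \<le> e / 2"
      by (intro mollify_close \<tau> v(2)) auto
    then show ?thesis using e by (simp add: dist_norm)
  qed
  then show "\<forall>\<^sub>F \<tau> in at_right 0. dist (mollify \<tau> v x) (v x) < e"
    using d(1) by (auto simp: eventually_at_right_field intro!: exI[of _ "d / (DIM('a) + 1)"])
qed

lemma weak_gradient_bounded_Lipschitz:
  fixes v :: "'a::euclidean_space \<Rightarrow> 'a" and \<eta> C :: real
  assumes wg: "weak_gradient v D" and v: "continuous_on UNIV v"
    and l: "AE x in lebesgue. \<forall>i\<in>Basis. norm (D x i) \<le> \<eta>"
    and tr: "AE x in lebesgue. \<bar>trace_div (D x)\<bar> \<le> C"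
  shows "norm (v x - v y) \<le> DIM('a) * \<eta> * norm (x - y)"
proof -
  have lv: "locally_integrable v" using wg by (simp add: weak_gradient_def)
  have "((\<lambda>\<tau>. norm (mollify \<tau> v x - mollify \<tau> v y)) \<longlongrightarrow> norm (v x - v y)) (at_right 0)"
    by (intro tendsto_intros mollify_tendsto_continuous v lv)
  then show ?thesis
  proof (rule tendsto_upperbound)
    show "\<forall>\<^sub>F \<tau> in at_right 0. norm (mollify \<tau> v x - mollify \<tau> v y) \<le> DIM('a) * \<eta> * norm (x - y)"
      using weak_gradient_bounded_mollify(3)[OF wg l tr]
      by (auto simp: eventually_at_right_field intro!: exI[of _ 1])
  qed simp
qed

text \<open>A bound for the deviation from 1 of the Jacobian determinant of
  \<open>x + \<kappa> *\<^sub>R v x\<close>, for \<open>v\<close> with partial derivatives at most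
  \<open>\<eta>\<close> and divergence at most \<open>C\<close>.\<close>

definition distortion :: "'a::euclidean_space itself \<Rightarrow> real \<Rightarrow> real \<Rightarrow> real \<Rightarrow> real" where
  "distortion _ \<kappa> \<eta> C = \<bar>\<kappa>\<bar> * C + det_const DIM('a) * (\<bar>\<kappa>\<bar> * \<eta>)\<^sup>2"

text \<open>Mollification makes the map differentiable everywhere, with the same bounds on gradient
  and divergence, so that \<open>measure_image_bounds\<close> applies. That result concerns bounded
  sets; an exhaustion by balls extends it to open sets of any measure.\<close>

lemma mollified_perturbation:
  fixes v :: "'a::euclidean_space \<Rightarrow> 'a" and \<kappa> \<eta> C :: real
  assumes wg: "weak_gradient v D"
    and l: "AE x in lebesgue. \<forall>i\<in>Basis. norm (D x i) \<le> \<eta>"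
    and tr: "AE x in lebesgue. \<bar>trace_div (D x)\<bar> \<le> C" and \<tau>: "\<tau> > 0"
    and small: "\<bar>\<kappa>\<bar> * (DIM('a) * \<eta>) \<le> 1 / 2" "distortion TYPE('a) \<kappa> \<eta> C \<le> 1"
  defines "F \<equiv> \<lambda>x. x + \<kappa> *\<^sub>R mollify \<tau> v x"
  shows "norm (\<kappa> *\<^sub>R mollify \<tau> v x - \<kappa> *\<^sub>R mollify \<tau> v y) \<le> 1 / 2 * norm (x - y)"
    and "continuous_on UNIV F"
    and "open A \<Longrightarrow> ennreal (1 - distortion TYPE('a) \<kappa> \<eta> C) * emeasure lborel (F -` A) \<le> emeasure lborel A"
    and "open A \<Longrightarrow> emeasure lborel (F ` A) \<le> ennreal (1 + distortion TYPE('a) \<kappa> \<eta> C) * emeasure lborel A"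
proof -
  note moll = weak_gradient_bounded_mollify[OF wg l tr \<tau>]
  show contr: "norm (\<kappa> *\<^sub>R mollify \<tau> v x - \<kappa> *\<^sub>R mollify \<tau> v y) \<le> 1 / 2 * norm (x - y)" for x y
  proof -
    have "norm (\<kappa> *\<^sub>R mollify \<tau> v x - \<kappa> *\<^sub>R mollify \<tau> v y) = \<bar>\<kappa>\<bar> * norm (mollify \<tau> v x - mollify \<tau> v y)"
      by (simp add: scaleR_diff_right[symmetric])
    also have "\<dots> \<le> \<bar>\<kappa>\<bar> * (DIM('a) * \<eta> * norm (x - y))"
      by (intro mult_left_mono moll) simp
    also have "\<dots> = (\<bar>\<kappa>\<bar> * (DIM('a) * \<eta>)) * norm (x - y)"
      by (simp add: mult_ac)
    also have "\<dots> \<le> 1 / 2 * norm (x - y)"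
      by (intro mult_right_mono small) simp
    finally show ?thesis .
  qed
  have bij: "bij F"
    unfolding F_def by (rule contraction_perturbation_bij[OF contr])
  have der: "(F has_derivative (\<lambda>h. h + \<kappa> *\<^sub>R (\<Sum>i\<in>Basis. (h \<bullet> i) *\<^sub>R mollify \<tau> (\<lambda>y. D y i) x))) (at x)" for x
    unfolding F_def by (intro has_derivative_add has_derivative_ident has_derivative_scaleR_right mollify_has_derivative \<tau> wg)
  then show contF: "continuous_on UNIV F"
    by (meson continuous_at_imp_continuous_on has_derivative_continuous)
  obtain i :: 'a where "i \<in> Basis"
    using nonempty_Basis by blast
  from order_trans[OF norm_ge_zero moll(1)[OF this]] have l0: "0 \<le> \<eta>" .
  have "\<bar>\<kappa>\<bar> * \<eta> \<le> \<bar>\<kappa>\<bar> * (DIM('a) * \<eta>)"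
  proof (rule mult_left_mono)
    have "1 * \<eta> \<le> DIM('a) * \<eta>"
      using l0 DIM_positive[where 'a='a] by (intro mult_right_mono) auto
    then show "\<eta> \<le> DIM('a) * \<eta>" by simp
  qed simp
  then have kl: "\<bar>\<kappa>\<bar> * \<eta> \<le> 1" using small by linarith
  have bounds1: "ennreal (1 - distortion TYPE('a) \<kappa> \<eta> C) * emeasure lborel S \<le> emeasure lborel T"
    if "S \<in> sets borel" "bounded S" "T \<in> sets borel" "F ` S \<subseteq> T" for S T
    unfolding distortion_def
    by (rule measure_image_bounds(1)[OF der bij_is_inj[OF bij] _ moll(2) kl that(1,2) _ that(3,4)])
      (use moll(1) small(2) in \<open>auto simp: distortion_def\<close>)
  have bounds2: "emeasure lborel (F ` S) \<le> ennreal (1 + distortion TYPE('a) \<kappa> \<eta> C) * emeasure lborel S"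
    if "S \<in> sets borel" "bounded S" "F ` S \<in> sets borel" for S
    unfolding distortion_def
    by (rule measure_image_bounds(2)[OF der bij_is_inj[OF bij] _ moll(2) kl that(1,2) _ that(3)])
      (use moll(1) small(2) in \<open>auto simp: distortion_def\<close>)
  have FA: "F -` A \<in> sets borel" if "open A" for A
    using contF that by (intro borel_open open_vimage) auto
  show "ennreal (1 - distortion TYPE('a) \<kappa> \<eta> C) * emeasure lborel (F -` A) \<le> emeasure lborel A" if A: "open A"
  proof (rule emeasure_bounded_exhaustion[OF FA[OF A]])
    show "ennreal (1 - distortion TYPE('a) \<kappa> \<eta> C) * emeasure lborel (F -` A \<inter> ball 0 (real n)) \<le> emeasure lborel A" for n
      using FA[OF A] A by (intro bounds1) (auto intro: bounded_subset[OF bounded_ball])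
  qed
  \<comment> \<open>Images of open sets are preimages under the continuous inverse, hence Borel,
    which the upper bound in \<open>measure_image_bounds\<close> requires.\<close>
  have imF: "F ` A \<in> sets borel" if "open A" for A
  proof -
    have "continuous_on UNIV (inv F)"
      unfolding F_def by (rule contraction_perturbation_inv[OF contr])
    then have "open (inv F -` A)" using that by (intro open_vimage) auto
    then show ?thesis by (simp add: vimage_inv_bij[OF bij])
  qed
  show "emeasure lborel (F ` A) \<le> ennreal (1 + distortion TYPE('a) \<kappa> \<eta> C) * emeasure lborel A" if A: "open A"
  proof -
    have "(SUP n. emeasure lborel (F ` (A \<inter> ball 0 (real n)))) = emeasure lborel (\<Union>n. F ` (A \<inter> ball 0 (real n)))"
    proof (rule SUP_emeasure_incseq)
      show "range (\<lambda>n. F ` (A \<inter> ball 0 (real n))) \<subseteq> sets lborel"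
        using imF[OF open_Int[OF A open_ball]] by auto
      show "incseq (\<lambda>n. F ` (A \<inter> ball 0 (real n)))"
        unfolding incseq_def by (intro allI impI image_mono Int_mono subset_refl subset_ball) simp
    qed
    also have "(\<Union>n. F ` (A \<inter> ball 0 (real n))) = F ` A"
    proof -
      have "(\<Union>n. A \<inter> ball 0 (real n)) = A"
        using reals_Archimedean2 by auto
      then show ?thesis by (metis image_UN)
    qed
    finally have "emeasure lborel (F ` A) = (SUP n. emeasure lborel (F ` (A \<inter> ball 0 (real n))))" by simp
    also have "\<dots> \<le> ennreal (1 + distortion TYPE('a) \<kappa> \<eta> C) * emeasure lborel A"
    proof (rule SUP_least)
      fix n
      have "emeasure lborel (F ` (A \<inter> ball 0 (real n))) \<le> ennreal (1 + distortion TYPE('a) \<kappa> \<eta> C) * emeasure lborel (A \<inter> ball 0 (real n))"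
        using A imF[OF open_Int[OF A open_ball]] by (intro bounds2) (auto intro: bounded_subset[OF bounded_ball] borel_open)
      also have "\<dots> \<le> ennreal (1 + distortion TYPE('a) \<kappa> \<eta> C) * emeasure lborel A"
        using A by (intro mult_left_mono emeasure_mono) (auto intro: borel_open)
      finally show "emeasure lborel (F ` (A \<inter> ball 0 (real n))) \<le> ennreal (1 + distortion TYPE('a) \<kappa> \<eta> C) * emeasure lborel A" .
    qed
    finally show ?thesis .
  qed
qed

text \<open>The map and its inverse are pointwise limits of their mollified counterparts, so the
  bounds pass through \<open>emeasure_vimage_limit\<close>. For the inverses, the expansion estimate
  of the mollified map, applied to the two preimages of \<open>y\<close>, reduces convergence to
  that of the maps at the fixed point \<open>inv F y\<close>. The first bound serves the explicit
  half of a step and the second one the implicit half.\<close>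

lemma perturbation_preimage:
  fixes v :: "'a::euclidean_space \<Rightarrow> 'a" and \<kappa> \<eta> C :: real
  assumes wg: "weak_gradient v D" and v: "continuous_on UNIV v"
    and l: "AE x in lebesgue. \<forall>i\<in>Basis. norm (D x i) \<le> \<eta>"
    and tr: "AE x in lebesgue. \<bar>trace_div (D x)\<bar> \<le> C"
    and small: "\<bar>\<kappa>\<bar> * (DIM('a) * \<eta>) \<le> 1 / 2" "distortion TYPE('a) \<kappa> \<eta> C < 1"
    and A: "open A"
  defines "F \<equiv> \<lambda>x. x + \<kappa> *\<^sub>R v x"
  shows "emeasure lborel (F -` A) \<le> ennreal (1 / (1 - distortion TYPE('a) \<kappa> \<eta> C)) * emeasure lborel A"
    and "emeasure lborel (inv F -` A) \<le> ennreal (1 + distortion TYPE('a) \<kappa> \<eta> C) * emeasure lborel A"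
    and "bij F" "continuous_on UNIV F" "continuous_on UNIV (inv F)"
proof -
  let ?q = "distortion TYPE('a) \<kappa> \<eta> C"
  define \<tau> where "\<tau> n = inverse (real (Suc n))" for n
  have \<tau>: "\<tau> n > 0" for n by (simp add: \<tau>_def)
  have small2: "?q \<le> 1" using small by simp
  define F\<tau> where "F\<tau> n x = x + \<kappa> *\<^sub>R mollify (\<tau> n) v x" for n x
  note moll = mollified_perturbation[OF wg l tr \<tau> small(1) small2]
  have F\<tau>: "F\<tau> n = (\<lambda>x. x + \<kappa> *\<^sub>R mollify (\<tau> n) v x)" for n
    by (auto simp: F\<tau>_def)
  have lv: "locally_integrable v" using wg by (simp add: weak_gradient_def)
  have \<tau>0: "filterlim \<tau> (at_right 0) sequentially"
    unfolding \<tau>_def by (intro tendsto_imp_filterlim_at_right LIMSEQ_inverse_real_of_nat) auto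
  have lim: "(\<lambda>n. F\<tau> n x) \<longlonglongrightarrow> F x" for x
    unfolding F\<tau>_def F_def
    by (intro tendsto_intros filterlim_compose[OF mollify_tendsto_continuous[OF v lv] \<tau>0])
  show contF: "continuous_on UNIV F"
    unfolding F_def by (intro continuous_intros v)
  have contF\<tau>: "continuous_on UNIV (F\<tau> n)" for n
    unfolding F\<tau> by (rule moll(2))
  have [measurable]: "F\<tau> n \<in> borel_measurable borel" "F \<in> borel_measurable borel" for n
    using contF contF\<tau> by (auto intro: borel_measurable_continuous_onI)
  have contr: "norm (\<kappa> *\<^sub>R v x - \<kappa> *\<^sub>R v y) \<le> 1 / 2 * norm (x - y)" for x y
  proof (rule LIMSEQ_le_const2)
    show "(\<lambda>n. norm (\<kappa> *\<^sub>R mollify (\<tau> n) v x - \<kappa> *\<^sub>R mollify (\<tau> n) v y)) \<longlonglongrightarrow> norm (\<kappa> *\<^sub>R v x - \<kappa> *\<^sub>R v y)"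
      by (intro tendsto_intros filterlim_compose[OF mollify_tendsto_continuous[OF v lv] \<tau>0])
  qed (use moll(1) in auto)
  show bij: "bij F"
    unfolding F_def by (rule contraction_perturbation_bij[OF contr])
  show continv: "continuous_on UNIV (inv F)"
    unfolding F_def by (rule contraction_perturbation_inv[OF contr])
  have bij\<tau>: "bij (F\<tau> n)" for n
    unfolding F\<tau> by (rule contraction_perturbation_bij[OF moll(1)])
  have continv\<tau>: "continuous_on UNIV (inv (F\<tau> n))" for n
    unfolding F\<tau> by (rule contraction_perturbation_inv[OF moll(1)])
  show "emeasure lborel (F -` A) \<le> ennreal (1 / (1 - ?q)) * emeasure lborel A"
  proof (rule emeasure_vimage_limit[OF lim A])
    have "emeasure lborel (F\<tau> n -` A) \<le> ennreal (1 / (1 - ?q)) * emeasure lborel A" for n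
    proof -
      have "emeasure lborel (F\<tau> n -` A) = ennreal (1 / (1 - ?q)) * (ennreal (1 - ?q) * emeasure lborel (F\<tau> n -` A))"
        using small by (simp add: mult.assoc[symmetric] ennreal_mult[symmetric])
      also have "\<dots> \<le> ennreal (1 / (1 - ?q)) * emeasure lborel A"
        unfolding F\<tau> by (intro mult_left_mono moll(3) A) simp
      finally show ?thesis .
    qed
    then show "\<forall>\<^sub>F n in sequentially. emeasure lborel (F\<tau> n -` A) \<le> ennreal (1 / (1 - ?q)) * emeasure lborel A"
      by simp
  qed auto
  show "emeasure lborel (inv F -` A) \<le> ennreal (1 + ?q) * emeasure lborel A"
  proof (rule emeasure_vimage_limit[OF _ A])
    show "(\<lambda>n. inv (F\<tau> n) y) \<longlonglongrightarrow> inv F y" for y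
    proof (rule LIM_zero_cancel, rule Lim_null_comparison)
      have "norm (inv (F\<tau> n) y - inv F y) \<le> 2 * norm (y - F\<tau> n (inv F y))" for n
      proof -
        have "norm (a - b) \<le> 2 * norm (F\<tau> n a - F\<tau> n b)" for a b
          unfolding F\<tau>_def by (rule contraction_perturbation_expand[OF moll(1)])
        from this[of "inv (F\<tau> n) y" "inv F y"] show ?thesis
          by (simp only: surj_f_inv_f[OF bij_is_surj[OF bij\<tau>[of n]]])
      qed
      then show "\<forall>\<^sub>F n in sequentially. norm (inv (F\<tau> n) y - inv F y) \<le> 2 * norm (y - F\<tau> n (inv F y))"
        by simp
      have "(\<lambda>n. 2 * norm (y - F\<tau> n (inv F y))) \<longlonglongrightarrow> 2 * norm (y - F (inv F y))"
        by (intro tendsto_intros lim)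
      then show "(\<lambda>n. 2 * norm (y - F\<tau> n (inv F y))) \<longlonglongrightarrow> 0"
        by (simp add: surj_f_inv_f[OF bij_is_surj[OF bij]])
    qed
    show "\<forall>\<^sub>F n in sequentially. emeasure lborel (inv (F\<tau> n) -` A) \<le> ennreal (1 + ?q) * emeasure lborel A"
      unfolding vimage_inv_bij[OF bij\<tau>] using moll(4)[OF A] by (simp add: F\<tau>)
  qed (use continv continv\<tau> in \<open>auto intro: borel_measurable_continuous_onI\<close>)
qed

section \<open>Compressible maps\<close>

text \<open>Tested on open sets only, as in the definition of a regular Lagrangian flow; outer
  regularity extends the bound to Borel sets in \<open>compressible_borel\<close>.\<close>

definition compressible :: "real \<Rightarrow> ('a::euclidean_space \<Rightarrow> 'a) \<Rightarrow> bool" where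
  "compressible L F \<longleftrightarrow> F \<in> borel_measurable borel \<and>
     (\<forall>A. open A \<longrightarrow> emeasure lborel (F -` A) \<le> ennreal L * emeasure lborel A)"

lemma compressible_measurable: "compressible L F \<Longrightarrow> F \<in> borel_measurable borel"
  by (simp add: compressible_def)

lemma compressible_borel:
  assumes F: "compressible L F" and A: "A \<in> sets borel" and L: "L \<ge> 0"
  shows "emeasure lborel (F -` A) \<le> ennreal L * emeasure lborel A"
proof (rule ennreal_le_epsilon)
  fix e :: real assume e: "e > 0"
  define d where "d = e / (L + 1)"
  have d: "d > 0" using e L by (simp add: d_def)
  obtain U where U: "open U" "A \<subseteq> U" "emeasure lborel (U - A) < ennreal d"
    using outer_regular_lborel[OF A d] by blast
  have m: "F -` U \<in> sets borel"
    using measurable_sets[OF compressible_measurable[OF F], of U] U(1) by simp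
  have "emeasure lborel (F -` A) \<le> emeasure lborel (F -` U)"
    using U(2) m by (intro emeasure_mono) auto
  also have "\<dots> \<le> ennreal L * emeasure lborel U"
    using F U(1) by (auto simp: compressible_def)
  also have "emeasure lborel U = emeasure lborel A + emeasure lborel (U - A)"
    using U(1,2) A by (subst plus_emeasure) (auto intro!: arg_cong[of _ _ "emeasure lborel"])
  also have "ennreal L * \<dots> \<le> ennreal L * (emeasure lborel A + ennreal d)"
    using U(3) by (intro mult_left_mono add_left_mono) auto
  also have "\<dots> = ennreal L * emeasure lborel A + ennreal (L * d)"
    using L d by (simp add: distrib_left ennreal_mult)
  also have "\<dots> \<le> ennreal L * emeasure lborel A + ennreal e"
  proof (intro add_left_mono ennreal_leI)
    have "L * d \<le> (L + 1) * d" using d by simp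
    also have "\<dots> = e" using L by (simp add: d_def)
    finally show "L * d \<le> e" .
  qed
  finally show "emeasure lborel (F -` A) \<le> ennreal L * emeasure lborel A + ennreal e" .
qed

lemma compressible_nn_integral:
  assumes F: "compressible L F" and f[measurable]: "f \<in> borel_measurable borel" and L: "L \<ge> 0"
  shows "(\<integral>\<^sup>+x. f (F x) \<partial>lborel) \<le> ennreal L * (\<integral>\<^sup>+x. f x \<partial>lborel)"
proof -
  have [measurable]: "F \<in> borel_measurable borel" by (rule compressible_measurable[OF F])
  have "(\<integral>\<^sup>+x. f (F x) \<partial>lborel) = (\<integral>\<^sup>+x. f x \<partial>distr lborel borel F)"
    by (subst nn_integral_distr) auto
  also have "\<dots> \<le> (\<integral>\<^sup>+x. f x \<partial>scale_measure (ennreal L) lborel)"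
  proof (rule nn_integral_mono_measure)
    show "distr lborel borel F \<le> scale_measure (ennreal L) lborel"
      by (subst le_measure) (auto simp: emeasure_distr compressible_borel[OF F _ L])
  qed simp
  also have "\<dots> = ennreal L * (\<integral>\<^sup>+x. f x \<partial>lborel)"
    by (rule nn_integral_scale_measure) simp
  finally show ?thesis .
qed

lemma compressible_compose:
  assumes "compressible L F" "compressible K G" "L \<ge> 0" "K \<ge> 0"
  shows "compressible (L * K) (\<lambda>x. G (F x))"
  unfolding compressible_def
proof safe
  have [measurable]: "F \<in> borel_measurable borel" "G \<in> borel_measurable borel"
    using assms compressible_measurable by auto
  show "(\<lambda>x. G (F x)) \<in> borel_measurable borel" by measurable
  fix A :: "'a set" assume A: "open A"
  then have "G -` A \<in> sets borel"
    using measurable_sets[of G borel borel A] by simp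
  then have "emeasure lborel (F -` (G -` A)) \<le> ennreal L * emeasure lborel (G -` A)"
    by (intro compressible_borel assms)
  also have "\<dots> \<le> ennreal L * (ennreal K * emeasure lborel A)"
    using assms(2) A by (intro mult_left_mono) (auto simp: compressible_def)
  also have "\<dots> = ennreal (L * K) * emeasure lborel A"
    using assms by (simp add: ennreal_mult mult.assoc)
  finally show "emeasure lborel ((\<lambda>x. G (F x)) -` A) \<le> ennreal (L * K) * emeasure lborel A"
    by (simp add: vimage_def)
qed

lemma compressible_id: "compressible 1 (\<lambda>x. x)"
  by (simp add: compressible_def)

lemma compressible_mono: "compressible L F \<Longrightarrow> L \<le> L' \<Longrightarrow> compressible L' F"
  unfolding compressible_def by (meson ennreal_leI mult_right_mono order_trans zero_le)

lemma compressible_AE: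
  assumes F: "compressible L F" and L: "L \<ge> 0" and P: "AE x in lborel. P x"
  shows "AE x in lborel. P (F x)"
proof -
  obtain N where N: "{x. \<not> P x} \<subseteq> N" "N \<in> sets borel" "emeasure lborel N = 0"
    using P by (auto elim!: AE_E)
  have m: "F -` N \<in> sets borel"
    using measurable_sets[OF compressible_measurable[OF F] N(2)] by simp
  have "emeasure lborel (F -` N) \<le> ennreal L * emeasure lborel N"
    by (rule compressible_borel[OF F N(2) L])
  then have "emeasure lborel (F -` N) = 0"
    using N(3) by simp
  then have "F -` N \<in> null_sets lborel"
    using m by (auto intro: null_setsI)
  then have "AE x in lborel. x \<notin> F -` N"
    by (rule AE_not_in)
  then show ?thesis
    by eventually_elim (use N(1) in auto)
qed

definition maximal_const :: "'a::euclidean_space itself \<Rightarrow> real \<Rightarrow> real \<Rightarrow> real" where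
  "maximal_const _ p L = 2 * L * weak_type_const TYPE('a) p / (1 - 2 powr (1 - p))"

lemma weak_type_const_nonneg: "weak_type_const TYPE('a::euclidean_space) p \<ge> 0"
  by (simp add: weak_type_const_def)

text \<open>The superlevel sets of the maximal function are open, so compressibility transfers its
  weak type bound to the composition, and dyadic summation integrates it. Using
  \<open>\<kappa>\<close> itself as the lowest level makes the bound linear in
  \<open>\<kappa>\<close>; this matters because \<open>\<kappa>\<close> will depend on time and is
  merely integrable.\<close>

lemma maximal_compressible:
  fixes g :: "'a::euclidean_space \<Rightarrow> real"
  assumes F: "compressible L F" and L: "L \<ge> 0" and p: "p > 1" and \<kappa>: "\<kappa> > 0"
    and [measurable]: "g \<in> borel_measurable borel" and g0: "\<And>x. g x \<ge> 0"
    and gp: "(\<integral>\<^sup>+x. ennreal (g x powr p) \<partial>lborel) \<le> ennreal (\<kappa> powr p)"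
    and [measurable]: "E \<in> sets borel"
  shows "(\<integral>\<^sup>+x. maximal (\<lambda>x. ennreal (g x)) (F x) * indicator E x \<partial>lborel)
    \<le> ennreal \<kappa> * (emeasure lborel E + ennreal (maximal_const TYPE('a) p L))"
proof -
  let ?W = "weak_type_const TYPE('a) p"
  have W: "?W \<ge> 0" by (rule weak_type_const_nonneg)
  have [measurable]: "F \<in> borel_measurable borel" by (rule compressible_measurable[OF F])
  have "(\<integral>\<^sup>+x. maximal (\<lambda>x. ennreal (g x)) (F x) * indicator E x \<partial>lborel)
      \<le> ennreal \<kappa> * emeasure lborel E + ennreal (2 * \<kappa> * (L * ?W) / (1 - 2 powr (1 - p)))"
  proof (rule nn_integral_le_of_weak_type[OF _ _ p \<kappa>])
    fix s :: real assume s: "s \<ge> 1"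
    let ?A = "{y. ennreal (s * \<kappa>) < maximal (\<lambda>x. ennreal (g x)) y}"
    have "emeasure lborel {x \<in> space lborel. ennreal (s * \<kappa>) < maximal (\<lambda>x. ennreal (g x)) (F x)}
        = emeasure lborel (F -` ?A)"
      by (simp add: vimage_def)
    also have "\<dots> \<le> ennreal L * emeasure lborel ?A"
      using F open_maximal_gt[of "\<lambda>x. ennreal (g x)" "ennreal (s * \<kappa>)"] by (auto simp: compressible_def)
    also have "\<dots> \<le> ennreal L * (ennreal (?W / (s * \<kappa>) powr p) * ennreal (\<kappa> powr p))"
    proof (rule mult_left_mono)
      have "emeasure lborel ?A \<le> ennreal (?W / (s * \<kappa>) powr p) * (\<integral>\<^sup>+x. ennreal (g x powr p) \<partial>lborel)"
        using s \<kappa> by (intro maximal_weak_type g0 p) auto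
      also have "\<dots> \<le> ennreal (?W / (s * \<kappa>) powr p) * ennreal (\<kappa> powr p)"
        by (intro mult_left_mono gp) simp
      finally show "emeasure lborel ?A \<le> ennreal (?W / (s * \<kappa>) powr p) * ennreal (\<kappa> powr p)" .
    qed simp
    also have "\<dots> = ennreal (L * ?W / s powr p)"
      using L W s \<kappa> by (simp add: ennreal_mult[symmetric] powr_mult)
    finally show "emeasure lborel {x \<in> space lborel. ennreal (s * \<kappa>) < maximal (\<lambda>x. ennreal (g x)) (F x)}
        \<le> ennreal (L * ?W / s powr p)" .
  qed (use L W in auto)
  also have "2 * \<kappa> * (L * ?W) / (1 - 2 powr (1 - p)) = \<kappa> * maximal_const TYPE('a) p L"
    by (simp add: maximal_const_def)
  also have "ennreal \<kappa> * emeasure lborel E + ennreal (\<kappa> * maximal_const TYPE('a) p L)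
      = ennreal \<kappa> * (emeasure lborel E + ennreal (maximal_const TYPE('a) p L))"
    using \<kappa> by (simp add: distrib_left ennreal_mult')
  finally show ?thesis .
qed

section \<open>One-dimensional calculus\<close>

text \<open>A logarithmic growth bound for a path that is not assumed differentiable. On an interval
  so short that \<open>\<delta> + norm (D s)\<close> is constant up to a ratio \<open>c > 1\<close>,
  the increment of its logarithm is bounded by \<open>c\<close> times the integral. Bolzano's
  bisection principle adds such intervals up, and then \<open>c\<close> tends to 1.\<close>

lemma log_growth:
  fixes D :: "real \<Rightarrow> 'b::real_normed_vector"
  assumes \<delta>: "\<delta> > 0" and contD: "continuous_on {0..T} D" and D0: "D 0 = 0"
    and Q[measurable]: "Q \<in> borel_measurable borel" and Q0: "\<And>s. Q s \<ge> 0"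
    and incr: "\<And>a b. 0 \<le> a \<Longrightarrow> a \<le> b \<Longrightarrow> b \<le> T \<Longrightarrow>
      ennreal (norm (D b - D a)) \<le> (\<integral>\<^sup>+s. indicator {a<..b} s * ennreal (Q s) \<partial>lborel)"
    and t: "0 \<le> t" "t \<le> T"
  shows "ennreal (ln (1 + norm (D t) / \<delta>)) \<le> (\<integral>\<^sup>+s. indicator {0<..t} s * ennreal (Q s / (\<delta> + norm (D s))) \<partial>lborel)"
proof -
  \<comment> \<open>Continuity of \<open>D\<close> is known on \<open>{0..T}\<close> only; the
    extension by 0 is Borel on the whole line.\<close>
  define N where "N s = (if s \<in> {0..T} then norm (D s) else 0)" for s
  have N0: "N s \<ge> 0" for s by (simp add: N_def)
  have [measurable]: "N \<in> borel_measurable borel"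
    unfolding N_def by (intro borel_measurable_continuous_on_if continuous_intros contD) auto
  define \<phi> where "\<phi> s = ln (\<delta> + norm (D s))" for s
  define I where "I a b = (\<integral>\<^sup>+s. indicator {a<..b} s * ennreal (Q s / (\<delta> + N s)) \<partial>lborel)" for a b
  have I_add: "I a b + I b c = I a c" if "a \<le> b" "b \<le> c" for a b c
  proof -
    have "I a b + I b c = (\<integral>\<^sup>+s. indicator {a<..b} s * ennreal (Q s / (\<delta> + N s)) + indicator {b<..c} s * ennreal (Q s / (\<delta> + N s)) \<partial>lborel)"
      unfolding I_def by (rule nn_integral_add[symmetric]) measurable
    also have "\<dots> = I a c"
      unfolding I_def using that by (intro nn_integral_cong) (auto simp: indicator_def)
    finally show ?thesis .
  qed
  have main: "ennreal (\<phi> t - \<phi> 0) \<le> ennreal c * I 0 t" if c: "c > 1" for c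
  proof -
    define P where "P a b \<longleftrightarrow> (0 \<le> a \<and> a \<le> b \<and> b \<le> T \<longrightarrow> ennreal (\<phi> b - \<phi> a) \<le> ennreal c * I a b)" for a b
    have "P 0 t"
    proof (rule Bolzano[OF t(1), of P])
      fix a b d assume P: "P a b" "P b d" and le: "a \<le> b" "b \<le> d"
      show "P a d"
        unfolding P_def
      proof
        assume *: "0 \<le> a \<and> a \<le> d \<and> d \<le> T"
        have "ennreal (\<phi> d - \<phi> a) = ennreal ((\<phi> b - \<phi> a) + (\<phi> d - \<phi> b))" by simp
        also have "\<dots> \<le> ennreal (\<phi> b - \<phi> a) + ennreal (\<phi> d - \<phi> b)"
        proof -
          have "ennreal (x + y) \<le> ennreal x + ennreal y" for x y
          proof (cases "x \<ge> 0 \<and> y \<ge> 0")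
            case False
            then have "x + y \<le> max x 0 + max y 0" by auto
            then have "ennreal (x + y) \<le> ennreal (max x 0) + ennreal (max y 0)"
              by (simp add: ennreal_plus[symmetric] ennreal_leI del: ennreal_plus)
            moreover have "ennreal (max z 0) = ennreal z" for z
              by (simp add: max_def ennreal_neg)
            ultimately show ?thesis by simp
          qed simp
          then show ?thesis .
        qed
        also have "\<dots> \<le> ennreal c * I a b + ennreal c * I b d"
          using P le * unfolding P_def by (intro add_mono) auto
        also have "\<dots> = ennreal c * I a d"
          using I_add[OF le] by (simp add: distrib_left[symmetric])
        finally show "ennreal (\<phi> d - \<phi> a) \<le> ennreal c * I a d" .
      qed
    next
      fix x assume x: "0 \<le> x" "x \<le> t"
      define m where "m = \<delta> + norm (D x)"
      have m: "m > 0" using \<delta> by (simp add: m_def add_pos_nonneg)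
      \<comment> \<open>This choice makes the ratio of \<open>m + e\<close> to \<open>m - e\<close>
        exactly \<open>c\<close>.\<close>
      define e where "e = m * (c - 1) / (c + 1)"
      have e: "0 < e" "e < m" "m + e \<le> c * (m - e)"
        using c m by (auto simp: e_def field_simps)
      have "x \<in> {0..T}" using x t by auto
      then obtain d where d: "d > 0" "\<And>y. y \<in> {0..T} \<Longrightarrow> dist y x < d \<Longrightarrow> dist (D y) (D x) < e"
        using contD e(1) unfolding continuous_on_iff by blast
      show "\<exists>d>0. \<forall>a b. a \<le> x \<and> x \<le> b \<and> b - a < d \<longrightarrow> P a b"
      proof (intro exI[of _ d] conjI d allI impI)
        fix a b assume ab: "a \<le> x \<and> x \<le> b \<and> b - a < d"
        show "P a b" unfolding P_def
        proof
          assume *: "0 \<le> a \<and> a \<le> b \<and> b \<le> T"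
          have close: "m - e \<le> \<delta> + norm (D s)" "\<delta> + norm (D s) \<le> m + e" if "a \<le> s" "s \<le> b" for s
          proof -
            have "norm (D s - D x) < e"
              using d(2)[of s] that ab * by (auto simp: dist_norm)
            then show "m - e \<le> \<delta> + norm (D s)" "\<delta> + norm (D s) \<le> m + e"
              using norm_triangle_ineq3[of "D s" "D x"] unfolding m_def by auto
          qed
          have "\<phi> b - \<phi> a \<le> norm (D b - D a) / (m - e)"
          proof -
            have pos: "\<delta> + norm (D s) > 0" for s using \<delta> by (simp add: add_pos_nonneg)
            have "\<phi> b - \<phi> a = ln ((\<delta> + norm (D b)) / (\<delta> + norm (D a)))"
              unfolding \<phi>_def using pos[of a] pos[of b] by (simp add: ln_div less_imp_neq[THEN not_sym])
            also have "\<dots> \<le> (\<delta> + norm (D b)) / (\<delta> + norm (D a)) - 1"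
              using pos by (intro ln_le_minus_one) simp
            also have "\<dots> = (norm (D b) - norm (D a)) / (\<delta> + norm (D a))"
            proof -
              have "\<delta> + norm (D a) \<noteq> 0" using pos[of a] by simp
              then show ?thesis by (simp add: field_simps)
            qed
            also have "\<dots> \<le> norm (D b - D a) / (\<delta> + norm (D a))"
              using pos[of a] norm_triangle_ineq2[of "D b" "D a"] by (intro divide_right_mono) auto
            also have "\<dots> \<le> norm (D b - D a) / (m - e)"
              using close(1)[of a] * e by (intro divide_left_mono mult_pos_pos) auto
            finally show ?thesis .
          qed
          then have "ennreal (\<phi> b - \<phi> a) \<le> ennreal (1 / (m - e)) * ennreal (norm (D b - D a))"
            using e by (subst ennreal_mult[symmetric]) (auto intro: ennreal_leI)
          also have "\<dots> \<le> ennreal (1 / (m - e)) * (\<integral>\<^sup>+s. indicator {a<..b} s * ennreal (Q s) \<partial>lborel)"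
            using * by (intro mult_left_mono incr) auto
          also have "\<dots> = (\<integral>\<^sup>+s. ennreal (1 / (m - e)) * (indicator {a<..b} s * ennreal (Q s)) \<partial>lborel)"
            by (rule nn_integral_cmult[symmetric]) measurable
          also have "\<dots> \<le> (\<integral>\<^sup>+s. ennreal c * (indicator {a<..b} s * ennreal (Q s / (\<delta> + N s))) \<partial>lborel)"
          proof (rule nn_integral_mono)
            fix s
            show "ennreal (1 / (m - e)) * (indicator {a<..b} s * ennreal (Q s)) \<le> ennreal c * (indicator {a<..b} s * ennreal (Q s / (\<delta> + N s)))"
            proof (cases "s \<in> {a<..b}")
              case True
              then have N: "N s = norm (D s)" using * by (auto simp: N_def)
              have "\<delta> + N s \<le> c * (m - e)"
                using close(2)[of s] True e(3) unfolding N by auto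
              moreover have "\<delta> + N s > 0" using \<delta> N0[of s] by linarith
              ultimately have "1 / (m - e) \<le> c / (\<delta> + N s)"
                using e by (simp add: field_simps)
              from mult_right_mono[OF this Q0[of s]]
              have "1 / (m - e) * Q s \<le> c * (Q s / (\<delta> + N s))" by simp
              moreover have "0 \<le> Q s / (\<delta> + N s)"
                using Q0 \<delta> N0[of s] by simp
              ultimately show ?thesis
                using True e c Q0[of s] by (simp add: ennreal_mult[symmetric] ennreal_leI)
            qed simp
          qed
          also have "\<dots> = ennreal c * I a b"
            unfolding I_def by (rule nn_integral_cmult) measurable
          finally show "ennreal (\<phi> b - \<phi> a) \<le> ennreal c * I a b" .
        qed
      qed
    qed
    then show ?thesis using t by (simp add: P_def)
  qed
  have "ennreal (\<phi> t - \<phi> 0) \<le> I 0 t"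
  proof (cases "I 0 t")
    case (real r)
    have "\<phi> t - \<phi> 0 \<le> r"
    proof (rule field_le_mult_one_interval)
      fix z :: real assume z: "0 < z" "z < 1"
      have "ennreal (\<phi> t - \<phi> 0) \<le> ennreal ((1 / z) * r)"
        using main[of "1 / z"] z real by (simp add: ennreal_mult[symmetric])
      then have "\<phi> t - \<phi> 0 \<le> (1 / z) * r"
        using z real by (simp add: ennreal_le_iff)
      then show "z * (\<phi> t - \<phi> 0) \<le> r"
        using z by (simp add: field_simps)
    qed
    then show ?thesis using real by (simp add: ennreal_leI)
  qed simp
  moreover have "\<phi> t - \<phi> 0 = ln (1 + norm (D t) / \<delta>)"
  proof -
    have "1 + norm (D t) / \<delta> = (\<delta> + norm (D t)) / \<delta>"
      using \<delta> by (simp add: field_simps)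
    moreover have "\<delta> + norm (D t) > 0"
      using \<delta> by (rule add_pos_nonneg) simp
    ultimately show ?thesis
      using \<delta> by (simp add: \<phi>_def D0 ln_div less_imp_neq[THEN not_sym])
  qed
  moreover have "I 0 t = (\<integral>\<^sup>+s. indicator {0<..t} s * ennreal (Q s / (\<delta> + norm (D s))) \<partial>lborel)"
    unfolding I_def N_def using t by (intro nn_integral_cong) (auto simp: indicator_def)
  ultimately show ?thesis by simp
qed

text \<open>The fundamental theorem in gauge form. At tags where the derivative exists, the gauge
  makes the increment close to the derivative times the length. The cells of the remaining tags lie
  in an open set of small measure, where absolute continuity makes the sum of the increments
  small.\<close>

lemma abs_continuous_has_integral:
  fixes f :: "real \<Rightarrow> 'b::euclidean_space"
  assumes ac: "abs_continuous_on_interval 0 T f"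
    and der: "AE s in lebesgue_on {0<..<T}. (f has_vector_derivative g s) (at s)"
    and t: "0 \<le> t" "t \<le> T"
  shows "(g has_integral f t - f 0) {0..t}"
proof -
  have "AE s in lebesgue. s \<in> {0<..<T} \<longrightarrow> (f has_vector_derivative g s) (at s)"
    using der by (subst (asm) AE_restrict_space_iff) auto
  then obtain N0 where N0: "{s. \<not> (s \<in> {0<..<T} \<longrightarrow> (f has_vector_derivative g s) (at s))} \<subseteq> N0" "N0 \<in> null_sets lebesgue"
    by (auto elim!: AE_E simp: null_sets_def)
  \<comment> \<open>The end points join the exceptional set, since differentiability is given in the
    open interval only.\<close>
  define N where "N = N0 \<union> {0, T}"
  have "{0, T} \<in> null_sets lebesgue"
    by (simp add: negligible_iff_null_sets[symmetric])
  then have N: "N \<in> null_sets lebesgue"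
    using N0(2) unfolding N_def by (rule null_sets.Un[rotated])
  have der': "(f has_vector_derivative g s) (at s)" if "0 \<le> s" "s \<le> T" "s \<notin> N" for s
    using that N0(1) by (auto simp: N_def less_le)
  \<comment> \<open>Setting the integrand to 0 on \<open>N\<close> leaves only the increments of
    \<open>f\<close> at tags in \<open>N\<close>; the value is changed back by a negligible spike at
    the end.\<close>
  define g' where "g' s = (if s \<in> N then 0 else g s)" for s
  have "(g' has_integral f t - f 0) {0..t}"
    unfolding has_integral_real
  proof (intro allI impI)
    fix e :: real assume e: "e > 0"
    have e2: "e / 2 > 0" using e by simp
    have "\<exists>d>0. (\<forall>(n::nat) l u. (\<forall>i<n. 0 \<le> l i \<and> l i \<le> u i \<and> u i \<le> T) \<and>
        (\<forall>i<n. \<forall>j<n. i \<noteq> j \<longrightarrow> {l i<..<u i} \<inter> {l j<..<u j} = {}) \<and> (\<Sum>i<n. u i - l i) < d \<longrightarrow>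
        (\<Sum>i<n. dist (f (u i)) (f (l i))) < e / 2)"
      by (rule mp[OF spec[OF ac[unfolded abs_continuous_on_interval_def], of "e / 2"] e2])
    then obtain d where d_ac: "d > 0 \<and> (\<forall>(n::nat) l u. (\<forall>i<n. 0 \<le> l i \<and> l i \<le> u i \<and> u i \<le> T) \<and>
        (\<forall>i<n. \<forall>j<n. i \<noteq> j \<longrightarrow> {l i<..<u i} \<inter> {l j<..<u j} = {}) \<and> (\<Sum>i<n. u i - l i) < d \<longrightarrow>
        (\<Sum>i<n. dist (f (u i)) (f (l i))) < e / 2)"
      by (rule exE)
    note d = conjunct1[OF d_ac] mp[OF spec[OF spec[OF spec[OF conjunct2[OF d_ac]]]] conjI[OF _ conjI]]
    obtain U where U: "open U" "N \<subseteq> U" "emeasure lebesgue (U - N) < ennreal d"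
      using sets_lebesgue_outer_open[OF null_setsD2[OF N] d(1)] by (metis (no_types))
    have emU: "emeasure lebesgue U < ennreal d"
    proof -
      have "emeasure lebesgue U = emeasure lebesgue (U - N)"
        using emeasure_Diff_null_set[OF N, of U] U(1) by simp
      then show ?thesis using U(3) by simp
    qed
    define e' where "e' = e / (2 * (t + 1))"
    have e': "e' > 0" "e' * t < e / 2"
      using e t by (auto simp: e'_def field_simps)
    have "\<exists>\<rho>>0. (s \<in> N \<longrightarrow> ball s \<rho> \<subseteq> U) \<and> (0 \<le> s \<and> s \<le> T \<and> s \<notin> N \<longrightarrow>
        (\<forall>y. norm (y - s) < \<rho> \<longrightarrow> norm (f y - f s - (y - s) *\<^sub>R g s) \<le> e' * norm (y - s)))" for s
    proof (cases "s \<in> N")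
      case True
      then show ?thesis using U(1,2) by (auto simp: open_contains_ball)
    next
      case False
      show ?thesis
      proof (cases "0 \<le> s \<and> s \<le> T")
        case True
        then have "(f has_derivative (\<lambda>h. h *\<^sub>R g s)) (at s)"
          using der' False by (simp add: has_vector_derivative_def)
        then show ?thesis
          using False e'(1) by (auto simp: has_derivative_at_alt)
      qed (use False in \<open>auto intro: exI[of _ 1]\<close>)
    qed
    then obtain \<rho> where \<rho>: "\<And>s. \<rho> s > 0" "\<And>s. s \<in> N \<Longrightarrow> ball s (\<rho> s) \<subseteq> U"
      "\<And>s y. 0 \<le> s \<Longrightarrow> s \<le> T \<Longrightarrow> s \<notin> N \<Longrightarrow> norm (y - s) < \<rho> s \<Longrightarrow> norm (f y - f s - (y - s) *\<^sub>R g s) \<le> e' * norm (y - s)"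
      by metis
    show "\<exists>\<gamma>. gauge \<gamma> \<and> (\<forall>\<D>. \<D> tagged_division_of {0..t} \<and> \<gamma> fine \<D> \<longrightarrow>
        norm ((\<Sum>(x, K)\<in>\<D>. measure lborel K *\<^sub>R g' x) - (f t - f 0)) < e)"
    proof (intro exI[of _ "\<lambda>s. ball s (\<rho> s)"] conjI allI impI)
      show "gauge (\<lambda>s. ball s (\<rho> s))"
        using \<rho>(1) by (simp add: gauge_def)
      fix \<D> assume "\<D> tagged_division_of {0..t} \<and> (\<lambda>s. ball s (\<rho> s)) fine \<D>"
      then have tag: "\<D> tagged_division_of {0..t}" and fine: "(\<lambda>s. ball s (\<rho> s)) fine \<D>" by auto
      note tagD = tagged_division_ofD[OF tag]
      have finD: "finite \<D>" by (rule tagD(1))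
      define lo where "lo xK = Inf (snd xK)" for xK :: "real \<times> real set"
      define hi where "hi xK = Sup (snd xK)" for xK :: "real \<times> real set"
      have K: "snd xK = {lo xK..hi xK}" "lo xK \<le> fst xK" "fst xK \<le> hi xK" "0 \<le> lo xK" "hi xK \<le> t"
        "snd xK \<subseteq> ball (fst xK) (\<rho> (fst xK))" if xKD: "xK \<in> \<D>" for xK
      proof -
        obtain x K where xK: "xK = (x, K)" by (cases xK)
        obtain a b where ab: "K = {a..b}" using tagD(4)[of x K] xKD xK by auto
        have x: "x \<in> {a..b}" using tagD(2)[of x K] xKD xK ab by auto
        have sub: "{a..b} \<subseteq> {0..t}" using tagD(3)[of x K] xKD xK ab by auto
        show "snd xK = {lo xK..hi xK}" "lo xK \<le> fst xK" "fst xK \<le> hi xK" "0 \<le> lo xK" "hi xK \<le> t"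
          using x sub by (auto simp: lo_def hi_def xK ab)
        show "snd xK \<subseteq> ball (fst xK) (\<rho> (fst xK))"
          using fine xKD xK by (auto simp: fine_def)
      qed
      have content: "measure lborel (snd xK) = hi xK - lo xK" if "xK \<in> \<D>" for xK
        using K[OF that] by simp
      have tele: "(\<Sum>xK\<in>\<D>. f (hi xK) - f (lo xK)) = f t - f 0"
        using additive_tagged_division_1[OF t(1) tag, of f] by (simp add: lo_def hi_def case_prod_beta)
      have len: "(\<Sum>xK\<in>\<D>. hi xK - lo xK) = t"
        using additive_tagged_division_1[OF t(1) tag, of "\<lambda>x. x"] by (simp add: lo_def hi_def case_prod_beta)
      let ?A = "{xK \<in> \<D>. fst xK \<in> N}"
      let ?B = "{xK \<in> \<D>. fst xK \<notin> N}"
      have "(\<Sum>(x, K)\<in>\<D>. measure lborel K *\<^sub>R g' x) - (f t - f 0)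
          = (\<Sum>xK\<in>\<D>. (hi xK - lo xK) *\<^sub>R g' (fst xK) - (f (hi xK) - f (lo xK)))"
        unfolding tele[symmetric] sum_subtractf[symmetric]
        by (intro sum.cong) (auto simp: content case_prod_beta)
      also have "\<dots> = (\<Sum>xK\<in>?A. (hi xK - lo xK) *\<^sub>R g' (fst xK) - (f (hi xK) - f (lo xK)))
          + (\<Sum>xK\<in>?B. (hi xK - lo xK) *\<^sub>R g' (fst xK) - (f (hi xK) - f (lo xK)))"
        using finD by (subst sum.union_disjoint[symmetric]) (auto intro!: sum.cong)
      finally have "norm ((\<Sum>(x, K)\<in>\<D>. measure lborel K *\<^sub>R g' x) - (f t - f 0)) \<le> norm (\<Sum>xK\<in>?A. (hi xK - lo xK) *\<^sub>R g' (fst xK) - (f (hi xK) - f (lo xK)))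
          + norm (\<Sum>xK\<in>?B. (hi xK - lo xK) *\<^sub>R g' (fst xK) - (f (hi xK) - f (lo xK)))"
        by (simp only: norm_triangle_ineq)
      also have "\<dots> \<le> (\<Sum>xK\<in>?A. dist (f (hi xK)) (f (lo xK))) + (\<Sum>xK\<in>?B. e' * (hi xK - lo xK))"
      proof (intro add_mono sum_norm_le)
        fix xK assume "xK \<in> ?A"
        then show "norm ((hi xK - lo xK) *\<^sub>R g' (fst xK) - (f (hi xK) - f (lo xK))) \<le> dist (f (hi xK)) (f (lo xK))"
          by (simp add: g'_def dist_norm norm_minus_commute)
      next
        fix xK assume xK: "xK \<in> ?B"
        then have x: "0 \<le> fst xK" "fst xK \<le> T" "fst xK \<notin> N"
          using K[of xK] t by auto
        have mem: "hi xK \<in> snd xK" "lo xK \<in> snd xK"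
          using K[of xK] xK by auto
        then have "norm (hi xK - fst xK) < \<rho> (fst xK)" "norm (lo xK - fst xK) < \<rho> (fst xK)"
          using K(6)[of xK] xK by (auto simp: dist_norm norm_minus_commute)
        then have "norm (f (hi xK) - f (fst xK) - (hi xK - fst xK) *\<^sub>R g (fst xK)) \<le> e' * norm (hi xK - fst xK)"
          "norm (f (lo xK) - f (fst xK) - (lo xK - fst xK) *\<^sub>R g (fst xK)) \<le> e' * norm (lo xK - fst xK)"
          using \<rho>(3)[OF x] by auto
        moreover have "e' * norm (lo xK - fst xK) + e' * norm (hi xK - fst xK) = e' * (hi xK - lo xK)"
        proof -
          have "norm (lo xK - fst xK) + norm (hi xK - fst xK) = hi xK - lo xK"
            using K[of xK] xK by auto
          then show ?thesis by (simp only: distrib_left[symmetric])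
        qed
        moreover have "norm ((hi xK - lo xK) *\<^sub>R g' (fst xK) - (f (hi xK) - f (lo xK)))
            \<le> norm (f (lo xK) - f (fst xK) - (lo xK - fst xK) *\<^sub>R g (fst xK)) + norm (f (hi xK) - f (fst xK) - (hi xK - fst xK) *\<^sub>R g (fst xK))"
        proof -
          have "(hi xK - lo xK) *\<^sub>R g' (fst xK) - (f (hi xK) - f (lo xK))
            = (f (lo xK) - f (fst xK) - (lo xK - fst xK) *\<^sub>R g (fst xK)) - (f (hi xK) - f (fst xK) - (hi xK - fst xK) *\<^sub>R g (fst xK))"
            using x by (simp add: g'_def algebra_simps)
          then show ?thesis
            by (simp only: norm_triangle_ineq4)
        qed
        ultimately show "norm ((hi xK - lo xK) *\<^sub>R g' (fst xK) - (f (hi xK) - f (lo xK))) \<le> e' * (hi xK - lo xK)"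
          by linarith
      qed
      also have "(\<Sum>xK\<in>?B. e' * (hi xK - lo xK)) \<le> (\<Sum>xK\<in>\<D>. e' * (hi xK - lo xK))"
      proof (rule sum_mono2[OF finD])
        fix xK assume "xK \<in> \<D> - ?B"
        then have "xK \<in> \<D>" by blast
        from K(2,3)[OF this] e'(1) show "0 \<le> e' * (hi xK - lo xK)" by simp
      qed blast
      also have "\<dots> = e' * t"
        by (simp add: sum_distrib_left[symmetric] len)
      also have "(\<Sum>xK\<in>?A. dist (f (hi xK)) (f (lo xK))) < e / 2"
      proof -
        have finA: "finite ?A" using finD by simp
        obtain w n where w: "bij_betw w {..<n::nat} ?A"
          using ex_bij_betw_nat_finite[OF finA] by (auto simp: atLeast0LessThan)
        have wA: "w i \<in> ?A" if "i < n" for i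
          using w that by (auto simp: bij_betw_def)
        have disj: "{lo a<..<hi a} \<inter> {lo b<..<hi b} = {}" if "a \<in> \<D>" "b \<in> \<D>" "a \<noteq> b" for a b
        proof -
          have int: "interior (snd a) = {lo a<..<hi a}" if "a \<in> \<D>" for a
            by (subst K(1)[OF that]) (rule interior_atLeastAtMost_real)
          have "(fst a, snd a) \<in> \<D>" "(fst b, snd b) \<in> \<D>" "(fst a, snd a) \<noteq> (fst b, snd b)"
            using that by auto
          from tagD(5)[OF this] show ?thesis
            by (simp only: int[OF that(1)] int[OF that(2)])
        qed
        have "(\<Sum>i<n. dist (f (hi (w i))) (f (lo (w i)))) < e / 2"
        proof (rule d(2))
          show "\<forall>i<n. 0 \<le> lo (w i) \<and> lo (w i) \<le> hi (w i) \<and> hi (w i) \<le> T"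
          proof (intro allI impI)
            fix i assume "i < n"
            with wA have "w i \<in> \<D>" by blast
            from K(2-5)[OF this] t(2) show "0 \<le> lo (w i) \<and> lo (w i) \<le> hi (w i) \<and> hi (w i) \<le> T"
              by linarith
          qed
          show "\<forall>i<n. \<forall>j<n. i \<noteq> j \<longrightarrow> {lo (w i)<..<hi (w i)} \<inter> {lo (w j)<..<hi (w j)} = {}"
          proof (intro allI impI)
            fix i j assume ij: "i < n" "j < n" "i \<noteq> j"
            then have "w i \<noteq> w j"
              using w by (auto simp: bij_betw_def inj_on_def)
            then show "{lo (w i)<..<hi (w i)} \<inter> {lo (w j)<..<hi (w j)} = {}"
              using wA[OF ij(1)] wA[OF ij(2)] by (intro disj) auto
          qed
          have "(\<Sum>i<n. hi (w i) - lo (w i)) = (\<Sum>xK\<in>?A. hi xK - lo xK)"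
            by (rule sum.reindex_bij_betw[OF w])
          also have "ennreal \<dots> = (\<Sum>xK\<in>?A. emeasure lebesgue {lo xK<..<hi xK})"
          proof -
            have "lo xK \<le> hi xK" if "xK \<in> \<D>" for xK
              using K(2,3)[OF that] by linarith
            then show ?thesis
              by (subst sum_ennreal[symmetric]) (auto intro!: sum.cong)
          qed
          also have "\<dots> = emeasure lebesgue (\<Union>xK\<in>?A. {lo xK<..<hi xK})"
            using disj finA by (intro sum_emeasure) (auto simp: disjoint_family_on_def)
          also have "\<dots> \<le> emeasure lebesgue U"
          proof (rule emeasure_mono)
            show "(\<Union>xK\<in>?A. {lo xK<..<hi xK}) \<subseteq> U"
              using K(1,6) \<rho>(2) by fastforce
          qed (use U(1) in simp)
          also have "\<dots> < ennreal d" by (rule emU)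
          finally show "(\<Sum>i<n. hi (w i) - lo (w i)) < d"
            by (meson ennreal_leI leD leI)
        qed
        also have "(\<Sum>i<n. dist (f (hi (w i))) (f (lo (w i)))) = (\<Sum>xK\<in>?A. dist (f (hi xK)) (f (lo xK)))"
          by (rule sum.reindex_bij_betw[OF w])
        finally show ?thesis .
      qed
      finally show "norm ((\<Sum>(x, K)\<in>\<D>. measure lborel K *\<^sub>R g' x) - (f t - f 0)) < e"
        using e'(2) by linarith
    qed
  qed
  then show ?thesis
  proof (rule has_integral_spike[rotated 2])
    show "negligible N" using N by (simp add: negligible_iff_null_sets)
  qed (simp add: g'_def)
qed

section \<open>Borel representatives\<close>

lemma AE_time_iff: "(AE t in lebesgue_on {0<..<T::real}. P t) \<longleftrightarrow> (AE t in lborel. t \<in> {0<..<T} \<longrightarrow> P t)"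
  by (subst AE_restrict_space_iff) (auto simp: AE_completion_iff)

lemma space_time_set_borel[measurable]: "{0<..<T::real} \<times> (UNIV :: 'a::euclidean_space set) \<in> sets borel"
  by (intro borel_open open_Times) auto

lemma AE_lborel_pair:
  fixes P :: "(real \<times> 'a::euclidean_space) \<Rightarrow> bool"
  assumes "AE z in lborel. P z"
  shows "AE t in lborel. AE x in lborel. P (t, x)"
  using assms unfolding lborel_prod[symmetric] by (rule lborel_pair.AE_pair)

lemma AE_space_timeD:
  assumes "AE z in space_time T. P z"
  shows "AE t in lborel. t \<in> {0<..<T} \<longrightarrow> (AE x in lborel. P (t, x))"
proof -
  have "AE z in lebesgue. z \<in> {0<..<T} \<times> UNIV \<longrightarrow> P z"
    using assms unfolding space_time_def by (subst (asm) AE_restrict_space_iff) auto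
  then have "AE z in lborel. z \<in> {0<..<T} \<times> UNIV \<longrightarrow> P z"
    by (simp only: AE_completion_iff)
  from AE_lborel_pair[OF this] show ?thesis
    by eventually_elim auto
qed

lemma AE_lborel_swap:
  fixes P :: "real \<Rightarrow> 'a::euclidean_space \<Rightarrow> bool"
  assumes "{z. P (fst z) (snd z)} \<in> sets borel" "AE t in lborel. AE x in lborel. P t x"
  shows "AE x in lborel. AE t in lborel. P t x"
proof -
  have "{z \<in> space (lborel \<Otimes>\<^sub>M lborel). P (fst z) (snd z)} \<in> sets (lborel \<Otimes>\<^sub>M lborel)"
    using assms(1) by (simp only: lborel_prod space_lborel sets_lborel) simp
  from lborel_pair.AE_commute[OF this] assms(2) show ?thesis by simp
qed

lemma completion_ex_borel_euclidean:
  fixes f :: "'c::euclidean_space \<Rightarrow> 'b::euclidean_space"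
  assumes f: "f \<in> borel_measurable lebesgue"
  obtains f' where "f' \<in> borel_measurable borel" "AE x in lborel. f x = f' x"
proof -
  have "\<exists>g\<in>borel_measurable lborel. AE x in lborel. f x \<bullet> i = g x" for i
    using f by (intro completion_ex_borel_measurable_real borel_measurable_inner) auto
  then obtain g where g: "\<And>i. g i \<in> borel_measurable lborel" "\<And>i. AE x in lborel. f x \<bullet> i = g i x"
    by metis
  have "AE x in lborel. \<forall>i\<in>Basis. f x \<bullet> i = g i x"
    using g(2) by (intro AE_finite_allI) auto
  then have "AE x in lborel. f x = (\<Sum>i\<in>Basis. g i x *\<^sub>R i)"
  proof eventually_elim
    case (elim x)
    have "f x = (\<Sum>i\<in>Basis. (f x \<bullet> i) *\<^sub>R i)"
      by (simp add: euclidean_representation)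
    also have "\<dots> = (\<Sum>i\<in>Basis. g i x *\<^sub>R i)"
      using elim by (intro sum.cong) auto
    finally show ?case .
  qed
  moreover have "(\<lambda>x. \<Sum>i\<in>Basis. g i x *\<^sub>R i) \<in> borel_measurable borel"
    using g(1) by measurable
  ultimately show ?thesis by (rule that[rotated])
qed

text \<open>The exceptional set is a Borel null set of space-time and not merely an almost
  everywhere statement, so that it can be pulled back along trajectories.\<close>

lemma st_borel_representative:
  fixes f :: "real \<Rightarrow> 'a::euclidean_space \<Rightarrow> 'b::euclidean_space"
  assumes "st_measurable T f"
  obtains f' N where "joint_borel f'" "N \<in> sets borel" "emeasure lborel N = 0"
    "\<And>t x. t \<in> {0<..<T} \<Longrightarrow> (t, x) \<notin> N \<Longrightarrow> f t x = f' t x"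
proof -
  have "(\<lambda>z. if z \<in> {0<..<T} \<times> UNIV then (case z of (t, x) \<Rightarrow> f t x) else 0) \<in> borel_measurable lebesgue"
    using assms unfolding st_measurable_def space_time_def by (subst borel_measurable_if) auto
  then obtain F where F: "F \<in> borel_measurable borel"
    "AE z in lborel. (if z \<in> {0<..<T} \<times> UNIV then (case z of (t, x) \<Rightarrow> f t x) else 0) = F z"
    by (rule completion_ex_borel_euclidean)
  from AE_E[OF F(2)] obtain N where N: "{z \<in> space lborel. \<not> (if z \<in> {0<..<T} \<times> UNIV then (case z of (t, x) \<Rightarrow> f t x) else 0) = F z} \<subseteq> N"
    "emeasure lborel N = 0" "N \<in> sets lborel"
    by blast
  show ?thesis
  proof (rule that[of "\<lambda>t x. F (t, x)" N])
    show "(\<lambda>(t, x). F (t, x)) \<in> borel_measurable borel" using F(1) by simp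
    show "N \<in> sets borel" "emeasure lborel N = 0" using N by auto
    show "f t x = F (t, x)" if "t \<in> {0<..<T}" "(t, x) \<notin> N" for t x
    proof -
      have "(t, x) \<notin> {z \<in> space lborel. \<not> (if z \<in> {0<..<T} \<times> UNIV then (case z of (t, x) \<Rightarrow> f t x) else 0) = F z}"
        using N(1) that(2) by blast
      then show ?thesis using that(1) by simp
    qed
  qed
qed

lemma null_section_AE:
  fixes N :: "(real \<times> 'a::euclidean_space) set"
  assumes "N \<in> sets borel" "emeasure lborel N = 0"
  shows "AE t in lborel. AE x in lborel. (t, x) \<notin> N"
proof (rule AE_lborel_pair)
  show "AE z in lborel. z \<notin> N"
    using assms by (intro AE_not_in) (auto intro: null_setsI)
qed

lemma section_measurable:
  fixes f :: "real \<Rightarrow> 'a::euclidean_space \<Rightarrow> 'b::topological_space"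
  assumes "joint_borel f"
  shows "f t \<in> borel_measurable borel" "(\<lambda>t. f t x) \<in> borel_measurable borel"
proof -
  have "(\<lambda>x. (t, x)) \<in> borel_measurable (borel :: 'a measure)" "(\<lambda>t. (t, x)) \<in> borel_measurable (borel :: real measure)"
    by (auto intro!: borel_measurable_continuous_onI continuous_intros)
  from this[THEN measurable_compose, OF assms]
  show "f t \<in> borel_measurable borel" "(\<lambda>t. f t x) \<in> borel_measurable borel" by simp_all
qed

lemma joint_compose:
  fixes f :: "real \<Rightarrow> 'a::euclidean_space \<Rightarrow> 'b::topological_space" and F :: "real \<Rightarrow> 'c::euclidean_space \<Rightarrow> 'a"
  assumes "joint_borel f" "joint_borel F"
  shows "(\<lambda>(t, x). f t (F t x)) \<in> borel_measurable borel"
proof -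
  have "(\<lambda>z. (fst z, (\<lambda>(t, x). F t x) z)) \<in> borel_measurable (borel :: (real \<times> 'c) measure)"
    using assms(2) by (intro borel_measurable_Pair) (auto intro!: borel_measurable_continuous_onI continuous_intros)
  from measurable_compose[OF this assms(1)] show ?thesis
    by (simp add: case_prod_beta)
qed

lemma weak_gradient_cong_AE:
  fixes f f' :: "'a::euclidean_space \<Rightarrow> 'a"
  assumes wg: "weak_gradient f D"
    and f: "AE x in lborel. f x = f' x" "f' \<in> borel_measurable borel"
    and D: "\<And>i. i \<in> Basis \<Longrightarrow> AE x in lborel. D x i = D' x i" "\<And>i. i \<in> Basis \<Longrightarrow> (\<lambda>x. D' x i) \<in> borel_measurable borel"
  shows "weak_gradient f' D'"
proof -
  have f_ae: "AE x in lebesgue. f x = f' x"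
    using f(1) by (simp only: AE_completion_iff)
  have D_ae: "AE x in lebesgue. D x i = D' x i" if "i \<in> Basis" for i
    using D(1)[OF that] by (simp only: AE_completion_iff)
  have li: "locally_integrable g'" if g: "locally_integrable g" "AE x in lebesgue. g x = g' x" "g' \<in> borel_measurable borel"
    for g g' :: "'a \<Rightarrow> 'a"
    unfolding locally_integrable_def set_integrable_def
  proof (intro allI impI)
    fix K :: "'a set" assume K: "compact K"
    have "integrable lebesgue (\<lambda>x. indicator K x *\<^sub>R g x)"
      using g(1) K by (simp add: locally_integrable_def set_integrable_def)
    moreover have "(\<lambda>x. indicator K x *\<^sub>R g' x) \<in> borel_measurable lebesgue"
      using g(3) K by (intro measurable_completion) (auto intro!: borel_measurable_scaleR borel_measurable_indicator borel_compact)
    moreover have "AE x in lebesgue. indicator K x *\<^sub>R g x = indicator K x *\<^sub>R g' x"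
      using g(2) by eventually_elim simp
    ultimately show "integrable lebesgue (\<lambda>x. indicator K x *\<^sub>R g' x)"
      by (rule integrable_cong_AE_imp)
  qed
  have int_eq: "(LINT x|lebesgue. c x *\<^sub>R g x) = (LINT x|lebesgue. c x *\<^sub>R g' x)"
    if "c \<in> borel_measurable borel" "AE x in lebesgue. g x = g' x" "g \<in> borel_measurable lebesgue" "g' \<in> borel_measurable borel"
    for c and g g' :: "'a \<Rightarrow> 'a"
  proof (rule integral_cong_AE)
    have c: "c \<in> borel_measurable lebesgue" using that(1) by (intro measurable_completion) simp
    show "(\<lambda>x. c x *\<^sub>R g x) \<in> borel_measurable lebesgue"
      using c that(3) by (rule borel_measurable_scaleR)
    have "g' \<in> borel_measurable lebesgue" using that(4) by (intro measurable_completion) simp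
    with c show "(\<lambda>x. c x *\<^sub>R g' x) \<in> borel_measurable lebesgue"
      by (rule borel_measurable_scaleR)
    show "AE x in lebesgue. c x *\<^sub>R g x = c x *\<^sub>R g' x"
      using that(2) by eventually_elim simp
  qed
  have lf: "locally_integrable f" and lD: "\<And>i. i \<in> Basis \<Longrightarrow> locally_integrable (\<lambda>x. D x i)"
    using wg by (auto simp: weak_gradient_def)
  show ?thesis
    unfolding weak_gradient_def
  proof (intro conjI ballI allI impI)
    show "locally_integrable f'" by (rule li[OF lf f_ae f(2)])
    fix i :: 'a assume i: "i \<in> Basis"
    show "locally_integrable (\<lambda>x. D' x i)" by (rule li[OF lD[OF i] D_ae[OF i] D(2)[OF i]])
    fix \<phi> :: "'a \<Rightarrow> real" assume \<phi>: "test_function \<phi>"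
    have "(LINT x|lebesgue. pderiv_dir \<phi> i x *\<^sub>R f' x) = (LINT x|lebesgue. pderiv_dir \<phi> i x *\<^sub>R f x)"
      using int_eq[OF test_function_borel[OF test_function_pderiv[OF \<phi> i]] f_ae locally_integrable_measurable[OF lf] f(2)] by simp
    also have "\<dots> = - (LINT x|lebesgue. \<phi> x *\<^sub>R D x i)"
      using wg \<phi> i by (simp add: weak_gradient_def)
    also have "\<dots> = - (LINT x|lebesgue. \<phi> x *\<^sub>R D' x i)"
      using int_eq[OF test_function_borel[OF \<phi>] D_ae[OF i] locally_integrable_measurable[OF lD[OF i]] D(2)[OF i]] by simp
    finally show "(LINT x|lebesgue. pderiv_dir \<phi> i x *\<^sub>R f' x) = - (LINT x|lebesgue. \<phi> x *\<^sub>R D' x i)" .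
  qed
qed

lemma spatial_weak_gradient_representative:
  fixes b :: "real \<Rightarrow> 'a::euclidean_space \<Rightarrow> 'a"
  assumes "spatial_weak_gradient T b D"
  obtains b' D' N where "joint_borel b'"
    "\<And>i. i \<in> Basis \<Longrightarrow> (\<lambda>(t, x). D' t x i) \<in> borel_measurable borel"
    "N \<in> sets borel" "emeasure lborel N = 0"
    "\<And>t x. t \<in> {0<..<T} \<Longrightarrow> (t, x) \<notin> N \<Longrightarrow> b t x = b' t x"
    "\<And>t x i. t \<in> {0<..<T} \<Longrightarrow> (t, x) \<notin> N \<Longrightarrow> i \<in> Basis \<Longrightarrow> D t x i = D' t x i"
    "AE t in lborel. t \<in> {0<..<T} \<longrightarrow> weak_gradient (b t) (D t)"
proof -
  have b: "st_measurable T b" and D: "\<And>i. i \<in> Basis \<Longrightarrow> st_measurable T (\<lambda>t x. D t x i)"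
    and wg: "AE t in lborel. t \<in> {0<..<T} \<longrightarrow> weak_gradient (b t) (D t)"
    using assms by (auto simp: spatial_weak_gradient_def AE_time_iff)
  obtain b' N0 where b': "joint_borel b'" "N0 \<in> sets borel" "emeasure lborel N0 = 0"
    "\<And>t x. t \<in> {0<..<T} \<Longrightarrow> (t, x) \<notin> N0 \<Longrightarrow> b t x = b' t x"
    using st_borel_representative[OF b] by blast
  have "\<forall>i\<in>Basis. \<exists>f' N. joint_borel f' \<and> N \<in> sets borel \<and> emeasure lborel N = 0 \<and>
    (\<forall>t x. t \<in> {0<..<T} \<longrightarrow> (t, x) \<notin> N \<longrightarrow> D t x i = f' t x)"
    using st_borel_representative[OF D] by metis
  then obtain f' N1 where f': "\<And>i. i \<in> Basis \<Longrightarrow> (\<lambda>(t, x). f' i t x) \<in> borel_measurable borel"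
    "\<And>i. i \<in> Basis \<Longrightarrow> N1 i \<in> sets borel" "\<And>i. i \<in> Basis \<Longrightarrow> emeasure lborel (N1 i) = 0"
    "\<And>i t x. i \<in> Basis \<Longrightarrow> t \<in> {0<..<T} \<Longrightarrow> (t, x) \<notin> N1 i \<Longrightarrow> D t x i = f' i t x"
    by metis
  have "N0 \<union> (\<Union>i\<in>Basis. N1 i) \<in> null_sets lborel"
    using b' f' by (intro null_sets.Un null_sets.finite_UN) (auto intro: null_setsI)
  then show ?thesis
    using b' f' wg by (intro that[of b' "\<lambda>t x i. f' i t x" "N0 \<union> (\<Union>i\<in>Basis. N1 i)"]) (auto dest: null_setsD1 null_setsD2)
qed

text \<open>The normalised data of the limit field: Borel in \<open>(t, x)\<close>, bounded everywhere, and
  with \<open>\<kappa> t\<close> dominating the \<open>L\<^sup>p\<close> norm of the gradient.\<close>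

definition field_data :: "real \<Rightarrow> real \<Rightarrow> real \<Rightarrow> real \<Rightarrow> (real \<Rightarrow> 'a::euclidean_space \<Rightarrow> 'a) \<Rightarrow> (real \<Rightarrow> 'a \<Rightarrow> real) \<Rightarrow> (real \<Rightarrow> real) \<Rightarrow> bool" where
  "field_data T p B K b g \<kappa> \<longleftrightarrow>
     joint_borel b \<and> (\<forall>t x. norm (b t x) \<le> B) \<and>
     joint_borel g \<and> (\<forall>t x. g t x \<ge> 0) \<and>
     \<kappa> \<in> borel_measurable borel \<and> (\<forall>t. \<kappa> t > 0) \<and>
     (\<integral>\<^sup>+t. indicator {0<..<T} t * ennreal (\<kappa> t) \<partial>lborel) \<le> ennreal K \<and>
     (AE t in lborel. t \<in> {0<..<T} \<longrightarrow> (\<integral>\<^sup>+x. ennreal (g t x powr p) \<partial>lborel) \<le> ennreal (\<kappa> t powr p) \<and>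
        (\<exists>N. N \<in> sets borel \<and> emeasure lborel N = 0 \<and> (\<forall>x y. x \<notin> N \<longrightarrow> y \<notin> N \<longrightarrow>
          ennreal (norm (b t x - b t y)) \<le> ennreal (sobolev_const TYPE('a) * norm (x - y)) *
            (maximal (\<lambda>x. ennreal (g t x)) x + maximal (\<lambda>x. ennreal (g t x)) y))))"

lemma field_data_exists:
  fixes b :: "real \<Rightarrow> 'a::euclidean_space \<Rightarrow> 'a" and T p B G :: real
  assumes T: "T > 0" and p: "1 < p" and B: "B \<ge> 0" and G: "G \<ge> 0" and bW: "in_L1_W1p T p b Db"
    and bB: "Linf_norm T b = ennreal B"
    and bG: "L1_Lp_norm T p (\<lambda>t x. frobenius (Db t x)) = ennreal G"
  obtains b' g \<kappa> N where "field_data T p B (DIM('a) * G + T) b' g \<kappa>"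
    "N \<in> sets borel" "emeasure lborel N = 0" "\<And>t x. t \<in> {0<..<T} \<Longrightarrow> (t, x) \<notin> N \<Longrightarrow> b t x = b' t x"
proof -
  have "spatial_weak_gradient T b Db" using bW by (simp add: in_L1_W1p_def)
  then obtain b0 D N0 where b0: "joint_borel b0"
    and D: "\<And>i. i \<in> Basis \<Longrightarrow> (\<lambda>(t, x). D t x i) \<in> borel_measurable borel"
    and N0: "N0 \<in> sets borel" "emeasure lborel N0 = 0"
    and eqb: "\<And>t x. t \<in> {0<..<T} \<Longrightarrow> (t, x) \<notin> N0 \<Longrightarrow> b t x = b0 t x"
    and eqD: "\<And>t x i. t \<in> {0<..<T} \<Longrightarrow> (t, x) \<notin> N0 \<Longrightarrow> i \<in> Basis \<Longrightarrow> Db t x i = D t x i"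
    and wg: "AE t in lborel. t \<in> {0<..<T} \<longrightarrow> weak_gradient (b t) (Db t)"
    by (rule spatial_weak_gradient_representative) (rule that; assumption)
  have "AE z in space_time T. (case z of (t, x) \<Rightarrow> ennreal (norm (b t x))) \<le> ennreal B"
    using esssup_AE[of "\<lambda>(t, x). ennreal (norm (b t x))" "space_time T"] bB by (simp add: Linf_norm_def)
  then have "AE z in lebesgue. z \<in> {0<..<T} \<times> UNIV \<longrightarrow> (case z of (t, x) \<Rightarrow> ennreal (norm (b t x))) \<le> ennreal B"
    unfolding space_time_def by (subst (asm) AE_restrict_space_iff) auto
  then have "AE z in lborel. z \<in> {0<..<T} \<times> UNIV \<longrightarrow> (case z of (t, x) \<Rightarrow> ennreal (norm (b t x))) \<le> ennreal B"
    by (simp only: AE_completion_iff)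
  from AE_E[OF this] obtain N1 where N1: "{z \<in> space lborel. \<not> (z \<in> {0<..<T} \<times> UNIV \<longrightarrow> (case z of (t, x) \<Rightarrow> ennreal (norm (b t x))) \<le> ennreal B)} \<subseteq> N1"
    "emeasure lborel N1 = 0" "N1 \<in> sets lborel"
    by blast
  have bd: "norm (b t x) \<le> B" if "t \<in> {0<..<T}" "(t, x) \<notin> N1" for t x
  proof -
    have "(t, x) \<notin> {z \<in> space lborel. \<not> (z \<in> {0<..<T} \<times> UNIV \<longrightarrow> (case z of (t, x) \<Rightarrow> ennreal (norm (b t x))) \<le> ennreal B)}"
      using N1(1) that(2) by blast
    then show ?thesis using that(1) B by (simp add: ennreal_le_iff)
  qed
  define N where "N = N0 \<union> N1"
  have Nnull: "N \<in> null_sets lborel"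
    unfolding N_def using N0 N1 by (intro null_sets.Un) (auto intro: null_setsI)
  then have N: "N \<in> sets borel" "emeasure lborel N = 0" by (auto dest: null_setsD1 null_setsD2)
  \<comment> \<open>Truncation makes the bound hold at every point while changing the field on a
    null set only.\<close>
  define b' where "b' t x = (if norm (b0 t x) \<le> B then b0 t x else 0)" for t x
  have b'_borel: "joint_borel b'"
    using b0 unfolding b'_def case_prod_beta by measurable
  have eq: "b t x = b' t x" if "t \<in> {0<..<T}" "(t, x) \<notin> N" for t x
    using that eqb[of t x] bd[of t x] by (auto simp: N_def b'_def)
  define g where "g t x = (\<Sum>i\<in>Basis. norm (D t x i))" for t x
  have g_borel: "joint_borel g"
    using D unfolding g_def case_prod_beta by measurable
  define fr where "fr t x = frobenius (D t x)" for t x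
  have fr_borel: "joint_borel fr"
    using D unfolding fr_def frobenius_def case_prod_beta by measurable
  have [measurable]: "(\<lambda>x. fr t x) \<in> borel_measurable borel" for t
    by (rule section_measurable(1)[OF fr_borel])
  define I where "I t = (\<integral>\<^sup>+x. ennreal (fr t x powr p) \<partial>lborel)" for t
  have I_meas[measurable]: "I \<in> borel_measurable borel"
  proof -
    have "(\<lambda>(t, x). ennreal (fr t x powr p)) \<in> borel_measurable (borel \<Otimes>\<^sub>M lborel)"
      using fr_borel unfolding borel_prod[symmetric] case_prod_beta by measurable
    then show ?thesis
      unfolding I_def by (rule lborel.borel_measurable_nn_integral)
  qed
  have fr0: "fr t x \<ge> 0" for t x by (simp add: fr_def frobenius_def sum_nonneg)
  define n where "n t = (if I t = top then top else ennreal (enn2real (I t) powr (1 / p)))" for t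
  have n_meas[measurable]: "n \<in> borel_measurable borel" unfolding n_def by measurable
  have AEN: "AE t in lborel. AE x in lborel. (t, x) \<notin> N"
    by (rule null_section_AE[OF N])
  have "AE t in lborel. t \<in> {0<..<T} \<longrightarrow> Lp_norm p (\<lambda>x. frobenius (Db t x)) = n t"
    using AEN
  proof eventually_elim
    case (elim t)
    note ae = elim
    show ?case
    proof
    assume t: "t \<in> {0<..<T}"
    have "(\<integral>\<^sup>+x. ennreal (norm (frobenius (Db t x)) powr p) \<partial>lborel) = I t"
      unfolding I_def
    proof (rule nn_integral_cong_AE)
      show "AE x in lborel. ennreal (norm (frobenius (Db t x)) powr p) = ennreal (fr t x powr p)"
        using ae
      proof eventually_elim
        case (elim x)
        then have "frobenius (Db t x) = fr t x"
          using eqD[OF t, of x] by (auto simp: N_def fr_def frobenius_def)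
        then show ?case using fr0[of t x] by simp
      qed
    qed
    then show "Lp_norm p (\<lambda>x. frobenius (Db t x)) = n t" by (simp add: Lp_norm_def n_def nn_integral_completion)
    qed
  qed
  then have nG: "(\<integral>\<^sup>+t. indicator {0<..<T} t * n t \<partial>lborel) = ennreal G"
  proof -
    assume "AE t in lborel. t \<in> {0<..<T} \<longrightarrow> Lp_norm p (\<lambda>x. frobenius (Db t x)) = n t"
    then have "(\<integral>\<^sup>+t. indicator {0<..<T} t * n t \<partial>lborel)
        = (\<integral>\<^sup>+t. Lp_norm p (\<lambda>x. frobenius (Db t x)) * indicator {0<..<T} t \<partial>lborel)"
      by (intro nn_integral_cong_AE) (auto elim!: eventually_mono simp: indicator_def)
    also have "\<dots> = L1_Lp_norm T p (\<lambda>t x. frobenius (Db t x))"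
      unfolding L1_Lp_norm_def by (subst nn_integral_restrict_space) (auto simp: nn_integral_completion)
    finally show ?thesis using bG by simp
  qed
  \<comment> \<open>The factor \<open>DIM('a)\<close> compares the sum of the norms of the partial
    derivatives with the Frobenius norm; the summand 1 makes \<open>\<kappa>\<close> positive and
    adds \<open>T\<close> to its integral. An infinite norm is sent to 0 by \<open>enn2real\<close>,
    but \<open>n\<close> is finite almost everywhere.\<close>
  define \<kappa> where "\<kappa> t = DIM('a) * enn2real (n t) + 1" for t
  have \<kappa>_meas[measurable]: "\<kappa> \<in> borel_measurable borel" unfolding \<kappa>_def by measurable
  have \<kappa>_pos: "\<kappa> t > 0" for t
    unfolding \<kappa>_def by (intro add_nonneg_pos mult_nonneg_nonneg) auto
  have \<kappa>_int: "(\<integral>\<^sup>+t. indicator {0<..<T} t * ennreal (\<kappa> t) \<partial>lborel) \<le> ennreal (DIM('a) * G + T)"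
  proof -
    have "(\<integral>\<^sup>+t. indicator {0<..<T} t * ennreal (\<kappa> t) \<partial>lborel)
        \<le> (\<integral>\<^sup>+t. ennreal DIM('a) * (indicator {0<..<T} t * n t) + indicator {0<..<T} t \<partial>lborel)"
    proof (rule nn_integral_mono)
      fix t
      have "ennreal (\<kappa> t) = ennreal DIM('a) * ennreal (enn2real (n t)) + 1"
        by (simp add: \<kappa>_def ennreal_mult)
      also have "\<dots> \<le> ennreal DIM('a) * n t + 1"
        by (intro add_right_mono mult_left_mono) (auto simp: ennreal_enn2real_if)
      finally show "indicator {0<..<T} t * ennreal (\<kappa> t) \<le> ennreal DIM('a) * (indicator {0<..<T} t * n t) + indicator {0<..<T} t"
        by (auto simp: indicator_def)
    qed
    also have "\<dots> = ennreal DIM('a) * ennreal G + ennreal T"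
      using T by (simp add: nn_integral_add nn_integral_cmult nG)
    also have "\<dots> = ennreal (DIM('a) * G + T)"
      using G T by (simp add: ennreal_mult)
    finally show ?thesis .
  qed
  have n_fin: "AE t in lborel. t \<in> {0<..<T} \<longrightarrow> n t \<noteq> top"
  proof -
    have "AE t in lborel. indicator {0<..<T} t * n t \<noteq> \<infinity>"
      using nG by (intro nn_integral_PInf_AE) auto
    then show ?thesis by eventually_elim auto
  qed
  have gp: "(\<integral>\<^sup>+x. ennreal (g t x powr p) \<partial>lborel) \<le> ennreal (\<kappa> t powr p)" if "n t \<noteq> top" for t
  proof -
    have It: "I t \<noteq> top" using that by (auto simp: n_def)
    then have I_eq: "I t = ennreal (enn2real (I t))" by (simp add: less_top)
    have n_eq: "enn2real (n t) = enn2real (I t) powr (1 / p)" using It by (simp add: n_def)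
    have "g t x \<le> DIM('a) * fr t x" for x
    proof -
      have "norm (D t x i) \<le> fr t x" if "i \<in> Basis" for i
      proof -
        have "(norm (D t x i))\<^sup>2 \<le> (\<Sum>i\<in>Basis. (norm (D t x i))\<^sup>2)"
          by (rule member_le_sum) (use that in auto)
        then show ?thesis unfolding fr_def frobenius_def by (rule real_le_rsqrt)
      qed
      then show ?thesis
        unfolding g_def using sum_bounded_above[of Basis "\<lambda>i. norm (D t x i)" "fr t x"] by simp
    qed
    then have "(\<integral>\<^sup>+x. ennreal (g t x powr p) \<partial>lborel) \<le> (\<integral>\<^sup>+x. ennreal (DIM('a) powr p) * ennreal (fr t x powr p) \<partial>lborel)"
      using p fr0 by (intro nn_integral_mono) (auto simp: ennreal_mult[symmetric] powr_mult[symmetric] g_def intro!: ennreal_leI powr_mono2 sum_nonneg)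
    also have "\<dots> = ennreal (DIM('a) powr p) * I t"
      unfolding I_def by (rule nn_integral_cmult) measurable
    also have "\<dots> = ennreal ((DIM('a) * enn2real (n t)) powr p)"
      using p by (subst I_eq) (simp add: n_eq powr_mult powr_powr ennreal_mult[symmetric])
    also have "\<dots> \<le> ennreal (\<kappa> t powr p)"
      using p by (intro ennreal_leI powr_mono2) (auto simp: \<kappa>_def)
    finally show ?thesis .
  qed
  have sob: "AE t in lborel. t \<in> {0<..<T} \<longrightarrow> (\<exists>N. N \<in> sets borel \<and> emeasure lborel N = 0 \<and> (\<forall>x y. x \<notin> N \<longrightarrow> y \<notin> N \<longrightarrow>
          ennreal (norm (b' t x - b' t y)) \<le> ennreal (sobolev_const TYPE('a) * norm (x - y)) *
            (maximal (\<lambda>x. ennreal (g t x)) x + maximal (\<lambda>x. ennreal (g t x)) y)))"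
    using wg AEN
  proof eventually_elim
    case (elim t)
    note ae = elim(2)
    show ?case
    proof
    assume t: "t \<in> {0<..<T}"
    have bt: "b' t \<in> borel_measurable borel" by (rule section_measurable(1)[OF b'_borel])
    have Dt: "(\<lambda>x. D t x i) \<in> borel_measurable borel" if "i \<in> Basis" for i
      by (rule section_measurable(1)[OF D[OF that]])
    have "weak_gradient (b' t) (D t)"
    proof (rule weak_gradient_cong_AE[OF _ _ bt _ Dt])
      show "weak_gradient (b t) (Db t)" using elim(1) t by simp
      show "AE x in lborel. b t x = b' t x"
        using ae by eventually_elim (use eq t in auto)
      show "AE x in lborel. Db t x i = D t x i" if "i \<in> Basis" for i
        using ae by eventually_elim (use eqD t that in \<open>auto simp: N_def\<close>)
    qed
    from weak_gradient_pointwise[OF this Dt] obtain M where M: "negligible M"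
      "\<And>x y. x \<notin> M \<Longrightarrow> y \<notin> M \<Longrightarrow> ennreal (norm (b' t x - b' t y)) \<le> ennreal (sobolev_const TYPE('a) * norm (x - y)) *
            (maximal (\<lambda>x. ennreal (g t x)) x + maximal (\<lambda>x. ennreal (g t x)) y)"
      unfolding g_def by blast
    obtain M' where "M' \<in> null_sets lborel" "M \<subseteq> M'"
      using M(1) by (auto simp: negligible_iff_null_sets null_sets_completion_iff2)
    then show "\<exists>N. N \<in> sets borel \<and> emeasure lborel N = 0 \<and> (\<forall>x y. x \<notin> N \<longrightarrow> y \<notin> N \<longrightarrow>
          ennreal (norm (b' t x - b' t y)) \<le> ennreal (sobolev_const TYPE('a) * norm (x - y)) *
            (maximal (\<lambda>x. ennreal (g t x)) x + maximal (\<lambda>x. ennreal (g t x)) y))"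
      using M(2) by (intro exI[of _ M']) (auto dest: null_setsD1 null_setsD2)
    qed
  qed
  have "field_data T p B (DIM('a) * G + T) b' g \<kappa>"
    unfolding field_data_def
  proof (intro conjI allI)
    show "AE t in lborel. t \<in> {0<..<T} \<longrightarrow> (\<integral>\<^sup>+x. ennreal (g t x powr p) \<partial>lborel) \<le> ennreal (\<kappa> t powr p) \<and>
        (\<exists>N. N \<in> sets borel \<and> emeasure lborel N = 0 \<and> (\<forall>x y. x \<notin> N \<longrightarrow> y \<notin> N \<longrightarrow>
          ennreal (norm (b' t x - b' t y)) \<le> ennreal (sobolev_const TYPE('a) * norm (x - y)) *
            (maximal (\<lambda>x. ennreal (g t x)) x + maximal (\<lambda>x. ennreal (g t x)) y)))"
      using n_fin sob by eventually_elim (use gp in blast)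
    show "norm (b' t x) \<le> B" for t x using B by (simp add: b'_def)
    show "0 \<le> g t x" for t x by (simp add: g_def sum_nonneg)
  qed (fact b'_borel g_borel \<kappa>_meas \<kappa>_pos \<kappa>_int)+
  then show ?thesis using that N eq by blast
qed

lemma abs_continuous_imp_continuous:
  assumes "abs_continuous_on_interval a b f"
  shows "continuous_on {a..b} f"
  unfolding continuous_on_iff
proof (intro ballI allI impI)
  fix x and e :: real assume x: "x \<in> {a..b}" and e: "e > 0"
  have "\<exists>d>0. (\<forall>(n::nat) l u. (\<forall>i<n. a \<le> l i \<and> l i \<le> u i \<and> u i \<le> b) \<and>
        (\<forall>i<n. \<forall>j<n. i \<noteq> j \<longrightarrow> {l i<..<u i} \<inter> {l j<..<u j} = {}) \<and> (\<Sum>i<n. u i - l i) < d \<longrightarrow>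
        (\<Sum>i<n. dist (f (u i)) (f (l i))) < e)"
    by (rule mp[OF spec[OF assms[unfolded abs_continuous_on_interval_def], of e] e])
  then obtain d where d: "d > 0 \<and> (\<forall>(n::nat) l u. (\<forall>i<n. a \<le> l i \<and> l i \<le> u i \<and> u i \<le> b) \<and>
        (\<forall>i<n. \<forall>j<n. i \<noteq> j \<longrightarrow> {l i<..<u i} \<inter> {l j<..<u j} = {}) \<and> (\<Sum>i<n. u i - l i) < d \<longrightarrow>
        (\<Sum>i<n. dist (f (u i)) (f (l i))) < e)"
    by (rule exE)
  have one: "dist (f u) (f l) < e" if "a \<le> l" "l \<le> u" "u \<le> b" "u - l < d" for l u
    using spec[OF spec[OF spec[OF conjunct2[OF d], of "1::nat"], of "\<lambda>_. l"], of "\<lambda>_. u"] that by simp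
  show "\<exists>d>0. \<forall>x'\<in>{a..b}. dist x' x < d \<longrightarrow> dist (f x') (f x) < e"
  proof (intro exI[of _ d] conjI ballI impI)
    show "d > 0" using d by blast
    fix y assume y: "y \<in> {a..b}" "dist y x < d"
    show "dist (f y) (f x) < e"
    proof (cases "x \<le> y")
      case True
      then show ?thesis using one[of x y] x y by (simp add: dist_real_def)
    next
      case False
      then show ?thesis using one[of y x] x y by (simp add: dist_real_def dist_commute)
    qed
  qed
qed

section \<open>Regular Lagrangian flows with Borel data\<close>

text \<open>The integral equation holds for all times simultaneously, off a single null set of
  starting points; together with joint measurability this is the form in which the flow enters the
  estimates.\<close>

definition flow_data :: "real \<Rightarrow> (real \<Rightarrow> 'a::euclidean_space \<Rightarrow> 'a) \<Rightarrow> (real \<Rightarrow> 'a \<Rightarrow> 'a) \<Rightarrow> bool" where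
  "flow_data T b X \<longleftrightarrow> joint_borel X \<and>
     (AE x in lborel. \<forall>t\<in>{0..T}. X t x = x + (LINT s|lborel. indicator {0<..t} s *\<^sub>R b s (X s x)))"

text \<open>The flow is continuous in time for almost every starting point and Lebesgue measurable
  in space at each time. Borel versions at the countably many grid times, interpolated as step
  functions in time, converge off one null set, and on that set the identity is used instead. The
  limit is jointly Borel and inherits the compressibility bound.\<close>

lemma flow_data_exists:
  fixes b b' :: "real \<Rightarrow> 'a::euclidean_space \<Rightarrow> 'a"
  assumes T: "T > 0" and flow: "regular_Lagrangian_flow T b X"
    and b'[measurable]: "joint_borel b'" and b'B: "\<And>t x. norm (b' t x) \<le> B"
    and N: "N \<in> sets borel" "emeasure lborel N = 0"
    and eq: "\<And>t x. t \<in> {0<..<T} \<Longrightarrow> (t, x) \<notin> N \<Longrightarrow> b t x = b' t x"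
  obtains X' L where "L > 0" "\<And>t. t \<in> {0..T} \<Longrightarrow> compressible L (X' t)" "flow_data T b' X'"
    "AE x in lborel. \<forall>t\<in>{0..T}. X t x = X' t x"
proof -
  have good: "AE x in lborel. abs_continuous_on_interval 0 T (\<lambda>t. X t x) \<and> X 0 x = x \<and>
        (AE t in lebesgue_on {0<..<T}. ((\<lambda>s. X s x) has_vector_derivative b t (X t x)) (at t))"
    using flow unfolding regular_Lagrangian_flow_def AE_completion_iff by blast
  have Xm: "\<And>t. t \<in> {0..T} \<Longrightarrow> X t \<in> borel_measurable lebesgue"
    using flow unfolding regular_Lagrangian_flow_def by blast
  obtain L where L: "L > 0" "\<And>t A. t \<in> {0..T} \<Longrightarrow> open A \<Longrightarrow> emeasure lebesgue (X t -` A) \<le> ennreal L * emeasure lebesgue A"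
    using flow unfolding regular_Lagrangian_flow_def by blast
  define grid where "grid n k = min T (real k * T / real (Suc n))" for n k :: nat
  have grid: "grid n k \<in> {0..T}" for n k using T by (auto simp: grid_def)
  have "\<forall>n k. \<exists>R. R \<in> borel_measurable borel \<and> (AE x in lborel. X (grid n k) x = R x)"
    using completion_ex_borel_euclidean[OF Xm[OF grid]] by metis
  then obtain R where R: "\<And>n k. R n k \<in> borel_measurable borel" "\<And>n k. AE x in lborel. X (grid n k) x = R n k x"
    by metis
  have "AE x in lborel. (abs_continuous_on_interval 0 T (\<lambda>t. X t x) \<and> X 0 x = x \<and>
        (AE t in lebesgue_on {0<..<T}. ((\<lambda>s. X s x) has_vector_derivative b t (X t x)) (at t))) \<and>
        (\<forall>n k. X (grid n k) x = R n k x)"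
    using good R(2) by (intro AE_conjI) (auto simp: AE_all_countable)
  from AE_E[OF this] obtain E where E0: "{x \<in> space lborel. \<not> ((abs_continuous_on_interval 0 T (\<lambda>t. X t x) \<and> X 0 x = x \<and>
        (AE t in lebesgue_on {0<..<T}. ((\<lambda>s. X s x) has_vector_derivative b t (X t x)) (at t))) \<and>
        (\<forall>n k. X (grid n k) x = R n k x))} \<subseteq> E" "emeasure lborel E = 0" "E \<in> sets lborel"
    by blast
  have E: "abs_continuous_on_interval 0 T (\<lambda>t. X t x)" "X 0 x = x"
    "AE t in lebesgue_on {0<..<T}. ((\<lambda>s. X s x) has_vector_derivative b t (X t x)) (at t)"
    "X (grid n k) x = R n k x" if "x \<notin> E" for x n k
  proof -
    have "(abs_continuous_on_interval 0 T (\<lambda>t. X t x) \<and> X 0 x = x \<and>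
        (AE t in lebesgue_on {0<..<T}. ((\<lambda>s. X s x) has_vector_derivative b t (X t x)) (at t))) \<and>
        (\<forall>n k. X (grid n k) x = R n k x)"
      using E0(1) that by auto
    then show "abs_continuous_on_interval 0 T (\<lambda>t. X t x)" "X 0 x = x"
      "AE t in lebesgue_on {0<..<T}. ((\<lambda>s. X s x) has_vector_derivative b t (X t x)) (at t)"
      "X (grid n k) x = R n k x" by blast+
  qed
  have Eb[measurable]: "E \<in> sets borel" using E0(3) by simp
  have AE_notE: "AE x in lborel. x \<notin> E"
    using E0 by (intro AE_not_in) (auto intro: null_setsI)
  define Y where "Y n k x = (if x \<in> E then x else R n k x)" for n k x
  have Ym[measurable]: "Y n k \<in> borel_measurable borel" for n k
    using R(1)[of n k] unfolding Y_def by measurable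
  \<comment> \<open>Clamping the time to \<open>{0..T}\<close> makes the new flow a function of all
    real times.\<close>
  define cl where "cl t = max 0 (min t T)" for t :: real
  have cl: "cl t \<in> {0..T}" for t using T by (auto simp: cl_def)
  define idx where "idx n t = nat \<lfloor>cl t * real (Suc n) / T\<rfloor>" for n t
  define X' where "X' t x = (if x \<in> E then x else X (cl t) x)" for t x
  have conv: "(\<lambda>n. Y n (idx n t) x) \<longlonglongrightarrow> X' t x" for t x
  proof (cases "x \<in> E")
    case True
    then show ?thesis by (simp add: Y_def X'_def)
  next
    case False
    have dist: "\<bar>grid n (idx n t) - cl t\<bar> \<le> T * inverse (real (Suc n))" for n
    proof -
      have q: "0 \<le> cl t * real (Suc n) / T" using cl[of t] T by auto
      have S: "real (Suc n) > 0" by simp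
      have "real (idx n t) \<le> cl t * real (Suc n) / T" "cl t * real (Suc n) / T < real (idx n t) + 1"
        using q unfolding idx_def by linarith+
      then have "real (idx n t) * T \<le> cl t * real (Suc n)" "cl t * real (Suc n) < (real (idx n t) + 1) * T"
        by (simp_all only: pos_le_divide_eq[OF T] pos_divide_less_eq[OF T])
      then have "real (idx n t) * T / real (Suc n) \<le> cl t" "cl t < (real (idx n t) + 1) * T / real (Suc n)"
        by (simp_all only: pos_divide_le_eq[OF S] pos_less_divide_eq[OF S])
      then have "real (idx n t) * T / real (Suc n) \<le> cl t"
        "cl t < real (idx n t) * T / real (Suc n) + T * inverse (real (Suc n))"
        by (simp_all only: divide_inverse distrib_right mult_1)
      moreover from this(1) have "grid n (idx n t) = real (idx n t) * T / real (Suc n)"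
        using cl[of t] unfolding grid_def by simp
      moreover have "\<bar>g - c\<bar> \<le> z" if "y \<le> c" "c < y + z" "g = y" for g y z c :: real
        using that by linarith
      ultimately show ?thesis by blast
    qed
    have "(\<lambda>n. grid n (idx n t)) \<longlonglongrightarrow> cl t"
    proof (rule LIM_zero_cancel, rule Lim_null_comparison)
      show "\<forall>\<^sub>F n in sequentially. norm (grid n (idx n t) - cl t) \<le> T * inverse (real (Suc n))"
        using dist by simp
      show "(\<lambda>n. T * inverse (real (Suc n))) \<longlonglongrightarrow> 0"
        using tendsto_mult[OF tendsto_const[of T] LIMSEQ_inverse_real_of_nat] by simp
    qed
    then have "(\<lambda>n. X (grid n (idx n t)) x) \<longlonglongrightarrow> X (cl t) x"
      by (rule continuous_on_tendsto_compose[OF abs_continuous_imp_continuous[OF E(1)[OF False]] _ cl])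
        (intro always_eventually allI grid)
    then show ?thesis
      using False by (simp add: Y_def X'_def E(4))
  qed
  have X'_borel: "joint_borel X'"
  proof (rule borel_measurable_LIMSEQ_metric)
    show "(\<lambda>n. Y n (idx n (fst z)) (snd z)) \<longlonglongrightarrow> (case z of (t, x) \<Rightarrow> X' t x)" for z
      using conv by (simp add: case_prod_beta)
    have "(\<lambda>z. Y n (idx n (fst z)) (snd z)) \<in> borel_measurable (borel \<Otimes>\<^sub>M borel)" for n
    proof (rule measurable_compose_countable[where f = "\<lambda>k z. Y n k (snd z)" and g = "\<lambda>z. idx n (fst z)"])
      show "(\<lambda>z. Y n k (snd z)) \<in> borel_measurable (borel \<Otimes>\<^sub>M borel)" for k by measurable
      show "(\<lambda>z. idx n (fst z)) \<in> measurable (borel \<Otimes>\<^sub>M borel) (count_space UNIV)"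
        unfolding idx_def cl_def by measurable
    qed
    then show "(\<lambda>z. Y n (idx n (fst z)) (snd z)) \<in> borel_measurable borel" for n
      by (simp add: borel_prod)
  qed
  have X'm: "X' t \<in> borel_measurable borel" for t
    by (rule section_measurable(1)[OF X'_borel])
  have comp: "compressible L (X' t)" if t: "t \<in> {0..T}" for t
    unfolding compressible_def
  proof (intro conjI allI impI X'm)
    fix A :: "'a set" assume A: "open A"
    have clt: "cl t = t" using t by (auto simp: cl_def)
    have ml: "X t -` A \<in> sets lebesgue"
      using measurable_sets[OF Xm[OF t], of A] A by simp
    have "emeasure lborel (X' t -` A) = emeasure lebesgue (X' t -` A)"
      using measurable_sets[OF X'm[of t], of A] A by simp
    also have "\<dots> \<le> emeasure lebesgue (X t -` A \<union> E)"
      using ml by (intro emeasure_mono) (auto simp: X'_def clt)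
    also have "\<dots> \<le> emeasure lebesgue (X t -` A) + emeasure lebesgue E"
      using ml by (intro emeasure_subadditive) auto
    also have "\<dots> \<le> ennreal L * emeasure lborel A"
      using L(2)[OF t A] E0 A by simp
    finally show "emeasure lborel (X' t -` A) \<le> ennreal L * emeasure lborel A" .
  qed
  \<comment> \<open>Trajectories must avoid the set \<open>N\<close> where the two fields differ. At
    a fixed time almost every one does, by compressibility; Fubini, which needs the measurability of
    this set, exchanges the quantifiers.\<close>
  define Z where "Z s x = ((s, X' s x) \<notin> N)" for s x
  have Zm: "{z. Z (fst z) (snd z)} \<in> sets borel"
  proof -
    have "(\<lambda>z. (fst z, (\<lambda>(t, x). X' t x) z)) \<in> borel_measurable borel"
      by (rule borel_measurable_Pair[OF _ X'_borel]) (intro borel_measurable_continuous_onI continuous_intros)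
    then have "(\<lambda>z. (fst z, X' (fst z) (snd z))) \<in> borel_measurable borel"
      by (simp add: case_prod_beta)
    from measurable_sets[OF this, of "- N"] N(1) show ?thesis
      by (simp add: vimage_def Z_def)
  qed
  have "AE s in lborel. AE x in lborel. s \<in> {0<..<T} \<longrightarrow> Z s x"
    using null_section_AE[OF N]
  proof eventually_elim
    case (elim s)
    show ?case
    proof (cases "s \<in> {0<..<T}")
      case True
      then have "compressible L (X' s)" by (intro comp) auto
      from compressible_AE[OF this _ elim] L(1) show ?thesis by (simp add: Z_def)
    qed auto
  qed
  then have ZAE: "AE x in lborel. AE s in lborel. s \<in> {0<..<T} \<longrightarrow> Z s x"
  proof (rule AE_lborel_swap[rotated])
    have "{z. fst z \<in> {0<..<T} \<longrightarrow> Z (fst z) (snd z)} = - ({0<..<T} \<times> UNIV) \<union> {z. Z (fst z) (snd z)}"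
      by auto
    also have "\<dots> \<in> sets borel"
      using Zm by (intro sets.Un borel_comp) auto
    finally show "{z. fst z \<in> {0<..<T} \<longrightarrow> Z (fst z) (snd z)} \<in> sets borel" .
  qed
  have "AE x in lborel. \<forall>t\<in>{0..T}. X' t x = x + (LINT s|lborel. indicator {0<..t} s *\<^sub>R b' s (X' s x))"
    using ZAE AE_notE
  proof eventually_elim
    case (elim x)
    note ae = elim(1) and xE = elim(2)
    show ?case
    proof
      fix t assume t: "t \<in> {0..T}"
      have X'X: "X' s x = X s x" if "s \<in> {0..T}" for s
        using xE that by (auto simp: X'_def cl_def)
      have hi: "((\<lambda>s. b s (X s x)) has_integral X t x - X 0 x) {0..t}"
        using t by (intro abs_continuous_has_integral[OF E(1)[OF xE] E(3)[OF xE]]) auto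
      from ae have ae': "AE s in lebesgue. s \<in> {0<..<T} \<longrightarrow> Z s x"
        by (simp only: AE_completion_iff)
      obtain M where M: "{s. \<not> (s \<in> {0<..<T} \<longrightarrow> Z s x)} \<subseteq> M" "M \<in> null_sets lebesgue"
        using ae' by (auto elim!: AE_E simp: null_sets_def)
      have negl: "negligible (M \<union> {0, T})"
        using M(2) by (intro negligible_Un) (auto simp: negligible_iff_null_sets)
      have "((\<lambda>s. b' s (X' s x)) has_integral X t x - X 0 x) {0..t}"
      proof (rule has_integral_spike[OF negl _ hi])
        fix s assume s: "s \<in> {0..t} - (M \<union> {0, T})"
        then have sT: "s \<in> {0<..<T}" using t by auto
        then have "Z s x" using M(1) s by auto
        then have "b s (X' s x) = b' s (X' s x)" unfolding Z_def using eq[OF sT] by blast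
        then show "b' s (X' s x) = b s (X s x)"
          using X'X[of s] sT by simp
      qed
      moreover have int: "set_integrable lborel {0..t} (\<lambda>s. b' s (X' s x))"
      proof -
        have [measurable]: "(\<lambda>s. b' s (X' s x)) \<in> borel_measurable borel"
          by (rule section_measurable(2)[OF joint_compose[OF b' X'_borel]])
        have "integrable lborel (\<lambda>s. indicator {0..t} s *\<^sub>R B)"
          by (intro borel_integrable_compact compact_Icc continuous_on_const)
        then show ?thesis
          unfolding set_integrable_def
        proof (rule Bochner_Integration.integrable_bound)
          show "AE s in lborel. norm (indicator {0..t} s *\<^sub>R b' s (X' s x)) \<le> norm (indicator {0..t} s *\<^sub>R B)"
            using b'B by (auto simp: indicator_def intro: order_trans[OF _ abs_ge_self])
        qed measurable
      qed
      ultimately have "X t x - X 0 x = (LINT s:{0..t}|lborel. b' s (X' s x))"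
        using set_borel_integral_eq_integral(2)[OF int] integral_unique by metis
      also have "\<dots> = (LINT s|lborel. indicator {0<..t} s *\<^sub>R b' s (X' s x))"
        unfolding set_lebesgue_integral_def
      proof (rule integral_cong_AE)
        have [measurable]: "(\<lambda>s. b' s (X' s x)) \<in> borel_measurable borel"
          by (rule section_measurable(2)[OF joint_compose[OF b' X'_borel]])
        show "(\<lambda>s. indicator {0..t} s *\<^sub>R b' s (X' s x)) \<in> borel_measurable lborel"
          "(\<lambda>s. indicator {0<..t} s *\<^sub>R b' s (X' s x)) \<in> borel_measurable lborel"
          by measurable
        show "AE s in lborel. indicator {0..t} s *\<^sub>R b' s (X' s x) = indicator {0<..t} s *\<^sub>R b' s (X' s x)"
          using AE_lborel_singleton[of "0::real"] by eventually_elim (auto simp: indicator_def)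
      qed
      finally show "X' t x = x + (LINT s|lborel. indicator {0<..t} s *\<^sub>R b' s (X' s x))"
        using X'X[OF t] E(2)[OF xE] by (simp add: algebra_simps)
    qed
  qed
  moreover have "AE x in lborel. \<forall>t\<in>{0..T}. X t x = X' t x"
    using AE_notE by eventually_elim (auto simp: X'_def cl_def)
  ultimately show ?thesis
    using that[OF L(1) comp] X'_borel by (auto simp: flow_data_def)
qed

section \<open>Approximating fields with Borel data\<close>

definition approx_data :: "real \<Rightarrow> real \<Rightarrow> real \<Rightarrow> real \<Rightarrow> (real \<Rightarrow> 'a::euclidean_space \<Rightarrow> 'a) \<Rightarrow> (real \<Rightarrow> 'a \<Rightarrow> 'a \<Rightarrow> 'a) \<Rightarrow> bool" where
  "approx_data T C3 \<eta> C v D \<longleftrightarrow>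
     joint_borel v \<and> (\<forall>i\<in>Basis. (\<lambda>(t, x). D t x i) \<in> borel_measurable borel) \<and>
     (\<forall>t x. norm (v t x) \<le> C3) \<and> (\<forall>t x. \<forall>i\<in>Basis. norm (D t x i) \<le> \<eta>) \<and> (\<forall>t x. \<bar>trace_div (D t x)\<bar> \<le> C) \<and>
     (AE t in lborel. t \<in> {0<..<T} \<longrightarrow> continuous_on UNIV (v t) \<and> weak_gradient (v t) (D t))"

lemma mollify_joint_measurable:
  fixes v :: "real \<Rightarrow> 'a::euclidean_space \<Rightarrow> 'b::euclidean_space"
  assumes v: "joint_borel v" and \<tau>: "\<tau> > 0"
  shows "(\<lambda>(t, x). mollify \<tau> (v t) x) \<in> borel_measurable borel"
proof -
  have v': "case_prod v \<in> borel_measurable (borel \<Otimes>\<^sub>M borel)"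
    using v by (simp add: borel_prod)
  have [measurable]: "(\<lambda>w. v (fst (fst w)) (snd w)) \<in> borel_measurable ((borel \<Otimes>\<^sub>M borel) \<Otimes>\<^sub>M borel)"
    using v' by measurable
  have "(\<lambda>(z, y). scaled_kernel \<tau> (y - snd z) *\<^sub>R v (fst z) y) \<in> borel_measurable ((borel \<Otimes>\<^sub>M borel) \<Otimes>\<^sub>M lborel)"
    unfolding case_prod_beta by measurable
  then have "(\<lambda>z. LINT y|lborel. scaled_kernel \<tau> (y - snd z) *\<^sub>R v (fst z) y) \<in> borel_measurable (borel \<Otimes>\<^sub>M borel)"
    by (rule lborel.borel_measurable_lebesgue_integral)
  moreover have "mollify \<tau> (v t) x = (LINT y|lborel. scaled_kernel \<tau> (y - x) *\<^sub>R v t y)" for t x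
  proof -
    have "(\<lambda>y. scaled_kernel \<tau> (y - x) *\<^sub>R v t y) \<in> borel_measurable lborel"
      using section_measurable(1)[OF v, of t] by measurable
    then show ?thesis
      unfolding mollify_def conv_def by (rule integral_completion)
  qed
  ultimately show ?thesis
    by (simp add: borel_prod case_prod_beta')
qed

lemma Linf_norm_AE:
  assumes "Linf_norm T f \<le> ennreal c" "c \<ge> 0"
  shows "AE t in lborel. t \<in> {0<..<T} \<longrightarrow> (AE x in lborel. norm (f t x) \<le> c)"
proof -
  have "AE z in space_time T. (case z of (t, x) \<Rightarrow> ennreal (norm (f t x))) \<le> esssup (space_time T) (\<lambda>(t, x). ennreal (norm (f t x)))"
    by (rule esssup_AE)
  then have "AE z in space_time T. norm (f (fst z) (snd z)) \<le> c"
  proof eventually_elim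
    case (elim z)
    then have "ennreal (norm (f (fst z) (snd z))) \<le> Linf_norm T f"
      by (simp add: Linf_norm_def case_prod_beta)
    also have "\<dots> \<le> ennreal c" by (rule assms(1))
    finally show ?case using assms(2) by (simp add: ennreal_le_iff)
  qed
  from AE_space_timeD[OF this] show ?thesis by simp
qed

lemma L1_L1_norm_eq:
  fixes f f' :: "real \<Rightarrow> 'a::euclidean_space \<Rightarrow> 'b::euclidean_space"
  assumes f': "joint_borel f'"
    and ae: "AE t in lborel. t \<in> {0<..<T} \<longrightarrow> (AE x in lborel. f t x = f' t x)"
  shows "L1_Lp_norm T 1 f = (\<integral>\<^sup>+t. indicator {0<..<T} t * (\<integral>\<^sup>+x. ennreal (norm (f' t x)) \<partial>lborel) \<partial>lborel)"
proof -
  have Lp1: "Lp_norm 1 g = (\<integral>\<^sup>+x. ennreal (norm (g x)) \<partial>lborel)" for g :: "'a \<Rightarrow> 'b"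
  proof -
    have "(\<integral>\<^sup>+x. ennreal (norm (g x) powr 1) \<partial>lebesgue) = (\<integral>\<^sup>+x. ennreal (norm (g x)) \<partial>lborel)"
      by (simp add: nn_integral_completion)
    then show ?thesis
      by (auto simp: Lp_norm_def Let_def less_top)
  qed
  have "L1_Lp_norm T 1 f = (\<integral>\<^sup>+t. Lp_norm 1 (f t) * indicator {0<..<T} t \<partial>lborel)"
    unfolding L1_Lp_norm_def by (subst nn_integral_restrict_space) (auto simp: nn_integral_completion)
  also have "\<dots> = (\<integral>\<^sup>+t. indicator {0<..<T} t * (\<integral>\<^sup>+x. ennreal (norm (f' t x)) \<partial>lborel) \<partial>lborel)"
  proof (rule nn_integral_cong_AE)
    show "AE t in lborel. Lp_norm 1 (f t) * indicator {0<..<T} t = indicator {0<..<T} t * (\<integral>\<^sup>+x. ennreal (norm (f' t x)) \<partial>lborel)"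
      using ae
    proof eventually_elim
      case (elim t)
      have "(\<integral>\<^sup>+x. ennreal (norm (f t x)) \<partial>lborel) = (\<integral>\<^sup>+x. ennreal (norm (f' t x)) \<partial>lborel)" if "t \<in> {0<..<T}"
      proof (rule nn_integral_cong_AE)
        show "AE x in lborel. ennreal (norm (f t x)) = ennreal (norm (f' t x))"
          using elim[rule_format, OF that] by eventually_elim simp
      qed
      then show ?case by (auto simp: Lp1 indicator_def)
    qed
  qed
  finally show ?thesis .
qed

lemma continuous_AE_le:
  fixes f :: "'a::euclidean_space \<Rightarrow> 'b::euclidean_space"
  assumes f: "continuous_on UNIV f" and li: "locally_integrable f" and ae: "AE x in lborel. norm (f x) \<le> c"
  shows "norm (f x) \<le> c"
proof -
  have "((\<lambda>\<tau>. norm (mollify \<tau> f x)) \<longlongrightarrow> norm (f x)) (at_right 0)"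
    by (intro tendsto_norm mollify_tendsto_continuous f li)
  then show ?thesis
  proof (rule tendsto_upperbound)
    have ae': "AE x in lebesgue. norm (f x) \<le> c"
      using ae by (simp only: AE_completion_iff)
    have "norm (mollify \<tau> f x) \<le> c" if "\<tau> > 0" for \<tau>
    proof -
      have "AE y in lebesgue. y \<in> cbox x (x + \<tau> *\<^sub>R One) \<longrightarrow> norm (f y - 0) \<le> c"
        using ae' by eventually_elim simp
      from mollify_close[OF that li this] show ?thesis by simp
    qed
    then show "\<forall>\<^sub>F \<tau> in at_right 0. norm (mollify \<tau> f x) \<le> c"
      by (auto simp: eventually_at_right_field intro!: exI[of _ 1])
  qed simp
qed

text \<open>The scheme evaluates the field at points, so \<open>v\<close> must equal the continuous
  representative at every \<open>x\<close> for almost every time, and it must also be jointly Borel.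
  Both are achieved by taking the limit of the mollifications of a Borel version: mollification
  ignores null sets, and at continuous fields it converges everywhere.\<close>

lemma approx_data_exists:
  fixes b b' :: "real \<Rightarrow> 'a::euclidean_space \<Rightarrow> 'a" and T C1 C2 C3 \<beta> \<epsilon> :: real
  assumes appr: "approximating_sequence T b b\<epsilon> C0 C1 C2 C3 \<alpha> \<beta>" and \<epsilon>: "\<epsilon> > 0" and C: "C1 > 0" "C2 > 0" "C3 > 0"
    and b'[measurable]: "joint_borel b'"
    and N: "N \<in> sets borel" "emeasure lborel N = 0"
    and eq: "\<And>t x. t \<in> {0<..<T} \<Longrightarrow> (t, x) \<notin> N \<Longrightarrow> b t x = b' t x"
  obtains v D where "approx_data T C3 (C1 / \<epsilon> powr \<beta>) C2 v D"
    "AE t in lborel. t \<in> {0<..<T} \<longrightarrow> (\<forall>x. b\<epsilon> \<epsilon> t x = v t x)"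
    "L1_distance T v b' \<le> ennreal (C0 * \<epsilon> powr \<alpha>)"
proof -
  let ?\<eta> = "C1 / \<epsilon> powr \<beta>"
  have \<eta>: "?\<eta> \<ge> 0" using C \<epsilon> by simp
  have cont: "AE t in lborel. t \<in> {0<..<T} \<longrightarrow> continuous_on UNIV (b\<epsilon> \<epsilon> t)"
    and L1: "L1_Lp_norm T 1 (\<lambda>t x. b\<epsilon> \<epsilon> t x - b t x) \<le> ennreal (C0 * \<epsilon> powr \<alpha>)"
    and Li: "Linf_norm T (b\<epsilon> \<epsilon>) \<le> ennreal C3"
    using appr \<epsilon> by (auto simp: approximating_sequence_def AE_time_iff)
  obtain Dw where swg: "spatial_weak_gradient T (b\<epsilon> \<epsilon>) Dw"
    and LD: "Linf_norm T (\<lambda>t x. frobenius (Dw t x)) \<le> ennreal ?\<eta>"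
    and Ld: "Linf_norm T (\<lambda>t x. trace_div (Dw t x)) \<le> ennreal C2"
    using appr \<epsilon> by (auto simp: approximating_sequence_def)
  obtain v0 D0 N0 where v0: "joint_borel v0"
    and D0: "\<And>i. i \<in> Basis \<Longrightarrow> (\<lambda>(t, x). D0 t x i) \<in> borel_measurable borel"
    and N0: "N0 \<in> sets borel" "emeasure lborel N0 = 0"
    and eqv: "\<And>t x. t \<in> {0<..<T} \<Longrightarrow> (t, x) \<notin> N0 \<Longrightarrow> b\<epsilon> \<epsilon> t x = v0 t x"
    and eqD: "\<And>t x i. t \<in> {0<..<T} \<Longrightarrow> (t, x) \<notin> N0 \<Longrightarrow> i \<in> Basis \<Longrightarrow> Dw t x i = D0 t x i"
    and wg: "AE t in lborel. t \<in> {0<..<T} \<longrightarrow> weak_gradient (b\<epsilon> \<epsilon> t) (Dw t)"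
    using swg by (rule spatial_weak_gradient_representative) (rule that; assumption)
  define \<tau> where "\<tau> n = inverse (real (Suc n))" for n
  have \<tau>: "\<tau> n > 0" for n by (simp add: \<tau>_def)
  have \<tau>0: "filterlim \<tau> (at_right 0) sequentially"
    unfolding \<tau>_def by (intro tendsto_imp_filterlim_at_right LIMSEQ_inverse_real_of_nat) auto
  define v1 where "v1 t x = lim (\<lambda>n. mollify (\<tau> n) (v0 t) x)" for t x
  have v1_borel: "joint_borel v1"
    using mollify_joint_measurable[OF v0 \<tau>] unfolding v1_def case_prod_beta
    by (intro borel_measurable_lim_metric) auto
  define v where "v t x = (if norm (v1 t x) \<le> C3 then v1 t x else 0)" for t x
  have v_borel: "joint_borel v"
    using v1_borel unfolding v_def case_prod_beta by measurable
  \<comment> \<open>The gradient is set to 0 where one of the bounds fails; for almost every time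
    this changes it on a null set only, and the bounds then hold everywhere.\<close>
  define ok where "ok t x \<longleftrightarrow> (\<forall>i\<in>Basis. norm (D0 t x i) \<le> ?\<eta>) \<and> \<bar>trace_div (D0 t x)\<bar> \<le> C2" for t x
  define D where "D t x i = (if ok t x then D0 t x i else 0)" for t x i
  have D_borel: "(\<lambda>(t, x). D t x i) \<in> borel_measurable borel" if "i \<in> Basis" for i
  proof -
    have [measurable]: "(\<lambda>z. D0 (fst z) (snd z) j) \<in> borel_measurable borel" if "j \<in> Basis" for j
      using D0[OF that] by (simp add: case_prod_beta')
    have m: "Measurable.pred borel (\<lambda>z. ok (fst z) (snd z))"
      unfolding ok_def trace_div_def by (intro pred_intros_logic pred_intros_finite finite_Basis) measurable
    then show ?thesis
      using D0[OF that] unfolding D_def case_prod_beta' by measurable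
  qed
  have AEN0: "AE t in lborel. AE x in lborel. (t, x) \<notin> N0"
    by (rule null_section_AE[OF N0])
  have AEN: "AE t in lborel. AE x in lborel. (t, x) \<notin> N"
    by (rule null_section_AE[OF N])
  have main: "AE t in lborel. t \<in> {0<..<T} \<longrightarrow> (\<forall>x. b\<epsilon> \<epsilon> t x = v t x)"
    using cont wg AEN0 Linf_norm_AE[OF Li less_imp_le[OF C(3)]]
  proof eventually_elim
    case (elim t)
    note ae = elim(3)
    show ?case
    proof (intro impI allI)
      fix x assume t: "t \<in> {0<..<T}"
      have c: "continuous_on UNIV (b\<epsilon> \<epsilon> t)" and w: "weak_gradient (b\<epsilon> \<epsilon> t) (Dw t)"
        and bd: "AE x in lborel. norm (b\<epsilon> \<epsilon> t x) \<le> C3"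
        using elim t by auto
      have li: "locally_integrable (b\<epsilon> \<epsilon> t)" using w by (simp add: weak_gradient_def)
      have [measurable]: "v0 t \<in> borel_measurable borel" by (rule section_measurable(1)[OF v0])
      have bm[measurable]: "b\<epsilon> \<epsilon> t \<in> borel_measurable borel" by (rule borel_measurable_continuous_onI[OF c])
      have "mollify (\<tau> n) (v0 t) x = mollify (\<tau> n) (b\<epsilon> \<epsilon> t) x" for n
      proof -
        have "(LINT y|lborel. scaled_kernel (\<tau> n) (y - x) *\<^sub>R v0 t y) = (LINT y|lborel. scaled_kernel (\<tau> n) (y - x) *\<^sub>R b\<epsilon> \<epsilon> t y)"
        proof (rule integral_cong_AE)
          show "AE y in lborel. scaled_kernel (\<tau> n) (y - x) *\<^sub>R v0 t y = scaled_kernel (\<tau> n) (y - x) *\<^sub>R b\<epsilon> \<epsilon> t y"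
            using ae by eventually_elim (use eqv t in simp)
        qed measurable
        then show ?thesis
          unfolding mollify_def conv_def by (subst (1 2) integral_completion) measurable
      qed
      then have "(\<lambda>n. mollify (\<tau> n) (v0 t) x) \<longlonglongrightarrow> b\<epsilon> \<epsilon> t x"
        using filterlim_compose[OF mollify_tendsto_continuous[OF c li, of x] \<tau>0] by simp
      then have "v1 t x = b\<epsilon> \<epsilon> t x"
        unfolding v1_def by (rule limI)
      then show "b\<epsilon> \<epsilon> t x = v t x"
        using continuous_AE_le[OF c li bd, of x] by (simp add: v_def)
    qed
  qed
  have "approx_data T C3 ?\<eta> C2 v D"
    unfolding approx_data_def
  proof (intro conjI allI ballI)
    show "norm (v t x) \<le> C3" for t x using C by (simp add: v_def)
    show "norm (D t x i) \<le> ?\<eta>" if "i \<in> Basis" for t x i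
      using that \<eta> by (simp add: D_def ok_def)
    show "\<bar>trace_div (D t x)\<bar> \<le> C2" for t x
    proof (cases "ok t x")
      case True
      then have "trace_div (D t x) = trace_div (D0 t x)" by (simp add: D_def trace_div_def)
      then show ?thesis using True by (simp add: ok_def)
    next
      case False
      then have "trace_div (D t x) = 0" by (simp add: D_def trace_div_def)
      then show ?thesis using C by simp
    qed
    show "AE t in lborel. t \<in> {0<..<T} \<longrightarrow> continuous_on UNIV (v t) \<and> weak_gradient (v t) (D t)"
      using main cont wg AEN0 Linf_norm_AE[OF LD \<eta>] Linf_norm_AE[OF Ld less_imp_le[OF C(2)]]
    proof eventually_elim
      case (elim t)
      note ae = elim(4) and fr = elim(5) and tr = elim(6)
      show ?case
      proof
        assume t: "t \<in> {0<..<T}"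
        have vb: "v t = b\<epsilon> \<epsilon> t" using elim(1) t by (auto intro!: ext)
        have fr': "AE x in lborel. norm (frobenius (Dw t x)) \<le> ?\<eta>" using fr t by simp
        have tr': "AE x in lborel. norm (trace_div (Dw t x)) \<le> C2" using tr t by simp
        have "weak_gradient (v t) (D t)"
        proof (rule weak_gradient_cong_AE)
          show "weak_gradient (b\<epsilon> \<epsilon> t) (Dw t)" using elim t by auto
          show "AE x in lborel. b\<epsilon> \<epsilon> t x = v t x" by (simp add: vb)
          show "v t \<in> borel_measurable borel" by (rule section_measurable(1)[OF v_borel])
          fix i :: 'a assume i: "i \<in> Basis"
          show "(\<lambda>x. D t x i) \<in> borel_measurable borel" by (rule section_measurable(1)[OF D_borel[OF i]])
          show "AE x in lborel. Dw t x i = D t x i"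
            using ae fr' tr'
          proof eventually_elim
            case (elim x)
            have eqs: "\<And>j. j \<in> Basis \<Longrightarrow> Dw t x j = D0 t x j" using eqD[OF t elim(1)] .
            have "norm (D0 t x j) \<le> ?\<eta>" if j: "j \<in> Basis" for j
            proof -
              have "(norm (Dw t x j))\<^sup>2 \<le> (\<Sum>i\<in>Basis. (norm (Dw t x i))\<^sup>2)"
                by (rule member_le_sum) (use j in auto)
              then have "norm (Dw t x j) \<le> frobenius (Dw t x)"
                unfolding frobenius_def by (rule real_le_rsqrt)
              then show ?thesis using elim(2) eqs[OF j] by simp
            qed
            moreover have "trace_div (D0 t x) = trace_div (Dw t x)"
              using eqs by (simp add: trace_div_def)
            ultimately have "ok t x" using elim(3) by (simp add: ok_def)
            then show ?case using eqs[OF i] by (simp add: D_def)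
          qed
        qed
        then show "continuous_on UNIV (v t) \<and> weak_gradient (v t) (D t)"
          using elim(2) t by (simp add: vb)
      qed
    qed
  qed (use v_borel D_borel in auto)
  moreover have "L1_distance T v b' \<le> ennreal (C0 * \<epsilon> powr \<alpha>)"
  proof -
    have "L1_Lp_norm T 1 (\<lambda>t x. b\<epsilon> \<epsilon> t x - b t x) = L1_distance T v b'"
    proof (rule L1_L1_norm_eq)
      show "(\<lambda>(t, x). v t x - b' t x) \<in> borel_measurable borel"
        using v_borel b' unfolding case_prod_beta by measurable
      show "AE t in lborel. t \<in> {0<..<T} \<longrightarrow> (AE x in lborel. b\<epsilon> \<epsilon> t x - b t x = v t x - b' t x)"
        using main AEN
      proof eventually_elim
        case (elim t)
        note ae = elim(2) and m = elim(1)
        show ?case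
        proof
          assume t: "t \<in> {0<..<T}"
          show "AE x in lborel. b\<epsilon> \<epsilon> t x - b t x = v t x - b' t x"
            using ae by eventually_elim (use m t eq in simp)
        qed
      qed
    qed
    then show ?thesis using L1 by simp
  qed
  ultimately show ?thesis using that main by blast
qed

section \<open>Averages over time steps\<close>

text \<open>Half-open intervals make the cells of the grid disjoint, so that integrals over
  consecutive steps add up; the Borel integral takes the place of the Lebesgue integral in
  \<open>average\<close>.\<close>

definition time_avg :: "real \<Rightarrow> real \<Rightarrow> (real \<Rightarrow> 'b::euclidean_space) \<Rightarrow> 'b" where
  "time_avg a b F = (1 / (b - a)) *\<^sub>R (LINT s|lborel. indicator {a<..b} s *\<^sub>R F s)"

lemma bounded_time_integrable:
  fixes F :: "real \<Rightarrow> 'b::euclidean_space"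
  assumes [measurable]: "F \<in> borel_measurable borel" and K: "\<And>s. norm (F s) \<le> K"
  shows "integrable lborel (\<lambda>s. indicator {a<..b} s *\<^sub>R F s)"
proof (rule Bochner_Integration.integrable_bound)
  show "integrable lborel (\<lambda>s. indicator {a..b} s *\<^sub>R K)"
    by (intro borel_integrable_compact compact_Icc continuous_on_const)
  show "AE s in lborel. norm (indicator {a<..b} s *\<^sub>R F s) \<le> norm (indicator {a..b} s *\<^sub>R K)"
    using K by (auto simp: indicator_def intro: order_trans[OF _ abs_ge_self])
qed measurable

lemma time_avg_norm_le:
  fixes F :: "real \<Rightarrow> 'b::euclidean_space"
  assumes ab: "a < b" and F: "AE s in lborel. s \<in> {a<..b} \<longrightarrow> norm (F s) \<le> K"
    and int: "integrable lborel (\<lambda>s. indicator {a<..b} s *\<^sub>R F s)"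
  shows "norm (time_avg a b F) \<le> K"
proof -
  have ind: "integrable lborel (\<lambda>s. indicator {a<..b} s * K)"
    using bounded_time_integrable[of "\<lambda>_. K" "\<bar>K\<bar>" a b] by simp
  have "norm (LINT s|lborel. indicator {a<..b} s *\<^sub>R F s) \<le> (LINT s|lborel. norm (indicator {a<..b} s *\<^sub>R F s))"
    by (rule integral_norm_bound)
  also have "\<dots> \<le> (LINT s|lborel. indicator {a<..b} s * K)"
  proof (rule integral_mono_AE[OF integrable_norm[OF int] ind])
    show "AE s in lborel. norm (indicator {a<..b} s *\<^sub>R F s) \<le> indicator {a<..b} s * K"
      using F by eventually_elim (auto simp: indicator_def)
  qed
  also have "\<dots> = (b - a) * K"
    using ab by simp
  finally show ?thesis
    using ab by (simp add: time_avg_def field_simps)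
qed

lemma average_eq_time_avg:
  fixes f F :: "real \<Rightarrow> 'a::euclidean_space"
  assumes [measurable]: "F \<in> borel_measurable borel" and eq: "AE s in lborel. s \<in> {0<..<T} \<longrightarrow> f s = F s"
    and ab: "0 \<le> a" "b \<le> T"
  shows "average a b f = time_avg a b F"
proof -
  have "AE s in lborel. indicator {a<..b} s *\<^sub>R F s = indicator {a..b} s *\<^sub>R f s"
    using eq AE_lborel_singleton[of T] AE_lborel_singleton[of a] AE_lborel_singleton[of "0::real"]
    by eventually_elim (use ab in \<open>auto simp: indicator_def\<close>)
  then have ae: "AE s in lebesgue. indicator {a<..b} s *\<^sub>R F s = indicator {a..b} s *\<^sub>R f s"
    by (simp only: AE_completion_iff)
  have m: "(\<lambda>s. indicator {a<..b} s *\<^sub>R F s) \<in> borel_measurable lborel" by measurable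
  then have m': "(\<lambda>s. indicator {a<..b} s *\<^sub>R F s) \<in> borel_measurable lebesgue"
    by (rule measurable_completion)
  have "(LINT s|lborel. indicator {a<..b} s *\<^sub>R F s) = (LINT s|lebesgue. indicator {a<..b} s *\<^sub>R F s)"
    by (rule integral_completion[OF m, symmetric])
  also have "\<dots> = (LINT s|lebesgue. indicator {a..b} s *\<^sub>R f s)"
    by (rule integral_cong_AE[OF m' borel_measurable_AE[OF m' ae] ae])
  finally show ?thesis
    by (simp add: average_def time_avg_def set_lebesgue_integral_def)
qed

lemma test_function_integrable:
  fixes \<phi> :: "'a::euclidean_space \<Rightarrow> real"
  assumes "test_function \<phi>"
  shows "integrable lborel \<phi>"
proof -
  obtain R where R: "R > 0" "\<And>x. norm x \<ge> R \<Longrightarrow> \<phi> x = 0"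
    using test_function_bounded_support[OF assms] by blast
  have "integrable lborel (\<lambda>x. indicator (cball 0 R) x *\<^sub>R \<phi> x)"
    by (intro borel_integrable_compact compact_cball test_function_continuous assms)
  moreover have "(\<lambda>x. indicator (cball 0 R) x *\<^sub>R \<phi> x) = \<phi>"
    using R(2) by (auto simp: indicator_def fun_eq_iff)
  ultimately show ?thesis by simp
qed

lemma bounded_locally_integrable:
  fixes f :: "'a::euclidean_space \<Rightarrow> 'b::euclidean_space"
  assumes [measurable]: "f \<in> borel_measurable borel" and K: "\<And>x. norm (f x) \<le> K"
  shows "locally_integrable f"
  unfolding locally_integrable_def set_integrable_def
proof (intro allI impI)
  fix S :: "'a set" assume S: "compact S"
  then have [measurable]: "S \<in> sets borel" by (rule borel_compact)
  have "integrable lborel (\<lambda>x. indicator S x *\<^sub>R f x)"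
  proof (rule Bochner_Integration.integrable_bound)
    show "integrable lborel (\<lambda>x. indicator S x *\<^sub>R K)"
      by (intro borel_integrable_compact S continuous_on_const)
    show "AE x in lborel. norm (indicator S x *\<^sub>R f x) \<le> norm (indicator S x *\<^sub>R K)"
      using K by (auto simp: indicator_def intro: order_trans[OF _ abs_ge_self])
  qed measurable
  then show "integrable lebesgue (\<lambda>x. indicator S x *\<^sub>R f x)"
    by (subst integrable_completion) auto
qed

lemma time_avg_measurable:
  fixes F :: "real \<Rightarrow> 'a::euclidean_space \<Rightarrow> 'b::euclidean_space"
  assumes F: "joint_borel F"
  shows "(\<lambda>x. time_avg a b (\<lambda>s. F s x)) \<in> borel_measurable borel"
proof -
  have [measurable]: "case_prod F \<in> borel_measurable (borel \<Otimes>\<^sub>M borel)"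
    using F by (simp add: borel_prod)
  have "(\<lambda>(x, s). indicator {a<..b} s *\<^sub>R F s x) \<in> borel_measurable (borel \<Otimes>\<^sub>M lborel)"
    by measurable
  then have "(\<lambda>x. LINT s|lborel. indicator {a<..b} s *\<^sub>R F s x) \<in> borel_measurable borel"
    by (rule lborel.borel_measurable_lebesgue_integral)
  then show ?thesis unfolding time_avg_def by measurable
qed

lemma time_avg_Fubini:
  fixes F :: "real \<Rightarrow> 'a::euclidean_space \<Rightarrow> 'b::euclidean_space" and \<psi> :: "'a \<Rightarrow> real"
  assumes F: "joint_borel F" and K: "\<And>s x. norm (F s x) \<le> K"
    and \<psi>: "integrable lborel \<psi>"
  shows "(LINT x|lborel. \<psi> x *\<^sub>R time_avg a b (\<lambda>s. F s x)) = time_avg a b (\<lambda>s. LINT x|lborel. \<psi> x *\<^sub>R F s x)"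
proof -
  have [measurable]: "case_prod F \<in> borel_measurable (borel \<Otimes>\<^sub>M borel)"
    using F by (simp add: borel_prod)
  have [measurable]: "\<psi> \<in> borel_measurable borel" using \<psi> by (auto dest: borel_measurable_integrable)
  have sec[measurable]: "F s \<in> borel_measurable borel" for s by (rule section_measurable(1)[OF F])
  define H where "H s x = indicator {a<..b} s *\<^sub>R (\<psi> x *\<^sub>R F s x)" for s x
  have Hm: "case_prod H \<in> borel_measurable (lborel \<Otimes>\<^sub>M lborel)"
    unfolding H_def by measurable
  have K0: "K \<ge> 0" using order_trans[OF norm_ge_zero K] .
  have bd: "norm (\<psi> x *\<^sub>R F s x) \<le> norm (K * \<psi> x)" for s x
    using mult_left_mono[OF K[of s x], of "\<bar>\<psi> x\<bar>"] K0 by (simp add: abs_mult mult.commute)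
  have int1: "integrable lborel (\<lambda>x. \<psi> x *\<^sub>R F s x)" for s
    by (rule Bochner_Integration.integrable_bound[OF integrable_mult_right[OF \<psi>, of K]]) (use bd in auto)
  have "integrable (lborel \<Otimes>\<^sub>M lborel) (case_prod H)"
  proof (rule lborel_pair.Fubini_integrable[OF Hm])
    show "AE s in lborel. integrable lborel (\<lambda>x. case_prod H (s, x))"
      using int1 by (auto simp: H_def simp del: scaleR_scaleR intro!: AE_I2 integrable_scaleR_right)
    show "integrable lborel (\<lambda>s. LINT x|lborel. norm (case_prod H (s, x)))"
    proof (rule Bochner_Integration.integrable_bound)
      show "integrable lborel (\<lambda>s. indicator {a..b} s *\<^sub>R (K * (LINT x|lborel. \<bar>\<psi> x\<bar>)))"
        by (intro borel_integrable_compact compact_Icc continuous_on_const)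
      have "(\<lambda>(s, x). norm (H s x)) \<in> borel_measurable (lborel \<Otimes>\<^sub>M lborel)"
        using Hm by measurable
      from lborel.borel_measurable_lebesgue_integral[OF this]
      show "(\<lambda>s. LINT x|lborel. norm (case_prod H (s, x))) \<in> borel_measurable lborel" by simp
      have "norm (LINT x|lborel. norm (case_prod H (s, x))) \<le> norm (indicator {a..b} s *\<^sub>R (K * (LINT x|lborel. \<bar>\<psi> x\<bar>)))" for s
      proof (cases "s \<in> {a<..b}")
        case True
        have "(LINT x|lborel. norm (\<psi> x *\<^sub>R F s x)) \<le> (LINT x|lborel. K * \<bar>\<psi> x\<bar>)"
          using bd K0 by (intro integral_mono integrable_norm int1 integrable_mult_right integrable_abs \<psi>) (simp add: abs_mult)
        then show ?thesis
          using True K0 by (simp add: H_def)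
      qed (simp add: H_def)
      then show "AE s in lborel. norm (LINT x|lborel. norm (case_prod H (s, x))) \<le> norm (indicator {a..b} s *\<^sub>R (K * (LINT x|lborel. \<bar>\<psi> x\<bar>)))"
        by simp
    qed
  qed
  from lborel_pair.Fubini_integral[OF this]
  have "(LINT x|lborel. LINT s|lborel. H s x) = (LINT s|lborel. LINT x|lborel. H s x)" .
  moreover have "(LINT s|lborel. H s x) = \<psi> x *\<^sub>R (LINT s|lborel. indicator {a<..b} s *\<^sub>R F s x)" for x
    unfolding H_def scaleR_left_commute[of _ "\<psi> x"] by (rule integral_scaleR_right)
  moreover have "(LINT x|lborel. H s x) = indicator {a<..b} s *\<^sub>R (LINT x|lborel. \<psi> x *\<^sub>R F s x)" for s
    unfolding H_def by (rule integral_scaleR_right)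
  ultimately have eq: "(LINT x|lborel. \<psi> x *\<^sub>R (LINT s|lborel. indicator {a<..b} s *\<^sub>R F s x))
      = (LINT s|lborel. indicator {a<..b} s *\<^sub>R (LINT x|lborel. \<psi> x *\<^sub>R F s x))"
    by simp
  have "(LINT x|lborel. \<psi> x *\<^sub>R time_avg a b (\<lambda>s. F s x))
      = (LINT x|lborel. (1 / (b - a)) *\<^sub>R (\<psi> x *\<^sub>R (LINT s|lborel. indicator {a<..b} s *\<^sub>R F s x)))"
    unfolding time_avg_def by (rule Bochner_Integration.integral_cong[OF refl scaleR_left_commute])
  also have "\<dots> = (1 / (b - a)) *\<^sub>R (LINT x|lborel. \<psi> x *\<^sub>R (LINT s|lborel. indicator {a<..b} s *\<^sub>R F s x))"
    by (rule integral_scaleR_right)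
  finally show ?thesis
    unfolding eq time_avg_def .
qed

text \<open>Fubini exchanges the time average with integration against a test function, so the
  averaged weak gradients form a weak gradient of the average. The bounds survive because a mean of
  bounded quantities obeys the same bound.\<close>

lemma approx_data_time_avg:
  fixes v :: "real \<Rightarrow> 'a::euclidean_space \<Rightarrow> 'a" and T C3 \<eta> C :: real
  assumes data: "approx_data T C3 \<eta> C v D" and ab: "0 \<le> a" "a < b" "b \<le> T"
  defines "w \<equiv> \<lambda>x. time_avg a b (\<lambda>s. v s x)"
  shows "norm (w x - w y) \<le> DIM('a) * \<eta> * norm (x - y)"
    and "\<exists>D'. weak_gradient w D' \<and> (\<forall>x. \<forall>i\<in>Basis. norm (D' x i) \<le> \<eta>) \<and> (\<forall>x. \<bar>trace_div (D' x)\<bar> \<le> C)"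
proof -
  have v: "joint_borel v" and D: "\<And>i. i \<in> Basis \<Longrightarrow> (\<lambda>(t, x). D t x i) \<in> borel_measurable borel"
    and vb: "\<And>t x. norm (v t x) \<le> C3" and Db: "\<And>t x i. i \<in> Basis \<Longrightarrow> norm (D t x i) \<le> \<eta>" and tr: "\<And>t x. \<bar>trace_div (D t x)\<bar> \<le> C"
    and wg: "AE t in lborel. t \<in> {0<..<T} \<longrightarrow> continuous_on UNIV (v t) \<and> weak_gradient (v t) (D t)"
    using data by (auto simp: approx_data_def)
  have vx: "(\<lambda>s. v s x) \<in> borel_measurable borel" for x by (rule section_measurable(2)[OF v])
  have intv: "integrable lborel (\<lambda>s. indicator {a<..b} s *\<^sub>R v s x)" for x
    by (rule bounded_time_integrable[OF vx vb])
  have wg': "AE t in lborel. t \<in> {a<..b} \<longrightarrow> continuous_on UNIV (v t) \<and> weak_gradient (v t) (D t)"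
    using wg AE_lborel_singleton[of T] by eventually_elim (use ab in auto)
  show lip: "norm (w x - w y) \<le> DIM('a) * \<eta> * norm (x - y)" for x y
  proof -
    have "w x - w y = time_avg a b (\<lambda>s. v s x - v s y)"
      unfolding w_def time_avg_def scaleR_diff_right[of "indicator _ _"]
      by (simp add: Bochner_Integration.integral_diff[OF intv intv] scaleR_diff_right)
    also have "norm \<dots> \<le> DIM('a) * \<eta> * norm (x - y)"
    proof (rule time_avg_norm_le[OF ab(2)])
      show "AE s in lborel. s \<in> {a<..b} \<longrightarrow> norm (v s x - v s y) \<le> DIM('a) * \<eta> * norm (x - y)"
        using wg'
      proof eventually_elim
        case (elim s)
        then show ?case
          using weak_gradient_bounded_Lipschitz[of "v s" "D s" \<eta> C x y] Db tr by auto
      qed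
      show "integrable lborel (\<lambda>s. indicator {a<..b} s *\<^sub>R (v s x - v s y))"
        unfolding scaleR_diff_right by (intro Bochner_Integration.integrable_diff intv)
    qed
    finally show ?thesis .
  qed
  define D' where "D' x i = time_avg a b (\<lambda>s. D s x i)" for x i
  have Dx: "(\<lambda>s. D s x i) \<in> borel_measurable borel" if "i \<in> Basis" for x i
    by (rule section_measurable(2)[OF D[OF that]])
  have intD: "integrable lborel (\<lambda>s. indicator {a<..b} s *\<^sub>R D s x i)" if "i \<in> Basis" for x i
    by (rule bounded_time_integrable[OF Dx[OF that] Db[OF that]])
  have D'b: "norm (D' x i) \<le> \<eta>" if "i \<in> Basis" for x i
    unfolding D'_def by (rule time_avg_norm_le[OF ab(2) _ intD[OF that]]) (simp add: Db[OF that])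
  have D'm: "(\<lambda>x. D' x i) \<in> borel_measurable borel" if "i \<in> Basis" for i
    unfolding D'_def by (rule time_avg_measurable[OF D[OF that]])
  have wm: "w \<in> borel_measurable borel"
    unfolding w_def by (rule time_avg_measurable[OF v])
  have wb: "norm (w x) \<le> C3" for x
    unfolding w_def by (rule time_avg_norm_le[OF ab(2) _ intv]) (simp add: vb)
  have trace: "\<bar>trace_div (D' x)\<bar> \<le> C" for x
  proof -
    have "trace_div (D' x) = (\<Sum>i\<in>Basis. (1 / (b - a)) * (LINT s|lborel. (indicator {a<..b} s *\<^sub>R D s x i) \<bullet> i))"
      unfolding trace_div_def
    proof (rule sum.cong[OF refl])
      fix i :: 'a assume i: "i \<in> Basis"
      have "(LINT s|lborel. indicator {a<..b} s *\<^sub>R D s x i) \<bullet> i = (LINT s|lborel. (indicator {a<..b} s *\<^sub>R D s x i) \<bullet> i)"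
        by (rule integral_inner_left[symmetric]) (rule intD[OF i])
      then show "D' x i \<bullet> i = (1 / (b - a)) * (LINT s|lborel. (indicator {a<..b} s *\<^sub>R D s x i) \<bullet> i)"
        unfolding D'_def time_avg_def by (subst inner_scaleR_left) (rule arg_cong)
    qed
    also have "\<dots> = (1 / (b - a)) * (LINT s|lborel. (\<Sum>i\<in>Basis. (indicator {a<..b} s *\<^sub>R D s x i) \<bullet> i))"
      unfolding sum_distrib_left[symmetric]
      by (rule arg_cong[of _ _ "(*) (1 / (b - a))"], rule Bochner_Integration.integral_sum[symmetric],
          intro integrable_inner_left intD)
    also have "\<dots> = time_avg a b (\<lambda>s. trace_div (D s x))"
      by (simp only: time_avg_def trace_div_def sum_distrib_left inner_scaleR_left real_scaleR_def)
    finally have "trace_div (D' x) = time_avg a b (\<lambda>s. trace_div (D s x))" .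
    moreover have "norm (time_avg a b (\<lambda>s. trace_div (D s x))) \<le> C"
    proof (rule time_avg_norm_le[OF ab(2)])
      have "integrable lborel (\<lambda>s. \<Sum>i\<in>Basis. (indicator {a<..b} s *\<^sub>R D s x i) \<bullet> i)"
        by (intro Bochner_Integration.integrable_sum integrable_inner_left intD)
      then show "integrable lborel (\<lambda>s. indicator {a<..b} s *\<^sub>R trace_div (D s x))"
        by (simp add: trace_div_def sum_distrib_left)
    qed (simp add: tr)
    ultimately show ?thesis by simp
  qed
  have "weak_gradient w D'"
    unfolding weak_gradient_def
  proof (intro conjI ballI allI impI)
    show "locally_integrable w" by (rule bounded_locally_integrable[OF wm wb])
    fix i :: 'a assume i: "i \<in> Basis"
    show "locally_integrable (\<lambda>x. D' x i)" by (rule bounded_locally_integrable[OF D'm[OF i] D'b[OF i]])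
    fix \<phi> :: "'a \<Rightarrow> real" assume \<phi>: "test_function \<phi>"
    have \<phi>': "test_function (pderiv_dir \<phi> i)" by (rule test_function_pderiv[OF \<phi> i])
    have toborel: "(LINT x|lebesgue. \<psi> x *\<^sub>R f x) = (LINT x|lborel. \<psi> x *\<^sub>R f x)"
      if "test_function \<psi>" "f \<in> borel_measurable borel" for \<psi> and f :: "'a \<Rightarrow> 'a"
    proof -
      note [measurable] = test_function_borel[OF that(1)] that(2)
      show ?thesis by (rule integral_completion) measurable
    qed
    have "(LINT x|lebesgue. pderiv_dir \<phi> i x *\<^sub>R w x) = (LINT x|lborel. pderiv_dir \<phi> i x *\<^sub>R w x)"
      by (rule toborel[OF \<phi>' wm])
    also have "\<dots> = time_avg a b (\<lambda>s. LINT x|lborel. pderiv_dir \<phi> i x *\<^sub>R v s x)"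
      unfolding w_def by (rule time_avg_Fubini[OF v vb test_function_integrable[OF \<phi>']])
    also have "\<dots> = - time_avg a b (\<lambda>s. LINT x|lborel. \<phi> x *\<^sub>R D s x i)"
    proof -
      have meas: "(\<lambda>s. LINT x|lborel. \<psi> x *\<^sub>R F s x) \<in> borel_measurable borel"
        if "test_function \<psi>" "joint_borel F" for \<psi> :: "'a \<Rightarrow> real" and F :: "real \<Rightarrow> 'a \<Rightarrow> 'a"
      proof -
        have [measurable]: "case_prod F \<in> borel_measurable (borel \<Otimes>\<^sub>M borel)" "\<psi> \<in> borel_measurable borel"
          using that test_function_borel by (auto simp: borel_prod)
        have "(\<lambda>(s, x). \<psi> x *\<^sub>R F s x) \<in> borel_measurable (borel \<Otimes>\<^sub>M lborel)" by measurable
        then show ?thesis by (rule lborel.borel_measurable_lebesgue_integral)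
      qed
      note [measurable] = meas[OF \<phi>' v] meas[OF \<phi> D[OF i]]
      have "(LINT s|lborel. indicator {a<..b} s *\<^sub>R (LINT x|lborel. pderiv_dir \<phi> i x *\<^sub>R v s x))
          = (LINT s|lborel. indicator {a<..b} s *\<^sub>R - (LINT x|lborel. \<phi> x *\<^sub>R D s x i))"
      proof (rule integral_cong_AE)
        show "AE s in lborel. indicator {a<..b} s *\<^sub>R (LINT x|lborel. pderiv_dir \<phi> i x *\<^sub>R v s x)
            = indicator {a<..b} s *\<^sub>R - (LINT x|lborel. \<phi> x *\<^sub>R D s x i)"
          using wg'
        proof eventually_elim
          case (elim s)
          show ?case
          proof (cases "s \<in> {a<..b}")
            case True
            then have "weak_gradient (v s) (D s)" using elim by blast
            then have "(LINT x|lebesgue. pderiv_dir \<phi> i x *\<^sub>R v s x) = - (LINT x|lebesgue. \<phi> x *\<^sub>R D s x i)"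
              using \<phi> i by (simp add: weak_gradient_def)
            then show ?thesis
              using toborel[OF \<phi>' section_measurable(1)[OF v, of s]] toborel[OF \<phi> section_measurable(1)[OF D[OF i], of s]] by simp
          qed simp
        qed
      qed measurable
      then show ?thesis by (simp add: time_avg_def)
    qed
    also have "time_avg a b (\<lambda>s. LINT x|lborel. \<phi> x *\<^sub>R D s x i) = (LINT x|lborel. \<phi> x *\<^sub>R D' x i)"
      unfolding D'_def by (rule time_avg_Fubini[OF D[OF i] Db[OF i] test_function_integrable[OF \<phi>], symmetric])
    also have "\<dots> = (LINT x|lebesgue. \<phi> x *\<^sub>R D' x i)"
      by (rule toborel[OF \<phi> D'm[OF i], symmetric])
    finally show "(LINT x|lebesgue. pderiv_dir \<phi> i x *\<^sub>R w x) = - (LINT x|lebesgue. \<phi> x *\<^sub>R D' x i)" .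
  qed
  then show "\<exists>D'. weak_gradient w D' \<and> (\<forall>x. \<forall>i\<in>Basis. norm (D' x i) \<le> \<eta>) \<and> (\<forall>x. \<bar>trace_div (D' x)\<bar> \<le> C)"
    using D'b trace by blast
qed

section \<open>The logarithmic stability estimate\<close>

lemma nn_integral_swap_time:
  fixes H :: "real \<Rightarrow> 'a::euclidean_space \<Rightarrow> ennreal"
  assumes "joint_borel H"
  shows "(\<integral>\<^sup>+x. \<integral>\<^sup>+s. H s x \<partial>lborel \<partial>lborel) = (\<integral>\<^sup>+s. \<integral>\<^sup>+x. H s x \<partial>lborel \<partial>lborel)"
proof -
  have "case_prod H \<in> borel_measurable (lborel \<Otimes>\<^sub>M lborel)"
    using assms by (simp add: lborel_prod)
  from lborel_pair.Fubini'[OF this] show ?thesis by simp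
qed

text \<open>The dichotomy: where the delay \<open>norm (P - Z)\<close> is at most \<open>\<delta>\<close> the Sobolev estimate
  applies, elsewhere the trivial bound \<open>2 B\<close> is paid for by Markov's inequality.\<close>

lemma field_difference_quotient:
  fixes bP bX :: "'a::euclidean_space"
  assumes \<delta>: "\<delta> > 0" and B: "norm bP \<le> B" "norm bX \<le> B" and S: "S \<ge> 0"
    and sob: "ennreal (norm (bP - bX)) \<le> ennreal (S * norm (P - X)) * (m1 + m2)"
  shows "ennreal (norm (bP - bX) / (\<delta> + norm (Z - X))) \<le> ennreal S * (m1 + m2) + ennreal (2 * B / \<delta>\<^sup>2) * ennreal (norm (Z - P))"
proof (cases "norm (Z - P) \<le> \<delta>")
  case True
  have pos: "\<delta> + norm (Z - X) > 0" using \<delta> by (simp add: add_pos_nonneg)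
  have "norm (P - X) \<le> norm (Z - P) + norm (Z - X)"
    using norm_triangle_ineq4[of "Z - X" "Z - P"] by (simp add: algebra_simps)
  then have le: "norm (P - X) / (\<delta> + norm (Z - X)) \<le> 1"
    using True pos by (simp add: divide_le_eq)
  have "ennreal (norm (bP - bX) / (\<delta> + norm (Z - X))) = ennreal (1 / (\<delta> + norm (Z - X))) * ennreal (norm (bP - bX))"
    using pos by (simp add: ennreal_mult[symmetric])
  also have "\<dots> \<le> ennreal (1 / (\<delta> + norm (Z - X))) * (ennreal (S * norm (P - X)) * (m1 + m2))"
    by (intro mult_left_mono sob) simp
  also have "\<dots> = ennreal (S * (norm (P - X) / (\<delta> + norm (Z - X)))) * (m1 + m2)"
    using pos S by (simp add: mult.assoc[symmetric] ennreal_mult[symmetric])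
  also have "\<dots> \<le> ennreal (S * 1) * (m1 + m2)"
    using le S by (intro mult_right_mono ennreal_leI mult_left_mono) auto
  finally show ?thesis by (simp add: add_increasing2)
next
  case False
  have B0: "B \<ge> 0" using B(1) norm_ge_zero order_trans by blast
  have "norm (bP - bX) \<le> 2 * B"
    using B norm_triangle_ineq4[of bP bX] by linarith
  then have "norm (bP - bX) / (\<delta> + norm (Z - X)) \<le> 2 * B / \<delta>"
    using \<delta> B0 by (intro frac_le) auto
  \<comment> \<open>In this case \<open>norm (Z - P) / \<delta>\<close> exceeds 1; inserting it as a
    factor produces the second power of \<open>\<delta>\<close>.\<close>
  also have "\<dots> \<le> 2 * B / \<delta>\<^sup>2 * norm (Z - P)"
  proof -
    have "2 * B / \<delta> = 2 * B / \<delta>\<^sup>2 * \<delta>" using \<delta> by (simp add: power2_eq_square)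
    also have "\<dots> \<le> 2 * B / \<delta>\<^sup>2 * norm (Z - P)"
      using False B0 by (intro mult_left_mono) auto
    finally show ?thesis .
  qed
  finally have "ennreal (norm (bP - bX) / (\<delta> + norm (Z - X))) \<le> ennreal (2 * B / \<delta>\<^sup>2) * ennreal (norm (Z - P))"
    using B0 by (simp add: ennreal_mult[symmetric] ennreal_leI)
  then show ?thesis by (simp add: add_increasing)
qed

section \<open>Paths driven by a field at delayed positions\<close>

definition velocity :: "real \<Rightarrow> (real \<Rightarrow> 'a::euclidean_space \<Rightarrow> 'a) \<Rightarrow> (real \<Rightarrow> 'a \<Rightarrow> 'a) \<Rightarrow> (real \<Rightarrow> 'a \<Rightarrow> 'a) \<Rightarrow> real \<Rightarrow> 'a \<Rightarrow> 'a" where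
  "velocity \<theta> v P Q s x = (1 - \<theta>) *\<^sub>R v s (P s x) + \<theta> *\<^sub>R v s (Q s x)"

text \<open>For the scheme, \<open>P\<close> and \<open>Q\<close> are the current and the next grid
  value as functions of time, and the path meets the scheme at the grid times. Unlike the affine
  interpolation, it is driven by \<open>v\<close> at time \<open>s\<close> itself and not by an
  average over the step, so its velocity can be compared with \<open>b\<close> at equal
  times.\<close>

definition path :: "real \<Rightarrow> (real \<Rightarrow> 'a::euclidean_space \<Rightarrow> 'a) \<Rightarrow> (real \<Rightarrow> 'a \<Rightarrow> 'a) \<Rightarrow> (real \<Rightarrow> 'a \<Rightarrow> 'a) \<Rightarrow> real \<Rightarrow> 'a \<Rightarrow> 'a" where
  "path \<theta> v P Q t x = x + (LINT s|lborel. indicator {0<..t} s *\<^sub>R velocity \<theta> v P Q s x)"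

text \<open>The factor 4 counts maximal functions: one at \<open>P\<close>, one at \<open>Q\<close>,
  and the one at the flow twice.\<close>

definition stability_const :: "'a::euclidean_space itself \<Rightarrow> real \<Rightarrow> real \<Rightarrow> real \<Rightarrow> real" where
  "stability_const _ p r L = 4 * sobolev_const TYPE('a) * (measure lborel (ball (0::'a) r) + maximal_const TYPE('a) p L)"

lemma sobolev_const_nonneg: "sobolev_const TYPE('a::euclidean_space) \<ge> 0"
  using kernel_max_pos[where 'a='a] by (simp add: sobolev_const_def mollified_const_def)

lemma maximal_const_nonneg: "p > 1 \<Longrightarrow> L \<ge> 0 \<Longrightarrow> maximal_const TYPE('a::euclidean_space) p L \<ge> 0"
  using powr_less_mono[of "1 - p" 0 2] by (simp add: maximal_const_def weak_type_const_nonneg)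

lemma stability_const_nonneg: "p > 1 \<Longrightarrow> L \<ge> 0 \<Longrightarrow> stability_const TYPE('a::euclidean_space) p r L \<ge> 0"
  by (simp add: stability_const_def sobolev_const_nonneg maximal_const_nonneg)

locale path_data =
  fixes T p B K L \<theta> C3 r e :: real
    and b v P Q :: "real \<Rightarrow> 'a::euclidean_space \<Rightarrow> 'a" and g :: "real \<Rightarrow> 'a \<Rightarrow> real" and \<kappa> :: "real \<Rightarrow> real"
  assumes T: "T > 0" and p: "p > 1" and B: "B \<ge> 0" and K: "K \<ge> 0" and L: "L \<ge> 1" and \<theta>: "0 \<le> \<theta>" "\<theta> \<le> 1"
    and e0: "e \<ge> 0"
    and field: "field_data T p B K b g \<kappa>"
    and v: "joint_borel v" and vb: "\<And>t x. norm (v t x) \<le> C3"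
    and P: "joint_borel P" "\<And>t. compressible L (P t)"
    and Q: "joint_borel Q" "\<And>t. compressible L (Q t)"
    and close: "L1_distance T v b \<le> ennreal e"
begin

lemma b: "joint_borel b" and bb: "norm (b t x) \<le> B"
  and g: "joint_borel g" and g0: "g t x \<ge> 0"
  and \<kappa>m: "\<kappa> \<in> borel_measurable borel" and \<kappa>0: "\<kappa> t > 0"
  and \<kappa>int: "(\<integral>\<^sup>+t. indicator {0<..<T} t * ennreal (\<kappa> t) \<partial>lborel) \<le> ennreal K"
  using field by (auto simp: field_data_def)

lemma vP: "(\<lambda>(t, x). v t (P t x)) \<in> borel_measurable borel"
  and vQ: "(\<lambda>(t, x). v t (Q t x)) \<in> borel_measurable borel"
  and bP: "(\<lambda>(t, x). b t (P t x)) \<in> borel_measurable borel"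
  and bQ: "(\<lambda>(t, x). b t (Q t x)) \<in> borel_measurable borel"
  by (rule joint_compose; fact v b P Q)+

definition M :: "real \<Rightarrow> 'a \<Rightarrow> ennreal" where
  "M t x = maximal (\<lambda>x. ennreal (g t x)) x"

lemma M: "joint_borel M"
proof -
  have [measurable]: "case_prod g \<in> borel_measurable (borel \<Otimes>\<^sub>M borel)"
    using g by (simp add: borel_prod)
  have "(\<lambda>(z, w). indicator (ball 0 1) w * ennreal (g (fst z) (snd z + \<rho> *\<^sub>R w))) \<in> borel_measurable ((borel \<Otimes>\<^sub>M borel) \<Otimes>\<^sub>M lborel)" for \<rho>
    by measurable
  then have [measurable]: "(\<lambda>z. ball_avg (\<lambda>x. ennreal (g (fst z) x)) \<rho> (snd z)) \<in> borel_measurable (borel \<Otimes>\<^sub>M borel)" for \<rho>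
    unfolding ball_avg_def by (rule lborel.borel_measurable_nn_integral)
  have "(\<lambda>z. M (fst z) (snd z)) \<in> borel_measurable (borel \<Otimes>\<^sub>M borel)"
    unfolding M_def maximal_def by measurable
  then show ?thesis by (simp add: borel_prod case_prod_beta')
qed

abbreviation Z where "Z \<equiv> path \<theta> v P Q"

lemma velocity_measurable: "(\<lambda>(t, x). velocity \<theta> v P Q t x) \<in> borel_measurable borel"
  using vP vQ unfolding velocity_def case_prod_beta' by measurable

lemma velocity_bound: "norm (velocity \<theta> v P Q s x) \<le> C3"
proof -
  have "norm (velocity \<theta> v P Q s x) \<le> (1 - \<theta>) * norm (v s (P s x)) + \<theta> * norm (v s (Q s x))"
    unfolding velocity_def using \<theta> by (intro order_trans[OF norm_triangle_ineq]) auto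
  also have "\<dots> \<le> (1 - \<theta>) * C3 + \<theta> * C3"
    using \<theta> vb by (intro add_mono mult_left_mono) auto
  finally show ?thesis by (simp add: algebra_simps)
qed

lemma velocity_integrable: "integrable lborel (\<lambda>s. indicator {a<..t} s *\<^sub>R velocity \<theta> v P Q s x)"
  by (rule bounded_time_integrable[OF section_measurable(2)[OF velocity_measurable] velocity_bound])

lemma Z_measurable: "joint_borel Z"
proof -
  have [measurable]: "case_prod (velocity \<theta> v P Q) \<in> borel_measurable (borel \<Otimes>\<^sub>M borel)"
    using velocity_measurable by (simp add: borel_prod)
  have eq: "indicator {0<..fst z} s = (if 0 < s \<and> s \<le> fst z then 1 else 0 :: real)" for s and z :: "real \<times> 'a"
    by (auto simp: indicator_def)
  have "(\<lambda>(z, s). indicator {0<..fst z} s *\<^sub>R velocity \<theta> v P Q s (snd z)) \<in> borel_measurable ((borel \<Otimes>\<^sub>M borel) \<Otimes>\<^sub>M lborel)"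
    unfolding eq by measurable
  then have [measurable]: "(\<lambda>z. LINT s|lborel. indicator {0<..fst z} s *\<^sub>R velocity \<theta> v P Q s (snd z)) \<in> borel_measurable (borel \<Otimes>\<^sub>M borel)"
    by (rule lborel.borel_measurable_lebesgue_integral)
  have "(\<lambda>z. Z (fst z) (snd z)) \<in> borel_measurable (borel \<Otimes>\<^sub>M borel)"
    unfolding path_def by measurable
  then show ?thesis by (simp add: borel_prod case_prod_beta')
qed

text \<open>The weights \<open>1 - \<theta>\<close> and \<open>\<theta>\<close> are both replaced by
  1, which makes all later constants independent of \<open>\<theta>\<close>.\<close>

definition excess :: "real \<Rightarrow> 'a \<Rightarrow> real" where
  "excess s x = norm (v s (P s x) - b s (P s x)) + norm (v s (Q s x) - b s (Q s x))"

lemma excess_measurable: "joint_borel excess"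
  using vP vQ bP bQ unfolding excess_def case_prod_beta' by measurable

lemma velocity_le_excess: "norm (velocity \<theta> v P Q s x) \<le> B + excess s x"
proof -
  have eq: "velocity \<theta> v P Q s x = ((1 - \<theta>) *\<^sub>R (v s (P s x) - b s (P s x)) + \<theta> *\<^sub>R (v s (Q s x) - b s (Q s x)))
      + ((1 - \<theta>) *\<^sub>R b s (P s x) + \<theta> *\<^sub>R b s (Q s x))"
    by (simp add: velocity_def algebra_simps)
  have "norm (velocity \<theta> v P Q s x) \<le> (norm ((1 - \<theta>) *\<^sub>R (v s (P s x) - b s (P s x))) + norm (\<theta> *\<^sub>R (v s (Q s x) - b s (Q s x))))
      + (norm ((1 - \<theta>) *\<^sub>R b s (P s x)) + norm (\<theta> *\<^sub>R b s (Q s x)))"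
    unfolding eq by (rule order_trans[OF norm_triangle_ineq add_mono[OF norm_triangle_ineq norm_triangle_ineq]])
  also have "\<dots> = ((1 - \<theta>) * norm (v s (P s x) - b s (P s x)) + \<theta> * norm (v s (Q s x) - b s (Q s x)))
      + ((1 - \<theta>) * norm (b s (P s x)) + \<theta> * norm (b s (Q s x)))"
    using \<theta> by simp
  also have "\<dots> \<le> (1 * norm (v s (P s x) - b s (P s x)) + 1 * norm (v s (Q s x) - b s (Q s x)))
      + ((1 - \<theta>) * B + \<theta> * B)"
    using \<theta> bb by (intro add_mono mult_right_mono mult_left_mono) auto
  also have "\<dots> = B + excess s x"
    by (simp add: excess_def algebra_simps)
  finally show ?thesis .
qed

text \<open>At each time compressibility undoes the composition with \<open>P\<close> and with
  \<open>Q\<close>, so each of the two contributes \<open>L\<close> times the L1 distance of the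
  fields.\<close>

lemma integrated_excess:
  "(\<integral>\<^sup>+x. \<integral>\<^sup>+s. indicator {0<..<T} s * ennreal (excess s x) \<partial>lborel \<partial>lborel) \<le> ennreal (2 * L * e)"
proof -
  define n where "n s = (\<integral>\<^sup>+x. ennreal (norm (v s x - b s x)) \<partial>lborel)" for s
  have [measurable]: "case_prod v \<in> borel_measurable (borel \<Otimes>\<^sub>M borel)" "case_prod b \<in> borel_measurable (borel \<Otimes>\<^sub>M borel)"
    using v b by (auto simp: borel_prod)
  have n[measurable]: "n \<in> borel_measurable borel"
  proof -
    have "(\<lambda>(s, x). ennreal (norm (v s x - b s x))) \<in> borel_measurable (borel \<Otimes>\<^sub>M lborel)" by measurable
    then show ?thesis unfolding n_def by (rule lborel.borel_measurable_nn_integral)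
  qed
  have m: "(\<lambda>(s, x). indicator {0<..<T} s * ennreal (excess s x)) \<in> borel_measurable borel"
  proof -
    have [measurable]: "case_prod excess \<in> borel_measurable (borel \<Otimes>\<^sub>M borel)"
      using excess_measurable by (simp add: borel_prod)
    have "(\<lambda>(s, x). indicator {0<..<T} s * ennreal (excess s x)) \<in> borel_measurable (borel \<Otimes>\<^sub>M borel)" by measurable
    then show ?thesis by (simp add: borel_prod)
  qed
  have "(\<integral>\<^sup>+x. \<integral>\<^sup>+s. indicator {0<..<T} s * ennreal (excess s x) \<partial>lborel \<partial>lborel)
      = (\<integral>\<^sup>+s. \<integral>\<^sup>+x. indicator {0<..<T} s * ennreal (excess s x) \<partial>lborel \<partial>lborel)"
    by (rule nn_integral_swap_time[OF m])
  also have "\<dots> \<le> (\<integral>\<^sup>+s. ennreal (2 * L) * (indicator {0<..<T} s * n s) \<partial>lborel)"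
  proof (rule nn_integral_mono)
    fix s
    note sm = section_measurable(1)
    have [measurable]: "v s \<in> borel_measurable borel" "b s \<in> borel_measurable borel"
      "P s \<in> borel_measurable borel" "Q s \<in> borel_measurable borel"
      by (rule sm, fact v b P Q)+
    have F: "(\<integral>\<^sup>+x. ennreal (norm (v s (F x) - b s (F x))) \<partial>lborel) \<le> ennreal L * n s" if "compressible L F" for F
      unfolding n_def using L by (intro compressible_nn_integral[OF that]) auto
    have "(\<integral>\<^sup>+x. ennreal (excess s x) \<partial>lborel)
        = (\<integral>\<^sup>+x. ennreal (norm (v s (P s x) - b s (P s x))) \<partial>lborel) + (\<integral>\<^sup>+x. ennreal (norm (v s (Q s x) - b s (Q s x))) \<partial>lborel)"
      unfolding excess_def by (subst nn_integral_add[symmetric]) auto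
    also have "\<dots> \<le> ennreal L * n s + ennreal L * n s"
      by (intro add_mono F P Q)
    also have "\<dots> = ennreal (2 * L) * n s"
      using L by (simp add: distrib_right[symmetric] ennreal_plus[symmetric] del: ennreal_plus)
    finally show "(\<integral>\<^sup>+x. indicator {0<..<T} s * ennreal (excess s x) \<partial>lborel) \<le> ennreal (2 * L) * (indicator {0<..<T} s * n s)"
      by (auto simp: indicator_def)
  qed
  also have "\<dots> = ennreal (2 * L) * (\<integral>\<^sup>+s. indicator {0<..<T} s * n s \<partial>lborel)"
    by (rule nn_integral_cmult) measurable
  also have "\<dots> \<le> ennreal (2 * L) * ennreal e"
    using close unfolding n_def by (intro mult_left_mono) auto
  also have "\<dots> = ennreal (2 * L * e)"
    using L e0 by (simp add: ennreal_mult)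
  finally show ?thesis .
qed

text \<open>Only the part bounded by \<open>B\<close> uses the length of the time interval. The
  excess is integrated over all of \<open>{0<..<T}\<close>, a quantity that is small as a whole and
  independent of the interval.\<close>

lemma displacement_le:
  assumes ab: "0 \<le> a" "a \<le> c" "c \<le> T"
  shows "ennreal (norm (LINT s|lborel. indicator {a<..c} s *\<^sub>R velocity \<theta> v P Q s x))
    \<le> ennreal (B * (c - a)) + (\<integral>\<^sup>+s. indicator {0<..<T} s * ennreal (excess s x) \<partial>lborel)"
proof -
  have [measurable]: "(\<lambda>s. excess s x) \<in> borel_measurable borel"
    by (rule section_measurable(2)[OF excess_measurable])
  have ex0: "excess s x \<ge> 0" for s by (simp add: excess_def)
  have "ennreal (norm (LINT s|lborel. indicator {a<..c} s *\<^sub>R velocity \<theta> v P Q s x))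
      \<le> (\<integral>\<^sup>+s. ennreal (norm (indicator {a<..c} s *\<^sub>R velocity \<theta> v P Q s x)) \<partial>lborel)"
    by (rule integral_norm_bound_ennreal[OF velocity_integrable])
  also have "\<dots> \<le> (\<integral>\<^sup>+s. ennreal B * indicator {a<..c} s + indicator {0<..<T} s * ennreal (excess s x) \<partial>lborel)"
  proof (rule nn_integral_mono_AE)
    show "AE s in lborel. ennreal (norm (indicator {a<..c} s *\<^sub>R velocity \<theta> v P Q s x))
        \<le> ennreal B * indicator {a<..c} s + indicator {0<..<T} s * ennreal (excess s x)"
      using AE_lborel_singleton[of T]
    proof eventually_elim
      case (elim s)
      show ?case
      proof (cases "s \<in> {a<..c}")
        case True
        then have "s \<in> {0<..<T}" using ab elim by auto
        moreover have "ennreal (norm (velocity \<theta> v P Q s x)) \<le> ennreal B + ennreal (excess s x)"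
          using velocity_le_excess[of s x] B ex0[of s] by (simp add: ennreal_plus[symmetric] ennreal_leI del: ennreal_plus)
        ultimately show ?thesis using True by simp
      qed simp
    qed
  qed
  also have "\<dots> = ennreal (B * (c - a)) + (\<integral>\<^sup>+s. indicator {0<..<T} s * ennreal (excess s x) \<partial>lborel)"
    using ab B by (simp add: nn_integral_add nn_integral_cmult ennreal_mult)
  finally show ?thesis .
qed

lemma excess_integral_measurable[measurable]:
  "(\<lambda>x. \<integral>\<^sup>+s. indicator {0<..<T} s * ennreal (excess s x) \<partial>lborel) \<in> borel_measurable borel"
proof -
  have [measurable]: "case_prod excess \<in> borel_measurable (borel \<Otimes>\<^sub>M borel)"
    using excess_measurable by (simp add: borel_prod)
  have "(\<lambda>(x, s). indicator {0<..<T} s * ennreal (excess s x)) \<in> borel_measurable (borel \<Otimes>\<^sub>M lborel)" by measurable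
  then show ?thesis by (rule lborel.borel_measurable_nn_integral)
qed

lemma emeasure_ball_r: "emeasure lborel (ball (0::'a) r) = ennreal (measure lborel (ball (0::'a) r))"
  using emeasure_lborel_ball_finite[of "0::'a" r] by (intro emeasure_eq_ennreal_measure) (simp add: less_top)

lemma integrated_displacement:
  assumes ab: "0 \<le> a" "a \<le> c" "c \<le> T"
  shows "(\<integral>\<^sup>+x. indicator (ball 0 r) x * ennreal (norm (LINT s|lborel. indicator {a<..c} s *\<^sub>R velocity \<theta> v P Q s x)) \<partial>lborel)
    \<le> ennreal (B * (c - a) * measure lborel (ball (0::'a) r) + 2 * L * e)"
proof -
  have "(\<integral>\<^sup>+x. indicator (ball 0 r) x * ennreal (norm (LINT s|lborel. indicator {a<..c} s *\<^sub>R velocity \<theta> v P Q s x)) \<partial>lborel)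
      \<le> (\<integral>\<^sup>+x. ennreal (B * (c - a)) * indicator (ball 0 r) x + (\<integral>\<^sup>+s. indicator {0<..<T} s * ennreal (excess s x) \<partial>lborel) \<partial>lborel)"
    using displacement_le[OF ab] by (intro nn_integral_mono) (auto simp: indicator_def)
  also have "\<dots> = ennreal (B * (c - a)) * emeasure lborel (ball (0::'a) r) + (\<integral>\<^sup>+x. \<integral>\<^sup>+s. indicator {0<..<T} s * ennreal (excess s x) \<partial>lborel \<partial>lborel)"
    by (simp add: nn_integral_add nn_integral_cmult)
  also have "\<dots> \<le> ennreal (B * (c - a)) * emeasure lborel (ball (0::'a) r) + ennreal (2 * L * e)"
    by (intro add_left_mono integrated_excess)
  also have "\<dots> = ennreal (B * (c - a) * measure lborel (ball (0::'a) r) + 2 * L * e)"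
    using ab B L e0 by (simp add: emeasure_ball_r ennreal_mult)
  finally show ?thesis .
qed

end

section \<open>Comparison of a path with the flow\<close>

locale log_stability = path_data T p B K L \<theta> C3 r e b v P Q g \<kappa>
  for T p B K L \<theta> C3 r e :: real
    and b v P Q :: "real \<Rightarrow> 'a::euclidean_space \<Rightarrow> 'a" and g :: "real \<Rightarrow> 'a \<Rightarrow> real" and \<kappa> :: "real \<Rightarrow> real" +
  fixes X :: "real \<Rightarrow> 'a \<Rightarrow> 'a" and e2 \<delta> :: real
  assumes e20: "e2 \<ge> 0" and \<delta>: "\<delta> > 0" and flow: "flow_data T b X"
    and compX: "\<And>t. t \<in> {0..T} \<Longrightarrow> compressible L (X t)"
    and delayP: "\<And>s. s \<in> {0<..<T} \<Longrightarrow> ball_distance r (path \<theta> v P Q s) (P s) \<le> ennreal e2"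
    and delayQ: "\<And>s. s \<in> {0<..<T} \<Longrightarrow> ball_distance r (path \<theta> v P Q s) (Q s) \<le> ennreal e2"
begin

lemma X: "joint_borel X"
  using flow by (simp add: flow_data_def)

lemma bX: "(\<lambda>(t, x). b t (X t x)) \<in> borel_measurable borel"
  by (rule joint_compose; fact b X)

lemma bX_integrable: "integrable lborel (\<lambda>s. indicator {a<..t} s *\<^sub>R b s (X s x))"
  by (rule bounded_time_integrable[OF section_measurable(2)[OF bX] bb])

definition D :: "real \<Rightarrow> 'a \<Rightarrow> 'a" where "D t x = Z t x - X t x"

definition q :: "real \<Rightarrow> 'a \<Rightarrow> real" where "q s x = norm (velocity \<theta> v P Q s x - b s (X s x))"

text \<open>A majorant of the integrand of the logarithmic estimate in three pairs, one member for
  \<open>P\<close> and one for \<open>Q\<close>: the error of the approximating field, the Sobolev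
  estimate through maximal functions, and the price of a large delay.\<close>

definition E :: "real \<Rightarrow> 'a \<Rightarrow> ennreal" where
  "E s x = ennreal (1 / \<delta>) * ennreal (norm (v s (P s x) - b s (P s x))) + ennreal (1 / \<delta>) * ennreal (norm (v s (Q s x) - b s (Q s x)))
    + ennreal (sobolev_const TYPE('a)) * (M s (P s x) + M s (X s x)) + ennreal (sobolev_const TYPE('a)) * (M s (Q s x) + M s (X s x))
    + ennreal (2 * B / \<delta>\<^sup>2) * ennreal (norm (Z s x - P s x)) + ennreal (2 * B / \<delta>\<^sup>2) * ennreal (norm (Z s x - Q s x))"

lemma integrated_error:
  "(\<integral>\<^sup>+s. indicator {0<..<T} s * (\<integral>\<^sup>+x. indicator (ball 0 r) x * E s x \<partial>lborel) \<partial>lborel)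
    \<le> ennreal (2 * L * e / \<delta> + stability_const TYPE('a) p r L * K + 4 * B * T * e2 / \<delta>\<^sup>2)"
proof -
  let ?S = "sobolev_const TYPE('a)" and ?V = "measure lborel (ball (0::'a) r)" and ?A = "maximal_const TYPE('a) p L"
  have S: "?S \<ge> 0" by (rule sobolev_const_nonneg)
  have A: "?A \<ge> 0" using maximal_const_nonneg[of p L] p L by simp
  define n where "n s = (\<integral>\<^sup>+x. ennreal (norm (v s x - b s x)) \<partial>lborel)" for s
  have [measurable]: "case_prod v \<in> borel_measurable (borel \<Otimes>\<^sub>M borel)" "case_prod b \<in> borel_measurable (borel \<Otimes>\<^sub>M borel)"
    using v b by (auto simp: borel_prod)
  have n[measurable]: "n \<in> borel_measurable borel"
  proof -
    have "(\<lambda>(s, x). ennreal (norm (v s x - b s x))) \<in> borel_measurable (borel \<Otimes>\<^sub>M lborel)" by measurable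
    then show ?thesis unfolding n_def by (rule lborel.borel_measurable_nn_integral)
  qed
  note [measurable] = \<kappa>m
  have emB: "emeasure lborel (ball (0::'a) r) = ennreal ?V"
    using emeasure_lborel_ball_finite[of "0::'a" r] by (intro emeasure_eq_ennreal_measure) (simp add: less_top)
  have "AE s in lborel. indicator {0<..<T} s * (\<integral>\<^sup>+x. indicator (ball 0 r) x * E s x \<partial>lborel)
      \<le> ennreal (2 * L / \<delta>) * (indicator {0<..<T} s * n s) + ennreal (stability_const TYPE('a) p r L) * (indicator {0<..<T} s * ennreal (\<kappa> s))
        + ennreal (4 * B * e2 / \<delta>\<^sup>2) * indicator {0<..<T} s"
    using field[unfolded field_data_def, THEN conjunct2, THEN conjunct2, THEN conjunct2, THEN conjunct2, THEN conjunct2, THEN conjunct2, THEN conjunct2]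
  proof eventually_elim
    case (elim s)
    show ?case
    proof (cases "s \<in> {0<..<T}")
      case True
      have gp: "(\<integral>\<^sup>+x. ennreal (g s x powr p) \<partial>lborel) \<le> ennreal (\<kappa> s powr p)" using elim True by blast
      note sm = section_measurable(1)
      have [measurable]: "v s \<in> borel_measurable borel" "b s \<in> borel_measurable borel" "g s \<in> borel_measurable borel"
        "P s \<in> borel_measurable borel" "Q s \<in> borel_measurable borel" "X s \<in> borel_measurable borel" "Z s \<in> borel_measurable borel" "M s \<in> borel_measurable borel"
        by (rule sm, fact v b g P Q X Z_measurable M)+
      have vbF: "(\<integral>\<^sup>+x. indicator (ball 0 r) x * ennreal (norm (v s (F x) - b s (F x))) \<partial>lborel) \<le> ennreal L * n s"
        if F: "compressible L F" for F
      proof -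
        have "(\<integral>\<^sup>+x. indicator (ball 0 r) x * ennreal (norm (v s (F x) - b s (F x))) \<partial>lborel) \<le> (\<integral>\<^sup>+x. ennreal (norm (v s (F x) - b s (F x))) \<partial>lborel)"
          by (intro nn_integral_mono) (auto simp: indicator_def)
        also have "\<dots> \<le> ennreal L * n s"
          unfolding n_def using L by (intro compressible_nn_integral[OF F]) auto
        finally show ?thesis .
      qed
      have MF: "(\<integral>\<^sup>+x. indicator (ball 0 r) x * M s (F x) \<partial>lborel) \<le> ennreal (\<kappa> s * (?V + ?A))"
        if F: "compressible L F" for F
      proof -
        have "(\<integral>\<^sup>+x. M s (F x) * indicator (ball 0 r) x \<partial>lborel) \<le> ennreal (\<kappa> s) * (emeasure lborel (ball (0::'a) r) + ennreal ?A)"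
          unfolding M_def using L by (intro maximal_compressible[OF F _ p \<kappa>0 _ g0 gp]) auto
        also have "\<dots> = ennreal (\<kappa> s * (?V + ?A))"
          using A \<kappa>0[of s] by (simp add: emB ennreal_mult)
        finally show ?thesis by (simp add: mult.commute)
      qed
      have CX: "compressible L (X s)" using True by (intro compX) auto
      have MM: "(\<integral>\<^sup>+x. indicator (ball 0 r) x * (M s (F x) + M s (X s x)) \<partial>lborel) \<le> ennreal (2 * \<kappa> s * (?V + ?A))"
        if F: "compressible L F" for F
      proof -
        have [measurable]: "F \<in> borel_measurable borel" by (rule compressible_measurable[OF F])
        have "(\<integral>\<^sup>+x. indicator (ball 0 r) x * (M s (F x) + M s (X s x)) \<partial>lborel)
            = (\<integral>\<^sup>+x. indicator (ball 0 r) x * M s (F x) \<partial>lborel) + (\<integral>\<^sup>+x. indicator (ball 0 r) x * M s (X s x) \<partial>lborel)"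
          unfolding distrib_left by (rule nn_integral_add) measurable
        also have "\<dots> \<le> ennreal (\<kappa> s * (?V + ?A)) + ennreal (\<kappa> s * (?V + ?A))"
          by (intro add_mono MF F CX)
        also have "\<dots> = ennreal (2 * \<kappa> s * (?V + ?A))"
          using A \<kappa>0[of s] by (subst ennreal_plus[symmetric]) (auto intro!: mult_nonneg_nonneg simp: less_imp_le)
        finally show ?thesis .
      qed
      have "(\<integral>\<^sup>+x. indicator (ball 0 r) x * E s x \<partial>lborel)
        = (\<integral>\<^sup>+x. ennreal (1 / \<delta>) * (indicator (ball 0 r) x * ennreal (norm (v s (P s x) - b s (P s x))))
          + ennreal (1 / \<delta>) * (indicator (ball 0 r) x * ennreal (norm (v s (Q s x) - b s (Q s x))))
          + ennreal ?S * (indicator (ball 0 r) x * (M s (P s x) + M s (X s x)))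
          + ennreal ?S * (indicator (ball 0 r) x * (M s (Q s x) + M s (X s x)))
          + ennreal (2 * B / \<delta>\<^sup>2) * (indicator (ball 0 r) x * ennreal (norm (Z s x - P s x)))
          + ennreal (2 * B / \<delta>\<^sup>2) * (indicator (ball 0 r) x * ennreal (norm (Z s x - Q s x))) \<partial>lborel)"
        by (intro nn_integral_cong) (auto simp: E_def indicator_def)
      also have "\<dots> = ennreal (1 / \<delta>) * (\<integral>\<^sup>+x. indicator (ball 0 r) x * ennreal (norm (v s (P s x) - b s (P s x))) \<partial>lborel)
          + ennreal (1 / \<delta>) * (\<integral>\<^sup>+x. indicator (ball 0 r) x * ennreal (norm (v s (Q s x) - b s (Q s x))) \<partial>lborel)
          + ennreal ?S * (\<integral>\<^sup>+x. indicator (ball 0 r) x * (M s (P s x) + M s (X s x)) \<partial>lborel)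
          + ennreal ?S * (\<integral>\<^sup>+x. indicator (ball 0 r) x * (M s (Q s x) + M s (X s x)) \<partial>lborel)
          + ennreal (2 * B / \<delta>\<^sup>2) * ball_distance r (Z s) (P s)
          + ennreal (2 * B / \<delta>\<^sup>2) * ball_distance r (Z s) (Q s)"
        by (simp add: nn_integral_add nn_integral_cmult)
      also have "\<dots> \<le> ennreal (1 / \<delta>) * (ennreal L * n s) + ennreal (1 / \<delta>) * (ennreal L * n s)
          + ennreal ?S * ennreal (2 * \<kappa> s * (?V + ?A)) + ennreal ?S * ennreal (2 * \<kappa> s * (?V + ?A))
          + ennreal (2 * B / \<delta>\<^sup>2) * ennreal e2 + ennreal (2 * B / \<delta>\<^sup>2) * ennreal e2"
        by (intro add_mono mult_left_mono vbF MM P Q delayP[OF True] delayQ[OF True]) auto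
      also have "\<dots> = (ennreal (L / \<delta>) + ennreal (L / \<delta>)) * n s
          + (ennreal (?S * (2 * \<kappa> s * (?V + ?A))) + ennreal (?S * (2 * \<kappa> s * (?V + ?A))))
          + (ennreal (2 * B / \<delta>\<^sup>2 * e2) + ennreal (2 * B / \<delta>\<^sup>2 * e2))"
        using \<delta> L S A \<kappa>0[of s] B e20
        by (simp add: ennreal_mult[symmetric] mult.assoc[symmetric] distrib_right add_ac)
      also have "\<dots> = ennreal (2 * L / \<delta>) * n s + ennreal (stability_const TYPE('a) p r L * \<kappa> s) + ennreal (4 * B * e2 / \<delta>\<^sup>2)"
        using \<delta> L S A \<kappa>0[of s] B e20
        by (simp add: ennreal_plus[symmetric] stability_const_def mult_ac del: ennreal_plus)
      also have "ennreal (stability_const TYPE('a) p r L * \<kappa> s) = ennreal (stability_const TYPE('a) p r L) * ennreal (\<kappa> s)"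
        by (rule ennreal_mult') (use stability_const_nonneg[of p L r, where 'a='a] p L in simp)
      finally show ?thesis using True by simp
    qed simp
  qed
  then have "(\<integral>\<^sup>+s. indicator {0<..<T} s * (\<integral>\<^sup>+x. indicator (ball 0 r) x * E s x \<partial>lborel) \<partial>lborel)
      \<le> (\<integral>\<^sup>+s. ennreal (2 * L / \<delta>) * (indicator {0<..<T} s * n s) + ennreal (stability_const TYPE('a) p r L) * (indicator {0<..<T} s * ennreal (\<kappa> s))
        + ennreal (4 * B * e2 / \<delta>\<^sup>2) * indicator {0<..<T} s \<partial>lborel)"
    by (rule nn_integral_mono_AE)
  also have "\<dots> = ennreal (2 * L / \<delta>) * (\<integral>\<^sup>+s. indicator {0<..<T} s * n s \<partial>lborel)
      + ennreal (stability_const TYPE('a) p r L) * (\<integral>\<^sup>+s. indicator {0<..<T} s * ennreal (\<kappa> s) \<partial>lborel)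
      + ennreal (4 * B * e2 / \<delta>\<^sup>2) * ennreal T"
    using T by (simp add: nn_integral_add nn_integral_cmult)
  also have "\<dots> \<le> ennreal (2 * L / \<delta>) * ennreal e + ennreal (stability_const TYPE('a) p r L) * ennreal K + ennreal (4 * B * e2 / \<delta>\<^sup>2) * ennreal T"
    using close \<kappa>int unfolding n_def by (intro add_mono mult_left_mono) auto
  also have "\<dots> = ennreal (2 * L * e / \<delta> + stability_const TYPE('a) p r L * K + 4 * B * T * e2 / \<delta>\<^sup>2)"
    using \<delta> L B T K e0 e20 stability_const_nonneg[of p L r, where 'a='a] p
    by (simp add: ennreal_mult[symmetric] ennreal_plus[symmetric] mult_ac del: ennreal_plus)
  finally show ?thesis .
qed

end

context log_stability
begin

text \<open>For almost every time the Sobolev estimate fails only on a null set of points, and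
  compressibility of \<open>P s\<close>, \<open>Q s\<close> and \<open>X s\<close> makes its three
  preimages null. The velocity difference is then split at \<open>b s (P s x)\<close> and
  \<open>b s (Q s x)\<close>.\<close>

lemma q_le_error:
  "AE s in lborel. s \<in> {0<..<T} \<longrightarrow> (AE x in lborel. ennreal (q s x / (\<delta> + norm (D s x))) \<le> E s x)"
  using field[unfolded field_data_def, THEN conjunct2, THEN conjunct2, THEN conjunct2, THEN conjunct2, THEN conjunct2, THEN conjunct2, THEN conjunct2]
proof eventually_elim
  case (elim s)
  note sob = elim
  show ?case
  proof
    assume s: "s \<in> {0<..<T}"
    then obtain N where N: "N \<in> sets borel" "emeasure lborel N = 0" and ineq: "\<And>x y. x \<notin> N \<Longrightarrow> y \<notin> N \<Longrightarrow>
          ennreal (norm (b s x - b s y)) \<le> ennreal (sobolev_const TYPE('a) * norm (x - y)) * (M s x + M s y)"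
      using sob unfolding M_def by blast
    have nN: "AE x in lborel. x \<notin> N"
      using N by (intro AE_not_in) (auto intro: null_setsI)
    have L0: "L \<ge> 0" using L by simp
    have CX: "compressible L (X s)" using s by (intro compX) auto
    show "AE x in lborel. ennreal (q s x / (\<delta> + norm (D s x))) \<le> E s x"
      using compressible_AE[OF P(2)[of s] L0 nN] compressible_AE[OF Q(2)[of s] L0 nN] compressible_AE[OF CX L0 nN]
    proof eventually_elim
      case (elim x)
      let ?d = "\<delta> + norm (D s x)"
      have d: "?d > 0" "\<delta> \<le> ?d" using \<delta> by (auto simp: add_pos_nonneg)
      have S: "sobolev_const TYPE('a) \<ge> 0" by (rule sobolev_const_nonneg)
      have fd: "ennreal (norm (b s (F x) - b s (X s x)) / ?d)
          \<le> ennreal (sobolev_const TYPE('a)) * (M s (F x) + M s (X s x)) + ennreal (2 * B / \<delta>\<^sup>2) * ennreal (norm (Z s x - F x))"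
        if "F x \<notin> N" for F
        unfolding D_def by (rule field_difference_quotient[OF \<delta> bb bb S ineq[OF that elim(3)]])
      have vd: "ennreal (norm w / ?d) \<le> ennreal (1 / \<delta>) * ennreal (norm w)" for w :: 'a
        using d \<delta> by (subst ennreal_mult[symmetric]) (auto intro!: ennreal_leI divide_left_mono simp: add_pos_nonneg)
      let ?a = "norm (v s (P s x) - b s (P s x))" and ?b = "norm (b s (P s x) - b s (X s x))"
      let ?c = "norm (v s (Q s x) - b s (Q s x))" and ?f = "norm (b s (Q s x) - b s (X s x))"
      have "q s x \<le> (?a + ?b) + (?c + ?f)"
      proof -
        have "velocity \<theta> v P Q s x - b s (X s x)
            = (1 - \<theta>) *\<^sub>R ((v s (P s x) - b s (P s x)) + (b s (P s x) - b s (X s x)))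
              + \<theta> *\<^sub>R ((v s (Q s x) - b s (Q s x)) + (b s (Q s x) - b s (X s x)))"
          by (simp add: velocity_def algebra_simps)
        then have "q s x \<le> (1 - \<theta>) * norm ((v s (P s x) - b s (P s x)) + (b s (P s x) - b s (X s x)))
            + \<theta> * norm ((v s (Q s x) - b s (Q s x)) + (b s (Q s x) - b s (X s x)))"
          unfolding q_def using \<theta> by (simp only:) (rule order_trans[OF norm_triangle_ineq], simp)
        also have "\<dots> \<le> 1 * (?a + ?b) + 1 * (?c + ?f)"
          using \<theta> by (intro add_mono mult_mono norm_triangle_ineq) auto
        finally show ?thesis by simp
      qed
      then have "q s x / ?d \<le> (?a / ?d + ?b / ?d) + (?c / ?d + ?f / ?d)"
        using d by (simp add: add_divide_distrib[symmetric] divide_right_mono)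
      then have "ennreal (q s x / ?d) \<le> (ennreal (?a / ?d) + ennreal (?b / ?d)) + (ennreal (?c / ?d) + ennreal (?f / ?d))"
        using d by (simp add: ennreal_plus[symmetric] ennreal_leI del: ennreal_plus)
      also have "\<dots> \<le> (ennreal (1 / \<delta>) * ennreal ?a + (ennreal (sobolev_const TYPE('a)) * (M s (P s x) + M s (X s x)) + ennreal (2 * B / \<delta>\<^sup>2) * ennreal (norm (Z s x - P s x))))
          + (ennreal (1 / \<delta>) * ennreal ?c + (ennreal (sobolev_const TYPE('a)) * (M s (Q s x) + M s (X s x)) + ennreal (2 * B / \<delta>\<^sup>2) * ennreal (norm (Z s x - Q s x))))"
        by (intro add_mono vd fd elim)
      also have "\<dots> = E s x"
        unfolding E_def by (simp only: add_ac)
      finally show ?case .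
    qed
  qed
qed

lemma q_measurable: "joint_borel q"
  using velocity_measurable bX unfolding q_def case_prod_beta' by measurable

lemma D_measurable: "joint_borel D"
  using Z_measurable X unfolding D_def case_prod_beta' by measurable

lemma log_bound_AE:
  "AE x in lborel. \<forall>t\<in>{0..T}. ennreal (ln (1 + norm (D t x) / \<delta>))
     \<le> (\<integral>\<^sup>+s. indicator {0<..<T} s * ennreal (q s x / (\<delta> + norm (D s x))) \<partial>lborel)"
  using flow[unfolded flow_data_def, THEN conjunct2]
proof eventually_elim
  case (elim x)
  define F where "F s = velocity \<theta> v P Q s x - b s (X s x)" for s
  have int: "integrable lborel (\<lambda>s. indicator {a<..t} s *\<^sub>R F s)" for a t
    unfolding F_def scaleR_diff_right by (intro Bochner_Integration.integrable_diff velocity_integrable bX_integrable)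
  have Deq: "D t x = (LINT s|lborel. indicator {0<..t} s *\<^sub>R F s)" if "t \<in> {0..T}" for t
    using elim that unfolding D_def path_def F_def scaleR_diff_right
    by (simp add: Bochner_Integration.integral_diff[OF velocity_integrable bX_integrable])
  have Ddiff: "D c x - D a x = (LINT s|lborel. indicator {a<..c} s *\<^sub>R F s)" if "0 \<le> a" "a \<le> c" "c \<le> T" for a c
  proof -
    have "(LINT s|lborel. indicator {0<..a} s *\<^sub>R F s) + (LINT s|lborel. indicator {a<..c} s *\<^sub>R F s)
        = (LINT s|lborel. indicator {0<..a} s *\<^sub>R F s + indicator {a<..c} s *\<^sub>R F s)"
      by (rule Bochner_Integration.integral_add[OF int int, symmetric])
    also have "\<dots> = (LINT s|lborel. indicator {0<..c} s *\<^sub>R F s)"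
      using that by (intro Bochner_Integration.integral_cong) (auto simp: indicator_def)
    finally show ?thesis using that by (simp add: Deq algebra_simps)
  qed
  have incr: "ennreal (norm (D c x - D a x)) \<le> (\<integral>\<^sup>+s. indicator {a<..c} s * ennreal (q s x) \<partial>lborel)"
    if "0 \<le> a" "a \<le> c" "c \<le> T" for a c
  proof -
    have "ennreal (norm (D c x - D a x)) \<le> (\<integral>\<^sup>+s. ennreal (norm (indicator {a<..c} s *\<^sub>R F s)) \<partial>lborel)"
      unfolding Ddiff[OF that] by (rule integral_norm_bound_ennreal[OF int])
    also have "\<dots> = (\<integral>\<^sup>+s. indicator {a<..c} s * ennreal (q s x) \<partial>lborel)"
      by (intro nn_integral_cong) (auto simp: indicator_def q_def F_def)
    finally show ?thesis .
  qed
  have qb: "q s x \<le> C3 + B" for s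
    unfolding q_def using velocity_bound[of s x] bb[of s "X s x"]
    by (intro order_trans[OF norm_triangle_ineq4] add_mono)
  have q0: "q s x \<ge> 0" for s by (simp add: q_def)
  have CB: "C3 + B \<ge> 0" using order_trans[OF q0 qb] .
  \<comment> \<open>The Lipschitz constant serves only to make the difference continuous in time, so
    \<open>C3\<close> does not reach the estimate.\<close>
  have lip: "dist (D a x) (D c x) \<le> (C3 + B) * (c - a)" if "0 \<le> a" "a \<le> c" "c \<le> T" for a c
  proof -
    have "ennreal (norm (D c x - D a x)) \<le> (\<integral>\<^sup>+s. indicator {a<..c} s * ennreal (q s x) \<partial>lborel)"
      by (rule incr[OF that])
    also have "\<dots> \<le> (\<integral>\<^sup>+s. ennreal (C3 + B) * indicator {a<..c} s \<partial>lborel)"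
      using qb by (intro nn_integral_mono) (auto simp: indicator_def intro!: ennreal_leI)
    also have "\<dots> = ennreal ((C3 + B) * (c - a))"
      using that CB by (simp add: nn_integral_cmult ennreal_mult)
    finally show ?thesis
      using that CB by (simp add: ennreal_le_iff dist_norm norm_minus_commute)
  qed
  have cont: "continuous_on {0..T} (\<lambda>t. D t x)"
  proof (rule lipschitz_on_continuous_on, rule lipschitz_onI)
    fix s t assume st: "s \<in> {0..T}" "t \<in> {0..T}"
    show "dist (D s x) (D t x) \<le> (C3 + B) * dist s t"
      using lip[of s t] lip[of t s] st by (cases "s \<le> t") (auto simp: dist_real_def dist_commute)
  qed (rule CB)
  show ?case
  proof
    fix t assume t: "t \<in> {0..T}"
    have "ennreal (ln (1 + norm (D t x) / \<delta>)) \<le> (\<integral>\<^sup>+s. indicator {0<..t} s * ennreal (q s x / (\<delta> + norm (D s x))) \<partial>lborel)"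
    proof (rule log_growth[OF \<delta> cont])
      show "D 0 x = 0" using Deq[of 0] T by simp
      show "(\<lambda>s. q s x) \<in> borel_measurable borel" by (rule section_measurable(2)[OF q_measurable])
    qed (use q0 incr t in auto)
    also have "\<dots> \<le> (\<integral>\<^sup>+s. indicator {0<..<T} s * ennreal (q s x / (\<delta> + norm (D s x))) \<partial>lborel)"
    proof (rule nn_integral_mono_AE)
      show "AE s in lborel. indicator {0<..t} s * ennreal (q s x / (\<delta> + norm (D s x))) \<le> indicator {0<..<T} s * ennreal (q s x / (\<delta> + norm (D s x)))"
        using AE_lborel_singleton[of T] by eventually_elim (use t in \<open>auto simp: indicator_def\<close>)
    qed
    finally show "ennreal (ln (1 + norm (D t x) / \<delta>))
     \<le> (\<integral>\<^sup>+s. indicator {0<..<T} s * ennreal (q s x / (\<delta> + norm (D s x))) \<partial>lborel)" .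
  qed
qed

definition \<Lambda> where "\<Lambda> = 2 * L * e / \<delta> + stability_const TYPE('a) p r L * K + 4 * B * T * e2 / \<delta>\<^sup>2"

lemma \<Lambda>_nonneg: "\<Lambda> \<ge> 0"
  unfolding \<Lambda>_def using L e0 \<delta> stability_const_nonneg[of p L r, where 'a='a] p K B T e20 by (intro add_nonneg_nonneg) auto

lemma integrated_log:
  assumes t: "t \<in> {0..T}"
  shows "(\<integral>\<^sup>+x. indicator (ball 0 r) x * ennreal (ln (1 + norm (D t x) / \<delta>)) \<partial>lborel) \<le> ennreal \<Lambda>"
proof -
  define H where "H s x = indicator (ball 0 r) x * (indicator {0<..<T} s * ennreal (q s x / (\<delta> + norm (D s x))))" for s x
  have [measurable]: "case_prod q \<in> borel_measurable (borel \<Otimes>\<^sub>M borel)" "case_prod D \<in> borel_measurable (borel \<Otimes>\<^sub>M borel)"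
    using q_measurable D_measurable by (auto simp: borel_prod)
  have "(\<lambda>(s, x). H s x) \<in> borel_measurable (borel \<Otimes>\<^sub>M borel)"
    unfolding H_def by measurable
  then have H: "joint_borel H" by (simp add: borel_prod)
  have mq: "(\<lambda>s. indicator {0<..<T} s * ennreal (q s x / (\<delta> + norm (D s x)))) \<in> borel_measurable borel" for x
    by measurable
  have "(\<integral>\<^sup>+x. indicator (ball 0 r) x * ennreal (ln (1 + norm (D t x) / \<delta>)) \<partial>lborel) \<le> (\<integral>\<^sup>+x. \<integral>\<^sup>+s. H s x \<partial>lborel \<partial>lborel)"
  proof (rule nn_integral_mono_AE)
    show "AE x in lborel. indicator (ball 0 r) x * ennreal (ln (1 + norm (D t x) / \<delta>)) \<le> (\<integral>\<^sup>+s. H s x \<partial>lborel)"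
      using log_bound_AE
    proof eventually_elim
      case (elim x)
      have "(\<integral>\<^sup>+s. H s x \<partial>lborel) = indicator (ball 0 r) x * (\<integral>\<^sup>+s. indicator {0<..<T} s * ennreal (q s x / (\<delta> + norm (D s x))) \<partial>lborel)"
        unfolding H_def using mq by (intro nn_integral_cmult) simp
      with elim t show ?case by (simp add: mult_left_mono)
    qed
  qed
  also have "\<dots> = (\<integral>\<^sup>+s. \<integral>\<^sup>+x. H s x \<partial>lborel \<partial>lborel)"
    by (rule nn_integral_swap_time[OF H])
  also have "\<dots> \<le> (\<integral>\<^sup>+s. indicator {0<..<T} s * (\<integral>\<^sup>+x. indicator (ball 0 r) x * E s x \<partial>lborel) \<partial>lborel)"
  proof (rule nn_integral_mono_AE)
    show "AE s in lborel. (\<integral>\<^sup>+x. H s x \<partial>lborel) \<le> indicator {0<..<T} s * (\<integral>\<^sup>+x. indicator (ball 0 r) x * E s x \<partial>lborel)"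
      using q_le_error
    proof eventually_elim
      case (elim s)
      show ?case
      proof (cases "s \<in> {0<..<T}")
        case True
        have "(\<integral>\<^sup>+x. H s x \<partial>lborel) \<le> (\<integral>\<^sup>+x. indicator (ball 0 r) x * E s x \<partial>lborel)"
        proof (rule nn_integral_mono_AE)
          show "AE x in lborel. H s x \<le> indicator (ball 0 r) x * E s x"
            using elim[rule_format, OF True] by eventually_elim (auto simp: H_def indicator_def)
        qed
        then show ?thesis using True by simp
      qed (simp add: H_def)
    qed
  qed
  also have "\<dots> \<le> ennreal \<Lambda>"
    unfolding \<Lambda>_def by (rule integrated_error)
  finally show ?thesis .
qed

text \<open>The ball is split according to whether the difference exceeds
  \<open>sqrt \<delta>\<close>. Where it does, the logarithm is at least
  \<open>ln (1 + 1 / sqrt \<delta>)\<close>, so the displacement bound \<open>2 * B * T\<close> may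
  be multiplied by the quotient of the two logarithms and integrated. The displacement beyond
  \<open>2 * B * T\<close> is the integrated excess.\<close>

lemma integrated_difference:
  assumes t: "t \<in> {0..T}"
  shows "(\<integral>\<^sup>+x. indicator (ball 0 r) x * ennreal (norm (D t x)) \<partial>lborel)
    \<le> ennreal (sqrt \<delta> * measure lborel (ball (0::'a) r) + 2 * L * e + 2 * B * T * \<Lambda> / ln (1 + 1 / sqrt \<delta>))"
proof -
  let ?V = "measure lborel (ball (0::'a) r)" and ?l = "ln (1 + 1 / sqrt \<delta>)"
  define W where "W x = (\<integral>\<^sup>+s. indicator {0<..<T} s * ennreal (excess s x) \<partial>lborel)" for x
  have W[measurable]: "W \<in> borel_measurable borel" unfolding W_def by measurable
  have sd: "sqrt \<delta> > 0" using \<delta> by simp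
  have l: "?l > 0" using sd by (simp add: add_pos_pos)
  have [measurable]: "D t \<in> borel_measurable borel" by (rule section_measurable(1)[OF D_measurable])
  have "(\<integral>\<^sup>+x. indicator (ball 0 r) x * ennreal (norm (D t x)) \<partial>lborel)
      \<le> (\<integral>\<^sup>+x. ennreal (sqrt \<delta>) * indicator (ball 0 r) x + W x
        + ennreal (2 * B * T / ?l) * (indicator (ball 0 r) x * ennreal (ln (1 + norm (D t x) / \<delta>))) \<partial>lborel)"
  proof (rule nn_integral_mono_AE)
    show "AE x in lborel. indicator (ball 0 r) x * ennreal (norm (D t x)) \<le> ennreal (sqrt \<delta>) * indicator (ball 0 r) x + W x
        + ennreal (2 * B * T / ?l) * (indicator (ball 0 r) x * ennreal (ln (1 + norm (D t x) / \<delta>)))"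
      using flow[unfolded flow_data_def, THEN conjunct2]
    proof eventually_elim
      case (elim x)
      have ln0: "ln (1 + norm (D t x) / \<delta>) \<ge> 0" using \<delta> by (intro ln_ge_zero) simp
      have "ennreal (norm (D t x)) \<le> ennreal (sqrt \<delta>) + W x + ennreal (2 * B * T / ?l) * ennreal (ln (1 + norm (D t x) / \<delta>))"
      proof (cases "norm (D t x) \<le> sqrt \<delta>")
        case True
        then have "ennreal (norm (D t x)) \<le> ennreal (sqrt \<delta>)" by (rule ennreal_leI)
        then show ?thesis by (simp add: add_increasing2 add.assoc)
      next
        case False
        have "sqrt \<delta> / \<delta> = 1 / sqrt \<delta>"
          using \<delta> by (simp add: field_simps)
        moreover have "sqrt \<delta> / \<delta> \<le> norm (D t x) / \<delta>"
          using False \<delta> by (intro divide_right_mono) auto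
        ultimately have "1 + 1 / sqrt \<delta> \<le> 1 + norm (D t x) / \<delta>" by simp
        moreover have "1 + 1 / sqrt \<delta> > 0" using sd by (simp add: add_pos_pos)
        ultimately have "?l \<le> ln (1 + norm (D t x) / \<delta>)" by (subst ln_le_cancel_iff) auto
        then have "1 \<le> ln (1 + norm (D t x) / \<delta>) / ?l" using l by (simp add: field_simps)
        then have A: "2 * B * T \<le> 2 * B * T * (ln (1 + norm (D t x) / \<delta>) / ?l)"
          using B T mult_left_mono[of 1 "ln (1 + norm (D t x) / \<delta>) / ?l" "2 * B * T"] by simp
        have X1: "norm (X t x - x) \<le> B * T"
        proof -
          have "X t x - x = (LINT s|lborel. indicator {0<..t} s *\<^sub>R b s (X s x))"
            using elim t by simp
          also have "ennreal (norm \<dots>) \<le> (\<integral>\<^sup>+s. ennreal (norm (indicator {0<..t} s *\<^sub>R b s (X s x))) \<partial>lborel)"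
            by (rule integral_norm_bound_ennreal[OF bX_integrable])
          also have "\<dots> \<le> (\<integral>\<^sup>+s. ennreal B * indicator {0<..t} s \<partial>lborel)"
            using bb by (intro nn_integral_mono) (auto simp: indicator_def intro!: ennreal_leI)
          also have "\<dots> = ennreal (B * t)" using t B by (simp add: nn_integral_cmult ennreal_mult)
          also have "\<dots> \<le> ennreal (B * T)" using t B by (intro ennreal_leI mult_left_mono) auto
          finally show ?thesis using B T by (simp add: ennreal_le_iff)
        qed
        have "ennreal (norm (Z t x - x)) \<le> ennreal (B * (t - 0)) + W x"
          unfolding path_def W_def using displacement_le[of 0 t x] t by simp
        also have "\<dots> \<le> ennreal (B * T) + W x"
          using t B by (intro add_right_mono ennreal_leI mult_left_mono) auto
        finally have Z1: "ennreal (norm (Z t x - x)) \<le> ennreal (B * T) + W x" .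
        have "norm (D t x) \<le> norm (X t x - x) + norm (Z t x - x)"
          unfolding D_def using norm_triangle_ineq4[of "Z t x - x" "X t x - x"] by simp
        also have "\<dots> \<le> B * T + norm (Z t x - x)" using X1 by simp
        finally have "ennreal (norm (D t x)) \<le> ennreal (B * T) + ennreal (norm (Z t x - x))"
          using B T by (simp add: ennreal_plus[symmetric] ennreal_leI del: ennreal_plus)
        also have "\<dots> \<le> ennreal (B * T) + (ennreal (B * T) + W x)"
          by (intro add_left_mono Z1)
        also have "\<dots> = ennreal (2 * B * T) + W x"
          using B T by (simp add: add.assoc[symmetric] ennreal_plus[symmetric] del: ennreal_plus)
        also have "\<dots> \<le> ennreal (2 * B * T / ?l) * ennreal (ln (1 + norm (D t x) / \<delta>)) + W x"
          using A B T l ln0 by (intro add_right_mono) (simp add: ennreal_mult[symmetric] ennreal_leI)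
        also have "\<dots> \<le> ennreal (sqrt \<delta>) + W x + ennreal (2 * B * T / ?l) * ennreal (ln (1 + norm (D t x) / \<delta>))"
          by (simp add: add_ac add_increasing2)
        finally show ?thesis .
      qed
      then show ?case by (auto simp: indicator_def)
    qed
  qed
  also have "\<dots> = ennreal (sqrt \<delta>) * emeasure lborel (ball (0::'a) r) + (\<integral>\<^sup>+x. W x \<partial>lborel)
      + ennreal (2 * B * T / ?l) * (\<integral>\<^sup>+x. indicator (ball 0 r) x * ennreal (ln (1 + norm (D t x) / \<delta>)) \<partial>lborel)"
    by (simp add: nn_integral_add nn_integral_cmult)
  also have "\<dots> \<le> ennreal (sqrt \<delta>) * ennreal ?V + ennreal (2 * L * e) + ennreal (2 * B * T / ?l) * ennreal \<Lambda>"
    unfolding emeasure_ball_r W_def by (intro add_mono mult_left_mono integrated_excess integrated_log t) auto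
  also have "\<dots> = ennreal (sqrt \<delta> * ?V + 2 * L * e + 2 * B * T * \<Lambda> / ?l)"
    using \<delta> L e0 B T l \<Lambda>_nonneg by (simp add: ennreal_mult[symmetric])
  finally show ?thesis .
qed

end

section \<open>The regularized scheme\<close>

definition grid_avg :: "real \<Rightarrow> (real \<Rightarrow> 'a::euclidean_space \<Rightarrow> 'a) \<Rightarrow> nat \<Rightarrow> 'a \<Rightarrow> 'a" where
  "grid_avg h v i x = time_avg (real i * h) (real (Suc i) * h) (\<lambda>s. v s x)"

locale theta_scheme =
  fixes T h \<theta> C3 \<eta> C2 :: real and N :: nat
    and v :: "real \<Rightarrow> 'a::euclidean_space \<Rightarrow> 'a" and Dv :: "real \<Rightarrow> 'a \<Rightarrow> 'a \<Rightarrow> 'a" and Y :: "nat \<Rightarrow> 'a \<Rightarrow> 'a"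
  assumes T: "T > 0" and N: "N \<ge> 1" and h: "h = T / real N" and \<theta>: "0 \<le> \<theta>" "\<theta> \<le> 1"
    and \<eta>: "\<eta> \<ge> 0" and C2: "C2 \<ge> 0"
    and data: "approx_data T C3 \<eta> C2 v Dv"
    and Y0: "\<And>x. Y 0 x = x"
    and step: "\<And>i x. i < N \<Longrightarrow> Y (Suc i) x - Y i x =
      h *\<^sub>R ((1 - \<theta>) *\<^sub>R grid_avg h v i (Y i x) + \<theta> *\<^sub>R grid_avg h v i (Y (Suc i) x))"
begin

lemma h0: "h > 0" using T N h by simp

lemma grid_le: "i \<le> N \<Longrightarrow> real i * h \<le> T"
  using N T h0 mult_right_mono[of "real i" "real N" h] by (simp add: h)

lemma Nh: "real N * h = T" using N by (simp add: h)

lemma v: "joint_borel v" and vb: "norm (v t x) \<le> C3"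
  using data by (auto simp: approx_data_def)

lemma grid_cell: "i < N \<Longrightarrow> 0 \<le> real i * h \<and> real i * h < real (Suc i) * h \<and> real (Suc i) * h \<le> T"
  using h0 grid_le[of "Suc i"] by auto

definition \<omega> :: real where "\<omega> = distortion TYPE('a) h \<eta> C2"

lemma distortion_le: "\<bar>\<kappa>\<bar> \<le> h \<Longrightarrow> distortion TYPE('a) \<kappa> \<eta> C2 \<le> \<omega>"
  unfolding \<omega>_def distortion_def using \<eta> C2 h0
  by (intro add_mono mult_right_mono mult_left_mono power_mono) (auto simp: det_const_def)

lemma distortion_nonneg: "0 \<le> distortion TYPE('a) \<kappa> \<eta> C2"
  unfolding distortion_def using C2 by (simp add: det_const_def)

lemma Y_compressible:
  assumes small: "h * (DIM('a) * \<eta>) \<le> 1 / 2" "\<omega> \<le> 1 / 2"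
  shows "i \<le> N \<Longrightarrow> compressible ((1 + 4 * \<omega>) ^ i) (Y i)"
proof (induction i)
  case 0
  have "Y 0 = (\<lambda>x. x)" using Y0 by auto
  then show ?case using compressible_id by simp
next
  case (Suc i)
  then have i: "i < N" by simp
  note ab = grid_cell[OF i]
  let ?V = "grid_avg h v i"
  let ?F1 = "\<lambda>x. x + (h * (1 - \<theta>)) *\<^sub>R ?V x" and ?F2 = "\<lambda>x. x + (- (h * \<theta>)) *\<^sub>R ?V x"
  have lip: "norm (?V x - ?V y) \<le> DIM('a) * \<eta> * norm (x - y)" for x y
    unfolding grid_avg_def by (rule approx_data_time_avg(1)[OF data]) (use ab in auto)
  obtain D' where D': "weak_gradient ?V D'" "\<And>x i. i \<in> Basis \<Longrightarrow> norm (D' x i) \<le> \<eta>" "\<And>x. \<bar>trace_div (D' x)\<bar> \<le> C2"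
    using approx_data_time_avg(2)[OF data, of "real i * h" "real (Suc i) * h"] ab unfolding grid_avg_def by blast
  have cV: "continuous_on UNIV ?V"
    by (rule Lipschitz_imp_continuous[of _ "DIM('a) * \<eta>"]) (simp add: dist_norm lip)
  have q0: "\<omega> \<ge> 0" unfolding \<omega>_def by (rule distortion_nonneg)
  have k: "\<bar>h * (1 - \<theta>)\<bar> \<le> h" "\<bar>- (h * \<theta>)\<bar> \<le> h"
    using \<theta> h0 mult_left_mono[of "1 - \<theta>" 1 h] mult_left_mono[of \<theta> 1 h] by (auto simp: abs_mult)
  have sm: "\<bar>\<kappa>\<bar> * (DIM('a) * \<eta>) \<le> 1 / 2" if "\<bar>\<kappa>\<bar> \<le> h" for \<kappa>
    by (rule order_trans[OF mult_right_mono[OF that] small(1)]) (use \<eta> in simp)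
  have d1: "distortion TYPE('a) \<kappa> \<eta> C2 < 1" if "\<bar>\<kappa>\<bar> \<le> h" for \<kappa>
    using distortion_le[OF that] small(2) by simp
  have ae: "AE x in lebesgue. \<forall>i\<in>Basis. norm (D' x i) \<le> \<eta>" "AE x in lebesgue. \<bar>trace_div (D' x)\<bar> \<le> C2"
    using D' by auto
  note pp1 = perturbation_preimage[OF D'(1) cV ae sm[OF k(1)] d1[OF k(1)]]
    and pp2 = perturbation_preimage[OF D'(1) cV ae sm[OF k(2)] d1[OF k(2)]]
  have F1: "compressible (1 / (1 - \<omega>)) ?F1"
  proof (rule compressible_mono)
    show "compressible (1 / (1 - distortion TYPE('a) (h * (1 - \<theta>)) \<eta> C2)) ?F1"
      unfolding compressible_def using pp1(1) pp1(4)[OF open_UNIV] borel_measurable_continuous_onI by blast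
    show "1 / (1 - distortion TYPE('a) (h * (1 - \<theta>)) \<eta> C2) \<le> 1 / (1 - \<omega>)"
      using distortion_le[OF k(1)] small(2) by (intro divide_left_mono) auto
  qed
  have F2: "compressible (1 + \<omega>) (inv ?F2)"
  proof (rule compressible_mono)
    show "compressible (1 + distortion TYPE('a) (- (h * \<theta>)) \<eta> C2) (inv ?F2)"
      unfolding compressible_def using pp2(2) pp2(5)[OF open_UNIV] borel_measurable_continuous_onI by blast
    show "1 + distortion TYPE('a) (- (h * \<theta>)) \<eta> C2 \<le> 1 + \<omega>"
      using distortion_le[OF k(2)] by simp
  qed
  have inj: "inj ?F2" using pp2(3)[OF open_UNIV] by (rule bij_is_inj)
  have Yeq: "Y (Suc i) = (\<lambda>x. inv ?F2 (?F1 (Y i x)))"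
  proof
    fix x
    \<comment> \<open>Injectivity of \<open>?F2\<close> shows that the implicit equation has no
      other solution, so the given \<open>Y (Suc i)\<close>, characterized only by a relation, is a
      composition of compressible maps.\<close>
    have "?F2 (Y (Suc i) x) = ?F1 (Y i x)"
      using step[OF i, of x] by (simp add: algebra_simps)
    then show "Y (Suc i) x = inv ?F2 (?F1 (Y i x))" using inv_f_f[OF inj, of "Y (Suc i) x"] by simp
  qed
  have comp: "compressible ((1 + 4 * \<omega>) ^ i * (1 / (1 - \<omega>)) * (1 + \<omega>)) (\<lambda>x. inv ?F2 (?F1 (Y i x)))"
    by (rule compressible_compose[OF compressible_compose[OF Suc.IH F1] F2]) (use Suc.prems q0 small(2) in auto)
  have le: "(1 + 4 * \<omega>) ^ i * (1 / (1 - \<omega>)) * (1 + \<omega>) \<le> (1 + 4 * \<omega>) ^ Suc i"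
  proof -
    \<comment> \<open>After clearing denominators the claim is
      \<open>2 * \<omega>\<^sup>2 \<le> \<omega>\<close>, which is what
      \<open>\<omega> \<le> 1 / 2\<close> gives.\<close>
    have "\<omega> * \<omega> \<le> \<omega> * (1/2)" using q0 small(2) by (intro mult_left_mono) auto
    then have "1 + \<omega> \<le> (1 + 4 * \<omega>) * (1 - \<omega>)" by (simp add: algebra_simps)
    then have "(1 + \<omega>) / (1 - \<omega>) \<le> 1 + 4 * \<omega>" using small(2) by (simp add: divide_le_eq)
    from mult_left_mono[OF this, of "(1 + 4 * \<omega>) ^ i"] show ?thesis using q0 by (simp add: mult.commute)
  qed
  show ?case unfolding Yeq by (rule compressible_mono[OF comp le])
qed

text \<open>The cap at \<open>N - 1\<close> keeps \<open>P\<close> and \<open>Q\<close> among the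
  maps of the scheme at times from \<open>T\<close> on, and \<open>nat\<close> does so at negative
  times; \<open>path_data\<close> demands compressibility at every real time.\<close>

definition idx :: "real \<Rightarrow> nat" where "idx s = min (N - 1) (nat \<lfloor>s / h\<rfloor>)"

definition P :: "real \<Rightarrow> 'a \<Rightarrow> 'a" where "P s = Y (idx s)"

definition Q :: "real \<Rightarrow> 'a \<Rightarrow> 'a" where "Q s = Y (Suc (idx s))"

lemma idx_less: "idx s < N" using N by (simp add: idx_def)

lemma floor_cell:
  assumes "i < N" "real i * h \<le> s" "s < real (Suc i) * h"
  shows "nat \<lfloor>s / h\<rfloor> = i" "idx s = i"
proof -
  have "real i \<le> s / h" "s / h < real (Suc i)" using assms h0 by (simp_all only: pos_le_divide_eq pos_divide_less_eq)
  then show "nat \<lfloor>s / h\<rfloor> = i" by linarith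
  then show "idx s = i" using assms(1) by (simp add: idx_def)
qed

lemma idx_cell:
  assumes "0 \<le> s" "s < T"
  shows "nat \<lfloor>s / h\<rfloor> = idx s" "real (idx s) * h \<le> s" "s < real (Suc (idx s)) * h"
proof -
  have sN: "s / h < real N" using assms(2) h0 Nh by (simp only: pos_divide_less_eq)
  have s0: "0 \<le> s / h" using assms(1) h0 by simp
  have "nat \<lfloor>s / h\<rfloor> < N" using sN s0 by linarith
  then show e: "nat \<lfloor>s / h\<rfloor> = idx s" by (simp add: idx_def)
  have "real (nat \<lfloor>s / h\<rfloor>) \<le> s / h" "s / h < real (Suc (nat \<lfloor>s / h\<rfloor>))" using s0 by linarith+
  then show "real (idx s) * h \<le> s" "s < real (Suc (idx s)) * h"
    unfolding e using h0 by (simp_all only: pos_le_divide_eq pos_divide_less_eq)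
qed

lemma PQ_measurable:
  assumes Y: "\<And>i. i \<le> N \<Longrightarrow> Y i \<in> borel_measurable borel"
  shows "joint_borel P" "joint_borel Q"
proof -
  have "idx \<in> measurable borel (count_space UNIV)"
    unfolding idx_def by measurable
  moreover have "fst \<in> measurable (borel :: (real \<times> 'a) measure) borel"
    by (intro borel_measurable_continuous_onI continuous_intros)
  ultimately have [measurable]: "(\<lambda>z::real \<times> 'a. idx (fst z)) \<in> measurable borel (count_space UNIV)"
    by (rule measurable_compose[rotated])
  define Y' where "Y' i = (if i \<le> N then Y i else (\<lambda>x. x))" for i
  have [measurable]: "Y' i \<in> borel_measurable borel" for i using Y by (simp add: Y'_def)
  have snd[measurable]: "snd \<in> measurable (borel :: (real \<times> 'a) measure) borel"
    by (intro borel_measurable_continuous_onI continuous_intros)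
  have "(\<lambda>z::real \<times> 'a. Y' (idx (fst z)) (snd z)) \<in> borel_measurable borel"
    by (rule measurable_compose_countable[where g="\<lambda>z. idx (fst z)" and f="\<lambda>i z. Y' i (snd z)"]) measurable
  moreover have "(\<lambda>z::real \<times> 'a. Y' (Suc (idx (fst z))) (snd z)) \<in> borel_measurable borel"
    by (rule measurable_compose_countable[where g="\<lambda>z. idx (fst z)" and f="\<lambda>i z. Y' (Suc i) (snd z)"]) measurable
  ultimately show "joint_borel P" "joint_borel Q"
    unfolding P_def Q_def case_prod_beta' Y'_def if_P[OF less_imp_le[OF idx_less]] if_P[OF Suc_leI[OF idx_less]] .
qed

text \<open>Inside a cell \<open>P\<close> and \<open>Q\<close> do not depend on time, so the
  integral of the velocity over the cell is the combination of the two averages prescribed by the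
  step. The right end point belongs to the half-open cell but already has the next index; it is a
  null set.\<close>

lemma path_grid:
  assumes int: "\<And>a c. integrable lborel (\<lambda>s. indicator {a<..c} s *\<^sub>R velocity \<theta> v P Q s x)"
  shows "k \<le> N \<Longrightarrow> path \<theta> v P Q (real k * h) x = Y k x"
proof (induction k)
  case 0
  then show ?case by (simp add: path_def Y0)
next
  case (Suc k)
  then have k: "k < N" by simp
  note ab = grid_cell[OF k]
  have iv: "integrable lborel (\<lambda>s. indicator {a<..c} s *\<^sub>R v s y)" for a c y
    by (rule bounded_time_integrable[OF section_measurable(2)[OF v] vb])
  have ga: "h *\<^sub>R grid_avg h v k y = (LINT s|lborel. indicator {real k * h<..real (Suc k) * h} s *\<^sub>R v s y)" for y
  proof -
    have "real (Suc k) * h - real k * h = h" by (simp add: algebra_simps)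
    then show ?thesis using h0 unfolding grid_avg_def time_avg_def by simp
  qed
  have "(LINT s|lborel. indicator {0<..real (Suc k) * h} s *\<^sub>R velocity \<theta> v P Q s x)
      = (LINT s|lborel. indicator {0<..real k * h} s *\<^sub>R velocity \<theta> v P Q s x
          + indicator {real k * h<..real (Suc k) * h} s *\<^sub>R velocity \<theta> v P Q s x)"
    using ab by (intro Bochner_Integration.integral_cong refl) (auto simp: indicator_def)
  also have "\<dots> = (LINT s|lborel. indicator {0<..real k * h} s *\<^sub>R velocity \<theta> v P Q s x)
     + (LINT s|lborel. indicator {real k * h<..real (Suc k) * h} s *\<^sub>R velocity \<theta> v P Q s x)"
    by (rule Bochner_Integration.integral_add[OF int int])
  also have "(LINT s|lborel. indicator {real k * h<..real (Suc k) * h} s *\<^sub>R velocity \<theta> v P Q s x)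
     = (LINT s|lborel. (1 - \<theta>) *\<^sub>R (indicator {real k * h<..real (Suc k) * h} s *\<^sub>R v s (Y k x))
          + \<theta> *\<^sub>R (indicator {real k * h<..real (Suc k) * h} s *\<^sub>R v s (Y (Suc k) x)))"
  proof (rule integral_cong_AE)
    show "AE s in lborel. indicator {real k * h<..real (Suc k) * h} s *\<^sub>R velocity \<theta> v P Q s x
       = (1 - \<theta>) *\<^sub>R (indicator {real k * h<..real (Suc k) * h} s *\<^sub>R v s (Y k x))
          + \<theta> *\<^sub>R (indicator {real k * h<..real (Suc k) * h} s *\<^sub>R v s (Y (Suc k) x))"
      using AE_lborel_singleton[of "real (Suc k) * h"]
    proof eventually_elim
      case (elim s)
      show ?case
      proof (cases "s \<in> {real k * h<..real (Suc k) * h}")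
        case True
        then have "idx s = k" using floor_cell(2)[OF k, of s] elim by (auto simp del: of_nat_Suc)
        then show ?thesis using True by (simp add: velocity_def P_def Q_def)
      qed simp
    qed
    show "(\<lambda>s. indicator {real k * h<..real (Suc k) * h} s *\<^sub>R velocity \<theta> v P Q s x) \<in> borel_measurable lborel"
      using int by (rule borel_measurable_integrable)
    show "(\<lambda>s. (1 - \<theta>) *\<^sub>R (indicator {real k * h<..real (Suc k) * h} s *\<^sub>R v s (Y k x))
          + \<theta> *\<^sub>R (indicator {real k * h<..real (Suc k) * h} s *\<^sub>R v s (Y (Suc k) x))) \<in> borel_measurable lborel"
      by (intro borel_measurable_integrable Bochner_Integration.integrable_add integrable_scaleR_right iv)
  qed
  also have "\<dots> = (1 - \<theta>) *\<^sub>R (h *\<^sub>R grid_avg h v k (Y k x)) + \<theta> *\<^sub>R (h *\<^sub>R grid_avg h v k (Y (Suc k) x))"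
    unfolding ga by (subst Bochner_Integration.integral_add, (intro integrable_scaleR_right iv)[1],
        (intro integrable_scaleR_right iv)[1], simp only: integral_scaleR_right iv)
  also have "\<dots> = Y (Suc k) x - Y k x"
    unfolding step[OF k] by (simp add: scaleR_add_right mult.commute)
  finally have eq: "(LINT s|lborel. indicator {0<..real (Suc k) * h} s *\<^sub>R velocity \<theta> v P Q s x)
     = (LINT s|lborel. indicator {0<..real k * h} s *\<^sub>R velocity \<theta> v P Q s x) + (Y (Suc k) x - Y k x)" .
  have "path \<theta> v P Q (real (Suc k) * h) x = path \<theta> v P Q (real k * h) x + (Y (Suc k) x - Y k x)"
    unfolding path_def eq by (simp only: add.assoc)
  then show ?case using Suc.IH k by simp
qed

lemma affine_interpolation_less:
  assumes "0 \<le> t" "t < T"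
  shows "affine_interpolation T N Y t x = P t x + ((t - real (idx t) * h) / h) *\<^sub>R (Q t x - P t x)"
proof -
  have "nat \<lfloor>t / (T / real N)\<rfloor> = idx t" using idx_cell(1)[OF assms] by (simp only: h)
  then show ?thesis using assms unfolding affine_interpolation_def Let_def P_def Q_def h[symmetric] by simp
qed

end

locale scheme_stability = theta_scheme T h \<theta> C3 \<eta> C2 N v Dv Y
  for T h \<theta> C3 \<eta> C2 :: real and N :: nat
    and v :: "real \<Rightarrow> 'a::euclidean_space \<Rightarrow> 'a" and Dv :: "real \<Rightarrow> 'a \<Rightarrow> 'a \<Rightarrow> 'a" and Y :: "nat \<Rightarrow> 'a \<Rightarrow> 'a" +
  fixes p B K L r e \<delta> :: real and b :: "real \<Rightarrow> 'a \<Rightarrow> 'a" and g :: "real \<Rightarrow> 'a \<Rightarrow> real" and \<kappa> :: "real \<Rightarrow> real"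
    and X :: "real \<Rightarrow> 'a \<Rightarrow> 'a"
  assumes p: "p > 1" and B: "B \<ge> 0" and K: "K \<ge> 0" and L: "L \<ge> 1" and e0: "e \<ge> 0" and \<delta>: "\<delta> > 0"
    and field: "field_data T p B K b g \<kappa>"
    and YL: "\<And>i. i \<le> N \<Longrightarrow> compressible L (Y i)"
    and close: "L1_distance T v b \<le> ennreal e"
    and flow: "flow_data T b X" and compX: "\<And>t. t \<in> {0..T} \<Longrightarrow> compressible L (X t)"
begin

lemma PQc: "compressible L (P s)" "compressible L (Q s)"
  unfolding P_def Q_def using YL idx_less[of s] by auto

sublocale path_data T p B K L \<theta> C3 r e b v P Q g \<kappa>
  using PQ_measurable[OF compressible_measurable[OF YL]] PQc
  by unfold_locales (use T p B K L \<theta> e0 field v vb close in auto)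

definition delay_bound :: real where
  "delay_bound = h * B * measure lborel (ball (0::'a) r) + 2 * L * e"

lemma path_split:
  assumes "0 \<le> a" "a \<le> c"
  shows "path \<theta> v P Q c x - path \<theta> v P Q a x = (LINT s|lborel. indicator {a<..c} s *\<^sub>R velocity \<theta> v P Q s x)"
proof -
  have "(LINT s|lborel. indicator {0<..c} s *\<^sub>R velocity \<theta> v P Q s x)
    = (LINT s|lborel. indicator {0<..a} s *\<^sub>R velocity \<theta> v P Q s x + indicator {a<..c} s *\<^sub>R velocity \<theta> v P Q s x)"
    using assms by (intro Bochner_Integration.integral_cong refl) (auto simp: indicator_def)
  then show ?thesis unfolding path_def by (simp add: Bochner_Integration.integral_add[OF velocity_integrable velocity_integrable])
qed

lemma displacement_delay_bound:
  assumes "0 \<le> a" "a \<le> c" "c \<le> T" "c - a \<le> h"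
  shows "ball_distance r (path \<theta> v P Q c) (path \<theta> v P Q a) \<le> ennreal delay_bound"
proof -
  have "B * (c - a) * measure lborel (ball (0::'a) r) + 2 * L * e \<le> delay_bound"
    unfolding delay_bound_def using assms(4) B h0
    by (intro add_mono mult_right_mono order_refl) (auto simp: mult.commute mult_left_mono)
  with integrated_displacement[OF assms(1-3)] show ?thesis
    unfolding path_split[OF assms(1,2)] by (meson ennreal_leI order_trans)
qed

text \<open>\<open>P s\<close> and \<open>Q s\<close> are the positions of the path at the two ends
  of the cell containing \<open>s\<close>, hence at time distance at most \<open>h\<close> from its
  position at \<open>s\<close>.\<close>

lemma delay:
  assumes "0 \<le> s" "s < T"
  shows "ball_distance r (path \<theta> v P Q s) (P s) \<le> ennreal delay_bound"
    and "ball_distance r (path \<theta> v P Q s) (Q s) \<le> ennreal delay_bound"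
proof -
  note ic = idx_cell[OF assms] and gc = grid_cell[OF idx_less, of s]
  have P: "P s x = path \<theta> v P Q (real (idx s) * h) x" and Q: "Q s x = path \<theta> v P Q (real (Suc (idx s)) * h) x" for x
    using path_grid[OF velocity_integrable] idx_less[of s] by (simp_all add: P_def Q_def del: of_nat_Suc)
  show "ball_distance r (path \<theta> v P Q s) (P s) \<le> ennreal delay_bound"
    unfolding P by (rule displacement_delay_bound) (use ic gc assms in \<open>auto simp: algebra_simps\<close>)
  have "(\<integral>\<^sup>+x. indicator (ball 0 r) x * ennreal (norm (path \<theta> v P Q (real (Suc (idx s)) * h) x - path \<theta> v P Q s x)) \<partial>lborel) \<le> ennreal delay_bound"
    by (rule displacement_delay_bound) (use ic gc assms in \<open>auto simp: algebra_simps\<close>)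
  then show "ball_distance r (path \<theta> v P Q s) (Q s) \<le> ennreal delay_bound"
    unfolding Q by (simp add: norm_minus_commute)
qed

lemma delay_bound_nonneg: "delay_bound \<ge> 0"
  using h0 B L e0 by (simp add: delay_bound_def)

sublocale log_stability T p B K L \<theta> C3 r e b v P Q g \<kappa> X delay_bound \<delta>
  by unfold_locales (use delay_bound_nonneg \<delta> flow compX delay in auto)

lemma grid_difference:
  assumes k: "k \<le> N"
  shows "ball_distance r (Y k) (X (real k * h))
    \<le> ennreal (sqrt \<delta> * measure lborel (ball (0::'a) r) + 2 * L * e + 2 * B * T * \<Lambda> / ln (1 + 1 / sqrt \<delta>))"
proof -
  have "real k * h \<in> {0..T}" using grid_le[OF k] h0 by simp
  from integrated_difference[OF this] show ?thesis
    unfolding D_def using path_grid[OF velocity_integrable k] by simp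
qed

text \<open>The interpolation is a convex combination of \<open>P t\<close> and \<open>Q t\<close>,
  both of which are close to the path up to a delay; the path in turn is close to the flow. The
  summand \<open>2 * delay_bound\<close> accounts for the two ends of the cell.\<close>

lemma interpolation_difference:
  assumes t: "t \<in> {0..T}"
  shows "ball_distance r (affine_interpolation T N Y t) (X t)
    \<le> ennreal (2 * delay_bound + (sqrt \<delta> * measure lborel (ball (0::'a) r) + 2 * L * e + 2 * B * T * \<Lambda> / ln (1 + 1 / sqrt \<delta>)))"
    (is "?I \<le> ennreal (2 * delay_bound + ?S)")
proof -
  have \<delta>l: "ln (1 + 1 / sqrt \<delta>) \<ge> 0" using \<delta> by (intro ln_ge_zero) simp
  have S: "?S \<ge> 0" using \<delta> L e0 B T \<Lambda>_nonneg \<delta>l by simp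
  show ?thesis
  proof (cases "t = T")
    case True
    have "?I \<le> ennreal ?S"
      using grid_difference[of N] True by (simp add: affine_interpolation_def Nh)
    also have "\<dots> \<le> ennreal (2 * delay_bound + ?S)" using delay_bound_nonneg by (intro ennreal_leI) simp
    finally show ?thesis .
  next
    case False
    with t have t': "0 \<le> t" "t < T" by auto
    have [measurable]: "path \<theta> v P Q t \<in> borel_measurable borel" "P t \<in> borel_measurable borel" "Q t \<in> borel_measurable borel"
      "D t \<in> borel_measurable borel"
      using section_measurable(1)[OF Z_measurable] compressible_measurable[OF PQc(1)] compressible_measurable[OF PQc(2)]
        section_measurable(1)[OF D_measurable] by auto
    define c where "c = (t - real (idx t) * h) / h"
    have c: "0 \<le> c" "c \<le> 1"
      using idx_cell(2,3)[OF t'] h0 by (auto simp: c_def field_simps)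
    have "?I \<le> (\<integral>\<^sup>+x. indicator (ball 0 r) x * ennreal (norm (path \<theta> v P Q t x - P t x))
       + (indicator (ball 0 r) x * ennreal (norm (path \<theta> v P Q t x - Q t x)) + indicator (ball 0 r) x * ennreal (norm (D t x))) \<partial>lborel)"
    proof (rule nn_integral_mono)
      fix x
      have eq: "affine_interpolation T N Y t x - X t x
          = (1 - c) *\<^sub>R (P t x - path \<theta> v P Q t x) + c *\<^sub>R (Q t x - path \<theta> v P Q t x) + D t x"
        unfolding affine_interpolation_less[OF t'] c_def[symmetric] D_def by (simp add: algebra_simps)
      have "norm (affine_interpolation T N Y t x - X t x) \<le> norm ((1 - c) *\<^sub>R (P t x - path \<theta> v P Q t x)) + norm (c *\<^sub>R (Q t x - path \<theta> v P Q t x)) + norm (D t x)"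
        unfolding eq by (intro order_trans[OF norm_triangle_ineq] add_right_mono norm_triangle_ineq)
      also have "\<dots> \<le> 1 * norm (P t x - path \<theta> v P Q t x) + 1 * norm (Q t x - path \<theta> v P Q t x) + norm (D t x)"
        using c unfolding norm_scaleR by (intro add_mono mult_right_mono) auto
      finally have "norm (affine_interpolation T N Y t x - X t x)
          \<le> norm (path \<theta> v P Q t x - P t x) + (norm (path \<theta> v P Q t x - Q t x) + norm (D t x))"
        by (simp add: norm_minus_commute)
      then have "ennreal (norm (affine_interpolation T N Y t x - X t x))
          \<le> ennreal (norm (path \<theta> v P Q t x - P t x)) + (ennreal (norm (path \<theta> v P Q t x - Q t x)) + ennreal (norm (D t x)))"
        by (simp add: ennreal_plus[symmetric] ennreal_leI del: ennreal_plus)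
      then show "indicator (ball 0 r) x * ennreal (norm (affine_interpolation T N Y t x - X t x))
        \<le> indicator (ball 0 r) x * ennreal (norm (path \<theta> v P Q t x - P t x))
       + (indicator (ball 0 r) x * ennreal (norm (path \<theta> v P Q t x - Q t x)) + indicator (ball 0 r) x * ennreal (norm (D t x)))"
        by (auto simp: indicator_def)
    qed
    also have "\<dots> = ball_distance r (path \<theta> v P Q t) (P t)
       + (ball_distance r (path \<theta> v P Q t) (Q t)
         + (\<integral>\<^sup>+x. indicator (ball 0 r) x * ennreal (norm (D t x)) \<partial>lborel))"
      by (simp add: nn_integral_add)
    also have "\<dots> \<le> ennreal delay_bound + (ennreal delay_bound + ennreal ?S)"
      by (intro add_mono delay t' integrated_difference t)
    also have "\<dots> = ennreal (2 * delay_bound + ?S)"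
      using delay_bound_nonneg S by (simp add: ennreal_plus[symmetric] del: ennreal_plus)
    finally show ?thesis .
  qed
qed

end

section \<open>Choice of the parameters\<close>

text \<open>The exponent of \<open>h\<close> in \<open>\<delta>\<close>. Twice its value is
  \<open>min 1 a\<close>, so for \<open>h < 1\<close> both \<open>h\<close> and
  \<open>h powr a\<close>, and with them the delay, are at most a constant times
  \<open>\<delta>\<^sup>2\<close>.\<close>

definition rate_exponent :: "real \<Rightarrow> real" where
  "rate_exponent a = min 1 a / 2"

text \<open>The leading factor is the inverse of the exponent of \<open>sqrt \<delta>\<close> as a
  power of \<open>h\<close>, since \<open>ln (1 / sqrt \<delta>)\<close> is
  \<open>rate_exponent a / 2\<close> times \<open>\<bar>ln h\<bar>\<close>.\<close>

definition rate_const :: "real \<Rightarrow> real \<Rightarrow> real \<Rightarrow> real \<Rightarrow> real \<Rightarrow> real \<Rightarrow> real \<Rightarrow> real" where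
  "rate_const a T B V C0 L S = 2 / rate_exponent a * (2 * (B * V + 2 * L * C0) + V + 2 * L * C0
     + 2 * B * T * (2 * L * C0 + S + 4 * B * T * (B * V + 2 * L * C0)))"

text \<open>With \<open>u = sqrt \<delta>\<close>, the error and delay terms are bounded by
  multiples of \<open>u\<close>, which decays faster than the inverse logarithm, while the quotients
  by \<open>\<delta>\<close> and \<open>\<delta>\<^sup>2\<close> stay bounded. Only the term divided
  by \<open>ln (1 + 1 / sqrt \<delta>)\<close> is truly of logarithmic order.\<close>

lemma rate_bound:
  fixes h a T B V C0 L S :: real
  assumes h: "0 < h" "h < 1" and a: "a > 0" and nn: "T \<ge> 0" "B \<ge> 0" "V \<ge> 0" "C0 \<ge> 0" "L \<ge> 0" "S \<ge> 0"
    and e: "e = C0 * h powr a" and \<delta>: "\<delta> = h powr rate_exponent a" and e2: "e2 = h * B * V + 2 * L * e"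
  shows "2 * e2 + (sqrt \<delta> * V + 2 * L * e + 2 * B * T * (2 * L * e / \<delta> + S + 4 * B * T * e2 / \<delta>\<^sup>2) / ln (1 + 1 / sqrt \<delta>))
    \<le> rate_const a T B V C0 L S / \<bar>ln h\<bar>"
proof -
  define \<kappa> where "\<kappa> = rate_exponent a"
  define c where "c = \<kappa> / 2"
  define u where "u = h powr c"
  define l where "l = \<bar>ln h\<bar>"
  define E where "E = B * V + 2 * L * C0"
  define \<Lambda> where "\<Lambda> = 2 * L * C0 + S + 4 * B * T * E"
  have \<kappa>: "\<kappa> > 0" "\<kappa> \<le> a / 2" "\<kappa> \<le> 1 / 2" "2 * \<kappa> = min 1 a" using a by (auto simp: \<kappa>_def rate_exponent_def)
  have c: "c > 0" "c \<le> 1" "c \<le> a" using \<kappa> a by (auto simp: c_def)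
  have l: "l > 0" "l = - ln h" using h by (auto simp: l_def)
  have u: "u > 0" using h by (simp add: u_def)
  have mono: "h powr x \<le> h powr y" if "y \<le> x" for x y
    using powr_mono'[OF that] h by simp
  have lu: "ln (1 / u) = c * l" using h l by (simp add: u_def ln_div ln_powr)
  \<comment> \<open>The elementary bound of \<open>ln y\<close> by \<open>y - 1\<close>, at
    \<open>y = 1 / u\<close>, is all that is needed to trade a power of \<open>h\<close> for an
    inverse logarithm.\<close>
  have "c * l \<le> 1 / u" using ln_le_minus_one[of "1 / u"] u lu by simp
  then have "u * (c * l) \<le> 1" using u by (simp add: pos_le_divide_eq mult.commute)
  then have ul: "u \<le> 1 / (c * l)" using c l(1) by (simp add: pos_le_divide_eq)
  have sd: "sqrt \<delta> = u"
    using h by (simp add: \<delta> u_def c_def \<kappa>_def[symmetric] powr_half_sqrt[symmetric] powr_powr)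
  have d2: "\<delta>\<^sup>2 = h powr min 1 a"
    using h \<kappa>(4) by (simp add: \<delta> \<kappa>_def[symmetric] powr_add[symmetric] power2_eq_square)
  have \<delta>0: "\<delta> > 0" using h by (simp add: \<delta>)
  have hu: "h \<le> u" "h powr a \<le> u" using mono[OF c(2)] mono[OF c(3)] h by (auto simp: u_def)
  have hd: "h \<le> \<delta>\<^sup>2" "h powr a \<le> \<delta>\<^sup>2" unfolding d2 using mono[of "min 1 a" 1] mono[of "min 1 a" a] h by auto
  have hd1: "h powr a \<le> \<delta>" unfolding \<delta> \<kappa>_def[symmetric] using \<kappa> a by (intro mono) auto
  have E0: "E \<ge> 0" using nn by (simp add: E_def)
  have e2': "e2 = h * (B * V) + (h powr a) * (2 * L * C0)" by (simp add: e2 e)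
  have e2u: "e2 \<le> u * E"
    unfolding e2' E_def distrib_left using nn by (intro add_mono mult_right_mono hu) auto
  have e2d: "e2 \<le> \<delta>\<^sup>2 * E"
    unfolding e2' E_def distrib_left using nn by (intro add_mono mult_right_mono hd) auto
  have eu: "e \<le> C0 * u" "e \<le> C0 * \<delta>" unfolding e using nn hu hd1 by (auto intro: mult_left_mono)
  have le1: "2 * L * e / \<delta> \<le> 2 * L * C0"
    using mult_left_mono[OF eu(2), of "2 * L"] \<delta>0 nn by (simp add: divide_le_eq mult.assoc)
  have le2: "4 * B * T * e2 / \<delta>\<^sup>2 \<le> 4 * B * T * E"
    using mult_left_mono[OF e2d, of "4 * B * T"] \<delta>0 nn by (simp add: divide_le_eq mult_ac)
  have e20: "e2 \<ge> 0" "e \<ge> 0" using nn h by (auto simp: e2 e)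
  have \<Lambda>le: "2 * L * e / \<delta> + S + 4 * B * T * e2 / \<delta>\<^sup>2 \<le> \<Lambda>" unfolding \<Lambda>_def using le1 le2 by linarith
  have ln: "c * l \<le> ln (1 + 1 / u)" unfolding lu[symmetric] using u by (subst ln_le_cancel_iff) (auto simp: add_pos_pos)
  have \<Lambda>0: "\<Lambda> \<ge> 0" using nn E0 by (simp add: \<Lambda>_def)
  have "2 * B * T * (2 * L * e / \<delta> + S + 4 * B * T * e2 / \<delta>\<^sup>2) / ln (1 + 1 / sqrt \<delta>) \<le> 2 * B * T * \<Lambda> / (c * l)"
    unfolding sd using \<Lambda>le ln mult_pos_pos[OF c(1) l(1)] nn \<Lambda>0 by (intro frac_le mult_left_mono) auto
  moreover have "2 * e2 + (u * V + 2 * L * e) \<le> u * (2 * E + V + 2 * L * C0)"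
    using e2u mult_left_mono[OF eu(1), of "2 * L"] nn by (simp add: algebra_simps)
  moreover have "u * (2 * E + V + 2 * L * C0) \<le> 1 / (c * l) * (2 * E + V + 2 * L * C0)"
    using E0 nn by (intro mult_right_mono ul) auto
  ultimately have "2 * e2 + (sqrt \<delta> * V + 2 * L * e + 2 * B * T * (2 * L * e / \<delta> + S + 4 * B * T * e2 / \<delta>\<^sup>2) / ln (1 + 1 / sqrt \<delta>))
     \<le> 1 / (c * l) * (2 * E + V + 2 * L * C0) + 2 * B * T * \<Lambda> / (c * l)"
    unfolding sd by linarith
  also have "\<dots> = rate_const a T B V C0 L S / l"
    using c l by (simp add: rate_const_def c_def \<kappa>_def[symmetric] E_def \<Lambda>_def field_simps)
  finally show ?thesis by (simp add: l_def)
qed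

lemma rate_const_nonneg:
  assumes "a > 0" "T \<ge> 0" "B \<ge> 0" "V \<ge> 0" "C0 \<ge> 0" "L \<ge> 0" "S \<ge> 0"
  shows "rate_const a T B V C0 L S \<ge> 0"
  using assms by (simp add: rate_const_def rate_exponent_def)

context scheme_stability
begin

lemma rate_of_convergence:
  assumes h1: "h < 1" and a: "a > 0" and C0: "C0 \<ge> 0" and e: "e = C0 * h powr a" and \<delta>': "\<delta> = h powr rate_exponent a"
  defines "R \<equiv> rate_const a T B (measure lborel (ball (0::'a) r)) C0 L (stability_const TYPE('a) p r L * K) / \<bar>ln h\<bar>"
  shows "t \<in> {0..T} \<Longrightarrow>
      ball_distance r (affine_interpolation T N Y t) (X t) \<le> ennreal R"
    and "k \<le> N \<Longrightarrow> ball_distance r (Y k) (X (real k * h)) \<le> ennreal R"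
proof -
  have S: "stability_const TYPE('a) p r L * K \<ge> 0"
    using stability_const_nonneg[where 'a='a, of p L r] p L K by simp
  have "2 * delay_bound + (sqrt \<delta> * measure lborel (ball (0::'a) r) + 2 * L * e + 2 * B * T * \<Lambda> / ln (1 + 1 / sqrt \<delta>)) \<le> R"
    unfolding \<Lambda>_def R_def
    by (rule rate_bound[OF h0 h1 a _ _ _ C0 _ S e \<delta>' delay_bound_def]) (use T B L in auto)
  moreover have "0 \<le> 2 * delay_bound" using delay_bound_nonneg by simp
  ultimately have R: "ennreal (2 * delay_bound + (sqrt \<delta> * measure lborel (ball (0::'a) r) + 2 * L * e + 2 * B * T * \<Lambda> / ln (1 + 1 / sqrt \<delta>))) \<le> ennreal R"
    "ennreal (sqrt \<delta> * measure lborel (ball (0::'a) r) + 2 * L * e + 2 * B * T * \<Lambda> / ln (1 + 1 / sqrt \<delta>)) \<le> ennreal R"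
    by (auto intro!: ennreal_leI)
  show "t \<in> {0..T} \<Longrightarrow>
      ball_distance r (affine_interpolation T N Y t) (X t) \<le> ennreal R"
    by (rule order_trans[OF interpolation_difference R(1)])
  show "k \<le> N \<Longrightarrow> ball_distance r (Y k) (X (real k * h)) \<le> ennreal R"
    by (rule order_trans[OF grid_difference R(2)])
qed

end

section \<open>Time regularity of the flow and limits of compressible maps\<close>

lemma flow_data_Lipschitz:
  fixes b :: "real \<Rightarrow> 'a::euclidean_space \<Rightarrow> 'a"
  assumes flow: "flow_data T b X" and b: "joint_borel b" and bb: "\<And>t x. norm (b t x) \<le> B"
    and st: "0 \<le> s" "s \<le> t" "t \<le> T"
  shows "AE x in lborel. norm (X t x - X s x) \<le> B * (t - s)"
  using flow[unfolded flow_data_def, THEN conjunct2]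
proof eventually_elim
  case (elim x)
  let ?F = "\<lambda>u. b u (X u x)"
  have X: "joint_borel X" using flow by (simp add: flow_data_def)
  have F: "?F \<in> borel_measurable borel" by (rule section_measurable(2)[OF joint_compose[OF b X]])
  note int = bounded_time_integrable[OF F, of B, OF bb]
  have B: "B \<ge> 0" using order_trans[OF norm_ge_zero bb] .
  show ?case
  proof (cases "s = t")
    case False
    with st have lt: "s < t" by simp
    have "(LINT u|lborel. indicator {0<..t} u *\<^sub>R ?F u) = (LINT u|lborel. indicator {0<..s} u *\<^sub>R ?F u + indicator {s<..t} u *\<^sub>R ?F u)"
      using st by (intro Bochner_Integration.integral_cong refl) (auto simp: indicator_def)
    also have "\<dots> = (LINT u|lborel. indicator {0<..s} u *\<^sub>R ?F u) + (LINT u|lborel. indicator {s<..t} u *\<^sub>R ?F u)"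
      by (rule Bochner_Integration.integral_add[OF int int])
    finally have "X t x - X s x = (LINT u|lborel. indicator {s<..t} u *\<^sub>R ?F u)"
      using elim[rule_format, of t] elim[rule_format, of s] st by simp
    also have "\<dots> = (t - s) *\<^sub>R time_avg s t ?F" using lt by (simp add: time_avg_def)
    finally show ?thesis
      using time_avg_norm_le[OF lt _ int, of B] bb lt by (simp add: mult.commute[of B] mult_left_mono)
  qed simp
qed

text \<open>Convergence is only local in L1, so Markov's inequality replaces pointwise limits: if
  \<open>G x\<close> lies deep inside \<open>A\<close> and \<open>F n x\<close> does not lie in
  \<open>A\<close>, the two are a definite distance apart, and the measure of such points in a ball
  tends to 0.\<close>

lemma compressible_L1_limit:
  fixes F :: "nat \<Rightarrow> 'a::euclidean_space \<Rightarrow> 'a"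
  assumes L: "L \<ge> 0" and F: "\<forall>\<^sub>F n in sequentially. compressible L (F n)" and G[measurable]: "G \<in> borel_measurable borel"
    and lim: "\<And>R. R > 0 \<Longrightarrow> (\<lambda>n. \<integral>\<^sup>+x. indicator (ball 0 R) x * ennreal (norm (F n x - G x)) \<partial>lborel) \<longlonglongrightarrow> 0"
  shows "compressible L G"
  unfolding compressible_def
proof (intro conjI allI impI G)
  fix A :: "'a set" assume A: "open A"
  \<comment> \<open>Both parameters grow with \<open>m\<close>: the sets exhaust the preimage of
    \<open>A\<close>, while each is bounded and has images at a positive distance from the
    complement of \<open>A\<close>.\<close>
  define S where "S m = G -` {y. ball y (1 / real (Suc m)) \<subseteq> A} \<inter> ball 0 (real (Suc m))" for m
  have S[measurable]: "S m \<in> sets borel" for m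
  proof -
    have "- {y. ball y (1 / real (Suc m)) \<subseteq> A} = (\<Union>z\<in>-A. ball z (1 / real (Suc m)))"
      by (auto simp: subset_iff dist_commute)
    then have "open (- {y. ball y (1 / real (Suc m)) \<subseteq> A})" by auto
    then have "{y. ball y (1 / real (Suc m)) \<subseteq> A} \<in> sets borel" by (simp add: closed_def)
    from measurable_sets[OF G this] show ?thesis unfolding S_def by simp
  qed
  have "incseq S"
    unfolding incseq_Suc_iff S_def
  proof (intro allI subsetI)
    fix m x assume "x \<in> G -` {y. ball y (1 / real (Suc m)) \<subseteq> A} \<inter> ball 0 (real (Suc m))"
    moreover have "ball y (1 / real (Suc (Suc m))) \<subseteq> ball y (1 / real (Suc m))" for y :: 'a
      by (intro subset_ball) (simp add: field_simps)
    ultimately show "x \<in> G -` {y. ball y (1 / real (Suc (Suc m))) \<subseteq> A} \<inter> ball 0 (real (Suc (Suc m)))" by fastforce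
  qed
  moreover have "(\<Union>m. S m) = G -` A"
  proof (intro equalityI subsetI)
    fix x assume "x \<in> (\<Union>m. S m)"
    then obtain m where "ball (G x) (1 / real (Suc m)) \<subseteq> A" by (auto simp: S_def)
    then show "x \<in> G -` A" using centre_in_ball[of "G x" "1 / real (Suc m)"] by (auto simp: subset_iff simp del: of_nat_Suc)
  next
    fix x assume "x \<in> G -` A"
    then obtain d where d: "d > 0" "ball (G x) d \<subseteq> A" using A by (auto simp: open_contains_ball)
    obtain m1 where m1: "inverse (real (Suc m1)) < d" using reals_Archimedean[OF d(1)] by auto
    obtain m2 :: nat where m2: "norm x < real m2" using reals_Archimedean2 by blast
    let ?m = "max m1 m2"
    have "1 / real (Suc ?m) \<le> 1 / real (Suc m1)" by (intro divide_left_mono) auto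
    then have "1 / real (Suc ?m) \<le> d" using m1 by (simp add: inverse_eq_divide)
    then have "ball (G x) (1 / real (Suc ?m)) \<subseteq> A" using d(2) subset_ball by blast
    moreover have "norm x < real (Suc ?m)" using m2 by auto
    ultimately have "x \<in> S ?m" by (simp add: S_def)
    then show "x \<in> (\<Union>m. S m)" by blast
  qed
  ultimately have sup: "(SUP m. emeasure lborel (S m)) = emeasure lborel (G -` A)"
    using SUP_emeasure_incseq[of S lborel, OF image_subsetI] S by simp
  have "emeasure lborel (S m) \<le> ennreal L * emeasure lborel A" for m
  proof -
    let ?I = "\<lambda>n. \<integral>\<^sup>+x. indicator (ball 0 (real (Suc m))) x * ennreal (norm (F n x - G x)) \<partial>lborel"
    have "\<forall>\<^sub>F n in sequentially. emeasure lborel (S m) \<le> ennreal L * emeasure lborel A + ennreal (real (Suc m)) * ?I n"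
      using F
    proof eventually_elim
      case (elim n)
      note [measurable] = compressible_measurable[OF elim]
      have Am: "F n -` A \<in> sets borel" using measurable_sets[OF compressible_measurable[OF elim], of A] A by simp
      have "emeasure lborel (S m) = (\<integral>\<^sup>+x. indicator (S m) x \<partial>lborel)" by simp
      also have "\<dots> \<le> (\<integral>\<^sup>+x. indicator (F n -` A) x
          + ennreal (real (Suc m)) * (indicator (ball 0 (real (Suc m))) x * ennreal (norm (F n x - G x))) \<partial>lborel)"
      proof (rule nn_integral_mono)
        fix x
        show "indicator (S m) x \<le> indicator (F n -` A) x
          + ennreal (real (Suc m)) * (indicator (ball 0 (real (Suc m))) x * ennreal (norm (F n x - G x)))"
        proof (cases "x \<in> S m \<and> F n x \<notin> A")
          case True
          then have b: "x \<in> ball 0 (real (Suc m))" and "ball (G x) (1 / real (Suc m)) \<subseteq> A" by (auto simp: S_def)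
          with True have "F n x \<notin> ball (G x) (1 / real (Suc m))" by auto
          then have "1 / real (Suc m) \<le> norm (F n x - G x)" by (simp add: dist_norm norm_minus_commute)
          then have "1 \<le> real (Suc m) * norm (F n x - G x)" by (simp add: field_simps)
          then have "1 \<le> ennreal (real (Suc m)) * ennreal (norm (F n x - G x))"
            by (simp add: ennreal_mult[symmetric] del: of_nat_Suc)
          then show ?thesis using True b by (simp add: indicator_def)
        qed (auto simp: indicator_def)
      qed
      also have "\<dots> = emeasure lborel (F n -` A) + ennreal (real (Suc m)) * ?I n"
        using Am by (simp add: nn_integral_add nn_integral_cmult)
      also have "\<dots> \<le> ennreal L * emeasure lborel A + ennreal (real (Suc m)) * ?I n"
        using elim A by (intro add_right_mono) (simp add: compressible_def)
      finally show ?case .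
    qed
    moreover have "(\<lambda>n. ennreal L * emeasure lborel A + ennreal (real (Suc m)) * ?I n) \<longlonglongrightarrow> ennreal L * emeasure lborel A + ennreal (real (Suc m)) * 0"
      by (intro tendsto_add tendsto_const ennreal_tendsto_cmult lim) auto
    ultimately show ?thesis using tendsto_lowerbound[of _ _ sequentially "emeasure lborel (S m)"] by fastforce
  qed
  then show "emeasure lborel (G -` A) \<le> ennreal L * emeasure lborel A"
    unfolding sup[symmetric] by (rule SUP_least)
qed

section \<open>Large time steps\<close>

context theta_scheme
begin

text \<open>A pointwise bound free of \<open>C3\<close> is obtained by averaging over the unit ball
  around \<open>x\<close>. The Lipschitz bound of the averaged field pays
  \<open>DIM('a) * \<eta>\<close> for moving the point; on the ball the field exceeds
  \<open>B\<close> only by its deviation from \<open>b\<close>, whose integral over space and time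
  is at most \<open>e\<close>.\<close>

lemma grid_avg_bound:
  fixes b :: "real \<Rightarrow> 'a \<Rightarrow> 'a"
  assumes i: "i < N" and e: "e \<ge> 0"
    and b: "joint_borel b" and bb: "\<And>t x. norm (b t x) \<le> B"
    and close: "L1_distance T v b \<le> ennreal e"
  shows "norm (grid_avg h v i x) \<le> DIM('a) * \<eta> + B + e / (h * unit_ball_vol DIM('a))"
proof -
  define \<nu> where "\<nu> = unit_ball_vol (real DIM('a))"
  have \<nu>: "\<nu> > 0" by (simp add: \<nu>_def)
  define W where "W y = (\<integral>\<^sup>+s. indicator {0<..<T} s * ennreal (norm (v s y - b s y)) \<partial>lborel)" for y
  note ab = grid_cell[OF i]
  let ?J = "{real i * h<..real (Suc i) * h}"
  have B: "B \<ge> 0" using order_trans[OF norm_ge_zero bb] .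
  have vb': "(\<lambda>(s, y). indicator {0<..<T} s * ennreal (norm (v s y - b s y))) \<in> borel_measurable borel"
  proof -
    have [measurable]: "case_prod v \<in> borel_measurable (borel \<Otimes>\<^sub>M borel)" "case_prod b \<in> borel_measurable (borel \<Otimes>\<^sub>M borel)"
      using v b by (simp_all add: borel_prod)
    have "(\<lambda>z. indicator {0<..<T} (fst z) * ennreal (norm (v (fst z) (snd z) - b (fst z) (snd z)))) \<in> borel_measurable (borel \<Otimes>\<^sub>M borel)"
      by measurable
    then show ?thesis by (simp add: borel_prod case_prod_beta')
  qed
  have [measurable]: "(\<lambda>s. v s y) \<in> borel_measurable borel" "(\<lambda>s. b s y) \<in> borel_measurable borel"
    "v s \<in> borel_measurable borel" "b s \<in> borel_measurable borel" for y s
    by (rule section_measurable[OF v] section_measurable[OF b])+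
  have [measurable]: "W \<in> borel_measurable borel"
  proof -
    have "(\<lambda>(y, s). indicator {0<..<T} s * ennreal (norm (v s y - b s y))) \<in> borel_measurable (borel \<Otimes>\<^sub>M lborel)"
    proof -
      have [measurable]: "case_prod v \<in> borel_measurable (borel \<Otimes>\<^sub>M borel)" "case_prod b \<in> borel_measurable (borel \<Otimes>\<^sub>M borel)"
        using v b by (simp_all add: borel_prod)
      show ?thesis by measurable
    qed
    then show ?thesis unfolding W_def by (rule lborel.borel_measurable_nn_integral)
  qed
  have len: "real (Suc i) * h - real i * h = h" by (simp add: algebra_simps)
  have avg: "ennreal (norm (grid_avg h v i y)) \<le> ennreal B + ennreal (1 / h) * W y" for y
  proof -
    have "ennreal (norm (LINT s|lborel. indicator ?J s *\<^sub>R v s y)) \<le> (\<integral>\<^sup>+s. ennreal (norm (indicator ?J s *\<^sub>R v s y)) \<partial>lborel)"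
      by (intro integral_norm_bound_ennreal bounded_time_integrable[of _ C3] vb) measurable
    also have "\<dots> \<le> (\<integral>\<^sup>+s. ennreal B * indicator ?J s + indicator {0<..<T} s * ennreal (norm (v s y - b s y)) \<partial>lborel)"
    proof (rule nn_integral_mono_AE)
      show "AE s in lborel. ennreal (norm (indicator ?J s *\<^sub>R v s y)) \<le> ennreal B * indicator ?J s + indicator {0<..<T} s * ennreal (norm (v s y - b s y))"
        using AE_lborel_singleton[of T]
      proof eventually_elim
        case (elim s)
        show ?case
        proof (cases "s \<in> ?J")
          case True
          have "norm (v s y) \<le> B + norm (v s y - b s y)"
            using norm_triangle_sub[of "v s y" "b s y"] bb[of s y] by linarith
          then have "ennreal (norm (v s y)) \<le> ennreal B + ennreal (norm (v s y - b s y))"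
            using B by (simp add: ennreal_plus[symmetric] ennreal_leI del: ennreal_plus)
          moreover have "s \<in> {0<..<T}" using True ab elim by auto
          ultimately show ?thesis using True by (simp add: indicator_def)
        qed simp
      qed
    qed
    also have "\<dots> = ennreal (B * h) + W y"
      using ab h0 B len unfolding W_def by (simp add: nn_integral_add nn_integral_cmult ennreal_mult del: of_nat_Suc)
    finally have "ennreal (norm (LINT s|lborel. indicator ?J s *\<^sub>R v s y)) \<le> ennreal (B * h) + W y" .
    from mult_left_mono[OF this, of "ennreal (1 / h)"]
    have "ennreal (1 / h) * ennreal (norm (LINT s|lborel. indicator ?J s *\<^sub>R v s y)) \<le> ennreal (1 / h) * ennreal (B * h) + ennreal (1 / h) * W y"
      by (simp add: distrib_left)
    then show ?thesis
      unfolding grid_avg_def time_avg_def len using h0 B by (simp add: ennreal_mult[symmetric])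
  qed
  have Wint: "(\<integral>\<^sup>+y. W y \<partial>lborel) \<le> ennreal e"
  proof -
    have "(\<integral>\<^sup>+y. W y \<partial>lborel) = (\<integral>\<^sup>+s. \<integral>\<^sup>+y. indicator {0<..<T} s * ennreal (norm (v s y - b s y)) \<partial>lborel \<partial>lborel)"
      unfolding W_def by (rule nn_integral_swap_time[OF vb'])
    also have "\<dots> = L1_distance T v b"
      by (simp add: nn_integral_cmult)
    finally show ?thesis using close by simp
  qed
  have ball: "emeasure lborel (ball x 1) = ennreal \<nu>"
    using emeasure_ball[of 1 x] by (simp add: \<nu>_def)
  have "ennreal (norm (grid_avg h v i x) * \<nu>) = (\<integral>\<^sup>+y. ennreal (norm (grid_avg h v i x)) * indicator (ball x 1) y \<partial>lborel)"
    using \<nu> by (simp add: nn_integral_cmult ball ennreal_mult)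
  also have "\<dots> \<le> (\<integral>\<^sup>+y. ennreal (DIM('a) * \<eta> + B) * indicator (ball x 1) y + ennreal (1 / h) * W y \<partial>lborel)"
  proof (rule nn_integral_mono)
    fix y
    show "ennreal (norm (grid_avg h v i x)) * indicator (ball x 1) y \<le> ennreal (DIM('a) * \<eta> + B) * indicator (ball x 1) y + ennreal (1 / h) * W y"
    proof (cases "y \<in> ball x 1")
      case True
      have "norm (grid_avg h v i x - grid_avg h v i y) \<le> DIM('a) * \<eta> * norm (x - y)"
        unfolding grid_avg_def by (rule approx_data_time_avg(1)[OF data]) (use ab in auto)
      also have "\<dots> \<le> DIM('a) * \<eta> * 1" using True \<eta> by (intro mult_left_mono) (auto simp: dist_norm)
      finally have "norm (grid_avg h v i x) \<le> DIM('a) * \<eta> + norm (grid_avg h v i y)"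
        using norm_triangle_sub[of "grid_avg h v i x" "grid_avg h v i y"] by linarith
      then have "ennreal (norm (grid_avg h v i x)) \<le> ennreal (DIM('a) * \<eta>) + ennreal (norm (grid_avg h v i y))"
        using \<eta> by (simp add: ennreal_plus[symmetric] ennreal_leI del: ennreal_plus)
      also have "\<dots> \<le> ennreal (DIM('a) * \<eta>) + (ennreal B + ennreal (1 / h) * W y)"
        by (intro add_left_mono avg)
      also have "\<dots> = ennreal (DIM('a) * \<eta> + B) + ennreal (1 / h) * W y"
        using \<eta> B by (simp add: add.assoc)
      finally show ?thesis using True by simp
    qed simp
  qed
  also have "\<dots> = ennreal (DIM('a) * \<eta> + B) * ennreal \<nu> + ennreal (1 / h) * (\<integral>\<^sup>+y. W y \<partial>lborel)"
    by (simp add: nn_integral_add nn_integral_cmult ball)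
  also have "\<dots> \<le> ennreal (DIM('a) * \<eta> + B) * ennreal \<nu> + ennreal (1 / h) * ennreal e"
    by (intro add_left_mono mult_left_mono Wint) simp
  also have "\<dots> = ennreal ((DIM('a) * \<eta> + B) * \<nu> + e / h)"
    using \<eta> B \<nu> h0 e by (simp add: ennreal_mult[symmetric] del: ennreal_plus add: ennreal_plus[symmetric])
  finally have le: "ennreal (norm (grid_avg h v i x) * \<nu>) \<le> ennreal ((DIM('a) * \<eta> + B) * \<nu> + e / h)" .
  have "0 \<le> (DIM('a) * \<eta> + B) * \<nu> + e / h" using \<eta> B \<nu> h0 e by simp
  with le have "norm (grid_avg h v i x) * \<nu> \<le> (DIM('a) * \<eta> + B) * \<nu> + e / h"
    by (simp only: ennreal_le_iff)
  then have "norm (grid_avg h v i x) \<le> ((DIM('a) * \<eta> + B) * \<nu> + e / h) / \<nu>"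
    using \<nu> by (simp only: pos_le_divide_eq)
  also have "\<dots> = DIM('a) * \<eta> + B + e / (h * \<nu>)" using \<nu> by (simp add: add_divide_distrib)
  finally show ?thesis by (simp add: \<nu>_def)
qed

lemma interpolation_displacement:
  assumes M: "\<And>i x. i < N \<Longrightarrow> norm (grid_avg h v i x) \<le> M" and t: "t \<in> {0..T}"
  shows "norm (affine_interpolation T N Y t x - x) \<le> T * M"
proof -
  have M0: "M \<ge> 0" using order_trans[OF norm_ge_zero M[of 0]] N by simp
  have Y: "norm (Y i x - x) \<le> real i * h * M" if "i \<le> N" for i
    using that
  proof (induction i)
    case (Suc i)
    then have i: "i < N" by simp
    have "norm (Y (Suc i) x - Y i x) \<le> h * ((1 - \<theta>) * norm (grid_avg h v i (Y i x)) + \<theta> * norm (grid_avg h v i (Y (Suc i) x)))"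
      unfolding step[OF i] norm_scaleR using h0 \<theta> by (intro mult_mono order_trans[OF norm_triangle_ineq]) auto
    also have "\<dots> \<le> h * ((1 - \<theta>) * M + \<theta> * M)"
      using h0 \<theta> M[OF i] by (intro mult_left_mono add_mono) auto
    also have "\<dots> = h * M" by (simp add: algebra_simps)
    finally show ?case
      using Suc.IH i norm_triangle_ineq[of "Y i x - x" "Y (Suc i) x - Y i x"] by (simp add: algebra_simps)
  qed (simp add: Y0)
  have YT: "norm (Y i x - x) \<le> T * M" if "i \<le> N" for i
    using Y[OF that] mult_right_mono[OF grid_le[OF that] M0] by simp
  show ?thesis
  proof (cases "t = T")
    case True
    then show ?thesis using YT[of N] by (simp add: affine_interpolation_def)
  next
    case False
    with t have t': "0 \<le> t" "t < T" by auto
    define c where "c = (t - real (idx t) * h) / h"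
    have c: "0 \<le> c" "c \<le> 1" using idx_cell(2,3)[OF t'] h0 by (auto simp: c_def field_simps)
    have eq: "affine_interpolation T N Y t x - x = (1 - c) *\<^sub>R (P t x - x) + c *\<^sub>R (Q t x - x)"
      unfolding affine_interpolation_less[OF t'] c_def[symmetric] by (simp add: algebra_simps)
    have "norm ((1 - c) *\<^sub>R (P t x - x) + c *\<^sub>R (Q t x - x)) \<le> (1 - c) * norm (P t x - x) + c * norm (Q t x - x)"
      using c by (intro order_trans[OF norm_triangle_ineq]) simp
    also have "\<dots> \<le> (1 - c) * (T * M) + c * (T * M)"
      unfolding P_def Q_def using c idx_less[of t] by (intro add_mono mult_left_mono YT) auto
    also have "\<dots> = T * M" by (simp add: algebra_simps)
    finally show ?thesis unfolding eq .
  qed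
qed

end

section \<open>The compressibility constant\<close>

text \<open>With the gradient bound \<open>C1 / sqrt h\<close>, even the quadratic part of
  \<open>distortion\<close> at step \<open>h\<close> is linear in \<open>h\<close>; this is the
  resulting slope.\<close>

definition defect_rate :: "'a::euclidean_space itself \<Rightarrow> real \<Rightarrow> real \<Rightarrow> real" where
  "defect_rate _ C1 C2 = C2 + det_const DIM('a) * C1\<^sup>2"

definition flow_const :: "'a::euclidean_space itself \<Rightarrow> real \<Rightarrow> real \<Rightarrow> real \<Rightarrow> real" where
  "flow_const _ T C1 C2 = exp (4 * defect_rate TYPE('a) C1 C2 * T)"

text \<open>The three bounds ensure in turn that \<open>h < 1\<close>, that each half of a step
  perturbs the identity by a contraction with constant 1/2, and that the distortion is at most
  1/2.\<close>

definition step_threshold :: "'a::euclidean_space itself \<Rightarrow> real \<Rightarrow> real \<Rightarrow> real" where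
  "step_threshold _ C1 C2 = min (1 / 2) (min ((1 / (2 * (real DIM('a) * C1)))\<^sup>2) (1 / (2 * defect_rate TYPE('a) C1 C2)))"

lemma defect_rate_pos: "C2 > 0 \<Longrightarrow> defect_rate TYPE('a::euclidean_space) C1 C2 > 0"
  by (simp add: defect_rate_def det_const_def add_pos_nonneg)

lemma flow_const_ge_1: "T > 0 \<Longrightarrow> C2 > 0 \<Longrightarrow> flow_const TYPE('a::euclidean_space) T C1 C2 \<ge> 1"
  using defect_rate_pos[where 'a='a, of C2 C1] by (simp add: flow_const_def)

lemma step_threshold_pos: "C1 > 0 \<Longrightarrow> C2 > 0 \<Longrightarrow> step_threshold TYPE('a::euclidean_space) C1 C2 > 0"
  using defect_rate_pos[where 'a='a, of C2 C1] by (simp add: step_threshold_def)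

lemma small_step:
  fixes h C1 C2 :: real
  assumes h: "0 < h" "h \<le> step_threshold TYPE('a::euclidean_space) C1 C2" and C: "C1 > 0" "C2 > 0"
  shows "h < 1" "h * (DIM('a) * (C1 / sqrt h)) \<le> 1 / 2"
    "distortion TYPE('a) h (C1 / sqrt h) C2 = h * defect_rate TYPE('a) C1 C2" "h * defect_rate TYPE('a) C1 C2 \<le> 1 / 2"
proof -
  note d = defect_rate_pos[where 'a='a, OF C(2), of C1]
  have hs: "h / sqrt h = sqrt h" using h by (simp add: real_div_sqrt)
  show "h < 1" using h by (simp add: step_threshold_def)
  have "sqrt h \<le> sqrt ((1 / (2 * (real DIM('a) * C1)))\<^sup>2)" using h by (intro real_sqrt_le_mono) (simp add: step_threshold_def)
  then have "sqrt h \<le> 1 / (2 * (real DIM('a) * C1))" using C by simp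
  then have "sqrt h * (2 * (real DIM('a) * C1)) \<le> 1" using C by (simp add: pos_le_divide_eq)
  moreover have "h * (DIM('a) * (C1 / sqrt h)) = (h / sqrt h) * (DIM('a) * C1)" by simp
  ultimately show "h * (DIM('a) * (C1 / sqrt h)) \<le> 1 / 2" unfolding hs by simp
  have "(h * (C1 / sqrt h))\<^sup>2 = (h / sqrt h * C1)\<^sup>2" by simp
  also have "\<dots> = h * C1\<^sup>2" unfolding hs using h by (simp add: power_mult_distrib)
  finally show "distortion TYPE('a) h (C1 / sqrt h) C2 = h * defect_rate TYPE('a) C1 C2"
    using h by (simp add: distortion_def defect_rate_def algebra_simps)
  have "h \<le> 1 / (2 * defect_rate TYPE('a) C1 C2)" using h by (simp add: step_threshold_def)
  then have "h * (2 * defect_rate TYPE('a) C1 C2) \<le> 1" using d by (simp add: pos_le_divide_eq)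
  then show "h * defect_rate TYPE('a) C1 C2 \<le> 1 / 2" by simp
qed

text \<open>The factors \<open>1 + 4 * \<omega>\<close> of at most \<open>N\<close> steps accumulate
  to an exponential, and \<open>real i * h \<le> T\<close> removes the dependence on
  \<open>N\<close>.\<close>

lemma scheme_compressible:
  fixes Y :: "nat \<Rightarrow> 'a::euclidean_space \<Rightarrow> 'a"
  assumes scheme: "theta_scheme T h \<theta> C3 (C1 / sqrt h) C2 N v Dv Y" and C: "C1 > 0" "C2 > 0"
    and hle: "h \<le> step_threshold TYPE('a) C1 C2" and i: "i \<le> N"
  shows "compressible (flow_const TYPE('a) T C1 C2) (Y i)"
proof -
  interpret theta_scheme T h \<theta> C3 "C1 / sqrt h" C2 N v Dv Y by (rule scheme)
  note s = small_step[OF h0 hle C]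
  let ?d = "defect_rate TYPE('a) C1 C2"
  have d: "?d > 0" using defect_rate_pos C by blast
  have "(1 + 4 * (h * ?d)) ^ i \<le> exp (4 * (h * ?d)) ^ i"
    using d h0 by (intro power_mono exp_ge_add_one_self) simp
  also have "\<dots> = exp (4 * ?d * (real i * h))" by (simp add: exp_of_nat_mult[symmetric] mult_ac)
  also have "\<dots> \<le> flow_const TYPE('a) T C1 C2"
    unfolding flow_const_def using grid_le[OF i] d by simp
  finally have "(1 + 4 * (h * ?d)) ^ i \<le> flow_const TYPE('a) T C1 C2" .
  moreover have "compressible ((1 + 4 * (h * ?d)) ^ i) (Y i)"
    using Y_compressible[OF s(2) _ i] s(3,4) by (simp add: \<omega>_def)
  ultimately show ?thesis by (rule compressible_mono[rotated])
qed

locale flow_approximation =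
  fixes T p B K C0 C1 C2 C3 \<alpha> \<beta> :: real and b0 b :: "real \<Rightarrow> 'a::euclidean_space \<Rightarrow> 'a"
    and b\<epsilon> :: "real \<Rightarrow> real \<Rightarrow> 'a \<Rightarrow> 'a" and g :: "real \<Rightarrow> 'a \<Rightarrow> real" and \<kappa> :: "real \<Rightarrow> real" and Z :: "(real \<times> 'a) set"
    and X :: "real \<Rightarrow> 'a \<Rightarrow> 'a"
  assumes T: "T > 0" and p: "p > 1" and K: "K \<ge> 0" and C: "C0 > 0" "C1 > 0" "C2 > 0" "C3 > 0" and \<alpha>: "\<alpha> > 0" and \<beta>: "\<beta> > 0"
    and field: "field_data T p B K b g \<kappa>"
    and approx: "approximating_sequence T b0 b\<epsilon> C0 C1 C2 C3 \<alpha> \<beta>"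
    and Z: "Z \<in> sets borel" "emeasure lborel Z = 0" and b0: "\<And>t x. t \<in> {0<..<T} \<Longrightarrow> (t, x) \<notin> Z \<Longrightarrow> b0 t x = b t x"
    and flow: "flow_data T b X"
begin

lemma b: "joint_borel b" and bb: "norm (b t x) \<le> B"
  using field by (auto simp: field_data_def)

lemma B: "B \<ge> 0" using order_trans[OF norm_ge_zero bb] .

abbreviation error where "error h \<equiv> C0 * h powr (\<alpha> / (2 * \<beta>))"

abbreviation close where "close v h \<equiv>
  L1_distance T v b \<le> ennreal (error h)"

lemma approx_field:
  assumes h: "h > 0"
  obtains v Dv where "approx_data T C3 (C1 / sqrt h) C2 v Dv"
    "AE t in lborel. t \<in> {0<..<T} \<longrightarrow> (\<forall>x. b\<epsilon> (h powr (1 / (2 * \<beta>))) t x = v t x)" "close v h"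
proof -
  have "(h powr (1 / (2 * \<beta>))) powr \<beta> = sqrt h" "(h powr (1 / (2 * \<beta>))) powr \<alpha> = h powr (\<alpha> / (2 * \<beta>))"
    using h \<beta> by (simp_all add: powr_powr powr_half_sqrt[symmetric])
  then show ?thesis
    using approx_data_exists[OF approx _ C(2,3,4) b Z b0, of "h powr (1 / (2 * \<beta>))"] h that by auto
qed

text \<open>\<open>L\<close> is left free above \<open>flow_const\<close>, so that the estimate can
  be used both with the unknown compressibility constant of the flow and with the controlled
  one.\<close>

lemma scheme_rate:
  fixes Y :: "nat \<Rightarrow> 'a \<Rightarrow> 'a"
  assumes scheme: "theta_scheme T h \<theta> C3 (C1 / sqrt h) C2 N v Dv Y" and close: "close v h"
    and h: "h \<le> step_threshold TYPE('a) C1 C2" and L: "L \<ge> flow_const TYPE('a) T C1 C2" and X: "\<And>t. t \<in> {0..T} \<Longrightarrow> compressible L (X t)"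
  defines "R \<equiv> \<lambda>r. rate_const (\<alpha> / (2 * \<beta>)) T B (measure lborel (ball (0::'a) r)) C0 L (stability_const TYPE('a) p r L * K) / \<bar>ln h\<bar>"
  shows "t \<in> {0..T} \<Longrightarrow>
      ball_distance r (affine_interpolation T N Y t) (X t) \<le> ennreal (R r)"
    and "k \<le> N \<Longrightarrow> ball_distance r (Y k) (X (real k * h)) \<le> ennreal (R r)"
proof -
  interpret S: theta_scheme T h \<theta> C3 "C1 / sqrt h" C2 N v Dv Y by (rule scheme)
  note s = small_step[OF S.h0 h C(2,3)]
  have L1: "L \<ge> 1" using L flow_const_ge_1[where 'a='a, OF T C(3), of C1] by simp
  interpret scheme_stability T h \<theta> C3 "C1 / sqrt h" C2 N v Dv Y p B K L r "error h" "h powr rate_exponent (\<alpha> / (2 * \<beta>))" b g \<kappa> X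
  proof unfold_locales
    show "\<And>i. i \<le> N \<Longrightarrow> compressible L (Y i)"
      using scheme_compressible[OF scheme C(2,3) h] L compressible_mono by blast
  qed (use p B K L1 C S.h0 field close flow X in auto)
  note R = rate_of_convergence[OF s(1) _ _ refl refl, folded R_def]
  show "t \<in> {0..T} \<Longrightarrow>
      ball_distance r (affine_interpolation T N Y t) (X t) \<le> ennreal (R r)"
    unfolding R_def by (rule rate_of_convergence(1)[OF s(1) _ _ refl refl]) (use \<alpha> \<beta> C in auto)
  show "k \<le> N \<Longrightarrow> ball_distance r (Y k) (X (real k * h)) \<le> ennreal (R r)"
    unfolding R_def by (rule rate_of_convergence(2)[OF s(1) _ _ refl refl]) (use \<alpha> \<beta> C in auto)
qed

lemma euler_scheme:
  assumes data: "approx_data T C3 (C1 / sqrt h) C2 v Dv" and N: "N \<ge> 1" and h: "h = T / real N"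
  obtains Y where "theta_scheme T h 0 C3 (C1 / sqrt h) C2 N v Dv Y"
proof
  define Y where "Y = rec_nat (\<lambda>x. x) (\<lambda>i F x. F x + h *\<^sub>R grid_avg h v i (F x))"
  show "theta_scheme T h 0 C3 (C1 / sqrt h) C2 N v Dv Y"
    by unfold_locales (use T N h C data in \<open>auto simp: Y_def\<close>)
qed

text \<open>The rate \<open>c r\<close> depends on the unknown \<open>L\<close> through
  \<open>M\<close>, but it only has to tend to 0 after division by the logarithm; the
  compressibility constant of the approximating maps is free of \<open>L\<close>, and it is that
  constant which survives in the L1 limit.\<close>

lemma compressibility_improvement:
  assumes XL: "\<And>t. t \<in> {0..T} \<Longrightarrow> compressible L (X t)" and t: "t \<in> {0..T}"
  shows "compressible (flow_const TYPE('a) T C1 C2) (X t)"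
proof -
  define M where "M = max L (flow_const TYPE('a) T C1 C2)"
  have L1: "flow_const TYPE('a) T C1 C2 \<ge> 1" by (rule flow_const_ge_1[OF T C(3)])
  have XM: "\<And>t. t \<in> {0..T} \<Longrightarrow> compressible M (X t)" using XL compressible_mono unfolding M_def by fastforce
  define h where "h n = T / real (Suc n)" for n
  define V where "V r = measure lborel (ball (0::'a) r)" for r
  define c where "c r = rate_const (\<alpha> / (2 * \<beta>)) T B (V r) C0 M (stability_const TYPE('a) p r M * K)" for r
  \<comment> \<open>The implication makes the claim vacuous for the finitely many \<open>n\<close>
    whose step is too large, so that a sequence can be chosen over all \<open>n\<close>.\<close>
  have "\<exists>F. h n \<le> step_threshold TYPE('a) C1 C2 \<longrightarrow> compressible (flow_const TYPE('a) T C1 C2) F \<and>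
      (\<forall>r. ball_distance r F (X t) \<le> ennreal (c r / \<bar>ln (h n)\<bar>) + ennreal (B * h n) * ennreal (V r))" for n
  proof (cases "h n \<le> step_threshold TYPE('a) C1 C2")
    case True
    have hn: "h n > 0" using T by (simp add: h_def)
    obtain v Dv where v: "approx_data T C3 (C1 / sqrt (h n)) C2 v Dv" "close v (h n)"
      using approx_field[OF hn] by blast
    obtain Y where Y: "theta_scheme T (h n) 0 C3 (C1 / sqrt (h n)) C2 (Suc n) v Dv Y"
      using euler_scheme[OF v(1), of "Suc n"] by (auto simp: h_def)
    \<comment> \<open>The last grid time not after \<open>t\<close>; the flow moves by at most
      \<open>B * h n\<close> from there to \<open>t\<close>.\<close>
    define k where "k = nat \<lfloor>t / h n\<rfloor>"
    have q: "0 \<le> t / h n" using t hn by simp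
    have "t / h n \<le> real (Suc n)" using t hn divide_right_mono[of t T "h n"] T by (simp add: h_def)
    then have k: "k \<le> Suc n" unfolding k_def using q by linarith
    have k2: "real k \<le> t / h n" "t / h n < real k + 1" unfolding k_def using q by linarith+
    have kt: "real k * h n \<le> t" "t - real k * h n \<le> h n"
      using k2 hn by (simp_all add: pos_le_divide_eq pos_divide_less_eq algebra_simps)
    have [measurable]: "Y k \<in> borel_measurable borel" "X s \<in> borel_measurable borel" for s
      using compressible_measurable[OF scheme_compressible[OF Y C(2,3) True k]] flow
      by (auto simp: flow_data_def intro: section_measurable(1))
    have "ball_distance r (Y k) (X t) \<le> ennreal (c r / \<bar>ln (h n)\<bar>) + ennreal (B * h n) * ennreal (V r)" for r
    proof -
      have "AE x in lborel. norm (X t x - X (real k * h n) x) \<le> B * (t - real k * h n)"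
        by (rule flow_data_Lipschitz[OF flow b bb]) (use kt hn t in auto)
      then have "ball_distance r (Y k) (X t)
        \<le> (\<integral>\<^sup>+x. indicator (ball 0 r) x * ennreal (norm (Y k x - X (real k * h n) x)) + ennreal (B * h n) * indicator (ball 0 r) x \<partial>lborel)"
      proof (intro nn_integral_mono_AE, eventually_elim)
        case (elim x)
        have "norm (Y k x - X t x) \<le> norm (Y k x - X (real k * h n) x) + norm (X t x - X (real k * h n) x)"
          using norm_triangle_ineq4[of "Y k x - X (real k * h n) x" "X t x - X (real k * h n) x"] by simp
        also have "\<dots> \<le> norm (Y k x - X (real k * h n) x) + B * h n"
          using elim mult_left_mono[OF kt(2) B] by simp
        finally have "ennreal (norm (Y k x - X t x)) \<le> ennreal (norm (Y k x - X (real k * h n) x)) + ennreal (B * h n)"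
          using B hn by (simp add: ennreal_plus[symmetric] ennreal_leI del: ennreal_plus)
        then show ?case by (auto simp: indicator_def)
      qed
      also have "\<dots> = ball_distance r (Y k) (X (real k * h n)) + ennreal (B * h n) * emeasure lborel (ball (0::'a) r)"
        by (simp add: nn_integral_add nn_integral_cmult)
      also have "emeasure lborel (ball (0::'a) r) = ennreal (V r)"
        unfolding V_def using emeasure_lborel_ball_finite[of "0::'a" r] by (intro emeasure_eq_ennreal_measure) (simp add: less_top)
      finally show ?thesis
        using scheme_rate(2)[OF Y v(2) True _ XM k, of r] unfolding c_def V_def
        by (rule order_trans[OF _ add_right_mono]) (simp_all add: M_def)
    qed
    then show ?thesis using scheme_compressible[OF Y C(2,3) True k] by blast
  qed simp
  then have "\<exists>F. \<forall>n. h n \<le> step_threshold TYPE('a) C1 C2 \<longrightarrow> compressible (flow_const TYPE('a) T C1 C2) (F n) \<and>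
      (\<forall>r. ball_distance r (F n) (X t) \<le> ennreal (c r / \<bar>ln (h n)\<bar>) + ennreal (B * h n) * ennreal (V r))"
    by (intro choice allI)
  then obtain F where F: "\<And>n. h n \<le> step_threshold TYPE('a) C1 C2 \<Longrightarrow> compressible (flow_const TYPE('a) T C1 C2) (F n)"
    "\<And>n r. h n \<le> step_threshold TYPE('a) C1 C2 \<Longrightarrow>
      ball_distance r (F n) (X t) \<le> ennreal (c r / \<bar>ln (h n)\<bar>) + ennreal (B * h n) * ennreal (V r)"
    by blast
  have "h = (\<lambda>n. T / real (Suc n))" by (auto simp: h_def)
  then have h0: "h \<longlonglongrightarrow> 0"
    using LIMSEQ_Suc[OF lim_const_over_n[of T]] by (simp only:)
  then have hr: "filterlim h (at_right 0) sequentially"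
    using T by (intro tendsto_imp_filterlim_at_right) (auto simp: h_def)
  have ev: "\<forall>\<^sub>F n in sequentially. h n \<le> step_threshold TYPE('a) C1 C2"
    using order_tendstoD(2)[OF h0 step_threshold_pos[where 'a='a, OF C(2,3)]] by eventually_elim simp
  show ?thesis
  proof (rule compressible_L1_limit[of _ F])
    show "\<forall>\<^sub>F n in sequentially. compressible (flow_const TYPE('a) T C1 C2) (F n)" using ev by eventually_elim (rule F(1))
    show "X t \<in> borel_measurable borel" using flow by (auto simp: flow_data_def intro: section_measurable(1))
    fix r :: real
    have "filterlim (\<lambda>n. ln (h n)) at_infinity sequentially"
      by (rule filterlim_mono[OF filterlim_compose[OF ln_at_0 hr] at_bot_le_at_infinity order_refl])
    then have "(\<lambda>n. c r / ln (h n)) \<longlonglongrightarrow> 0" by (rule tendsto_divide_0[OF tendsto_const])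
    then have "(\<lambda>n. \<bar>c r\<bar> / \<bar>ln (h n)\<bar>) \<longlonglongrightarrow> 0" using tendsto_rabs_zero by fastforce
    then have "(\<lambda>n. ennreal (\<bar>c r\<bar> / \<bar>ln (h n)\<bar>) + ennreal (B * h n) * ennreal (V r)) \<longlonglongrightarrow> ennreal 0 + ennreal (B * 0) * ennreal (V r)"
      unfolding mult.commute[of _ "ennreal (V r)"]
      by (intro tendsto_add tendsto_ennrealI ennreal_tendsto_cmult tendsto_mult_left h0) auto
    then have lim: "(\<lambda>n. ennreal (\<bar>c r\<bar> / \<bar>ln (h n)\<bar>) + ennreal (B * h n) * ennreal (V r)) \<longlonglongrightarrow> 0" by simp
    show "(\<lambda>n. \<integral>\<^sup>+x. indicator (ball 0 r) x * ennreal (norm (F n x - X t x)) \<partial>lborel) \<longlonglongrightarrow> 0"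
    proof (rule tendsto_sandwich[OF _ _ tendsto_const lim])
      show "\<forall>\<^sub>F n in sequentially. ball_distance r (F n) (X t) \<le> ennreal (\<bar>c r\<bar> / \<bar>ln (h n)\<bar>) + ennreal (B * h n) * ennreal (V r)"
        using ev
      proof eventually_elim
        case (elim n)
        show ?case by (rule order_trans[OF F(2)[OF elim]]) (intro add_right_mono ennreal_leI divide_right_mono abs_ge_self; simp)
      qed
    qed simp
  qed (use L1 in simp)
qed

lemma scheme_of_method:
  assumes \<theta>: "0 \<le> \<theta>" "\<theta> \<le> 1" and N: "N \<ge> 1" and h: "h = T / real N"
    and meth: "theta_method T N \<theta> (b\<epsilon> (h powr (1 / (2 * \<beta>)))) Y"
  obtains v Dv where "theta_scheme T h \<theta> C3 (C1 / sqrt h) C2 N v Dv Y" "close v h"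
proof -
  have h0: "h > 0" using T N h by simp
  obtain v Dv where v: "approx_data T C3 (C1 / sqrt h) C2 v Dv" "close v h"
    and eq: "AE t in lborel. t \<in> {0<..<T} \<longrightarrow> (\<forall>x. b\<epsilon> (h powr (1 / (2 * \<beta>))) t x = v t x)"
    using approx_field[OF h0] by blast
  have vm: "joint_borel v" using v(1) by (simp add: approx_data_def)
  have avg: "average (real i * h) (real (Suc i) * h) (\<lambda>s. b\<epsilon> (h powr (1 / (2 * \<beta>))) s y) = grid_avg h v i y" if "i < N" for i y
    unfolding grid_avg_def
  proof (rule average_eq_time_avg[OF section_measurable(2)[OF vm]])
    show "AE s in lborel. s \<in> {0<..<T} \<longrightarrow> b\<epsilon> (h powr (1 / (2 * \<beta>))) s y = v s y"
      using eq by eventually_elim simp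
    show "0 \<le> real i * h" using h0 by simp
    have "real (Suc i) * h \<le> real N * h" using that h0 by (intro mult_right_mono) auto
    then show "real (Suc i) * h \<le> T" using N by (simp add: h)
  qed
  have "theta_scheme T h \<theta> C3 (C1 / sqrt h) C2 N v Dv Y"
  proof unfold_locales
    show "Y 0 x = x" for x using meth by (simp add: theta_method_def Let_def)
    fix i x assume i: "i < N"
    have "(1 / h) *\<^sub>R (Y (Suc i) x - Y i x) = (1 - \<theta>) *\<^sub>R grid_avg h v i (Y i x) + \<theta> *\<^sub>R grid_avg h v i (Y (Suc i) x)"
      using meth i unfolding theta_method_def Let_def h[symmetric] by (simp only: avg)
    then have "h *\<^sub>R ((1 / h) *\<^sub>R (Y (Suc i) x - Y i x)) = h *\<^sub>R ((1 - \<theta>) *\<^sub>R grid_avg h v i (Y i x) + \<theta> *\<^sub>R grid_avg h v i (Y (Suc i) x))"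
      by (simp only:)
    then show "Y (Suc i) x - Y i x = h *\<^sub>R ((1 - \<theta>) *\<^sub>R grid_avg h v i (Y i x) + \<theta> *\<^sub>R grid_avg h v i (Y (Suc i) x))"
      using h0 by simp
  qed (use T N h \<theta> C h0 v in auto)
  with v(2) show ?thesis using that by blast
qed

text \<open>For \<open>h\<close> between \<open>\<tau>\<close> and \<open>T\<close> the gradient
  bound is at most \<open>C1 / sqrt \<tau>\<close> and the L1 error at most its value at
  \<open>T\<close>, so the scheme and the flow both stay within a fixed distance of the starting
  point.\<close>

lemma large_step_bound:
  fixes Y :: "nat \<Rightarrow> 'a \<Rightarrow> 'a"
  assumes scheme: "theta_scheme T h \<theta> C3 (C1 / sqrt h) C2 N v Dv Y" and close: "close v h"
    and hle: "\<tau> \<le> h" and \<tau>: "\<tau> > 0" and t: "t \<in> {0..T}"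
  shows "ball_distance r (affine_interpolation T N Y t) (X t)
    \<le> ennreal ((T * (DIM('a) * (C1 / sqrt \<tau>) + B + error T / (\<tau> * unit_ball_vol DIM('a))) + T * B) * measure lborel (ball (0::'a) r))"
proof -
  interpret theta_scheme T h \<theta> C3 "C1 / sqrt h" C2 N v Dv Y by (rule scheme)
  let ?M = "DIM('a) * (C1 / sqrt \<tau>) + B + error T / (\<tau> * unit_ball_vol (real DIM('a)))"
  have hT: "h \<le> T" using grid_le[of 1] N by simp
  have M: "norm (grid_avg h v i x) \<le> ?M" if "i < N" for i x
  proof -
    have "norm (grid_avg h v i x) \<le> DIM('a) * (C1 / sqrt h) + B + error h / (h * unit_ball_vol DIM('a))"
      by (rule grid_avg_bound[OF that _ b bb close]) (use C in simp)
    also have "\<dots> \<le> ?M"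
      using hle \<tau> hT h0 C \<alpha> \<beta>
      by (intro add_mono mult_left_mono frac_le mult_right_mono powr_mono2 order_refl) auto
    finally show ?thesis .
  qed
  have M0: "?M \<ge> 0" using \<tau> C B by simp
  have "AE x in lborel. norm (X t x - X 0 x) \<le> B * (t - 0)"
    by (rule flow_data_Lipschitz[OF flow b bb]) (use t in auto)
  with flow[unfolded flow_data_def, THEN conjunct2]
  have "AE x in lborel. indicator (ball 0 r) x * ennreal (norm (affine_interpolation T N Y t x - X t x))
    \<le> ennreal (T * ?M + T * B) * indicator (ball 0 r) x"
  proof eventually_elim
    case (elim x)
    have "X 0 x = x" using elim(1)[rule_format, of 0] T by simp
    then have "norm (X t x - x) \<le> T * B"
      using elim(2) t B mult_left_mono[of t T B] by (simp add: mult.commute)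
    moreover have "norm (affine_interpolation T N Y t x - x) \<le> T * ?M"
      by (rule interpolation_displacement[OF M t])
    ultimately have "norm (affine_interpolation T N Y t x - X t x) \<le> T * ?M + T * B"
      using norm_triangle_ineq4[of "affine_interpolation T N Y t x - x" "X t x - x"] by simp
    then have "ennreal (norm (affine_interpolation T N Y t x - X t x)) \<le> ennreal (T * ?M + T * B)" by (rule ennreal_leI)
    then show ?case by (auto simp: indicator_def)
  qed
  then have "ball_distance r (affine_interpolation T N Y t) (X t)
    \<le> (\<integral>\<^sup>+x. ennreal (T * ?M + T * B) * indicator (ball (0::'a) r) x \<partial>lborel)"
    by (rule nn_integral_mono_AE)
  also have "\<dots> = ennreal (T * ?M + T * B) * emeasure lborel (ball (0::'a) r)" by (simp add: nn_integral_cmult)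
  also have "emeasure lborel (ball (0::'a) r) = ennreal (measure lborel (ball (0::'a) r))"
    using emeasure_lborel_ball_finite[of "0::'a" r] by (intro emeasure_eq_ennreal_measure) (simp add: less_top)
  also have "ennreal (T * ?M + T * B) * ennreal (measure lborel (ball (0::'a) r)) = ennreal ((T * ?M + T * B) * measure lborel (ball (0::'a) r))"
    using M0 T B by (simp only: ennreal_mult mult_nonneg_nonneg add_nonneg_nonneg less_imp_le measure_nonneg)
  finally show ?thesis .
qed

end

theorem theorem1:
  fixes T p r B G C0 C1 C2 \<alpha> \<beta> :: real
  assumes "T > 0" and "1 < p" and "r > 0" and "B \<ge> 0" and "G \<ge> 0"
    and "C0 > 0" and "C1 > 0" and "C2 > 0" and "\<alpha> > 0" and "\<beta> > 0"
  shows "\<exists>C>0. \<forall>(\<theta>::real) (b :: real \<Rightarrow> 'a::euclidean_space \<Rightarrow> 'a) Db X b\<epsilon> C3 (N::nat) h Y.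
    0 \<le> \<theta> \<and> \<theta> \<le> 1 \<and>
    in_L1_W1p T p b Db \<and> divergence_free T Db \<and>
    Linf_norm T b = ennreal B \<and>
    L1_Lp_norm T p (\<lambda>t x. frobenius (Db t x)) = ennreal G \<and>
    regular_Lagrangian_flow T b X \<and>
    C3 > 0 \<and> approximating_sequence T b b\<epsilon> C0 C1 C2 C3 \<alpha> \<beta> \<and>
    N \<ge> 1 \<and> h = T / real N \<and>
    theta_method T N \<theta> (b\<epsilon> (h powr (1 / (2 * \<beta>)))) Y
    \<longrightarrow> (\<forall>t\<in>{0..T}.
          (\<integral>\<^sup>+ x\<in>ball 0 r. ennreal (norm (affine_interpolation T N Y t x - X t x)) \<partial>lebesgue)
            \<le> ennreal C / ennreal \<bar>ln h\<bar>)"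
proof -
  define \<tau> where "\<tau> = step_threshold TYPE('a) C1 C2"
  define V where "V = measure lborel (ball (0::'a) r)"
  define Lf where "Lf = flow_const TYPE('a) T C1 C2"
  define K where "K = DIM('a) * G + T"
  define S where "S = stability_const TYPE('a) p r Lf * K"
  define c1 where "c1 = rate_const (\<alpha> / (2 * \<beta>)) T B V C0 Lf S"
  define U where "U = (T * (DIM('a) * (C1 / sqrt \<tau>) + B + (C0 * T powr (\<alpha> / (2 * \<beta>))) / (\<tau> * unit_ball_vol DIM('a))) + T * B) * V"
  \<comment> \<open>For \<open>h\<close> in the interval from \<open>\<tau>\<close> to
    \<open>T\<close> the logarithm is at most \<open>m\<close> in absolute value, so the bound
    \<open>U\<close> of the large steps is at most \<open>U * m\<close> divided by
    \<open>\<bar>ln h\<bar>\<close>.\<close>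
  define m where "m = max \<bar>ln \<tau>\<bar> \<bar>ln T\<bar>"
  have \<tau>: "\<tau> > 0" using step_threshold_pos assms unfolding \<tau>_def by blast
  have Lf: "Lf \<ge> 1" using flow_const_ge_1 assms unfolding Lf_def by blast
  have K: "K \<ge> 0" using assms by (simp add: K_def)
  have V: "V \<ge> 0" by (simp add: V_def)
  have "S \<ge> 0" unfolding S_def using stability_const_nonneg[where 'a='a, of p Lf r] assms Lf K by simp
  then have c1: "c1 \<ge> 0" unfolding c1_def using assms Lf V by (intro rate_const_nonneg) auto
  have U: "U \<ge> 0" unfolding U_def using assms \<tau> V by simp
  have m: "m \<ge> 0" by (simp add: m_def)
  show ?thesis
  \<comment> \<open>The summand 1 keeps the constant positive even if the other two vanish.\<close>
  proof (intro exI[of _ "c1 + U * m + 1"] conjI allI impI ballI)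
    show "c1 + U * m + 1 > 0" using c1 U m by (simp add: add_nonneg_pos)
    fix \<theta> :: real and b :: "real \<Rightarrow> 'a \<Rightarrow> 'a" and Db X b\<epsilon> and C3 :: real and N :: nat and h Y t
    assume A: "0 \<le> \<theta> \<and> \<theta> \<le> 1 \<and>
    in_L1_W1p T p b Db \<and> divergence_free T Db \<and>
    Linf_norm T b = ennreal B \<and>
    L1_Lp_norm T p (\<lambda>t x. frobenius (Db t x)) = ennreal G \<and>
    regular_Lagrangian_flow T b X \<and>
    C3 > 0 \<and> approximating_sequence T b b\<epsilon> C0 C1 C2 C3 \<alpha> \<beta> \<and>
    N \<ge> 1 \<and> h = T / real N \<and>
    theta_method T N \<theta> (b\<epsilon> (h powr (1 / (2 * \<beta>)))) Y" and t: "t \<in> {0..T}"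
    have \<theta>: "0 \<le> \<theta>" "\<theta> \<le> 1" and W: "in_L1_W1p T p b Db" and BB: "Linf_norm T b = ennreal B"
      and GG: "L1_Lp_norm T p (\<lambda>t x. frobenius (Db t x)) = ennreal G" and RLF: "regular_Lagrangian_flow T b X"
      and C3: "C3 > 0" and app: "approximating_sequence T b b\<epsilon> C0 C1 C2 C3 \<alpha> \<beta>"
      and N: "N \<ge> 1" and h: "h = T / real N" and meth: "theta_method T N \<theta> (b\<epsilon> (h powr (1 / (2 * \<beta>)))) Y"
      by (insert A; elim conjE; assumption)+
    have h0: "h > 0" "h \<le> T" using assms(1) N by (auto simp: h divide_le_eq)
    obtain b' g \<kappa> Z where field': "field_data T p B (DIM('a) * G + T) b' g \<kappa>" and Z: "Z \<in> sets borel" "emeasure lborel Z = 0"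
      and eq: "\<And>t x. t \<in> {0<..<T} \<Longrightarrow> (t, x) \<notin> Z \<Longrightarrow> b t x = b' t x"
    proof (rule field_data_exists[OF assms(1,2,4,5) W BB GG])
      fix b' g \<kappa> and Z :: "(real \<times> 'a) set"
      assume H: "field_data T p B (DIM('a) * G + T) b' g \<kappa>" "Z \<in> sets borel" "emeasure lborel Z = 0"
        "\<And>t x. t \<in> {0<..<T} \<Longrightarrow> (t, x) \<notin> Z \<Longrightarrow> b t x = b' t x"
      show thesis by (rule that[OF H])
    qed
    note field = field'[folded K_def]
    have b': "joint_borel b'" "\<And>t x. norm (b' t x) \<le> B"
      using field by (auto simp: field_data_def)
    obtain X' L where L: "L > 0" "\<And>t. t \<in> {0..T} \<Longrightarrow> compressible L (X' t)" and flow: "flow_data T b' X'"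
      and XX: "AE x in lborel. \<forall>t\<in>{0..T}. X t x = X' t x"
    proof (rule flow_data_exists[OF assms(1) RLF b' Z eq])
      fix X' L
      assume H: "L > 0" "\<And>t. t \<in> {0..T} \<Longrightarrow> compressible L (X' t)" "flow_data T b' X'"
        "AE x in lborel. \<forall>t\<in>{0..T}. X t x = X' t x"
      show thesis by (rule that[OF H])
    qed
    interpret flow_approximation T p B K C0 C1 C2 C3 \<alpha> \<beta> b b' b\<epsilon> g \<kappa> Z X'
      by unfold_locales (use assms K C3 field app Z eq flow in auto)
    have X'c: "\<And>t. t \<in> {0..T} \<Longrightarrow> compressible Lf (X' t)"
      unfolding Lf_def by (rule compressibility_improvement[OF L(2)])
    obtain v Dv where scheme: "theta_scheme T h \<theta> C3 (C1 / sqrt h) C2 N v Dv Y" and close: "close v h"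
      using scheme_of_method[OF \<theta> N h meth] by blast
    let ?I = "\<integral>\<^sup>+x. indicator (ball 0 r) x * ennreal (norm (affine_interpolation T N Y t x - X' t x)) \<partial>lborel"
    have "AE x in lborel. ennreal (norm (affine_interpolation T N Y t x - X t x)) * indicator (ball 0 r) x
      = indicator (ball 0 r) x * ennreal (norm (affine_interpolation T N Y t x - X' t x))"
      using XX by eventually_elim (use t in \<open>simp add: mult.commute\<close>)
    then have I: "(\<integral>\<^sup>+ x\<in>ball 0 r. ennreal (norm (affine_interpolation T N Y t x - X t x)) \<partial>lebesgue) = ?I"
      unfolding nn_integral_completion by (rule nn_integral_cong_AE)
    show "(\<integral>\<^sup>+ x\<in>ball 0 r. ennreal (norm (affine_interpolation T N Y t x - X t x)) \<partial>lebesgue)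
            \<le> ennreal (c1 + U * m + 1) / ennreal \<bar>ln h\<bar>"
    proof (cases "ln h = 0")
      case True
      \<comment> \<open>Here \<open>h = 1\<close>, and a positive numerator divided by 0 is
        \<open>top\<close> in the extended nonnegative reals.\<close>
      have "c1 + U * m + 1 > 0" using c1 U m by (simp add: add_nonneg_pos)
      then have "ennreal (c1 + U * m + 1) / ennreal \<bar>ln h\<bar> = top"
        unfolding True by (simp add: divide_ennreal_def ennreal_mult_top del: ennreal_plus)
      then show ?thesis by simp
    next
      case False
      then have l: "\<bar>ln h\<bar> > 0" by simp
      have "?I \<le> ennreal ((c1 + U * m + 1) / \<bar>ln h\<bar>)"
      proof (cases "h \<le> \<tau>")
        case True
        have "?I \<le> ennreal (c1 / \<bar>ln h\<bar>)"
          using scheme_rate(1)[OF scheme close True[unfolded \<tau>_def] _ X'c t, of r]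
          unfolding c1_def V_def S_def by (simp add: Lf_def)
        also have "\<dots> \<le> ennreal ((c1 + U * m + 1) / \<bar>ln h\<bar>)"
          using U m l by (intro ennreal_leI divide_right_mono) auto
        finally show ?thesis .
      next
        case False
        then have "ln \<tau> \<le> ln h" "ln h \<le> ln T" using \<tau> h0 assms(1) by simp_all
        then have lm: "\<bar>ln h\<bar> \<le> m" unfolding m_def by linarith
        have "?I \<le> ennreal U"
          using large_step_bound[OF scheme close _ \<tau> t, of r] False unfolding U_def V_def by simp
        also have "U \<le> (c1 + U * m + 1) / \<bar>ln h\<bar>"
          using mult_left_mono[OF lm U] c1 l by (simp add: pos_le_divide_eq)
        finally show ?thesis by (simp add: ennreal_leI)
      qed
      then show ?thesis
        unfolding I by (subst divide_ennreal) (use c1 U m l in auto)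
    qed
  qed
qed

end
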